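(* Let $\Lambda\in\mathtt P^+$, $i\in I$, $\beta\in\mathtt Q^+$ with $|\beta|=n$. Define $$F^\Lambda=R^\Lambda(\beta+\alpha_i)e(\beta,i),\quad K_0=\frac{R(\beta+\alpha_i)e(\beta,i)}{R(\beta+\alpha_i)a^\Lambda(x_1)R(\beta)e(\beta,i)},\quad K_1=\frac{R(\beta+\alpha_i)e(i,\beta)}{R(\beta+\alpha_i)a^\Lambda(x_2)\xi(R(\beta))e(i,\beta)},$$ where in $K_0$ we use the embedding $R(\beta)\subset R(\beta+\alpha_i)$ ($e(\nu)\mapsto e(\nu,i)$, $x_k\mapsto x_k$, $\tau_\ell\mapsto\tau_\ell$) and in $K_1$ the right $R^\Lambda(\beta)$-structure is through $\xi$. Right multiplication by $a^\Lambda(x_1)\tau_1\cdots\tau_n$ induces a well-defined homomorphism $P:K_1\to K_0$, and with $\pi:K_0\to F^\Lambda$ the canonical projection, the sequence $$0\to K_1\xrightarrow{P}K_0\xrightarrow{\pi}F^\Lambda\to0$$ is a short exact sequence of $(R(\beta+\alpha_i),R^\Lambda(\beta))$-bimodules, all of which are projective as right $R^\Lambda(\beta)$-modules.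
   Context: Let $I$ be a finite set and $\mathtt A=(a_{ij})_{i,j\in I}$ an integer matrix with $a_{ii}=2$ or $a_{ii}\in 2\mathbb Z_{\le 0}$, $a_{ij}\le 0$ for $i\neq j$, and $a_{ij}=0\iff a_{ji}=0$. Assume there are $d_i\in\mathbb Z_{>0}$ with $(d_ia_{ij})$ symmetric. Fix a free abelian group $\mathtt P$, linearly independent $\alpha_i\in\mathtt P$, and $h_i\in\mathrm{Hom}(\mathtt P,\mathbb Z)$ with $\langle h_i,\alpha_j\rangle=a_{ij}$, such that for each $i$ there is $\Lambda_i$ with $\langle h_j,\Lambda_i\rangle=\delta_{ij}$. Let $(\alpha_i|\alpha_j)=d_ia_{ij}$. $\mathtt P^+=\{\lambda:\langle h_i,\lambda\rangle\ge0\ \forall i\}$, $\mathtt Q^+=\sum_i\mathbb Z_{\ge0}\alpha_i$; for $\beta=\sum k_i\alpha_i$, $|\beta|=\sum k_i$, $I^\beta=\{\nu\in I^{|\beta|}:\sum_k\alpha_{\nu_k}=\beta\}$. Let $\mathbf k=\bigoplus_{n\ge0}\mathbf k_n$ be a graded commutative ring, $\mathcal Q_{i,j}(u,v)\in\mathbf k[u,v]$ with $\mathcal Q_{i,j}(u,v)=\mathcal Q_{j,i}(v,u)$, $\mathcal Q_{i,i}=0$, and for $i\ne j$, $\mathcal Q_{i,j}=\sum_{d_ip+d_jq\le-(\alpha_i|\alpha_j)}t^{p,q}_{i,j}u^pv^q$ with $t^{-a_{ij},0}_{i,j}\in\mathbf k_0^\times$, $t^{p,q}_{i,j}\in\mathbf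 k_{-2((\alpha_i|\alpha_j)+d_ip+d_jq)}$, $t^{p,q}_{i,j}=t^{q,p}_{j,i}$; $\mathcal P_i(u,v)=\sum_{p+q\le1-a_{ii}/2}w_i^{p,q}u^pv^q$ with $w_i^{1-a_{ii}/2,0},w_i^{0,1-a_{ii}/2}\in\mathbf k_0^\times$, $w_i^{p,q}\in\mathbf k_{2d_i(1-p-q-a_{ii}/2)}$. $R(n)$ is the $\mathbf k$-algebra generated by $e(\nu)$ ($\nu\in I^n$), $x_k$, $\tau_\ell$ with relations: $e(\nu)e(\nu')=\delta_{\nu\nu'}e(\nu)$, $\sum e(\nu)=1$, $x_kx_l=x_lx_k$, $x_ke(\nu)=e(\nu)x_k$, $\tau_\ell e(\nu)=e(s_\ell\nu)\tau_\ell$, $\tau_k\tau_\ell=\tau_\ell\tau_k$ ($|k-\ell|>1$); $\tau_k^2e(\nu)=(\partial_k\mathcal P_{\nu_k}(x_k,x_{k+1}))\tau_ke(\nu)$ if $\nu_k=\nu_{k+1}$, else $\mathcal Q_{\nu_k,\nu_{k+1}}(x_k,x_{k+1})e(\nu)$; $(\tau_kx_\ell-x_{s_k(\ell)}\tau_k)e(\nu)$ is $-\mathcal P_{\nu_k}(x_k,x_{k+1})e(\nu)$ if $\ell=k,\nu_k=\nu_{k+1}$, is $\mathcal P_{\nu_k}(x_k,x_{k+1})e(\nu)$ if $\ell=k+1,\nu_k=\nu_{k+1}$, and $0$ otherwise; $(\tau_{k+1}\tau_k\tau_{k+1}-\tau_k\tau_{k+1}\tau_k)e(\nu)$ is $\mathcal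 P_{\nu_k}(x_k,x_{k+2})\overline{\mathcal Q}_{\nu_k,\nu_{k+1}}(x_k,x_{k+1},x_{k+2})e(\nu)$ if $\nu_k=\nu_{k+2}\ne\nu_{k+1}$, is $\overline{\mathcal P}'_{\nu_k}(x_k,x_{k+1},x_{k+2})\tau_ke(\nu)+\overline{\mathcal P}''_{\nu_k}(x_k,x_{k+1},x_{k+2})\tau_{k+1}e(\nu)$ if $\nu_k=\nu_{k+1}=\nu_{k+2}$, and $0$ otherwise; where $\partial_kf=(s_kf-f)/(x_k-x_{k+1})$, $\overline{\mathcal Q}_{i,j}(u,v,w)=\frac{\mathcal Q_{i,j}(u,v)-\mathcal Q_{i,j}(w,v)}{u-w}$, $\overline{\mathcal P}'_i(u,v,w)=\frac{\mathcal P_i(v,u)\mathcal P_i(u,w)}{(u-v)(u-w)}+\frac{\mathcal P_i(u,w)\mathcal P_i(v,w)}{(u-w)(v-w)}-\frac{\mathcal P_i(u,v)\mathcal P_i(v,w)}{(u-v)(v-w)}$, $\overline{\mathcal P}''_i(u,v,w)=-\frac{\mathcal P_i(u,v)\mathcal P_i(u,w)}{(u-v)(u-w)}-\frac{\mathcal P_i(u,w)\mathcal P_i(w,v)}{(u-w)(v-w)}+\frac{\mathcal P_i(u,v)\mathcal P_i(v,w)}{(u-v)(v-w)}$. Grading $\deg e(\nu)=0$, $\deg x_ke(\nu)=2d_{\nu_k}$, $\deg\tau_\ell e(\nu)=-(\alpha_{\nu_\ell}|\alpha_{\nu_{\ell+1}})$. $R(\beta)=e(\beta)R(n)$, $e(\beta)=\sum_{\nu\in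 I^\beta}e(\nu)$; $e(\beta,i)=\sum_{\nu\in I^{\beta+\alpha_i},\nu_{n+1}=i}e(\nu)$, $e(i,\beta)=\sum_{\nu\in I^{\beta+\alpha_i},\nu_1=i}e(\nu)$; $\xi:R(n)\to R(n+1)$ is the algebra map $x_k\mapsto x_{k+1}$, $\tau_\ell\mapsto\tau_{\ell+1}$, $e(\nu)\mapsto\sum_{j\in I}e(j,\nu)$. For $\Lambda\in\mathtt P^+$ fix monic $a_i^\Lambda(u)=\sum_{k=0}^{\langle h_i,\Lambda\rangle}c_{i;k}u^{\langle h_i,\Lambda\rangle-k}$, $c_{i;k}\in\mathbf k_{2kd_i}$, $c_{i;0}=1$; $a^\Lambda(x_k)=\sum_\nu a^\Lambda_{\nu_k}(x_k)e(\nu)$; $R^\Lambda(\beta)=R(\beta)/R(\beta)a^\Lambda(x_1)R(\beta)$. *)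

theory Defs
  imports Main "HOL-Library.Poly_Mapping" "HOL-Library.Function_Algebras"
begin

text \<open>Generators of R(n): E nu = e(nu), X k = x_k, T l = tau_l (indices 1-based).\<close>
datatype 'i gen = E "'i list" | X nat | T nat

text \<open>Elements of the free k-algebra: coefficient functions on words.
  Addition, zero, negation and finite sums are the pointwise ones
  (Function_Algebras); multiplication is concatenation-convolution fmul.\<close>
type_synonym ('i,'k) fa = "'i gen list \<Rightarrow> 'k"

definition fone :: "('i,'k::comm_ring_1) fa" where
  "fone = (\<lambda>w. if w = [] then 1 else 0)"

definition fgen :: "'i gen \<Rightarrow> ('i,'k::comm_ring_1) fa" where
  "fgen g = (\<lambda>w. if w = [g] then 1 else 0)"

definition fsmul :: "'k::comm_ring_1 \<Rightarrow> ('i,'k) fa \<Rightarrow> ('i,'k) fa" where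
  "fsmul c f = (\<lambda>w. c * f w)"

definition fmul :: "('i,'k::comm_ring_1) fa \<Rightarrow> ('i,'k) fa \<Rightarrow> ('i,'k) fa" where
  "fmul f g = (\<lambda>w. \<Sum>j\<le>length w. f (take j w) * g (drop j w))"

primrec fpow :: "('i,'k::comm_ring_1) fa \<Rightarrow> nat \<Rightarrow> ('i,'k) fa" where
  "fpow f 0 = fone"
| "fpow f (Suc m) = fmul f (fpow f m)"

definition fprod :: "('i,'k::comm_ring_1) fa list \<Rightarrow> ('i,'k) fa" where
  "fprod xs = foldr fmul xs fone"

fun vgen :: "nat \<Rightarrow> 'i gen \<Rightarrow> bool" where
  "vgen n (E nu) = (length nu = n)"
| "vgen n (X k) = (1 \<le> k \<and> k \<le> n)"
| "vgen n (T l) = (1 \<le> l \<and> l < n)"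

definition FA :: "nat \<Rightarrow> ('i,'k::comm_ring_1) fa set" where
  "FA n = {f. finite {w. f w \<noteq> 0} \<and> (\<forall>w. f w \<noteq> 0 \<longrightarrow> (\<forall>g\<in>set w. vgen n g))}"

abbreviation ee :: "'i list \<Rightarrow> ('i,'k::comm_ring_1) fa" where "ee nu \<equiv> fgen (E nu)"
abbreviation xx :: "nat \<Rightarrow> ('i,'k::comm_ring_1) fa" where "xx k \<equiv> fgen (X k)"
abbreviation tt :: "nat \<Rightarrow> ('i,'k::comm_ring_1) fa" where "tt l \<equiv> fgen (T l)"

inductive_set rideal :: "('i,'k::comm_ring_1) fa set \<Rightarrow> ('i,'k) fa set \<Rightarrow> ('i,'k) fa set"
  for C S where
  rid_zero: "0 \<in> rideal C S"
| rid_gen: "s \<in> S \<Longrightarrow> a \<in> C \<Longrightarrow> b \<in> C \<Longrightarrow> fmul (fmul a s) b \<in> rideal C S"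
| rid_add: "x \<in> rideal C S \<Longrightarrow> y \<in> rideal C S \<Longrightarrow> x + y \<in> rideal C S"

inductive_set sspan :: "('i,'k::comm_ring_1) fa set \<Rightarrow> ('i,'k) fa set" for S where
  ssp_zero: "0 \<in> sspan S"
| ssp_gen: "s \<in> S \<Longrightarrow> s \<in> sspan S"
| ssp_add: "x \<in> sspan S \<Longrightarrow> y \<in> sspan S \<Longrightarrow> x + y \<in> sspan S"

type_synonym 'k mpoly = "(nat \<Rightarrow>\<^sub>0 nat) \<Rightarrow>\<^sub>0 'k"

definition Vr :: "nat \<Rightarrow> 'k::comm_ring_1 mpoly" where
  "Vr j = Poly_Mapping.single (Poly_Mapping.single j 1) 1"

definition p2 :: "(nat \<Rightarrow> nat \<Rightarrow> 'k::comm_ring_1) \<Rightarrow> nat \<Rightarrow> nat \<Rightarrow> 'k mpoly" where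
  "p2 c a b = (\<Sum>pq\<in>{(p,q). c p q \<noteq> 0}.
      Poly_Mapping.single (Poly_Mapping.single a (fst pq) + Poly_Mapping.single b (snd pq)) (c (fst pq) (snd pq)))"

text \<open>quotient of polynomials num / den (a polynomial in all uses below)\<close>
definition dq :: "'k::comm_ring_1 mpoly \<Rightarrow> 'k mpoly \<Rightarrow> 'k mpoly" where
  "dq num den = (THE g. den * g = num)"

definition evp :: "'k::comm_ring_1 mpoly \<Rightarrow> ('i,'k) fa list \<Rightarrow> ('i,'k) fa" where
  "evp p xs = (\<Sum>mo\<in>Poly_Mapping.keys p. fsmul (Poly_Mapping.lookup p mo)
      (fprod (map (\<lambda>j. fpow (xs!j) (Poly_Mapping.lookup (mo :: nat \<Rightarrow>\<^sub>0 nat) j)) [0..<length xs])))"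

text \<open>Variables: u = 0, v = 1, w = 2.\<close>
definition dP :: "(nat \<Rightarrow> nat \<Rightarrow> 'k::comm_ring_1) \<Rightarrow> 'k mpoly" where
  "dP w = dq (p2 w 1 0 - p2 w 0 1) (Vr 0 - Vr 1)"

definition Qbar :: "(nat \<Rightarrow> nat \<Rightarrow> 'k::comm_ring_1) \<Rightarrow> 'k mpoly" where
  "Qbar t = dq (p2 t 0 1 - p2 t 2 1) (Vr 0 - Vr 2)"

definition Dvdm :: "'k::comm_ring_1 mpoly" where
  "Dvdm = (Vr 0 - Vr 1) * (Vr 0 - Vr 2) * (Vr 1 - Vr 2)"

definition Pbar1 :: "(nat \<Rightarrow> nat \<Rightarrow> 'k::comm_ring_1) \<Rightarrow> 'k mpoly" where
  "Pbar1 w = dq (p2 w 1 0 * p2 w 0 2 * (Vr 1 - Vr 2) + p2 w 0 2 * p2 w 1 2 * (Vr 0 - Vr 1)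
                 - p2 w 0 1 * p2 w 1 2 * (Vr 0 - Vr 2)) Dvdm"

definition Pbar2 :: "(nat \<Rightarrow> nat \<Rightarrow> 'k::comm_ring_1) \<Rightarrow> 'k mpoly" where
  "Pbar2 w = dq (- (p2 w 0 1 * p2 w 0 2 * (Vr 1 - Vr 2)) - p2 w 0 2 * p2 w 2 1 * (Vr 0 - Vr 1)
                 + p2 w 0 1 * p2 w 1 2 * (Vr 0 - Vr 2)) Dvdm"

definition nth1 :: "'i list \<Rightarrow> nat \<Rightarrow> 'i" where "nth1 nu k = nu ! (k - 1)"

definition sw :: "nat \<Rightarrow> 'i list \<Rightarrow> 'i list" where
  "sw l nu = nu[l - 1 := nu ! l, l := nu ! (l - 1)]"

definition sidx :: "nat \<Rightarrow> nat \<Rightarrow> nat" where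
  "sidx k l = (if l = k then k + 1 else if l = k + 1 then k else l)"

definition Iseqs :: "nat \<Rightarrow> 'i list set" where
  "Iseqs n = {nu. length nu = n}"

text \<open>t i j p q = t^{p,q}_{i,j} (coefficients of Q_{i,j}); w i p q = w_i^{p,q} (coefficients of P_i)\<close>
definition rels :: "('i \<Rightarrow> 'i \<Rightarrow> nat \<Rightarrow> nat \<Rightarrow> 'k::comm_ring_1) \<Rightarrow> ('i \<Rightarrow> nat \<Rightarrow> nat \<Rightarrow> 'k)
    \<Rightarrow> nat \<Rightarrow> ('i,'k) fa set" where
  "rels t w n =
     {fmul (ee nu) (ee nu') - (if nu = nu' then ee nu else 0) | nu nu'. nu \<in> Iseqs n \<and> nu' \<in> Iseqs n}
   \<union> {(\<Sum>nu\<in>Iseqs n. ee nu) - fone}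
   \<union> {fmul (xx k) (xx l) - fmul (xx l) (xx k) | k l. 1 \<le> k \<and> k \<le> n \<and> 1 \<le> l \<and> l \<le> n}
   \<union> {fmul (xx k) (ee nu) - fmul (ee nu) (xx k) | k nu. 1 \<le> k \<and> k \<le> n \<and> nu \<in> Iseqs n}
   \<union> {fmul (tt l) (ee nu) - fmul (ee (sw l nu)) (tt l) | l nu. 1 \<le> l \<and> l < n \<and> nu \<in> Iseqs n}
   \<union> {fmul (tt k) (tt l) - fmul (tt l) (tt k) | k l. 1 \<le> k \<and> k < n \<and> 1 \<le> l \<and> l < n
         \<and> (k + 1 < l \<or> l + 1 < k)}
   \<union> {fmul (fmul (tt k) (tt k)) (ee nu) -
        (if nth1 nu k = nth1 nu (k+1)
         then fmul (fmul (evp (dP (w (nth1 nu k))) [xx k, xx (k+1)]) (tt k)) (ee nu)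
         else fmul (evp (p2 (t (nth1 nu k) (nth1 nu (k+1))) 0 1) [xx k, xx (k+1)]) (ee nu))
      | k nu. 1 \<le> k \<and> k < n \<and> nu \<in> Iseqs n}
   \<union> {fmul (fmul (tt k) (xx l) - fmul (xx (sidx k l)) (tt k)) (ee nu) -
        (if l = k \<and> nth1 nu k = nth1 nu (k+1)
         then - fmul (evp (p2 (w (nth1 nu k)) 0 1) [xx k, xx (k+1)]) (ee nu)
         else if l = k + 1 \<and> nth1 nu k = nth1 nu (k+1)
         then fmul (evp (p2 (w (nth1 nu k)) 0 1) [xx k, xx (k+1)]) (ee nu)
         else 0)
      | k l nu. 1 \<le> k \<and> k < n \<and> 1 \<le> l \<and> l \<le> n \<and> nu \<in> Iseqs n}
   \<union> {fmul (fmul (fmul (tt (k+1)) (tt k)) (tt (k+1)) - fmul (fmul (tt k) (tt (k+1))) (tt k)) (ee nu) -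
        (if nth1 nu k = nth1 nu (k+2) \<and> nth1 nu k \<noteq> nth1 nu (k+1)
         then fmul (fmul (evp (p2 (w (nth1 nu k)) 0 1) [xx k, xx (k+2)])
                         (evp (Qbar (t (nth1 nu k) (nth1 nu (k+1)))) [xx k, xx (k+1), xx (k+2)])) (ee nu)
         else if nth1 nu k = nth1 nu (k+1) \<and> nth1 nu (k+1) = nth1 nu (k+2)
         then fmul (fmul (evp (Pbar1 (w (nth1 nu k))) [xx k, xx (k+1), xx (k+2)]) (tt k)) (ee nu)
            + fmul (fmul (evp (Pbar2 (w (nth1 nu k))) [xx k, xx (k+1), xx (k+2)]) (tt (k+1))) (ee nu)
         else 0)
      | k nu. 1 \<le> k \<and> k + 1 < n \<and> nu \<in> Iseqs n}"

text \<open>the two-sided ideal of defining relations: R(n) = FA n / Jrel t w n\<close>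
definition Jrel :: "('i \<Rightarrow> 'i \<Rightarrow> nat \<Rightarrow> nat \<Rightarrow> 'k::comm_ring_1) \<Rightarrow> ('i \<Rightarrow> nat \<Rightarrow> nat \<Rightarrow> 'k)
    \<Rightarrow> nat \<Rightarrow> ('i,'k) fa set" where
  "Jrel t w n = rideal (FA n) (rels t w n)"

text \<open>beta in Q^+ is given by its coefficient vector b (beta = sum b_j alpha_j);
  I^beta = sequences with exactly b j occurrences of j.\<close>
definition Iseq :: "('i \<Rightarrow> nat) \<Rightarrow> 'i list set" where
  "Iseq b = {nu. \<forall>j. length (filter (\<lambda>x. x = j) nu) = b j}"

definition eblk :: "('i \<Rightarrow> nat) \<Rightarrow> ('i,'k::comm_ring_1) fa" where
  "eblk b = (\<Sum>nu\<in>Iseq b. ee nu)"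

text \<open>a^Lambda(x_p) in R(N): sum_nu a_{nu_p}(x_p) e(nu); hL j = <h_j,Lambda>, c j k = c_{j;k}.
  For p > N (in particular in R(0)) there is no x_p and we put 0.\<close>
definition aL :: "('i \<Rightarrow> int) \<Rightarrow> ('i \<Rightarrow> nat \<Rightarrow> 'k::comm_ring_1) \<Rightarrow> nat \<Rightarrow> nat \<Rightarrow> ('i,'k) fa" where
  "aL hL c N p = (if 1 \<le> p \<and> p \<le> N then
      (\<Sum>nu\<in>Iseqs N. fmul (\<Sum>k\<le>nat (hL (nth1 nu p)).
            fsmul (c (nth1 nu p) k) (fpow (xx p) (nat (hL (nth1 nu p)) - k))) (ee nu))
     else 0)"

text \<open>cyclotomic ideal: R^Lambda(n) = FA n / JL\<close>
definition JL :: "('i \<Rightarrow> 'i \<Rightarrow> nat \<Rightarrow> nat \<Rightarrow> 'k::comm_ring_1) \<Rightarrow> ('i \<Rightarrow> nat \<Rightarrow> nat \<Rightarrow> 'k)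
    \<Rightarrow> ('i \<Rightarrow> int) \<Rightarrow> ('i \<Rightarrow> nat \<Rightarrow> 'k) \<Rightarrow> nat \<Rightarrow> ('i,'k) fa set" where
  "JL t w hL c n = rideal (FA n) (rels t w n \<union> {aL hL c n 1})"

definition linext :: "('i gen list \<Rightarrow> ('j,'k::comm_ring_1) fa) \<Rightarrow> ('i,'k) fa \<Rightarrow> ('j,'k) fa" where
  "linext F f = (\<Sum>u\<in>{u. f u \<noteq> 0}. fsmul (f u) (F u))"

fun iota_gen :: "'i \<Rightarrow> 'i gen \<Rightarrow> ('i,'k::comm_ring_1) fa" where
  "iota_gen i (E nu) = ee (nu @ [i])"
| "iota_gen i (X k) = xx k"
| "iota_gen i (T l) = tt l"

text \<open>non-unital embedding: 1 = sum e(nu) goes to sum e(nu,i)\<close>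
definition iota :: "nat \<Rightarrow> 'i \<Rightarrow> ('i,'k::comm_ring_1) fa \<Rightarrow> ('i,'k) fa" where
  "iota n i = linext (\<lambda>u. fmul (\<Sum>nu\<in>Iseqs n. ee (nu @ [i])) (fprod (map (iota_gen i) u)))"

fun xi_gen :: "'i gen \<Rightarrow> ('i,'k::comm_ring_1) fa" where
  "xi_gen (E nu) = (\<Sum>j\<in>UNIV. ee (j # nu))"
| "xi_gen (X k) = xx (k + 1)"
| "xi_gen (T l) = tt (l + 1)"

definition xi :: "('i,'k::comm_ring_1) fa \<Rightarrow> ('i,'k) fa" where
  "xi = linext (\<lambda>u. fprod (map xi_gen u))"

text \<open>Abstract right modules over the ring (Rc modulo Ir, unit u), carrier in type 'z.\<close>
definition is_rmod :: "'z set \<Rightarrow> ('z \<Rightarrow> 'z \<Rightarrow> 'z) \<Rightarrow> 'z \<Rightarrow> ('z \<Rightarrow> ('i,'k::comm_ring_1) fa \<Rightarrow> 'z)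
     \<Rightarrow> ('i,'k) fa set \<Rightarrow> ('i,'k) fa set \<Rightarrow> ('i,'k) fa \<Rightarrow> bool" where
  "is_rmod M pl z ac Rc Ir u \<longleftrightarrow>
     z \<in> M \<and> (\<forall>a\<in>M. \<forall>b\<in>M. pl a b \<in> M)
   \<and> (\<forall>a\<in>M. \<forall>b\<in>M. \<forall>c\<in>M. pl (pl a b) c = pl a (pl b c))
   \<and> (\<forall>a\<in>M. \<forall>b\<in>M. pl a b = pl b a) \<and> (\<forall>a\<in>M. pl z a = a)
   \<and> (\<forall>a\<in>M. \<exists>b\<in>M. pl a b = z)
   \<and> (\<forall>a\<in>M. \<forall>r\<in>Rc. ac a r \<in> M) \<and> (\<forall>a\<in>M. ac a u = a)
   \<and> (\<forall>a\<in>M. \<forall>b\<in>M. \<forall>r\<in>Rc. ac (pl a b) r = pl (ac a r) (ac b r))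
   \<and> (\<forall>a\<in>M. \<forall>r\<in>Rc. \<forall>s\<in>Rc. ac a (r + s) = pl (ac a r) (ac a s))
   \<and> (\<forall>a\<in>M. \<forall>r\<in>Rc. \<forall>s\<in>Rc. ac (ac a r) s = ac a (fmul r s))
   \<and> (\<forall>a\<in>M. \<forall>r\<in>Rc. \<forall>s\<in>Rc. r - s \<in> Ir \<longrightarrow> ac a r = ac a s)"

text \<open>The quotient Ms / Ns (representatives in the free algebra) as a bimodule:
  left ring (Lc mod Il), right ring (Rc mod Ir, unit u), right action act.\<close>
definition is_qbimod :: "('i,'k::comm_ring_1) fa set \<Rightarrow> ('i,'k) fa set \<Rightarrow> (('i,'k) fa \<Rightarrow> ('i,'k) fa \<Rightarrow> ('i,'k) fa)
     \<Rightarrow> ('i,'k) fa set \<Rightarrow> ('i,'k) fa set \<Rightarrow> ('i,'k) fa set \<Rightarrow> ('i,'k) fa set \<Rightarrow> ('i,'k) fa \<Rightarrow> bool" where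
  "is_qbimod Ms Ns act Lc Il Rc Ir u \<longleftrightarrow>
     Ns \<subseteq> Ms \<and> 0 \<in> Ns \<and> (\<forall>a\<in>Ns. \<forall>b\<in>Ns. a + b \<in> Ns \<and> - a \<in> Ns)
   \<and> (\<forall>a\<in>Ms. \<forall>b\<in>Ms. a + b \<in> Ms \<and> - a \<in> Ms)
   \<and> (\<forall>y\<in>Ms. \<forall>r\<in>Lc. fmul r y \<in> Ms \<and> (y \<in> Ns \<longrightarrow> fmul r y \<in> Ns))
   \<and> (\<forall>y\<in>Ms. \<forall>r\<in>Lc. \<forall>r'\<in>Lc. r - r' \<in> Il \<longrightarrow> fmul r y - fmul r' y \<in> Ns)
   \<and> (\<forall>y\<in>Ms. \<forall>s\<in>Rc. act y s \<in> Ms \<and> (y \<in> Ns \<longrightarrow> act y s \<in> Ns))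
   \<and> (\<forall>y\<in>Ms. \<forall>s\<in>Rc. \<forall>s'\<in>Rc. s - s' \<in> Ir \<longrightarrow> act y s - act y s' \<in> Ns)
   \<and> (\<forall>y\<in>Ms. act y u - y \<in> Ns)
   \<and> (\<forall>y\<in>Ms. \<forall>y'\<in>Ms. \<forall>s\<in>Rc. act (y + y') s - (act y s + act y' s) \<in> Ns)
   \<and> (\<forall>y\<in>Ms. \<forall>s\<in>Rc. \<forall>s'\<in>Rc. act y (s + s') - (act y s + act y s') \<in> Ns)
   \<and> (\<forall>y\<in>Ms. \<forall>s\<in>Rc. \<forall>s'\<in>Rc. act (act y s) s' - act y (fmul s s') \<in> Ns)
   \<and> (\<forall>y\<in>Ms. \<forall>r\<in>Lc. \<forall>s\<in>Rc. act (fmul r y) s - fmul r (act y s) \<in> Ns)"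

definition qhom :: "('i,'k::comm_ring_1) fa set \<Rightarrow> ('i,'k) fa set \<Rightarrow> (('i,'k) fa \<Rightarrow> ('i,'k) fa \<Rightarrow> ('i,'k) fa)
     \<Rightarrow> ('i,'k) fa set \<Rightarrow> 'z set \<Rightarrow> ('z \<Rightarrow> 'z \<Rightarrow> 'z) \<Rightarrow> ('z \<Rightarrow> ('i,'k) fa \<Rightarrow> 'z)
     \<Rightarrow> (('i,'k) fa \<Rightarrow> 'z) \<Rightarrow> bool" where
  "qhom Ms Ns act Rc M pl ac h \<longleftrightarrow>
     (\<forall>y\<in>Ms. h y \<in> M) \<and> (\<forall>y\<in>Ms. \<forall>y'\<in>Ms. y - y' \<in> Ns \<longrightarrow> h y = h y')
   \<and> (\<forall>y\<in>Ms. \<forall>y'\<in>Ms. h (y + y') = pl (h y) (h y'))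
   \<and> (\<forall>y\<in>Ms. \<forall>s\<in>Rc. h (act y s) = ac (h y) s)"

definition mhom :: "'z set \<Rightarrow> ('z \<Rightarrow> 'z \<Rightarrow> 'z) \<Rightarrow> ('z \<Rightarrow> ('i,'k::comm_ring_1) fa \<Rightarrow> 'z)
     \<Rightarrow> 'z set \<Rightarrow> ('z \<Rightarrow> 'z \<Rightarrow> 'z) \<Rightarrow> ('z \<Rightarrow> ('i,'k) fa \<Rightarrow> 'z) \<Rightarrow> ('i,'k) fa set \<Rightarrow> ('z \<Rightarrow> 'z) \<Rightarrow> bool" where
  "mhom M pl ac M' pl' ac' Rc g \<longleftrightarrow>
     (\<forall>a\<in>M. g a \<in> M') \<and> (\<forall>a\<in>M. \<forall>b\<in>M. g (pl a b) = pl' (g a) (g b))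
   \<and> (\<forall>a\<in>M. \<forall>r\<in>Rc. g (ac a r) = ac' (g a) r)"

text \<open>Projectivity of the right module Ms/Ns (lifting property w.r.t. all
  right modules with carrier in the type 'z).\<close>
definition qproj :: "'z itself \<Rightarrow> ('i,'k::comm_ring_1) fa set \<Rightarrow> ('i,'k) fa set
     \<Rightarrow> (('i,'k) fa \<Rightarrow> ('i,'k) fa \<Rightarrow> ('i,'k) fa)
     \<Rightarrow> ('i,'k) fa set \<Rightarrow> ('i,'k) fa set \<Rightarrow> ('i,'k) fa \<Rightarrow> bool" where
  "qproj Z Ms Ns act Rc Ir u \<longleftrightarrow>
    (\<forall>(M::'z set) pl z ac M' pl' z' ac' g h.
       is_rmod M pl z ac Rc Ir u \<and> is_rmod M' pl' z' ac' Rc Ir u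
       \<and> mhom M pl ac M' pl' ac' Rc g \<and> g ` M = M'
       \<and> qhom Ms Ns act Rc M' pl' ac' h
     \<longrightarrow> (\<exists>h'. qhom Ms Ns act Rc M pl ac h' \<and> (\<forall>y\<in>Ms. g (h' y) = h y)))"

definition cartan :: "('i \<Rightarrow> 'i \<Rightarrow> int) \<Rightarrow> ('i \<Rightarrow> nat) \<Rightarrow> bool" where
  "cartan A d \<longleftrightarrow>
     (\<forall>i. A i i = 2 \<or> (A i i \<le> 0 \<and> even (A i i)))
   \<and> (\<forall>i j. i \<noteq> j \<longrightarrow> A i j \<le> 0)
   \<and> (\<forall>i j. A i j = 0 \<longleftrightarrow> A j i = 0)
   \<and> (\<forall>i. d i > 0) \<and> (\<forall>i j. int (d i) * A i j = int (d j) * A j i)"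

definition graded :: "(int \<Rightarrow> 'k::comm_ring_1 set) \<Rightarrow> bool" where
  "graded gr \<longleftrightarrow>
     (\<forall>n. 0 \<in> gr n \<and> (\<forall>a\<in>gr n. \<forall>b\<in>gr n. a + b \<in> gr n \<and> - a \<in> gr n))
   \<and> (\<forall>n < 0. gr n = {0}) \<and> 1 \<in> gr 0
   \<and> (\<forall>m n. \<forall>a\<in>gr m. \<forall>b\<in>gr n. a * b \<in> gr (m + n))
   \<and> (\<forall>x. \<exists>f. finite {n. f n \<noteq> 0} \<and> (\<forall>n. f n \<in> gr n) \<and> x = (\<Sum>n\<in>{n. f n \<noteq> 0}. f n))
   \<and> (\<forall>f. finite {n. f n \<noteq> 0} \<and> (\<forall>n. f n \<in> gr n) \<and> (\<Sum>n\<in>{n. f n \<noteq> 0}. f n) = 0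
          \<longrightarrow> (\<forall>n. f n = 0))"

definition unit0 :: "(int \<Rightarrow> 'k::comm_ring_1 set) \<Rightarrow> 'k \<Rightarrow> bool" where
  "unit0 gr a \<longleftrightarrow> a \<in> gr 0 \<and> (\<exists>b\<in>gr 0. a * b = 1)"

definition Qdata :: "('i \<Rightarrow> 'i \<Rightarrow> int) \<Rightarrow> ('i \<Rightarrow> nat) \<Rightarrow> (int \<Rightarrow> 'k::comm_ring_1 set)
     \<Rightarrow> ('i \<Rightarrow> 'i \<Rightarrow> nat \<Rightarrow> nat \<Rightarrow> 'k) \<Rightarrow> bool" where
  "Qdata A d gr t \<longleftrightarrow>
     (\<forall>i j p q. t i j p q = t j i q p)
   \<and> (\<forall>i p q. t i i p q = 0)
   \<and> (\<forall>i j p q. i \<noteq> j \<and> int (d i * p + d j * q) > - (int (d i) * A i j) \<longrightarrow> t i j p q = 0)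
   \<and> (\<forall>i j. i \<noteq> j \<longrightarrow> unit0 gr (t i j (nat (- A i j)) 0))
   \<and> (\<forall>i j p q. i \<noteq> j \<longrightarrow> t i j p q \<in> gr (-2 * (int (d i) * A i j + int (d i * p + d j * q))))"

definition Pdata :: "('i \<Rightarrow> 'i \<Rightarrow> int) \<Rightarrow> ('i \<Rightarrow> nat) \<Rightarrow> (int \<Rightarrow> 'k::comm_ring_1 set)
     \<Rightarrow> ('i \<Rightarrow> nat \<Rightarrow> nat \<Rightarrow> 'k) \<Rightarrow> bool" where
  "Pdata A d gr w \<longleftrightarrow>
     (\<forall>i p q. int (p + q) > 1 - A i i div 2 \<longrightarrow> w i p q = 0)
   \<and> (\<forall>i. unit0 gr (w i (nat (1 - A i i div 2)) 0) \<and> unit0 gr (w i 0 (nat (1 - A i i div 2))))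
   \<and> (\<forall>i p q. w i p q \<in> gr (2 * int (d i) * (1 - int (p + q) - A i i div 2)))"

definition Ldata :: "('i \<Rightarrow> nat) \<Rightarrow> (int \<Rightarrow> 'k::comm_ring_1 set) \<Rightarrow> ('i \<Rightarrow> int)
     \<Rightarrow> ('i \<Rightarrow> nat \<Rightarrow> 'k) \<Rightarrow> bool" where
  "Ldata d gr hL c \<longleftrightarrow> (\<forall>i. hL i \<ge> 0) \<and> (\<forall>i. c i 0 = 1)
     \<and> (\<forall>i k. int k \<le> hL i \<longrightarrow> c i k \<in> gr (2 * int k * int (d i)))"

end

theory Submission
  imports Defs "HOL-Computational_Algebra.Polynomial" "HOL-Library.Multiset"
begin

text \<open>\<open>R(n)\<close> acts faithfully on polynomials indexed by colour sequences: a crossing of two equal colours acts by a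
  Demazure operator multiplied by \<open>P\<close>, and of two crossings of distinct colours one carries the factor \<open>Q\<close>.
  The intertwiners \<open>\<theta>\<^sub>k = \<tau>\<^sub>k x\<^sub>k\<^sub>+\<^sub>1 - x\<^sub>k\<^sub>+\<^sub>1 \<tau>\<^sub>k\<close> are injective in this representation, so commutators with the
  variables separate the products \<open>\<tau>\<^sub>k \<dots> \<tau>\<^sub>j\<close>. This yields faithfulness, and freeness of \<open>R(\<beta> + \<alpha>\<^sub>i)e(\<beta>, i)\<close> and
  \<open>R(\<beta> + \<alpha>\<^sub>i)e(i, \<beta>)\<close> as right modules over \<open>R(\<beta>)\<close>, so that \<open>K\<^sub>0\<close> and \<open>K\<^sub>1\<close> are free over polynomials in
  one variable with coefficients in \<open>R\<^sup>\<Lambda>(\<beta>)\<close>.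

  Multiplying \<open>a(x\<^sub>1)\<tau>\<^sub>1 \<dots> \<tau>\<^sub>n\<close> on the right by \<open>\<theta>\<^sub>n \<dots> \<theta>\<^sub>1 \<Prod> (x\<^sub>1 - x\<^sub>a\<^sub>+\<^sub>1)\<close> gives on \<open>K\<^sub>1\<close> a polynomial which is monic in
  \<open>x\<^sub>1\<close> up to a unit. Division with remainder by it turns this multiplication into a right linear left inverse of the
  map \<open>P\<close>. Hence \<open>P\<close> is injective and the sequence splits over \<open>R\<^sup>\<Lambda>(\<beta>)\<close>, which gives projectivity.\<close>

section \<open>Polynomials\<close>

text \<open>The factors x_1 - x_{a+1} come from an identity tau_m theta_m (x_m - x_{m+1}) = U + V
  theta_m. For equal colours U = P(x_m, x_{m+1}) P(x_{m+1}, x_m) and V = P(x_m, x_{m+1}); for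
  distinct ones U = -(x_m - x_{m+1})^2 Q and V = 0. The U build the monic polynomial, whose unit
  comes from the extreme coefficients of P and Q. In a V term one crossing is lost; the other
  crossings then pass through the intertwiners, a(x_1) turns into a(x_2), and the term lies in the
  cyclotomic ideal of the shifted R(beta), so it vanishes in K_1.

  The obstacle is that a(x_1) tau_1 ... tau_n commutes with R(beta) only up to errors. Every
  relation that is applied breaks the chain, and a(x_1) then meets a copy of R(beta), where it
  generates the cyclotomic ideal. Freeness turns vanishing in K_0 or K_1 into a condition on
  coefficients.

  For exactness in the middle an element is written as a sum of h_k tau_1 ... tau_k with h_k free of
  tau_1, hence commuting with a(x_1); in K_0 only the term k = n survives.\<close>

definition cst :: "'k::comm_ring_1 => 'k mpoly" where
 "cst c = Poly_Mapping.single 0 c"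

lemma cst_0 [simp]: "cst 0 = 0" and cst_1 [simp]: "cst 1 = 1"
 and cst_add: "cst (a + b) = cst a + cst b" and cst_mult: "cst (a * b) = cst a * cst b"
 and cst_uminus: "cst (- a) = - cst a"
 by (simp_all add: cst_def single_add mult_single single_uminus)

lemma single_conv_Vr: "Poly_Mapping.single (Poly_Mapping.single j n) 1 = (Vr j :: 'k::comm_ring_1 mpoly) ^ n"
proof (induction n)
 case (Suc n)
 have "Poly_Mapping.single (Poly_Mapping.single j (Suc n)) (1::'k) = Vr j * Poly_Mapping.single (Poly_Mapping.single j n) 1"
  unfolding Vr_def mult_single by (simp flip: single_add)
 then show ?case using Suc by simp
qed simp

lemma single_Suc_conv: "Poly_Mapping.single m c = cst c * (Poly_Mapping.single m 1 :: 'k::comm_ring_1 mpoly)"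
 by (simp add: cst_def mult_single)

text \<open>Constants and variables generate the ring, so identities between ring homomorphisms, and
  congruences, have to be checked only there.\<close>

lemma mpoly_induct [case_names cst Vr add mult]:
 fixes p :: "'k::comm_ring_1 mpoly"
 assumes c: "!!c. P (cst c)" and v: "!!j. P (Vr j)"
  and add: "!!p q. P p ==> P q ==> P (p + q)" and mult: "!!p q. P p ==> P q ==> P (p * q)"
 shows "P p"
proof -
 have one: "P 1" using c[of 1] by simp
 have pow: "P (Vr j ^ n)" for j n
  by (induction n) (auto intro: one v mult)
 have mon: "P (Poly_Mapping.single m 1)" for m :: "nat \<Rightarrow>\<^sub>0 nat"
 proof (induction m rule: update_induct)
  case const
  then show ?case using one by (simp add: single_one)
 next
  case (update f a b)
  then have "Poly_Mapping.update a b f = f + Poly_Mapping.single a b"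
   by (intro poly_mapping_eqI) (auto simp: lookup_update lookup_add lookup_single when_def in_keys_iff)
  then have "Poly_Mapping.single (Poly_Mapping.update a b f) 1 =
    (Poly_Mapping.single f 1 * Vr a ^ b :: 'k mpoly)"
   by (simp add: mult_single flip: single_conv_Vr)
  then show ?case using update mult pow by metis
 qed
 show ?thesis
 proof (induction p rule: update_induct)
  case const
  then show ?case using c[of 0] by simp
 next
  case (update f a b)
  then have "Poly_Mapping.update a b f = f + Poly_Mapping.single a b"
   by (intro poly_mapping_eqI) (auto simp: lookup_update lookup_add lookup_single when_def in_keys_iff)
  then show ?case using update add mult mon c single_Suc_conv[of a b] by metis
 qed
qed

section \<open>Evaluation homomorphisms on polynomials\<close>

definition insm :: "(nat => 'b::comm_ring_1) => (nat \<Rightarrow>\<^sub>0 nat) => 'b" where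
 "insm v m = (\<Prod>j\<in>Poly_Mapping.keys m. v j ^ Poly_Mapping.lookup m j)"

text \<open>The target is an arbitrary commutative ring because two evaluations occur: substitution
  of polynomials (\<open>sub\<close>) and the reading of a polynomial as univariate over the
  remaining variables (\<open>uni\<close>).\<close>

definition ins :: "('k::comm_ring_1 => 'b) => (nat => 'b::comm_ring_1) => 'k mpoly => 'b" where
 "ins ka v p = (\<Sum>m\<in>Poly_Mapping.keys p. ka (Poly_Mapping.lookup p m) * insm v m)"

lemma insm_superset:
 "finite S ==> Poly_Mapping.keys m \<subseteq> S ==> insm v m = (\<Prod>j\<in>S. v j ^ Poly_Mapping.lookup m j)"
 unfolding insm_def by (rule prod.mono_neutral_left) (auto simp: in_keys_iff)

lemma insm_add: "insm v (m + m') = insm v m * insm v m'"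
proof -
 let ?S = "Poly_Mapping.keys m \<union> Poly_Mapping.keys m'"
 have "insm v (m + m') = (\<Prod>j\<in>?S. v j ^ Poly_Mapping.lookup (m + m') j)"
  using keys_add[of m m'] by (intro insm_superset) auto
 also have "... = insm v m * insm v m'"
  by (simp add: insm_superset[of ?S] lookup_add power_add prod.distrib)
 finally show ?thesis .
qed

locale ring_hom_fun =
 fixes h :: "'a::comm_ring_1 => 'b::comm_ring_1"
 assumes add: "h (x + y) = h x + h y" and mult: "h (x * y) = h x * h y" and one [simp]: "h 1 = 1"
begin
lemma zero [simp]: "h 0 = 0" using add[of 0 0] by simp
lemma uminus: "h (- x) = - h x" using add[of x "- x"] by (simp add: eq_neg_iff_add_eq_0 add.commute)
lemma diff: "h (x - y) = h x - h y" using add[of x "- y"] by (simp add: uminus)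
lemma power: "h (x ^ n) = h x ^ n" by (induction n) (simp_all add: mult)
lemma sum: "h (sum f S) = (\<Sum>x\<in>S. h (f x))" by (induction S rule: infinite_finite_induct) (simp_all add: add)
lemma prod: "h (prod f S) = (\<Prod>x\<in>S. h (f x))" by (induction S rule: infinite_finite_induct) (simp_all add: mult)
end

lemma ring_hom_cst: "ring_hom_fun cst"
 by standard (simp_all add: cst_add cst_mult)

context
 fixes ka :: "'k::comm_ring_1 => 'b::comm_ring_1" and v :: "nat => 'b"
 assumes ka: "ring_hom_fun ka"
begin

interpretation ka: ring_hom_fun ka by (rule ka)

lemma ins_superset:
 "finite S ==> Poly_Mapping.keys p \<subseteq> S ==> ins ka v p = (\<Sum>m\<in>S. ka (Poly_Mapping.lookup p m) * insm v m)"
 unfolding ins_def by (rule sum.mono_neutral_left) (auto simp: in_keys_iff)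

lemma ins_add: "ins ka v (p + q) = ins ka v p + ins ka v q"
proof -
 let ?S = "Poly_Mapping.keys p \<union> Poly_Mapping.keys q"
 have "ins ka v (p + q) = (\<Sum>m\<in>?S. ka (Poly_Mapping.lookup (p + q) m) * insm v m)"
  using keys_add[of p q] by (intro ins_superset) auto
 also have "... = ins ka v p + ins ka v q"
  by (simp add: ins_superset[of ?S] lookup_add ka.add distrib_right sum.distrib)
 finally show ?thesis .
qed

lemma ins_single: "ins ka v (Poly_Mapping.single m c) = ka c * insm v m"
 by (simp add: ins_def keys_single)

lemma mpoly_add_induct:
 fixes p :: "'k mpoly"
 assumes "!!m c. P (Poly_Mapping.single m c)" "!!p q. P p ==> P q ==> P (p + q)"
 shows "P p"
proof (induction p rule: update_induct)
 case const
 then show ?case using assms(1)[of 0 0] by simp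
next
 case (update f a b)
 then have "Poly_Mapping.update a b f = f + Poly_Mapping.single a b"
  by (intro poly_mapping_eqI) (auto simp: lookup_update lookup_add lookup_single when_def in_keys_iff)
 then show ?case using update assms by metis
qed

lemma ins_mult: "ins ka v (p * q) = ins ka v p * ins ka v q"
proof (induction p rule: mpoly_add_induct)
 case (1 m c)
 show ?case
  by (induction q rule: mpoly_add_induct)
    (simp_all add: mult_single ins_single insm_add ka.mult ins_add algebra_simps)
qed (simp add: distrib_right ins_add)

lemma ring_hom_ins: "ring_hom_fun (ins ka v)"
 by standard (simp_all add: ins_add ins_mult ins_single insm_def flip: single_one)

lemma ins_cst [simp]: "ins ka v (cst c) = ka c"
 by (simp add: cst_def ins_single insm_def)

lemma ins_Vr [simp]: "ins ka v (Vr j) = v j"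
 by (simp add: Vr_def ins_single insm_def)

end

abbreviation sub :: "(nat => 'k mpoly) => 'k mpoly => 'k::comm_ring_1 mpoly" where
 "sub \<equiv> ins cst"

interpretation sub: ring_hom_fun "sub v" for v by (rule ring_hom_ins[OF ring_hom_cst])

lemma sub_cst [simp]: "sub v (cst c) = cst c" and sub_Vr [simp]: "sub v (Vr j) = v j"
 by (simp_all add: ring_hom_cst)

lemma sub_sub: "sub v (sub u p) = sub (\<lambda>j. sub v (u j)) p"
 by (induction p rule: mpoly_induct) (simp_all add: sub.add sub.mult)

lemma sub_id [simp]: "sub Vr p = p"
 by (induction p rule: mpoly_induct) (simp_all add: sub.add sub.mult)

lemma sub_cong: "(!!j. u j = v j) ==> sub u p = sub v p"
 by (induction p rule: mpoly_induct) (simp_all add: sub.add sub.mult)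

text \<open>Evaluation respects congruences modulo \<open>m\<close>. The divided differences below
  are polynomials for this reason: a transposition changes each variable by a multiple of the
  denominator.\<close>

lemma sub_diff_dvd:
 assumes "!!j. m dvd u j - v j"
 shows "m dvd sub u p - sub v p"
proof (induction p rule: mpoly_induct)
 case (add p q)
 then have "m dvd (sub u p - sub v p) + (sub u q - sub v q)" by (rule dvd_add)
 then show ?case by (simp add: sub.add algebra_simps)
next
 case (mult p q)
 then have "m dvd (sub u p - sub v p) * sub u q + sub v p * (sub u q - sub v q)" by (intro dvd_add) auto
 then show ?case by (simp add: sub.mult algebra_simps)
qed (use assms in simp_all)

section \<open>Regular elements and exact quotients\<close>

definition regular :: "'a::comm_ring_1 => bool" where
 "regular m \<longleftrightarrow> (\<forall>h. m * h = 0 --> h = 0)"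

lemma regularD: "regular m ==> m * f = m * g ==> f = g"
 unfolding regular_def by (metis right_diff_distrib right_minus_eq)

lemma regular_mult: "regular a ==> regular b ==> regular (a * b)"
 unfolding regular_def by (metis mult.assoc)

text \<open>\<open>dq\<close> is a definite description, so it denotes a quotient only if that is
  unique. The coefficient ring may have zero divisors; regularity of the denominator supplies
  uniqueness.\<close>

lemma dqI: "regular d ==> d * g = f ==> dq f d = g"
 unfolding dq_def by (rule the_equality) (auto dest: regularD)

lemma dq_mult: "regular d ==> d dvd f ==> d * dq f d = f"
 by (metis dqI dvdE)

text \<open>The coefficients remain in the full polynomial ring instead of a ring with one variable
  fewer. Thus evaluation at \<open>Vr j\<close> inverts \<open>uni j\<close>, and regularity can be
  tested on a univariate leading coefficient.\<close>

definition uni :: "nat => 'k::comm_ring_1 mpoly => 'k mpoly poly" where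
 "uni j = ins (\<lambda>c. [:cst c:]) (\<lambda>a. if a = j then [:0, 1:] else [:Vr a:])"

lemma ring_hom_cstpoly: "ring_hom_fun (\<lambda>c. [:cst c:])"
 by standard (simp_all add: cst_add cst_mult flip: one_pCons)

interpretation uni: ring_hom_fun "uni j" for j
 unfolding uni_def by (rule ring_hom_ins[OF ring_hom_cstpoly])

lemma uni_cst [simp]: "uni j (cst c) = [:cst c:]"
 and uni_Vr: "uni j (Vr a) = (if a = j then [:0, 1:] else [:Vr a:])"
 by (simp_all add: uni_def ring_hom_cstpoly)

lemma poly_uni: "poly (uni j p) (Vr j) = p"
 by (induction p rule: mpoly_induct) (simp_all add: uni.add uni.mult uni_Vr)

lemma unit_lead_regular_poly:
 fixes p :: "'a::comm_ring_1 poly"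
 assumes "lead_coeff p * u = 1"
 shows "regular p"
 unfolding regular_def
proof (intro allI impI)
 fix h assume "p * h = 0"
 then have "lead_coeff p * lead_coeff h = 0"
  by (metis coeff_mult_degree_sum coeff_0)
 then have "u * (lead_coeff p * lead_coeff h) = 0" by simp
 then have "lead_coeff h = 0" using assms by (metis mult.assoc mult.commute mult_1)
 then show "h = 0" by simp
qed

lemma regular_uniI: "regular (uni j p) ==> regular p"
 unfolding regular_def by (metis uni.mult uni.zero poly_uni poly_0)

lemma degree_eqI: "coeff p d ~= 0 ==> (!!e. e > d ==> coeff p e = 0) ==> degree p = d"
 by (meson degree_le le_antisym le_degree)

text \<open>A univariate polynomial with invertible leading coefficient is no zero divisor over any
  commutative ring. Differences of variables and the polynomials \<open>P\<close> and
  \<open>Q\<close> all become of this kind once one variable is singled out.\<close>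

lemma unit_coeff_regular:
 fixes p :: "'k::comm_ring_1 mpoly"
 assumes "coeff (uni j p) d = cst c" "c * c' = 1" "!!e. e > d ==> coeff (uni j p) e = 0"
 shows "regular p"
proof (rule regular_uniI[of j])
 have *: "cst c * cst c' = (1 :: 'k mpoly)" using assms(2) by (simp flip: cst_mult)
 then have "cst c ~= (0 :: 'k mpoly)" by auto
 then have "degree (uni j p) = d" using assms by (intro degree_eqI) auto
 then show "regular (uni j p)" using assms(1) * unit_lead_regular_poly by metis
qed

lemma regular_Vr_diff [intro!]: "a ~= b ==> regular (Vr a - Vr b :: 'k::comm_ring_1 mpoly)"
 by (rule unit_coeff_regular[of a _ 1 1 1])
   (auto simp: uni.diff uni_Vr coeff_pCons split: nat.splits)

lemma p2_eq: "p2 w a b = (\<Sum>pq\<in>{(p, q). w p q ~= 0}. cst (w (fst pq) (snd pq)) * Vr a ^ fst pq * Vr b ^ snd pq)"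
 unfolding p2_def
 by (intro sum.cong) (auto simp: cst_def mult_single simp flip: single_conv_Vr)

lemma p2_eq_double:
 assumes "!!p q. p > m \<or> q > m ==> w p q = 0"
 shows "p2 w a b = (\<Sum>p\<le>m. \<Sum>q\<le>m. cst (w p q) * Vr a ^ p * Vr b ^ q)"
proof -
 have "p2 w a b = (\<Sum>pq\<in>{..m} \<times> {..m}. cst (w (fst pq) (snd pq)) * Vr a ^ fst pq * Vr b ^ snd pq)"
  unfolding p2_eq using assms
  by (intro sum.mono_neutral_left) (auto simp: not_less[symmetric])
 then show ?thesis by (simp add: sum.cartesian_product split_def)
qed

lemma sub_p2: "(!!j. j = a \<or> j = b ==> v j = Vr (f j)) ==> sub v (p2 w a b) = p2 w (f a) (f b)"
 unfolding p2_eq by (simp add: sub.sum sub.mult sub.power)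

lemma p2_flip: "p2 (\<lambda>p q. w q p) a b = p2 w b a"
 unfolding p2_eq
 by (rule sum.reindex_bij_witness[of _ "\<lambda>(p, q). (q, p)" "\<lambda>(p, q). (q, p)"]) (auto simp: mult_ac)

lemma coeff_uni_p2:
 assumes ab: "a ~= b" and fin: "!!p q. p > m \<or> q > m ==> w p q = 0"
 shows "coeff (uni a (p2 w a b)) e = (\<Sum>q\<le>m. cst (w e q) * Vr b ^ q)"
proof -
 have "coeff (uni a (p2 w a b)) e = (\<Sum>p\<le>m. \<Sum>q\<le>m. coeff ([:cst (w p q):] * monom 1 p * [:Vr b:] ^ q) e)"
  using ab by (simp add: p2_eq_double[OF fin] uni.sum uni.mult uni.power uni_Vr coeff_sum monom_altdef)
 also have "... = (\<Sum>p\<le>m. \<Sum>q\<le>m. if p = e then cst (w p q) * Vr b ^ q else 0)"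
  by (intro sum.cong refl) (simp add: poly_const_pow coeff_monom_mult smult_monom mult.commute[of "monom _ _"])
 also have "... = (\<Sum>p\<le>m. if p = e then (\<Sum>q\<le>m. cst (w p q) * Vr b ^ q) else 0)"
  by (intro sum.cong) auto
 also have "... = (if e \<le> m then \<Sum>q\<le>m. cst (w e q) * Vr b ^ q else 0)"
  by simp
 also have "... = (\<Sum>q\<le>m. cst (w e q) * Vr b ^ q)"
  using fin by simp
 finally show ?thesis .
qed

text \<open>As a polynomial in the first variable it has the constant unit \<open>w d 0\<close> as
  its top coefficient.\<close>

lemma regular_p2:
 assumes "a ~= b" "!!p q. p > m \<or> q > m ==> w p q = 0"
  and c: "w d 0 * c' = 1" and z: "!!q. q > 0 ==> w d q = 0" and top: "!!p q. p > d ==> w p q = 0"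
 shows "regular (p2 w a b)"
proof (rule unit_coeff_regular[of a _ d _ c'])
 have "(\<Sum>q\<le>m. cst (w d q) * Vr b ^ q) = (\<Sum>q\<le>m. if q = 0 then cst (w d 0) else 0)"
  using z by (intro sum.cong) auto
 then show "coeff (uni a (p2 w a b)) d = cst (w d 0)"
  by (simp add: coeff_uni_p2[OF assms(1,2)])
 show "coeff (uni a (p2 w a b)) e = 0" if "e > d" for e
  using that top by (simp add: coeff_uni_p2[OF assms(1,2)])
qed (rule c)

section \<open>Transpositions of variables and divided differences\<close>

abbreviation sp :: "nat => 'k::comm_ring_1 mpoly => 'k mpoly" where
 "sp l \<equiv> sub (\<lambda>j. Vr (sidx l j))"

lemma sidx_sidx [simp]: "sidx l (sidx l j) = j" by (auto simp: sidx_def)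

lemma sidx_simps [simp]: "sidx l l = Suc l" "sidx l (Suc l) = l"
 "j < l ==> sidx l j = j" "Suc l < j ==> sidx l j = j"
 by (auto simp: sidx_def)

lemma sp_sp [simp]: "sp l (sp l p) = p"
 by (simp add: sub_sub)

lemma sp_p2: "sp l (p2 w a b) = p2 w (sidx l a) (sidx l b)"
 by (rule sub_p2) simp

lemma sp_braid: "sp l (sp (Suc l) (sp l p)) = sp (Suc l) (sp l (sp (Suc l) p))"
 unfolding sub_sub by (rule sub_cong) (auto simp: sidx_def)

lemma sp_commute: "k + 1 < l \<or> l + 1 < k ==> sp k (sp l p) = sp l (sp k p)"
 unfolding sub_sub by (rule sub_cong) (auto simp: sidx_def)

definition dd :: "nat => 'k::comm_ring_1 mpoly => 'k mpoly" where
 "dd l f = dq (sp l f - f) (Vr l - Vr (Suc l))"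

lemma dd_eq: "(Vr l - Vr (Suc l)) * dd l f = sp l f - f"
proof -
 have "Vr l - Vr (Suc l) dvd sp l f - sub Vr f"
 proof (rule sub_diff_dvd)
  fix j
  show "Vr l - Vr (Suc l) dvd Vr (sidx l j) - (Vr j :: 'a mpoly)"
   using dvd_minus_iff[of "Vr l - Vr (Suc l) :: 'a mpoly" "Vr l - Vr (Suc l)"] by (auto simp: sidx_def)
 qed
 then show ?thesis unfolding dd_def by (intro dq_mult) auto
qed

lemma ddI: "(Vr l - Vr (Suc l)) * g = sp l f - f ==> dd l f = g"
 unfolding dd_def by (rule dqI) auto

lemma dd_add: "dd l (f + g) = dd l f + dd l g"
 by (rule ddI) (simp add: distrib_left dd_eq sub.add)

lemma dd_sym_mult: "sp l g = g ==> dd l (g * f) = g * dd l f"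
proof (rule ddI)
 assume g: "sp l g = g"
 have "(Vr l - Vr (Suc l)) * (g * dd l f) = g * ((Vr l - Vr (Suc l)) * dd l f)"
  by (simp only: mult.left_commute)
 then show "(Vr l - Vr (Suc l)) * (g * dd l f) = sp l (g * f) - g * f"
  by (simp only: dd_eq sub.mult g right_diff_distrib)
qed

lemma sp_dd [simp]: "sp l (dd l f) = dd l f"
proof -
 have "sp l ((Vr l - Vr (Suc l)) * dd l f) = sp l (sp l f - f)" by (simp add: dd_eq)
 then have "(Vr (Suc l) - Vr l) * sp l (dd l f) = f - sp l f"
  by (simp add: sub.mult sub.diff)
 then have "(Vr l - Vr (Suc l)) * sp l (dd l f) = sp l f - f" by (simp add: algebra_simps)
 from ddI[OF this] show ?thesis by simp
qed

text \<open>The values of \<open>dd l\<close> are symmetric and hence pass through a further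
  \<open>dd l\<close>. For \<open>p\<close> the polynomial \<open>P\<close> this is the quadratic
  relation for equal colours.\<close>

lemma dd_dd_mult: "dd l (p * dd l f) = dd l p * dd l f"
proof (rule ddI)
 show "(Vr l - Vr (Suc l)) * (dd l p * dd l f) = sp l (p * dd l f) - p * dd l f"
  unfolding mult.assoc[symmetric] dd_eq sub.mult sp_dd by (rule left_diff_distrib)
qed

text \<open>Divided differences are equivariant under a renaming \<open>g\<close> of the variables
  that carries the pair l, l+1 to k, k+1. This serves the braid relations as well as the shift of
  strands by \<open>xi\<close>.\<close>

lemma dd_sub:
 assumes "!!j. sub v (Vr (sidx l j)) = Vr (sidx k (g j))" "!!j. v j = Vr (g j)" "g l = k" "g (Suc l) = Suc k"
 shows "sub v (dd l f) = dd k (sub v f)"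
proof -
 have "sub v ((Vr l - Vr (Suc l)) * dd l f) = sub v (sp l f - f)" by (simp add: dd_eq)
 then have "(Vr k - Vr (Suc k)) * sub v (dd l f) = sub v (sp l f) - sub v f"
  using assms by (simp add: sub.mult sub.diff)
 moreover have "sub v (sp l f) = sp k (sub v f)"
  unfolding sub_sub by (rule sub_cong) (use assms in simp)
 ultimately show ?thesis by (intro ddI[symmetric]) simp
qed

lemma dvd_Vr_diff_iff: "Vr a - Vr b dvd f \<longleftrightarrow> sub (Vr(a := Vr b)) f = (0 :: 'k::comm_ring_1 mpoly)"
proof
 assume "Vr a - Vr b dvd f"
 then obtain g where "f = (Vr a - Vr b) * g" by (elim dvdE)
 then show "sub (Vr(a := Vr b)) f = 0" by (auto simp: sub.mult sub.diff)
next
 assume *: "sub (Vr(a := Vr b)) f = 0"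
 have "Vr a - Vr b dvd sub Vr f - sub (Vr(a := Vr b)) f"
  by (rule sub_diff_dvd) auto
 then show "Vr a - Vr b dvd f" using * by simp
qed

text \<open>Identifying the two variables kills \<open>f\<close> while \<open>m\<close> stays
  regular, so it kills the cofactor of \<open>m\<close>. Regularity takes the place of
  coprimality.\<close>

lemma mult_Vr_diff_dvd:
 assumes "m dvd f" "Vr a - Vr b dvd f" "regular (sub (Vr(a := Vr b)) m)"
 shows "m * (Vr a - Vr b) dvd (f :: 'k::comm_ring_1 mpoly)"
proof -
 obtain g where g: "f = m * g" using assms(1) by (elim dvdE)
 then have "sub (Vr(a := Vr b)) m * sub (Vr(a := Vr b)) g = 0"
  using assms(2) by (simp add: dvd_Vr_diff_iff sub.mult)
 then have "sub (Vr(a := Vr b)) g = 0" using assms(3) by (simp add: regular_def)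
 then have "Vr a - Vr b dvd g" by (simp add: dvd_Vr_diff_iff)
 then show ?thesis using g by (simp add: mult_dvd_mono)
qed

text \<open>The value at the variables \<open>ks\<close> of a polynomial in \<open>u, v, w\<close>; like \<open>evp\<close>, it sets
 all further variables to 1.\<close>

definition ev :: "nat list => 'k::comm_ring_1 mpoly => 'k mpoly" where
 "ev ks = sub (\<lambda>j. if j < length ks then Vr (ks ! j) else 1)"

lemma ev_p2: "a < length ks ==> b < length ks ==> ev ks (p2 w a b) = p2 w (ks ! a) (ks ! b)"
 unfolding ev_def by (rule sub_p2) auto

lemma ev_simps: "ev ks (f * g) = ev ks f * ev ks g" "ev ks (f + g) = ev ks f + ev ks g"
 "ev ks (f - g) = ev ks f - ev ks g" "ev ks (- f) = - ev ks f"
 "j < length ks ==> ev ks (Vr j) = Vr (ks ! j)"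
 by (simp_all add: ev_def sub.mult sub.add sub.diff sub.uminus)

lemma ev_dP: "ev [k, Suc k] (dP w) = dd k (p2 w k (Suc k))"
proof (rule ddI[symmetric])
 have "(Vr 0 - Vr 1) * dP w = p2 w 1 0 - p2 w 0 1"
  unfolding dP_def using dd_eq[of 0 "p2 w 0 1"]
  by (intro dq_mult) (auto simp: sp_p2 dvd_def intro: sym)
 then have "ev [k, Suc k] ((Vr 0 - Vr 1) * dP w) = ev [k, Suc k] (p2 w 1 0 - p2 w 0 1)" by simp
 then show "(Vr k - Vr (Suc k)) * ev [k, Suc k] (dP w) = sp k (p2 w k (Suc k)) - p2 w k (Suc k)"
  by (simp add: ev_simps ev_p2 sp_p2)
qed

lemma sub_upd_p2: "sub (Vr(i := Vr j)) (p2 w a b) = p2 w (if a = i then j else a) (if b = i then j else b)"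
 by (subst sub_p2[of a b _ "\<lambda>x. if x = i then j else x"]) auto

lemma ev_Qbar:
 "(Vr k - Vr m) * ev [k, l, m] (Qbar q) = p2 q k l - p2 q m l"
proof -
 have "Vr 0 - Vr 2 dvd p2 q 0 1 - p2 q 2 1"
  by (simp add: dvd_Vr_diff_iff sub.diff sub_upd_p2)
 then have "(Vr 0 - Vr 2) * Qbar q = p2 q 0 1 - p2 q 2 1"
  unfolding Qbar_def by (intro dq_mult) auto
 then have "ev [k, l, m] ((Vr 0 - Vr 2) * Qbar q) = ev [k, l, m] (p2 q 0 1 - p2 q 2 1)" by simp
 then show ?thesis by (simp add: ev_simps ev_p2)
qed

text \<open>The numerator of P-bar' over the common denominator \<open>vdm\<close>, the Vandermonde
  product of the three variables; \<open>Pb2\<close> is the same for P-bar''.\<close>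

definition Pb1 :: "(nat => nat => 'k::comm_ring_1) => nat => nat => nat => 'k mpoly" where
 "Pb1 w a b c = p2 w b a * p2 w a c * (Vr b - Vr c) + p2 w a c * p2 w b c * (Vr a - Vr b)
         - p2 w a b * p2 w b c * (Vr a - Vr c)"

definition Pb2 :: "(nat => nat => 'k::comm_ring_1) => nat => nat => nat => 'k mpoly" where
 "Pb2 w a b c = - (p2 w a b * p2 w a c * (Vr b - Vr c)) - p2 w a c * p2 w c b * (Vr a - Vr b)
         + p2 w a b * p2 w b c * (Vr a - Vr c)"

definition vdm :: "nat => nat => nat => 'k::comm_ring_1 mpoly" where
 "vdm a b c = (Vr a - Vr b) * (Vr a - Vr c) * (Vr b - Vr c)"

lemma regular_vdm: "a ~= b ==> a ~= c ==> b ~= c ==> regular (vdm a b c)"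
 unfolding vdm_def by (intro regular_mult regular_Vr_diff)

text \<open>The linear factors are split off one at a time; the product of the earlier ones stays
  regular when the next two variables are identified.\<close>

lemma vdm_dvd:
 assumes "sub (Vr(0 := Vr 1)) f = 0" "sub (Vr(0 := Vr 2)) f = 0" "sub (Vr(1 := Vr 2)) f = 0"
 shows "vdm 0 1 2 dvd (f :: 'k::comm_ring_1 mpoly)"
 unfolding vdm_def
proof (rule mult_Vr_diff_dvd)
 show "(Vr 0 - Vr 1) * (Vr 0 - Vr 2) dvd f"
  by (rule mult_Vr_diff_dvd) (use assms in \<open>auto simp: dvd_Vr_diff_iff sub.diff\<close>)
qed (use assms in \<open>auto simp: dvd_Vr_diff_iff sub.diff sub.mult intro!: regular_mult\<close>)

lemma Pb_dvd: "vdm 0 1 2 dvd Pb1 w 0 1 2" "vdm 0 1 2 dvd Pb2 w 0 1 2"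
 by (rule vdm_dvd; simp add: Pb1_def Pb2_def sub.diff sub.mult sub.add sub.uminus sub_upd_p2 algebra_simps)+

lemma ev_Pbar:
 "vdm a b c * ev [a, b, c] (Pbar1 w) = Pb1 w a b c"
 "vdm a b c * ev [a, b, c] (Pbar2 w) = Pb2 w a b c"
proof -
 have r: "regular (vdm 0 1 2 :: 'a mpoly)" by (rule regular_vdm) auto
 have "Pbar1 w = dq (Pb1 w 0 1 2) (vdm 0 1 2)" "Pbar2 w = dq (Pb2 w 0 1 2) (vdm 0 1 2)"
  by (simp_all add: Pbar1_def Pbar2_def Dvdm_def vdm_def Pb1_def Pb2_def)
 then have "vdm 0 1 2 * Pbar1 w = Pb1 w 0 1 2" "vdm 0 1 2 * Pbar2 w = Pb2 w 0 1 2"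
  using dq_mult[OF r Pb_dvd(1)] dq_mult[OF r Pb_dvd(2)] by auto
 then have "ev [a, b, c] (vdm 0 1 2 * Pbar1 w) = ev [a, b, c] (Pb1 w 0 1 2)"
   "ev [a, b, c] (vdm 0 1 2 * Pbar2 w) = ev [a, b, c] (Pb2 w 0 1 2)" by auto
 then show "vdm a b c * ev [a, b, c] (Pbar1 w) = Pb1 w a b c"
  "vdm a b c * ev [a, b, c] (Pbar2 w) = Pb2 w a b c"
  by (simp_all add: ev_simps ev_p2 vdm_def Pb1_def Pb2_def)
qed

text \<open>After multiplication by the regular product \<open>?D\<close> of the three differences,
  both composites become combinations of \<open>f\<close> and its permuted images. In the difference
  all images under permutations of length two and three cancel. What remains is
  \<open>s1 f - s2 f\<close> together with terms in \<open>A1\<close> and \<open>A2\<close>, and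
  these form the two correction terms.\<close>

lemma demazure_braid:
 fixes f :: "'k::comm_ring_1 mpoly" and w :: "nat => nat => 'k" and k :: nat
 defines "P \<equiv> p2 w"
 defines "T1 \<equiv> \<lambda>f. P k (Suc k) * dd k f" and "T2 \<equiv> \<lambda>f. P (Suc k) (Suc (Suc k)) * dd (Suc k) f"
 shows "T2 (T1 (T2 f)) - T1 (T2 (T1 f)) =
  ev [k, Suc k, Suc (Suc k)] (Pbar1 w) * T1 f + ev [k, Suc k, Suc (Suc k)] (Pbar2 w) * T2 f"
proof -
 let ?l = "Suc k" and ?m = "Suc (Suc k)"
 define x12 x13 x23 where x: "x12 = Vr k - (Vr ?l :: 'k mpoly)" "x13 = Vr k - (Vr ?m :: 'k mpoly)"
  "x23 = Vr ?l - (Vr ?m :: 'k mpoly)"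
 let ?s1 = "sp k" and ?s2 = "sp ?l"
 have sP: "sp l (P a b) = P (sidx l a) (sidx l b)" for l a b by (simp add: P_def sp_p2)
 have d1: "x12 * dd k g = ?s1 g - g" and d2: "x23 * dd ?l g = ?s2 g - g" for g
  by (simp_all add: x dd_eq)
 have s: "?s1 x12 = - x12" "?s1 x13 = x23" "?s1 x23 = x13" "?s2 x12 = x13" "?s2 x13 = x12" "?s2 x23 = - x23"
  by (simp_all add: x sub.diff)
 define A1 A2 where "A1 = dd k f" and "A2 = dd ?l f"
 have A1: "x12 * A1 = ?s1 f - f" "x13 * ?s2 A1 = ?s2 (?s1 f) - ?s2 f"
  "x23 * ?s1 (?s2 A1) = ?s1 (?s2 (?s1 f)) - ?s1 (?s2 f)" "?s1 A1 = A1"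
 proof -
  show "x12 * A1 = ?s1 f - f" "?s1 A1 = A1" by (simp_all add: A1_def d1)
  show "x13 * ?s2 A1 = ?s2 (?s1 f) - ?s2 f"
   using arg_cong[OF d1[of f], of ?s2] by (simp only: sub.mult sub.diff s A1_def)
  then show "x23 * ?s1 (?s2 A1) = ?s1 (?s2 (?s1 f)) - ?s1 (?s2 f)"
   by (metis sub.mult sub.diff s)
 qed
 have A2: "x23 * A2 = ?s2 f - f" "x13 * ?s1 A2 = ?s1 (?s2 f) - ?s1 f"
  "x12 * ?s2 (?s1 A2) = ?s2 (?s1 (?s2 f)) - ?s2 (?s1 f)" "?s2 A2 = A2"
 proof -
  show "x23 * A2 = ?s2 f - f" "?s2 A2 = A2" by (simp_all add: A2_def d2)
  show "x13 * ?s1 A2 = ?s1 (?s2 f) - ?s1 f"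
   using arg_cong[OF d2[of f], of ?s1] by (simp only: sub.mult sub.diff s A2_def)
  then show "x12 * ?s2 (?s1 A2) = ?s2 (?s1 (?s2 f)) - ?s2 (?s1 f)"
   by (metis sub.mult sub.diff s)
 qed
 define B1 B2 where "B1 = dd ?l (T1 f)" and "B2 = dd k (T2 f)"
 have B1: "x23 * B1 = P k ?m * ?s2 A1 - P k ?l * A1"
  by (simp add: B1_def d2 T1_def sub.mult sP A1_def)
 have B1': "x13 * ?s1 B1 = P ?l ?m * ?s1 (?s2 A1) - P ?l k * A1"
  using arg_cong[OF B1, of ?s1] by (simp add: s sub.mult sub.diff sP A1(4))
 have B2: "x12 * B2 = P k ?m * ?s1 A2 - P ?l ?m * A2"
  by (simp add: B2_def d1 T2_def sub.mult sP A2_def)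
 have B2': "x13 * ?s2 B2 = P k ?l * ?s2 (?s1 A2) - P ?m ?l * A2"
  using arg_cong[OF B2, of ?s2] by (simp add: s sub.mult sub.diff sP A2(4))
 define C1 C2 where "C1 = dd k (T2 (T1 f))" and "C2 = dd ?l (T1 (T2 f))"
 have C1: "x12 * C1 = P k ?m * ?s1 B1 - P ?l ?m * B1"
  by (simp add: C1_def d1 T2_def sub.mult sP B1_def)
 have C2: "x23 * C2 = P k ?m * ?s2 B2 - P k ?l * B2"
  by (simp add: C2_def d2 T1_def sub.mult sP B2_def)
 have br: "?s1 (?s2 (?s1 f)) = ?s2 (?s1 (?s2 f))" by (rule sp_braid)
 let ?D = "x12 * x13 * x23"
 have "?D * C1 = x23 * (x13 * (x12 * C1))" by (simp add: mult_ac)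
 also have "... = x23 * (P k ?m * (x13 * ?s1 B1)) - x13 * (P ?l ?m * (x23 * B1))"
  unfolding C1 by (simp add: algebra_simps)
 also have "... = P k ?m * P ?l ?m * (x23 * ?s1 (?s2 A1)) - P k ?m * P ?l k * x23 * A1
   - P ?l ?m * P k ?m * (x13 * ?s2 A1) + P ?l ?m * P k ?l * x13 * A1"
  unfolding B1 B1' by (simp add: algebra_simps)
 finally have D1: "?D * C1 = P k ?m * P ?l ?m * (?s1 (?s2 (?s1 f)) - ?s1 (?s2 f)) - P k ?m * P ?l k * x23 * A1
   - P ?l ?m * P k ?m * (?s2 (?s1 f) - ?s2 f) + P ?l ?m * P k ?l * x13 * A1"
  unfolding A1 .
 have "?D * C2 = x12 * (x13 * (x23 * C2))" by (simp add: mult_ac)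
 also have "... = x12 * (P k ?m * (x13 * ?s2 B2)) - x13 * (P k ?l * (x12 * B2))"
  unfolding C2 by (simp add: algebra_simps)
 also have "... = P k ?m * P k ?l * (x12 * ?s2 (?s1 A2)) - P k ?m * P ?m ?l * x12 * A2
   - P k ?l * P k ?m * (x13 * ?s1 A2) + P k ?l * P ?l ?m * x13 * A2"
  unfolding B2 B2' by (simp add: algebra_simps)
 finally have D2: "?D * C2 = P k ?m * P k ?l * (?s2 (?s1 (?s2 f)) - ?s2 (?s1 f)) - P k ?m * P ?m ?l * x12 * A2
   - P k ?l * P k ?m * (?s1 (?s2 f) - ?s1 f) + P k ?l * P ?l ?m * x13 * A2"
  unfolding A2 .
 \<comment> \<open>The surviving permuted images are expressed through \<open>A1\<close> and
   \<open>A2\<close>, so that only the coefficients of these two have to be compared.\<close>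
 have f12: "?s1 f = x12 * A1 + f" "?s2 f = x23 * A2 + f" by (simp_all add: A1 A2)
 have "?D * (P ?l ?m * C2 - P k ?l * C1) = P ?l ?m * (?D * C2) - P k ?l * (?D * C1)"
  by (simp add: algebra_simps)
 also have "... = Pb1 w k ?l ?m * (P k ?l * A1) + Pb2 w k ?l ?m * (P ?l ?m * A2)"
  unfolding D1 D2 br Pb1_def Pb2_def x[symmetric] P_def[symmetric]
  unfolding f12 by (simp add: algebra_simps)
 also have "... = ?D * (ev [k, ?l, ?m] (Pbar1 w) * T1 f + ev [k, ?l, ?m] (Pbar2 w) * T2 f)"
  unfolding T1_def T2_def A1_def[symmetric] A2_def[symmetric] ev_Pbar[symmetric] vdm_def x[symmetric]
  by (simp add: algebra_simps)
 finally have "?D * (P ?l ?m * C2 - P k ?l * C1) =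
  ?D * (ev [k, ?l, ?m] (Pbar1 w) * T1 f + ev [k, ?l, ?m] (Pbar2 w) * T2 f)" .
 moreover have "regular ?D" unfolding x by (intro regular_mult regular_Vr_diff) auto
 ultimately have "P ?l ?m * C2 - P k ?l * C1 = ev [k, ?l, ?m] (Pbar1 w) * T1 f + ev [k, ?l, ?m] (Pbar2 w) * T2 f"
  by (metis regularD)
 then show ?thesis unfolding C1_def C2_def T1_def T2_def by simp
qed

lemma dd_far_sp: "k + 1 < l \<or> l + 1 < k ==> sp l (dd k f) = dd k (sp l f)"
 by (rule dd_sub[where g = "sidx l"]) (auto simp: sidx_def)

lemma dd_far: "k + 1 < l \<or> l + 1 < k ==> dd k (dd l f) = dd l (dd k (f :: 'k::comm_ring_1 mpoly))"
proof -
 assume kl: "k + 1 < l \<or> l + 1 < k"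
 let ?c = "Vr l - Vr (Suc l) :: 'k mpoly"
 have c: "sp k ?c = ?c" using kl by (auto simp: sub.diff)
 have "?c * dd k (dd l f) = dd k (?c * dd l f)" using dd_sym_mult[OF c] by simp
 also have "... = dd k (sp l f - f)" by (simp add: dd_eq)
 also have "... = sp l (dd k f) - dd k f"
  using kl dd_add[of k "sp l f - f" f] by (simp add: dd_far_sp)
 finally show ?thesis by (metis ddI)
qed

lemma dd_braid_sp: "dd k (sp (Suc k) (sp k f)) = sp (Suc k) (sp k (dd (Suc k) f))"
 "dd (Suc k) (sp k (sp (Suc k) f)) = sp k (sp (Suc k) (dd k f))"
 unfolding sub_sub
 by (rule sym, rule dd_sub[where g = "\<lambda>j. sidx (Suc k) (sidx k j)"], auto simp: sidx_def)
   (rule sym, rule dd_sub[where g = "\<lambda>j. sidx k (sidx (Suc k) j)"], auto simp: sidx_def)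

section \<open>The polynomial representation\<close>

lemma dd_0 [simp]: "dd l 0 = 0"
 by (rule ddI) simp

lemma dd_sym_mult': "sp l g = g ==> dd l (f * g) = dd l f * g"
 using dd_sym_mult[of l g f] by (simp add: mult.commute)

lemma dd_dd_mult': "dd l (dd l f * p) = dd l p * dd l f"
 using dd_dd_mult[of l p f] by (simp add: mult.commute)

section \<open>Colour sequences under adjacent transpositions\<close>

lemma nth1_eqI: "length mu = length nu ==> (!!k. 1 \<le> k ==> k \<le> length mu ==> nth1 mu k = nth1 nu k) ==> mu = nu"
 unfolding nth1_def by (rule nth_equalityI) (use Suc_leI in \<open>auto dest: spec[of _ "Suc _"], force\<close>)

lemma length_sw [simp]: "length (sw l mu) = length mu"
 by (simp add: sw_def)

lemma nth1_sw: "1 \<le> l ==> l < length mu ==> 1 \<le> k ==> nth1 (sw l mu) k = nth1 mu (sidx l k)"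
 by (cases l; cases k) (auto simp: nth1_def sw_def sidx_def nth_list_update)

lemma sw_sw [simp]: "1 \<le> l ==> l < length mu ==> sw l (sw l mu) = mu"
 by (rule nth1_eqI) (auto simp: nth1_sw sidx_def)

lemma sw_eq_iff: "1 \<le> l ==> l < length mu ==> sw l mu = nu \<longleftrightarrow> mu = sw l nu \<and> length mu = length nu"
 by (metis sw_sw length_sw)

lemma sw_far: "1 \<le> k ==> k < length mu ==> 1 \<le> l ==> l < length mu ==> k + 1 < l \<or> l + 1 < k ==>
  sw k (sw l mu) = sw l (sw k mu)"
 by (rule nth1_eqI) (auto simp: nth1_sw sidx_def)

lemma sw_braid: "1 \<le> k ==> Suc k < length mu ==> sw k (sw (Suc k) (sw k mu)) = sw (Suc k) (sw k (sw (Suc k) mu))"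
 by (rule nth1_eqI) (auto simp: nth1_sw sidx_def)

lemma sw_same: "1 \<le> l ==> l < length mu ==> nth1 mu l = nth1 mu (Suc l) ==> sw l mu = mu"
 by (rule nth1_eqI) (auto simp: nth1_sw sidx_def)

section \<open>The ring of linear operators on polynomial-valued functions\<close>

type_synonym ('i, 'k) vec = "'i list => 'k mpoly"

typedef (overloaded) ('i, 'k::comm_ring_1) op =
 "{F :: ('i, 'k) vec => ('i, 'k) vec. (\<forall>f g. F (f + g) = F f + F g) \<and>
   (\<forall>c f. F (\<lambda>mu. cst c * f mu) = (\<lambda>mu. cst c * F f mu))}"
 morphisms ap Abs_op
 by (rule exI[of _ "\<lambda>f. f"]) auto

lifting_forget poly_mapping.lifting
setup_lifting type_definition_op

lemma op_eqI: "(!!f mu. ap A f mu = ap B f mu) ==> A = B"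
 by (metis ap_inject ext)

lemma ap_add: "ap A (f + g) = ap A f + ap A g" and ap_cst: "ap A (\<lambda>mu. cst c * f mu) mu = cst c * ap A f mu"
 using ap[of A] by auto

lemma ap_0 [simp]: "ap A 0 = 0" using ap_add[of A 0 0] by simp

lemma ap_sum: "ap A (sum f S) = (\<Sum>x\<in>S. ap A (f x))"
 by (induction S rule: infinite_finite_induct) (simp_all only: sum.infinite sum.empty sum.insert ap_0 ap_add not_False_eq_True)

instantiation op :: (type, comm_ring_1) ring_1
begin
lift_definition zero_op :: "('a, 'b) op" is "\<lambda>f. 0" by (auto simp: zero_fun_def)
lift_definition one_op :: "('a, 'b) op" is "\<lambda>f. f" by auto
lift_definition plus_op :: "('a, 'b) op => ('a, 'b) op => ('a, 'b) op" is "\<lambda>A B f. A f + B f"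
 by (auto simp: plus_fun_def algebra_simps)
lift_definition uminus_op :: "('a, 'b) op => ('a, 'b) op" is "\<lambda>A f. - A f"
 by (auto simp: plus_fun_def fun_Compl_def)
lift_definition minus_op :: "('a, 'b) op => ('a, 'b) op => ('a, 'b) op" is "\<lambda>A B f. A f - B f"
 by (auto simp: plus_fun_def fun_diff_def algebra_simps)
lift_definition times_op :: "('a, 'b) op => ('a, 'b) op => ('a, 'b) op" is "\<lambda>A B f. A (B f)"
 by auto
instance
proof
 show "(0 :: ('a, 'b) op) ~= 1"
 proof
  assume "(0 :: ('a, 'b) op) = 1"
  then have "ap (0 :: ('a, 'b) op) 1 [] = ap 1 1 []" by simp
  then show False by (simp add: zero_op.rep_eq one_op.rep_eq)
 qed
next
 fix a b c :: "('a, 'b) op"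
 show "a * (b + c) = a * b + a * c"
  by (rule op_eqI) (simp add: times_op.rep_eq plus_op.rep_eq ap_add)
qed (transfer; auto simp: algebra_simps)+
end

lemma ap_simps [simp]: "ap (A + B) f mu = ap A f mu + ap B f mu" "ap (A - B) f mu = ap A f mu - ap B f mu"
 "ap (- A) f mu = - ap A f mu" "ap (A * B) f = ap A (ap B f)" "ap 1 f = f" "ap 0 f = 0"
 by (simp_all add: plus_op.rep_eq minus_op.rep_eq uminus_op.rep_eq times_op.rep_eq one_op.rep_eq zero_op.rep_eq)

lemma ap_sum_left: "ap (sum A S) f mu = (\<Sum>x\<in>S. ap (A x) f mu)"
 by (induction S rule: infinite_finite_induct) simp_all

lift_definition dg :: "('i, 'k) vec => ('i, 'k::comm_ring_1) op" is "\<lambda>h f. h * f"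
 by (auto simp: algebra_simps times_fun_def)

lemma ap_dg [simp]: "ap (dg h) f mu = h mu * f mu"
 by (simp add: dg.rep_eq)

lemma dg_mult: "dg g * dg h = dg (g * h)" and dg_add: "dg g + dg h = dg (g + h)"
 and dg_diff: "dg g - dg h = dg (g - h)" and dg_uminus: "- dg g = dg (- g)"
 and dg_0 [simp]: "dg 0 = 0" and dg_1 [simp]: "dg 1 = 1"
 by (rule op_eqI; simp add: algebra_simps)+

lemma dg_commute: "dg g * dg h = dg h * dg g"
 by (simp add: dg_mult mult.commute)

definition po :: "'k mpoly => ('i, 'k::comm_ring_1) op" where
 "po p = dg (\<lambda>_. p)"

lemma ap_po [simp]: "ap (po p) f mu = p * f mu" by (simp add: po_def)

lemma po_mult: "po p * po q = po (p * q)" and po_add: "po p + po q = po (p + q)"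
 and po_diff: "po p - po q = po (p - q)" and po_0 [simp]: "po 0 = 0" and po_1 [simp]: "po 1 = 1"
 by (rule op_eqI; simp add: algebra_simps)+

lemma po_cst_commute: "po (cst c) * A = A * po (cst c)"
 by (rule op_eqI) (simp add: po_def dg.rep_eq times_fun_def ap_cst)

definition Eo :: "'i list => ('i, 'k::comm_ring_1) op" where
 "Eo nu = dg (\<lambda>mu. if mu = nu then 1 else 0)"

abbreviation Xo :: "nat => ('i, 'k::comm_ring_1) op" where
 "Xo k \<equiv> po (Vr k)"

lemma ap_Eo [simp]: "ap (Eo nu) f mu = (if mu = nu then f nu else 0)"
 by (simp add: Eo_def)

lemma dg_Eo: "dg h * Eo nu = po (h nu) * Eo nu"
 by (rule op_eqI) simp

lemma Eo_commute: "dg h * Eo nu = Eo nu * dg h" "po p * Eo nu = Eo nu * po p"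
 by (simp_all add: Eo_def dg_commute po_def)

lemma po_commute: "po p * po q = po q * po p" "po p * dg h = dg h * po p"
 by (simp_all add: po_def dg_commute)

text \<open>Crossings with a polynomial coefficient. The coefficient may depend on the two colours
 involved and is required to be equivariant where it matters.\<close>

lift_definition Go :: "('i => 'i => nat => nat => 'k mpoly) => nat => ('i, 'k::comm_ring_1) op" is
 "\<lambda>c l f mu. if 1 \<le> l \<and> l < length mu
   then c (nth1 mu l) (nth1 mu (Suc l)) l (Suc l) * sp l (f (sw l mu)) else 0"
 by (auto simp: fun_eq_iff algebra_simps sub.add sub.mult)

lemmas ap_Go = Go.rep_eq

definition equivar :: "('i => 'i => nat => nat => 'k::comm_ring_1 mpoly) => bool" where
 "equivar c \<longleftrightarrow> (\<forall>a b k m l. sp l (c a b k m) = c a b (sidx l k) (sidx l m))"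

lemma equivarD: "equivar c ==> sp l (c a b k m) = c a b (sidx l k) (sidx l m)"
 by (simp add: equivar_def)

text \<open>\<open>qd i j\<close> stands for -a_ij and \<open>pd i\<close> for 1 - a_ii/2, the
  exponents that carry the unit coefficients. The numbering \<open>ord\<close> decides which of the
  two crossings of distinct colours receives \<open>Q\<close>.\<close>

locale klr =
 fixes t :: "'i::finite => 'i => nat => nat => 'k::comm_ring_1" and w :: "'i => nat => nat => 'k"
  and ord :: "'i => nat" and qd :: "'i => 'i => nat" and pd :: "'i => nat"
 assumes inj_ord: "inj ord"
  and t_sym: "t i j p q = t j i q p"
  and t_bound: "i ~= j ==> \<exists>m. \<forall>p q. p > m \<or> q > m --> t i j p q = 0"
  and t_unit: "i ~= j ==> \<exists>c. t i j (qd i j) 0 * c = 1"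
  and t_lead: "i ~= j ==> q > 0 ==> t i j (qd i j) q = 0"
  and t_high: "i ~= j ==> p > qd i j ==> t i j p q = 0"
  and w_unit: "\<exists>c. w i (pd i) 0 * c = 1" "\<exists>c. w i 0 (pd i) * c = 1"
  and w_high: "p + q > pd i ==> w i p q = 0"
begin

definition PP :: "'i => nat => nat => 'k mpoly" where "PP i = p2 (w i)"
definition QQ :: "'i => 'i => nat => nat => 'k mpoly" where "QQ i j = p2 (t i j)"

text \<open>Placing \<open>Q\<close> on only one of the two mixed crossings gives the square \<open>Q\<close>.\<close>
definition qq :: "'i => 'i => nat => nat => 'k mpoly" where
 "qq i j k m = (if ord i < ord j then QQ i j k m else 1)"

text \<open>The coefficients of the intertwiner \<open>\<tau>\<^sub>k x\<^sub>k\<^sub>+\<^sub>1 - x\<^sub>k\<^sub>+\<^sub>1 \<tau>\<^sub>k\<close>.\<close>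
definition cc :: "'i => 'i => nat => nat => 'k mpoly" where
 "cc i j k m = (if i = j then PP i k m else (Vr k - Vr m) * qq i j k m)"

lemma QQ_sym: "QQ i j k m = QQ j i m k"
proof -
 have *: "t i j = (\<lambda>p q. t j i q p)" by (intro ext t_sym)
 show ?thesis unfolding QQ_def by (subst *) (rule p2_flip)
qed

lemma qq_qq: "i ~= j ==> qq i j k m * qq j i m k = QQ i j k m"
 using inj_ord by (auto simp: qq_def QQ_sym[of j i] inj_eq)

lemma sp_PP: "sp l (PP i k m) = PP i (sidx l k) (sidx l m)"
 and sp_QQ: "sp l (QQ i j k m) = QQ i j (sidx l k) (sidx l m)"
 by (simp_all add: PP_def QQ_def sp_p2)

lemma sp_qq: "sp l (qq i j k m) = qq i j (sidx l k) (sidx l m)"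
 by (simp add: qq_def sp_QQ)

lemma equivar_qq: "equivar qq" and equivar_cc: "equivar cc"
 by (auto simp: equivar_def cc_def sp_qq sp_PP sub.mult sub.diff)

lemma regular_PP: "k ~= m ==> regular (PP i k m)"
 unfolding PP_def using w_unit[of i] w_high[of i]
 by (auto intro!: regular_p2[where m = "pd i" and d = "pd i"])

lemma regular_QQ:
 assumes "k ~= m" "i ~= j"
 shows "regular (QQ i j k m)"
proof -
 obtain M c where "!!p q. p > M \<or> q > M ==> t i j p q = 0" "t i j (qd i j) 0 * c = 1"
  using t_unit[OF assms(2)] t_bound[OF assms(2)] by blast
 then show ?thesis
  unfolding QQ_def using assms t_lead t_high by (intro regular_p2[of _ _ M _ "qd i j" c])
qed

lemma regular_1 [simp]: "regular 1" by (simp add: regular_def)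

lemma regular_qq: "k ~= m ==> i ~= j ==> regular (qq i j k m)"
 by (simp add: qq_def regular_QQ)

lemma regular_cc: "k ~= m ==> regular (cc i j k m)"
 by (auto simp: cc_def regular_PP intro: regular_mult regular_qq)

lift_definition To :: "nat => ('i, 'k) op" is
 "\<lambda>l f mu. if 1 \<le> l \<and> l < length mu then
   (if nth1 mu l = nth1 mu (Suc l) then PP (nth1 mu l) l (Suc l) * dd l (f mu)
   else qq (nth1 mu l) (nth1 mu (Suc l)) l (Suc l) * sp l (f (sw l mu))) else 0"
proof -
 fix l
 have "dd l (cst c * f) = cst c * dd l f" for c :: 'k and f
  by (rule dd_sym_mult) simp
 then show "?thesis l"
  by (auto simp: fun_eq_iff algebra_simps sub.add sub.mult dd_add)
qed

lemmas ap_To = To.rep_eq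

abbreviation Th :: "nat => ('i, 'k) op" where "Th \<equiv> Go cc"

lemma To_Eo: "1 \<le> l ==> l < length nu ==> To l * Eo nu = Eo (sw l nu) * To l"
 by (rule op_eqI) (auto simp: ap_To sw_same nth1_sw sw_eq_iff)

lemma Go_Eo: "1 \<le> l ==> l < length nu ==> Go c l * Eo nu = Eo (sw l nu) * Go c l"
 by (rule op_eqI) (auto simp: ap_Go nth1_sw)

lemma To_far: "k + 1 < l \<or> l + 1 < k ==> To k * To l = To l * To k"
proof (rule op_eqI)
 fix f :: "('i, 'k) vec" and mu :: "'i list"
 assume kl: "k + 1 < l \<or> l + 1 < k"
 have s: "sidx k l = l" "sidx k (Suc l) = Suc l" "sidx l k = k" "sidx l (Suc k) = Suc k"
  using kl by (auto simp: sidx_def)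
 have P: "dd k (PP a l (Suc l) * g) = PP a l (Suc l) * dd k g" "dd l (PP a k (Suc k) * g) = PP a k (Suc k) * dd l g"
   "dd k (qq a b l (Suc l) * g) = qq a b l (Suc l) * dd k g" "dd l (qq a b k (Suc k) * g) = qq a b k (Suc k) * dd l g"
   for a b g
  by (rule dd_sym_mult; simp add: sp_PP sp_qq s)+
 have kl': "l + 1 < k \<or> k + 1 < l" using kl by blast
 show "ap (To k * To l) f mu = ap (To l * To k) f mu"
  by (simp add: ap_To nth1_sw s P dd_sym_mult' sub.mult sp_PP sp_qq dd_far[OF kl] dd_far_sp[OF kl]
   dd_far_sp[OF kl'] sp_commute[OF kl] mult_ac)
    (use kl sw_far[of k mu l] in auto)
qed

text \<open>In the twisted Leibniz rule for \<open>dd\<close> the terms with a divided difference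
  cancel against the second product, and a bare transposition with coefficient \<open>P\<close> is
  left. For distinct colours the commutator contributes the difference of the two variables.\<close>

lemma Th_eq: "1 \<le> k ==> To k * Xo (Suc k) - Xo (Suc k) * To k = Th k"
 and Th_eq': "1 \<le> k ==> To k * Xo k - Xo k * To k = - Th k"
proof -
 have d: "dd k (Vr (Suc k) * g) = Vr (Suc k) * dd k g + sp k g" for g :: "'k mpoly"
 proof (rule ddI)
  have "(Vr k - Vr (Suc k)) * (Vr (Suc k) * dd k g + sp k g)
   = Vr (Suc k) * ((Vr k - Vr (Suc k)) * dd k g) + (Vr k - Vr (Suc k)) * sp k g"
   by (simp add: algebra_simps)
  then show "(Vr k - Vr (Suc k)) * (Vr (Suc k) * dd k g + sp k g) = sp k (Vr (Suc k) * g) - Vr (Suc k) * g"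
   unfolding dd_eq by (simp add: sub.mult algebra_simps)
 qed
 have d': "dd k (Vr k * g) = Vr k * dd k g - sp k g" for g :: "'k mpoly"
 proof (rule ddI)
  have "(Vr k - Vr (Suc k)) * (Vr k * dd k g - sp k g)
   = Vr k * ((Vr k - Vr (Suc k)) * dd k g) - (Vr k - Vr (Suc k)) * sp k g"
   by (simp add: algebra_simps)
  then show "(Vr k - Vr (Suc k)) * (Vr k * dd k g - sp k g) = sp k (Vr k * g) - Vr k * g"
   unfolding dd_eq by (simp add: sub.mult algebra_simps)
 qed
 note d2 = d[unfolded mult.commute[of "Vr (Suc k)"]] d'[unfolded mult.commute[of "Vr k"]]
 assume "1 \<le> k"
 then show "To k * Xo (Suc k) - Xo (Suc k) * To k = Th k" "To k * Xo k - Xo k * To k = - Th k"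
  by (auto intro!: op_eqI simp: ap_To ap_Go d d' d2 cc_def sub.mult sw_same algebra_simps)
qed

lemma To_po: "sp k p = p ==> To k * po p = po p * To k"
 by (rule op_eqI) (simp add: ap_To dd_sym_mult sub.mult mult_ac)

lemma Go_po: "Go c k * po p = po (sp k p) * Go c k"
 by (rule op_eqI) (simp add: ap_Go sub.mult mult_ac)

lemma To_Xo: "To k * Xo l = Xo l * To k" if "l ~= k" "l ~= Suc k"
 using that by (intro To_po) (simp add: sidx_def)

text \<open>The coefficients collected when two strands pass the third are symmetric in these two
  strands, so they commute with their crossing. Hence there is no correction term, unlike in the
  braid relation for \<open>To\<close> alone.\<close>

lemma Th_braid: "1 \<le> k ==> To k * (Th (Suc k) * Th k) = Th (Suc k) * Th k * To (Suc k)"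
proof (rule op_eqI)
 fix f :: "('i, 'k) vec" and mu :: "'i list"
 assume "1 \<le> k"
 let ?a = "nth1 mu k" and ?b = "nth1 mu (Suc k)" and ?c = "nth1 mu (Suc (Suc k))"
 show "ap (To k * (Th (Suc k) * Th k)) f mu = ap (Th (Suc k) * Th k * To (Suc k)) f mu"
 proof (cases "Suc k < length mu")
  case len: True
  show ?thesis
  proof (cases "?a = ?b")
   case True
   let ?p = "cc ?b ?c k (Suc (Suc k)) * cc ?b ?c (Suc k) (Suc (Suc k))"
   have "sp k ?p = ?p" using len by (simp add: sub.mult equivarD[OF equivar_cc] mult_ac)
   from dd_sym_mult[OF this]
   have D: "dd k (cc ?b ?c k (Suc (Suc k)) * (cc ?b ?c (Suc k) (Suc (Suc k)) * g)) =
     cc ?b ?c k (Suc (Suc k)) * (cc ?b ?c (Suc k) (Suc (Suc k)) * dd k g)" for g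
    by (simp add: mult.assoc)
   show ?thesis using True len \<open>1 \<le> k\<close>
    by (simp add: D ap_To ap_Go nth1_sw sub.mult equivarD[OF equivar_cc] sp_PP mult_ac dd_braid_sp)
  next
   case False
   then show ?thesis using len \<open>1 \<le> k\<close>
    by (simp add: ap_To ap_Go nth1_sw sub.mult equivarD[OF equivar_cc] sp_qq mult_ac sw_braid sp_braid)
  qed
 qed (simp add: ap_To ap_Go)
qed

lemma To_sq: "1 \<le> k ==> Suc k \<le> length nu ==> To k * To k * Eo nu =
 (if nth1 nu k = nth1 nu (Suc k) then po (ev [k, Suc k] (dP (w (nth1 nu k)))) * To k * Eo nu
  else po (QQ (nth1 nu k) (nth1 nu (Suc k)) k (Suc k)) * Eo nu)"
proof -
 assume k: "1 \<le> k" "Suc k \<le> length nu"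
 have "To k * To k * Eo nu = Eo nu * (To k * To k)"
  using k by (simp add: mult.assoc To_Eo) (simp add: mult.assoc[symmetric] To_Eo)
 moreover have "po p * To k * Eo nu = Eo nu * (po p * To k)" if "nth1 nu k = nth1 nu (Suc k)" for p
  using that k by (simp add: mult.assoc To_Eo sw_same) (simp add: mult.assoc[symmetric] Eo_commute)
 moreover have "Eo nu * (To k * To k) = (if nth1 nu k = nth1 nu (Suc k)
   then Eo nu * (po (ev [k, Suc k] (dP (w (nth1 nu k)))) * To k)
   else Eo nu * po (QQ (nth1 nu k) (nth1 nu (Suc k)) k (Suc k)))"
  using k qq_qq[of "nth1 nu k" "nth1 nu (Suc k)" k "Suc k"]
  by (intro op_eqI) (auto simp: ap_To dd_dd_mult dd_dd_mult' ev_dP nth1_sw sub.mult sp_qq mult_ac PP_def)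
 ultimately show ?thesis by (simp add: Eo_commute)
qed

text \<open>The five cases are the coincidences among the three colours. An error arises only if the
  outer colours agree. If just two neighbouring colours agree, the coefficients which this pair
  meets are symmetric and pass through its divided difference.\<close>

lemma To_braid_pointwise:
 assumes k: "1 \<le> k" "Suc k < length mu"
 defines "a \<equiv> nth1 mu k" and "b \<equiv> nth1 mu (Suc k)" and "c \<equiv> nth1 mu (Suc (Suc k))"
 shows "ap (To (Suc k) * To k * To (Suc k) - To k * To (Suc k) * To k) f mu =
  (if a = c \<and> a ~= b then PP a k (Suc (Suc k)) * ev [k, Suc k, Suc (Suc k)] (Qbar (t a b)) * f mu
   else if a = b \<and> b = c then
    ev [k, Suc k, Suc (Suc k)] (Pbar1 (w a)) * ap (To k) f mu + ev [k, Suc k, Suc (Suc k)] (Pbar2 (w a)) * ap (To (Suc k)) f mu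
   else 0)"
proof -
 let ?l = "Suc k" and ?m = "Suc (Suc k)"
 note s = ap_To nth1_sw sub.mult sp_PP sp_qq a_def[symmetric] b_def[symmetric] c_def[symmetric]
 consider "a = b" "b = c" | "a = b" "b ~= c" | "a ~= b" "b = c" | "a = c" "a ~= b" | "a ~= b" "b ~= c" "a ~= c"
  by blast
 then show ?thesis
 proof cases
  case 1
  then show ?thesis using k demazure_braid[where w = "w a" and k = k and f = "f mu"]
   by (simp add: s PP_def)
 next
  case 2
  have sym: "sp k (qq b c k ?m * qq b c ?l ?m) = qq b c k ?m * qq b c ?l ?m"
   by (simp add: sub.mult sp_qq mult_ac)
  from dd_sym_mult[OF this]
  have D: "dd k (qq b c k ?m * (qq b c ?l ?m * g)) = qq b c k ?m * (qq b c ?l ?m * dd k g)" for g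
   by (simp add: mult.assoc)
  show ?thesis using k 2
   by (simp add: D s mult_ac dd_braid_sp)
 next
  case 3
  have sym: "sp ?l (qq a c k ?l * qq a c k ?m) = qq a c k ?l * qq a c k ?m"
   by (simp add: sub.mult sp_qq mult_ac)
  from dd_sym_mult[OF this]
  have D: "dd ?l (qq a c k ?l * (qq a c k ?m * g)) = qq a c k ?l * (qq a c k ?m * dd ?l g)" for g
   by (simp add: mult.assoc)
  show ?thesis using k 3
   by (simp add: D s mult_ac dd_braid_sp)
 next
  case 4
  \<comment> \<open>Both composites are compared after multiplication by x_k - x_{k+2}. The fully
    permuted terms \<open>?F\<close> cancel, and the coefficients of \<open>f mu\<close> pair up by
    \<open>qq_qq\<close> to the numerator of Q-bar.\<close>
  let ?x = "Vr k - Vr ?m :: 'k mpoly"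
  let ?f = "f mu" and ?F = "sp k (sp ?l (sp k (f mu)))"
  define h where "h = qq a b ?l ?m * sp ?l ?f"
  define h' where "h' = qq b a k ?l * sp k ?f"
  have "sp ?l ((Vr k - Vr ?l) * dd k h) = sp ?l (sp k h - h)" by (simp add: dd_eq)
  then have h: "?x * sp ?l (dd k h) = qq a b k ?l * ?F - qq a b ?m ?l * ?f"
   by (simp add: sub.mult sub.diff h_def sp_qq sp_braid)
  have "sp k ((Vr ?l - Vr ?m) * dd ?l h') = sp k (sp ?l h' - h')" by (simp add: dd_eq)
  then have h': "?x * sp k (dd ?l h') = qq b a ?l ?m * ?F - qq b a ?l k * ?f"
   by (simp add: sub.mult sub.diff h'_def sp_qq)
  let ?P = "PP a k ?m"
  have mu: "sw k (sw k mu) = mu" "sw ?l (sw ?l mu) = mu" using k by auto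
  have sws: "sw k (sw ?l mu) = sw ?l mu" "sw ?l (sw k mu) = sw k mu"
   using k 4 by (auto intro!: sw_same simp: nth1_sw a_def b_def c_def)
  have e1: "ap (To ?l * To k * To ?l) f mu = qq b a ?l ?m * (?P * sp ?l (dd k h))"
   using 4 k by (simp add: s h_def)
  have e2: "ap (To k * To ?l * To k) f mu = qq a b k ?l * (?P * sp k (dd ?l h'))"
   using 4 k by (simp add: s h'_def)
  have "?x * (ap (To ?l * To k * To ?l) f mu - ap (To k * To ?l * To k) f mu)
    = ?P * (qq b a ?l ?m * (?x * sp ?l (dd k h)) - qq a b k ?l * (?x * sp k (dd ?l h')))"
   unfolding e1 e2 by (simp add: algebra_simps)
  also have "... = ?P * (qq a b k ?l * qq b a ?l k - qq a b ?m ?l * qq b a ?l ?m) * ?f"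
   unfolding h h' by (simp add: algebra_simps)
  also have "... = ?P * (?x * ev [k, ?l, ?m] (Qbar (t a b))) * ?f"
   using 4 by (simp add: qq_qq ev_Qbar QQ_def)
  finally have "?x * (ap (To ?l * To k * To ?l) f mu - ap (To k * To ?l * To k) f mu)
   = ?x * (?P * ev [k, ?l, ?m] (Qbar (t a b)) * ?f)" by (simp add: mult_ac)
  then have "ap (To ?l * To k * To ?l) f mu - ap (To k * To ?l * To k) f mu
   = ?P * ev [k, ?l, ?m] (Qbar (t a b)) * ?f"
   by (rule regularD[rotated]) auto
  with 4 show ?thesis by simp
 next
  case 5
  then show ?thesis using k by (simp add: s mult_ac sp_braid sw_braid)
 qed
qed

lemma To_braid:
 assumes k: "1 \<le> k" "Suc k < length nu"
 defines "a \<equiv> nth1 nu k" and "b \<equiv> nth1 nu (Suc k)" and "c \<equiv> nth1 nu (Suc (Suc k))"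
 shows "(To (Suc k) * To k * To (Suc k) - To k * To (Suc k) * To k) * Eo nu =
  (if a = c \<and> a ~= b then po (PP a k (Suc (Suc k)) * ev [k, Suc k, Suc (Suc k)] (Qbar (t a b))) * Eo nu
   else if a = b \<and> b = c then
    po (ev [k, Suc k, Suc (Suc k)] (Pbar1 (w a))) * To k * Eo nu
    + po (ev [k, Suc k, Suc (Suc k)] (Pbar2 (w a))) * To (Suc k) * Eo nu
   else 0)"
  (is "?L * _ = ?R")
proof -
 \<comment> \<open>The idempotent prescribes the colours before the three crossings, whereas the
   operators are evaluated at the sequence after them, where the three colours appear in reverse
   order.\<close>
 let ?mu = "sw k (sw (Suc k) (sw k nu))"
 have len: "length ?mu = length nu" by simp
 have cols: "nth1 ?mu k = c" "nth1 ?mu (Suc k) = b" "nth1 ?mu (Suc (Suc k)) = a"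
  using k by (simp_all add: nth1_sw a_def b_def c_def)
 have L: "?L * Eo nu = Eo ?mu * ?L"
  using k by (simp add: left_diff_distrib right_diff_distrib mult.assoc To_Eo)
   (simp add: mult.assoc[symmetric] To_Eo sw_braid)
 have same: "?mu = nu" if "a = c"
  by (rule nth1_eqI) (use k that in \<open>auto simp: nth1_sw a_def c_def sidx_def\<close>)
 have R: "po p * To k * Eo nu = Eo nu * (po p * To k)" "po p * To (Suc k) * Eo nu = Eo nu * (po p * To (Suc k))"
  if "a = b" "b = c" for p
  using that k by (simp_all add: mult.assoc To_Eo sw_same a_def b_def c_def)
   (simp_all add: mult.assoc[symmetric] Eo_commute)
 have pw: "ap (Eo ?mu * ?L) f mu = (if mu = ?mu then ap ?L f ?mu else 0)" for f mu by simp
 have k': "Suc k < length ?mu" using k by simp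
 note br = To_braid_pointwise[OF k(1) k', unfolded cols]
 consider "a = c" "a ~= b" | "a = b" "b = c" | "a ~= c" by blast
 then have "Eo ?mu * ?L = ?R"
 proof cases
  case 1
  then show ?thesis unfolding same[OF 1(1)]
   by (intro op_eqI) (simp add: br[unfolded same[OF 1(1)]] del: ap_simps(2))
 next
  case 2
  then have ac: "a = c" by simp
  show ?thesis unfolding same[OF ac] using 2
   by (intro op_eqI) (simp add: R br[unfolded same[OF ac]] del: ap_simps(2))
 next
  case 3
  have "Eo ?mu * ?L = 0"
   unfolding pw[abs_def] by (rule op_eqI) (subst pw, use 3 br in \<open>auto simp del: ap_simps(2)\<close>)
  with 3 show ?thesis by auto
 qed
 with L show ?thesis by simp
qed

end

section \<open>The free algebra and its action\<close>

lemmas fun_apply = plus_fun_apply zero_fun_apply times_fun_apply one_fun_apply minus_apply uminus_apply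

text \<open>As rewrite rules these would also fire on unapplied functions, by eta-expansion.\<close>
declare fun_apply [simp del]

definition fsupp :: "('i, 'k::comm_ring_1) fa => bool" where
 "fsupp f \<longleftrightarrow> finite {u. f u ~= 0}"

definition fw :: "'i gen list => ('i, 'k::comm_ring_1) fa" where
 "fw u = (\<lambda>v. if v = u then 1 else 0)"

text \<open>Summing over factorizations instead of cut positions makes associativity a reindexing:
  both triple products run over factorizations into three words.\<close>

lemma fmul_splits: "fmul f g w = (\<Sum>(u, v)\<in>{(u, v). u @ v = w}. f u * g v)"
 unfolding fmul_def
 by (rule sum.reindex_bij_witness[of _ "\<lambda>(u, v). length u" "\<lambda>j. (take j w, drop j w)"]) auto

lemma finite_splits: "finite {(u, v). u @ v = (w :: 'a list)}"
proof -
 have "{(u, v). u @ v = w} \<subseteq> (\<lambda>j. (take j w, drop j w)) ` {..length w}"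
 proof (safe, goal_cases)
  case (1 u v)
  show "(u, v) \<in> (\<lambda>j. (take j (u @ v), drop j (u @ v))) ` {..length (u @ v)}"
   by (rule image_eqI[of _ _ "length u"]) auto
 qed
 then show ?thesis by (rule finite_subset) simp
qed

lemma fmul_assoc: "fmul (fmul f g) h = fmul f (fmul g h)"
proof
 fix w
 have "fmul (fmul f g) h w = (\<Sum>(x, c)\<in>{(x, c). x @ c = w}. \<Sum>(a, b)\<in>{(a, b). a @ b = x}. f a * g b * h c)"
  unfolding fmul_splits by (simp add: sum_distrib_right split_def)
 also have "... = (\<Sum>((x, c), (a, b))\<in>(SIGMA (x, c):{(x, c). x @ c = w}. {(a, b). a @ b = x}). f a * g b * h c)"
  by (subst sum.Sigma[symmetric]) (auto simp: finite_splits finite_splits[unfolded split_def] split_def)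
 also have "... = (\<Sum>((a, y), (b, c))\<in>(SIGMA (a, y):{(a, y). a @ y = w}. {(b, c). b @ c = y}). f a * (g b * h c))"
  by (rule sum.reindex_bij_witness[of _ "\<lambda>((a, y), (b, c)). ((a @ b, c), (a, b))" "\<lambda>((x, c), (a, b)). ((a, b @ c), (b, c))"])
   (auto simp: mult.assoc)
 also have "... = (\<Sum>(a, y)\<in>{(a, y). a @ y = w}. \<Sum>(b, c)\<in>{(b, c). b @ c = y}. f a * (g b * h c))"
  by (subst sum.Sigma[symmetric]) (auto simp: finite_splits finite_splits[unfolded split_def] split_def)
 also have "... = fmul f (fmul g h) w"
  unfolding fmul_splits by (simp add: sum_distrib_left split_def)
 finally show "fmul (fmul f g) h w = fmul f (fmul g h) w" .
qed

lemma fmul_add_left: "fmul (f + g) h = fmul f h + fmul g h"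
 and fmul_add_right: "fmul f (g + h) = fmul f g + fmul f h"
 and fmul_0 [simp]: "fmul 0 h = 0" "fmul h 0 = 0"
 and fmul_minus: "fmul (- f) g = - fmul f g" "fmul f (- g) = - fmul f g"
 by (auto simp: fun_apply fmul_def fun_eq_iff algebra_simps sum.distrib sum_negf)

lemma fmul_diff_left: "fmul (f - g) h = fmul f h - fmul g h"
 and fmul_diff_right: "fmul f (g - h) = fmul f g - fmul f h"
 by (auto simp: fun_apply fmul_def fun_eq_iff algebra_simps sum_subtractf)

lemma fmul_sum_right: "fmul h (sum f S) = (\<Sum>x\<in>S. fmul h (f x))"
 by (induction S rule: infinite_finite_induct)
   (simp_all only: sum.infinite sum.empty sum.insert fmul_0 fmul_add_right not_False_eq_True)

lemma fw_mult: "fmul (fw u) (fw v) = fw (u @ v)"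
proof
 fix w
 have "fmul (fw u) (fw v) w = (\<Sum>x\<in>{(a, b). a @ b = w}. if x = (u, v) then 1 else 0)"
  unfolding fmul_splits by (intro sum.cong) (auto simp: fw_def split: if_splits)
 then show "fmul (fw u) (fw v) w = fw (u @ v) w"
  by (auto simp: finite_splits sum.delta fw_def)
qed

lemma fmul_fsmul: "fmul (fsmul c f) g = fsmul c (fmul f g)" "fmul f (fsmul c g) = fsmul c (fmul f g)"
 by (auto simp: fmul_def fsmul_def fun_eq_iff sum_distrib_left mult_ac)

lemma fsmul_simps: "fsmul c (fsmul d f) = fsmul (c * d) f" "fsmul c (f + g) = fsmul c f + fsmul c g"
 "fsmul (c + d) f = fsmul c f + fsmul d f" "fsmul 1 f = f" "fsmul 0 f = 0" "fsmul c 0 = 0"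
 by (auto simp: fun_apply fsmul_def fun_eq_iff algebra_simps)

lemma fgen_fw: "fgen g = fw [g]" and fone_fw: "fone = fw []"
 by (auto simp: fgen_def fone_def fw_def)

lemma fone_mult [simp]: "fmul fone f = f" "fmul f fone = f"
proof -
 have "fmul fone f v = (\<Sum>j\<le>length v. if j = 0 then f v else 0)" for v
  unfolding fmul_def fone_def by (intro sum.cong) auto
 then show "fmul fone f = f" by (auto simp: fun_eq_iff)
 have "fmul f fone v = (\<Sum>j\<le>length v. if j = length v then f v else 0)" for v
  unfolding fmul_def fone_def by (intro sum.cong) auto
 then show "fmul f fone = f" by (auto simp: fun_eq_iff)
qed

lemma fprod_gens: "fprod (map fgen u) = (fw u :: ('i, 'k::comm_ring_1) fa)"
proof (induction u)
 case (Cons a u)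
 have "fprod (map fgen (a # u)) = (fmul (fgen a) (fprod (map fgen u)) :: ('i, 'k) fa)"
  by (simp add: fprod_def)
 also have "... = fw (a # u)"
  by (simp only: Cons) (simp only: fgen_fw fw_mult append.simps)
 finally show ?case .
qed (simp add: fprod_def fone_fw)

lemma fsupp_subset: "finite S ==> (!!u. f u ~= 0 ==> u \<in> S) ==> fsupp f"
 unfolding fsupp_def by (erule rev_finite_subset) auto

lemma fsupp_add: "fsupp f ==> fsupp g ==> fsupp (f + g)"
 by (rule fsupp_subset[of "{u. f u ~= 0} \<union> {u. g u ~= 0}"]) (auto simp: fsupp_def fun_apply)

lemma fsupp_smul_fw: "fsupp (fsmul c (fw u))"
 by (rule fsupp_subset[of "{u}"]) (auto simp: fsmul_def fw_def split: if_splits)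

lemma fun_sum_apply: "sum f S x = (\<Sum>s\<in>S. f s x)"
 by (induction S rule: infinite_finite_induct) (simp_all add: fun_apply)

lemma fsupp_expand: "fsupp f ==> f = (\<Sum>u\<in>{u. f u ~= 0}. fsmul (f u) (fw u))"
proof
 fix v
 assume f: "fsupp f"
 have "(\<Sum>u\<in>{u. f u ~= 0}. fsmul (f u) (fw u)) v = (\<Sum>u\<in>{u. f u ~= 0}. fsmul (f u) (fw u) v)"
  by (rule fun_sum_apply)
 also have "... = (\<Sum>u\<in>{u. f u ~= 0}. if u = v then f v else 0)"
  by (intro sum.cong) (auto simp: fsmul_def fw_def)
 also have "... = f v" using f by (simp add: fsupp_def)
 finally show "f v = (\<Sum>u\<in>{u. f u ~= 0}. fsmul (f u) (fw u)) v" by simp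
qed

text \<open>Stated for an arbitrary predicate on generators, because \<open>FA n\<close> and the
  subalgebras with restricted crossings share all closure properties.\<close>

definition FAV :: "('i gen => bool) => ('i, 'k::comm_ring_1) fa set" where
 "FAV V = {f. fsupp f \<and> (\<forall>u. f u ~= 0 --> (\<forall>g\<in>set u. V g))}"

lemma FAV_iff: "f \<in> FAV V \<longleftrightarrow> fsupp f \<and> (\<forall>u. f u ~= 0 --> (\<forall>g\<in>set u. V g))"
 by (simp add: FAV_def)

lemma FA_FAV: "FA n = FAV (vgen n)"
 by (simp add: FA_def FAV_def fsupp_def)

lemma FAV_mono: "f \<in> FAV V ==> (!!g. V g ==> W g) ==> f \<in> FAV W"
 by (auto simp: FAV_iff)

lemma FAV_add: "f \<in> FAV V ==> g \<in> FAV V ==> f + g \<in> FAV V"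
 unfolding FAV_iff by (auto simp: fun_apply intro: fsupp_add) (metis add_cancel_right_left)

lemma FAV_0 [simp]: "0 \<in> FAV V" by (auto simp: FAV_iff fsupp_def fun_apply)

lemma FAV_sum: "(!!x. x \<in> S ==> f x \<in> FAV V) ==> sum f S \<in> FAV V"
 by (induction S rule: infinite_finite_induct)
   (simp_all only: sum.infinite sum.empty sum.insert FAV_0 FAV_add insert_iff not_False_eq_True simp_thms)

lemma FAV_smul_fw: "\<forall>g\<in>set u. V g ==> fsmul c (fw u) \<in> FAV V"
 by (auto simp: FAV_iff fsupp_smul_fw) (auto simp: fsmul_def fw_def split: if_splits)

lemma FAV_induct [consumes 1, case_names zero word add]:
 assumes "f \<in> FAV V" and "P 0" and "!!c u. \<forall>g\<in>set u. V g ==> P (fsmul c (fw u))"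
  and "!!f g. f \<in> FAV V ==> g \<in> FAV V ==> P f ==> P g ==> P (f + g)"
 shows "P f"
proof -
 have key: "P (\<Sum>u\<in>S. fsmul (f u) (fw u))" if "finite S" "!!u. u \<in> S ==> f u ~= 0" for S
  using that
 proof (induction S rule: finite_induct)
  case (insert u S)
  then have "P (fsmul (f u) (fw u))" "fsmul (f u) (fw u) \<in> FAV V"
   "(\<Sum>u\<in>S. fsmul (f u) (fw u)) \<in> FAV V"
   using assms(1) by (auto simp: FAV_iff[of f] intro!: assms(3) FAV_smul_fw FAV_sum)
  with insert assms(4) show ?case by auto
 qed (use assms in simp)
 have fs: "fsupp f" using assms(1) by (simp add: FAV_iff)
 then have "P (\<Sum>u\<in>{u. f u ~= 0}. fsmul (f u) (fw u))" by (intro key) (simp_all add: fsupp_def)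
 then show ?thesis by (subst fsupp_expand[OF fs])
qed

lemma FAV_fsmul: "f \<in> FAV V ==> fsmul c f \<in> FAV V"
 by (induction rule: FAV_induct) (auto simp: fsmul_simps intro: FAV_smul_fw FAV_add)

lemma FAV_minus: "f \<in> FAV V ==> - f \<in> FAV V"
proof -
 have "- f = fsmul (- 1) f" by (auto simp: fsmul_def fun_apply)
 then show "f \<in> FAV V ==> - f \<in> FAV V" by (simp add: FAV_fsmul)
qed

lemma FAV_diff: "f \<in> FAV V ==> g \<in> FAV V ==> f - g \<in> FAV V"
 using FAV_add[of f V "- g"] by (simp add: FAV_minus)

lemma FAV_fmul: "f \<in> FAV V ==> g \<in> FAV V ==> fmul f g \<in> FAV V"
proof (induction f rule: FAV_induct)
 case (word c u)
 show ?case using word(2)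
 proof (induction g rule: FAV_induct)
  case (word c' v)
  then show ?case using \<open>\<forall>g\<in>set u. V g\<close>
   by (auto simp: fmul_fsmul fw_mult fsmul_simps intro!: FAV_smul_fw)
 qed (auto simp: fmul_add_right intro: FAV_add)
qed (auto simp: fmul_add_left intro: FAV_add)

lemma FAV_fw: "\<forall>g\<in>set u. V g ==> fw u \<in> FAV V"
 using FAV_smul_fw[of u V 1] by (simp add: fsmul_simps)

lemma FAV_fone [simp]: "fone \<in> FAV V" by (simp add: fone_fw FAV_fw)

lemma FAV_gen: "V g ==> fgen g \<in> FAV V" by (simp add: fgen_fw FAV_fw)

lemma FAV_fpow: "f \<in> FAV V ==> fpow f m \<in> FAV V"
 by (induction m) (auto intro: FAV_fmul)

lemma FAV_fprod: "(!!f. f \<in> set fs ==> f \<in> FAV V) ==> fprod fs \<in> FAV V"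
 by (induction fs) (auto simp: fprod_def intro: FAV_fmul)

lemma FAV_evp: "(!!f. f \<in> set fs ==> f \<in> FAV V) ==> evp p fs \<in> FAV V"
 unfolding evp_def by (intro FAV_sum FAV_fsmul FAV_fprod) (auto intro!: FAV_fpow)

lemmas FAV_intros = FAV_add FAV_diff FAV_minus FAV_fmul FAV_sum FAV_fsmul FAV_fpow FAV_fprod FAV_evp FAV_gen FAV_fone FAV_0

context fixes n :: nat begin
lemmas FA_add = FAV_add[where V = "vgen n", folded FA_FAV]
lemmas FA_0 [simp] = FAV_0[where V = "vgen n", folded FA_FAV]
lemmas FA_sum = FAV_sum[where V = "vgen n", folded FA_FAV]
lemmas FA_smul_fw = FAV_smul_fw[where V = "vgen n", folded FA_FAV]
lemmas FA_induct [consumes 1, case_names zero word add] = FAV_induct[where V = "vgen n", folded FA_FAV]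
lemmas FA_fsmul = FAV_fsmul[where V = "vgen n", folded FA_FAV]
lemmas FA_minus = FAV_minus[where V = "vgen n", folded FA_FAV]
lemmas FA_diff = FAV_diff[where V = "vgen n", folded FA_FAV]
lemmas FA_fmul = FAV_fmul[where V = "vgen n", folded FA_FAV]
lemmas FA_fw = FAV_fw[where V = "vgen n", folded FA_FAV]
lemmas FA_fone [simp] = FAV_fone[where V = "vgen n", folded FA_FAV]
lemmas FA_gen = FAV_gen[where V = "vgen n", folded FA_FAV]
lemmas FA_fpow = FAV_fpow[where V = "vgen n", folded FA_FAV]
lemmas FA_fprod = FAV_fprod[where V = "vgen n", folded FA_FAV]
lemmas FA_evp = FAV_evp[where V = "vgen n", folded FA_FAV]
lemmas FA_intros = FAV_intros[where V = "vgen n", folded FA_FAV]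
end

text \<open>Scalar multiplication is a parameter, so that the extension to operators in
  \<open>rh\<close> and the extensions between free algebras in \<open>iota\<close> and
  \<open>xi\<close> are instances.\<close>

definition lext :: "('k::comm_ring_1 => 'v => 'v::comm_monoid_add) => ('i gen list => 'v) => ('i, 'k) fa => 'v" where
 "lext S F f = (\<Sum>u\<in>{u. f u ~= 0}. S (f u) (F u))"

context
 fixes S :: "'k::comm_ring_1 => 'v => 'v::comm_monoid_add"
 assumes S: "!!x. S 0 x = 0" "!!a b x. S (a + b) x = S a x + S b x"
begin

lemma lext_superset: "finite A ==> (!!u. f u ~= 0 ==> u \<in> A) ==> lext S F f = (\<Sum>u\<in>A. S (f u) (F u))"
 unfolding lext_def by (rule sum.mono_neutral_left) (auto simp: S)

lemma lext_add: "fsupp f ==> fsupp g ==> lext S F (f + g) = lext S F f + lext S F g"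
proof -
 assume fin: "fsupp f" "fsupp g"
 let ?A = "{u. f u ~= 0} \<union> {u. g u ~= 0}"
 have "lext S F (f + g) = (\<Sum>u\<in>?A. S ((f + g) u) (F u))"
  using fin by (intro lext_superset) (auto simp: fsupp_def fun_apply)
 also have "... = (\<Sum>u\<in>?A. S (f u) (F u)) + (\<Sum>u\<in>?A. S (g u) (F u))"
  by (simp add: S sum.distrib fun_apply)
 also have "... = lext S F f + lext S F g"
  using fin by (subst (1 2) lext_superset[of ?A]) (auto simp: fsupp_def)
 finally show ?thesis .
qed

lemma lext_word: "lext S F (fsmul c (fw u)) = S c (F u)"
 by (subst lext_superset[of "{u}"]) (auto simp: fsmul_def fw_def split: if_splits)

lemma lext_0: "lext S F 0 = 0" by (simp add: lext_def fun_apply)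

end

lemma linext_lext: "linext F = lext fsmul F"
 by (simp add: linext_def lext_def fun_eq_iff)

lemmas linext_simps = lext_add[of fsmul, folded linext_lext] lext_word[of fsmul, folded linext_lext]
 lext_0[of fsmul, folded linext_lext]

lemma FA_fsupp: "f \<in> FA n ==> fsupp f" by (simp add: FA_FAV FAV_iff)

section \<open>The action of the free algebra by operators\<close>

context klr begin

primrec gop :: "'i gen => ('i, 'k) op" where
 "gop (E nu) = Eo nu" | "gop (X k) = Xo k" | "gop (T l) = To l"

definition wop :: "'i gen list => ('i, 'k) op" where
 "wop u = foldr (\<lambda>g A. gop g * A) u 1"

lemma wop_simps [simp]: "wop [] = 1" "wop (g # u) = gop g * wop u"
 by (simp_all add: wop_def)

lemma wop_append: "wop (u @ v) = wop u * wop v"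
 by (induction u) (simp_all add: mult.assoc)

definition rh :: "('i, 'k) fa => ('i, 'k) op" where
 "rh = lext (\<lambda>c A. po (cst c) * A) wop"

lemma rh_simps: "fsupp f ==> fsupp g ==> rh (f + g) = rh f + rh g"
 "rh (fsmul c (fw u)) = po (cst c) * wop u" "rh 0 = 0"
 unfolding rh_def
 by (rule lext_add lext_word lext_0; simp add: cst_add distrib_right flip: po_add)+

lemma rh_fw: "rh (fw u) = wop u"
 using rh_simps(2)[of 1 u] by (simp add: fsmul_simps)

lemma rh_gen [simp]: "rh (fgen g) = gop g" and rh_fone [simp]: "rh fone = 1"
 by (simp_all add: fgen_fw fone_fw rh_fw)

lemma rh_add: "f \<in> FA n ==> g \<in> FA n ==> rh (f + g) = rh f + rh g"
 by (simp add: rh_simps FA_fsupp)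

lemma rh_sum: "(!!x. x \<in> S ==> f x \<in> FA n) ==> rh (sum f S) = (\<Sum>x\<in>S. rh (f x))"
proof (induction S rule: infinite_finite_induct)
 case (insert x F)
 then show ?case using rh_add[of "f x" n "sum f F"] FA_sum[of F f n]
  by (simp only: sum.insert insert_iff simp_thms)
qed (simp_all only: sum.infinite sum.empty rh_simps not_False_eq_True)

lemma rh_fsmul: "f \<in> FA n ==> rh (fsmul c f) = po (cst c) * rh f"
proof (induction rule: FA_induct)
 case (add f g)
 then show ?case using rh_add[of "fsmul c f" n "fsmul c g"] rh_add[of f n g]
  by (simp add: fsmul_simps FA_fsmul distrib_left)
qed (simp_all add: fsmul_simps rh_simps cst_mult mult.assoc flip: po_mult)

lemma rh_minus: "f \<in> FA n ==> rh (- f) = - rh f"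
 using rh_add[of f n "- f"] by (simp add: FA_minus rh_simps eq_neg_iff_add_eq_0 add.commute)

lemma rh_diff: "f \<in> FA n ==> g \<in> FA n ==> rh (f - g) = rh f - rh g"
 using rh_add[of f n "- g"] by (simp add: rh_minus FA_minus)

lemma rh_fmul: "f \<in> FA n ==> g \<in> FA n ==> rh (fmul f g) = rh f * rh g"
proof (induction f rule: FA_induct)
 case (word c u)
 show ?case using word(2)
 proof (induction g rule: FA_induct)
  case (word c' v)
  have "rh (fmul (fsmul c (fw u)) (fsmul c' (fw v))) = po (cst c) * (po (cst c') * wop u) * wop v"
   by (simp add: fmul_fsmul fw_mult fsmul_simps rh_simps wop_append cst_mult mult.assoc flip: po_mult)
    (simp only: mult.assoc[symmetric] po_commute)
  also have "... = po (cst c) * wop u * (po (cst c') * wop v)"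
   by (simp only: po_cst_commute[of c' "wop u"] mult.assoc)
  finally show ?case by (simp only: rh_simps)
 next
  case (add f g)
  then show ?case using word(1)
   by (simp add: fmul_add_right rh_add[of _ n] FA_intros FA_smul_fw distrib_left)
 qed (simp add: rh_simps)
next
 case (add f g')
 then show ?case by (simp add: fmul_add_left rh_add[of _ n] FA_intros distrib_right)
qed (simp add: rh_simps)

lemma rh_fpow: "f \<in> FA n ==> rh (fpow f m) = rh f ^ m"
 by (induction m) (simp_all add: rh_fmul[of _ n] FA_fpow)

lemma po_power: "po p ^ m = po (p ^ m)"
 by (induction m) (simp_all add: po_mult)

lemma po_sum: "po (sum f S) = (\<Sum>x\<in>S. po (f x))"
 by (induction S rule: infinite_finite_induct) (simp_all flip: po_add)

lemma rh_evp:
 assumes "\<forall>k\<in>set ks. 1 \<le> k \<and> k \<le> n"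
 shows "rh (evp p (map xx ks)) = po (ev ks p)"
proof -
 let ?v = "\<lambda>j. if j < length ks then Vr (ks ! j) else (1 :: 'k mpoly)"
 have xs: "xx k \<in> (FA n :: ('i, 'k) fa set)" if "k \<in> set ks" for k
  using assms that by (intro FA_gen) auto
 have mon: "rh (fprod (map (\<lambda>j. fpow (map xx ks ! j) (Poly_Mapping.lookup m j)) [0..<length (map xx ks)])) = po (insm ?v m)"
  for m :: "nat \<Rightarrow>\<^sub>0 nat"
 proof -
  have "insm ?v m = (\<Prod>j\<in>Poly_Mapping.keys m \<union> {..<length ks}. ?v j ^ Poly_Mapping.lookup m j)"
   by (rule insm_superset) auto
  also have "... = (\<Prod>j\<in>{..<length ks}. ?v j ^ Poly_Mapping.lookup m j)"
   by (rule prod.mono_neutral_right) auto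
  also have "... = prod_list (map (\<lambda>j. Vr (ks ! j) ^ Poly_Mapping.lookup m j) [0..<length ks])"
   by (subst prod.distinct_set_conv_list[symmetric]) (auto simp: atLeast0LessThan intro!: prod.cong)
  finally have 1: "insm ?v m = prod_list (map (\<lambda>j. Vr (ks ! j) ^ Poly_Mapping.lookup m j) [0..<length ks])" .
  have "rh (fprod (map (\<lambda>j. fpow (map xx ks ! j) (Poly_Mapping.lookup m j)) js)) =
    po (prod_list (map (\<lambda>j. Vr (ks ! j) ^ Poly_Mapping.lookup m j) js))"
   if "\<forall>j\<in>set js. j < length ks" for js
   using that
  proof (induction js)
   case Nil
   then show ?case by (simp add: fprod_def)
  next
   case (Cons j js)
   then have j: "xx (ks ! j) \<in> (FA n :: ('i, 'k) fa set)" by (intro xs) auto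
   have rest: "fprod (map (\<lambda>j. fpow (map xx ks ! j) (Poly_Mapping.lookup m j)) js) \<in> (FA n :: ('i, 'k) fa set)"
    using Cons(2) by (intro FA_fprod) (auto intro!: FA_fpow xs)
   have "fprod (map (\<lambda>j. fpow (map xx ks ! j) (Poly_Mapping.lookup m j)) (j # js)) =
    fmul (fpow (xx (ks ! j)) (Poly_Mapping.lookup m j)) (fprod (map (\<lambda>j. fpow (map xx ks ! j) (Poly_Mapping.lookup m j)) js) :: ('i, 'k) fa)"
    using Cons(2) by (simp add: fprod_def)
   then show ?case using Cons
    by (simp add: rh_fmul[OF FA_fpow[OF j] rest] rh_fpow[OF j] po_power po_mult)
  qed
  from this[of "[0..<length ks]"] 1 show ?thesis by simp
 qed
 have FAm: "fprod (map (\<lambda>j. fpow (map xx ks ! j) (Poly_Mapping.lookup m j)) [0..<length (map xx ks)]) \<in> (FA n :: ('i, 'k) fa set)"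
  for m :: "nat \<Rightarrow>\<^sub>0 nat"
  by (intro FA_fprod) (auto intro!: FA_fpow xs)
 have "rh (evp p (map xx ks)) = (\<Sum>m\<in>Poly_Mapping.keys p. po (cst (Poly_Mapping.lookup p m)) * po (insm ?v m))"
  unfolding evp_def
  by (subst rh_sum[of _ _ n]) (simp_all only: rh_fsmul[OF FAm] mon FA_fsmul[OF FAm])
 then show ?thesis
  by (simp add: po_mult ev_def ins_def po_sum)
qed

definition pr :: "nat => ('i, 'k) op" where
 "pr n = dg (\<lambda>mu. if length mu = n then 1 else 0)"

lemma ap_pr [simp]: "ap (pr n) f mu = (if length mu = n then f mu else 0)"
 by (simp add: pr_def)

lemma pr_To: "To l * pr n = pr n * To l"
 by (rule op_eqI) (auto simp: ap_To)

lemma pr_gop: "gop g * pr n = pr n * gop g"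
proof (cases g)
 case (T l)
 then show ?thesis by (simp add: pr_To)
qed (simp_all add: pr_def po_def Eo_def dg_commute)

lemma pr_wop: "wop u * pr n = pr n * wop u"
 by (induction u) (simp_all add: mult.assoc, metis mult.assoc pr_gop)

lemma pr_rh: "f \<in> FA m ==> rh f * pr n = pr n * rh f"
proof (induction rule: FA_induct)
 case (word c u)
 have "po (cst c) * (wop u * pr n) = pr n * po (cst c) * wop u"
  by (simp add: pr_wop mult.assoc po_cst_commute)
 then show ?case by (simp add: rh_simps mult.assoc)
qed (simp_all add: rh_simps rh_add[of _ m] distrib_left distrib_right)

lemma pr_idem [simp]: "pr n * pr n = pr n"
 by (rule op_eqI) simp

text \<open>The relation that the e(nu) sum to 1 holds only on sequences of length n, where their
  sum acts as \<open>pr n\<close>. This projection commutes with the action of the free algebra, so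
  the action cut down by it is still multiplicative.\<close>

definition rho :: "nat => ('i, 'k) fa => ('i, 'k) op" where
 "rho n f = pr n * rh f"

lemma rho_add: "f \<in> FA n ==> g \<in> FA n ==> rho n (f + g) = rho n f + rho n g"
 by (simp add: rho_def rh_add[of _ n] distrib_left)

lemma rho_diff: "f \<in> FA n ==> g \<in> FA n ==> rho n (f - g) = rho n f - rho n g"
 by (simp add: rho_def rh_diff[of _ n] right_diff_distrib)

lemma rho_minus: "f \<in> FA n ==> rho n (- f) = - rho n f"
 by (simp add: rho_def rh_minus[of _ n])

lemma rho_0 [simp]: "rho n 0 = 0" by (simp add: rho_def rh_simps)

lemma rho_fmul: "f \<in> FA n ==> g \<in> FA n ==> rho n (fmul f g) = rho n f * rho n g"
proof -
 assume fg: "f \<in> FA n" "g \<in> FA n"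
 have "rho n f * rho n g = pr n * (rh f * pr n) * rh g" by (simp add: rho_def mult.assoc)
 also have "... = (pr n * pr n) * rh f * rh g" using fg by (simp only: pr_rh mult.assoc)
 finally show ?thesis using fg by (simp add: rho_def rh_fmul[of _ n] mult.assoc)
qed

lemma rho_sum: "(!!x. x \<in> S ==> f x \<in> FA n) ==> rho n (sum f S) = (\<Sum>x\<in>S. rho n (f x))"
 by (simp add: rho_def rh_sum[of _ _ n] sum_distrib_left)

lemma po_uminus: "po (- p) = - po p"
 by (rule op_eqI) simp

lemma To_X_rel:
 assumes "1 \<le> k" "k < length nu"
 shows "(To k * Xo l - Xo (sidx k l) * To k) * Eo nu =
  (if l = k \<and> nth1 nu k = nth1 nu (Suc k) then - (po (PP (nth1 nu k) k (Suc k)) * Eo nu)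
   else if l = Suc k \<and> nth1 nu k = nth1 nu (Suc k) then po (PP (nth1 nu k) k (Suc k)) * Eo nu
   else 0)" (is "?L * _ = ?R")
proof -
 have d: "dd k (Vr (Suc k) * g) = Vr k * dd k g + g" "dd k (Vr k * g) = Vr (Suc k) * dd k g - g" for g :: "'k mpoly"
 proof -
  have "(Vr k - Vr (Suc k)) * (Vr k * dd k g + g) = Vr k * ((Vr k - Vr (Suc k)) * dd k g) + (Vr k - Vr (Suc k)) * g"
   "(Vr k - Vr (Suc k)) * (Vr (Suc k) * dd k g - g) = Vr (Suc k) * ((Vr k - Vr (Suc k)) * dd k g) - (Vr k - Vr (Suc k)) * g"
   by (simp_all add: algebra_simps)
  then have "(Vr k - Vr (Suc k)) * (Vr k * dd k g + g) = sp k (Vr (Suc k) * g) - Vr (Suc k) * g"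
   "(Vr k - Vr (Suc k)) * (Vr (Suc k) * dd k g - g) = sp k (Vr k * g) - Vr k * g"
   unfolding dd_eq by (simp_all add: sub.mult algebra_simps)
  then show "dd k (Vr (Suc k) * g) = Vr k * dd k g + g" "dd k (Vr k * g) = Vr (Suc k) * dd k g - g"
   by (auto intro: ddI)
 qed
 note d2 = d[unfolded mult.commute[of "Vr (Suc k)"]] d[unfolded mult.commute[of "Vr k"]]
 consider "l = k" | "l = Suc k" | "l ~= k" "l ~= Suc k" by blast
 then show ?thesis
 proof cases
  case 3
  then have "?L = 0" by (simp add: To_Xo sidx_def)
  then show ?thesis using 3 by simp
 next
  case 1
  have "?L = dg (\<lambda>mu. if 1 \<le> k \<and> k < length mu \<and> nth1 mu k = nth1 mu (Suc k) then - PP (nth1 mu k) k (Suc k) else 0)"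
   using 1 by (intro op_eqI) (simp add: ap_To d d2 sub.mult algebra_simps)
  then show ?thesis using 1 assms by (simp add: dg_Eo po_uminus)
 next
  case 2
  have "?L = dg (\<lambda>mu. if 1 \<le> k \<and> k < length mu \<and> nth1 mu k = nth1 mu (Suc k) then PP (nth1 mu k) k (Suc k) else 0)"
   using 2 by (intro op_eqI) (simp add: ap_To d d2 sub.mult algebra_simps)
  then show ?thesis using 2 assms by (simp add: dg_Eo)
 qed
qed

lemma finite_Iseqs [simp]: "finite (Iseqs n :: 'i list set)"
 unfolding Iseqs_def using finite_lists_length_eq[of "UNIV :: 'i set" n] by simp

lemma sum_Eo: "(\<Sum>nu\<in>Iseqs n. Eo nu) = pr n"
proof (rule op_eqI)
 fix f :: "('i, 'k) vec" and mu :: "'i list"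
 show "ap (\<Sum>nu\<in>Iseqs n. Eo nu) f mu = ap (pr n) f mu"
  by (simp add: ap_sum_left) (simp add: Iseqs_def)
qed

end

section \<open>Spanning by descending products\<close>

definition subgrp :: "'v::ab_group_add set => bool" where
 "subgrp S \<longleftrightarrow> 0 \<in> S \<and> (\<forall>a\<in>S. \<forall>b\<in>S. a - b \<in> S)"

lemma subgrpD: "subgrp S ==> 0 \<in> S" "subgrp S ==> a \<in> S ==> b \<in> S ==> a - b \<in> S"
 "subgrp S ==> a \<in> S ==> - a \<in> S" "subgrp S ==> a \<in> S ==> b \<in> S ==> a + b \<in> S"
proof -
 assume S: "subgrp S"
 show 0: "0 \<in> S" using S by (simp add: subgrp_def)
 show *: "a - b \<in> S" if "a \<in> S" "b \<in> S" for a b using S that by (simp add: subgrp_def)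
 show "- a \<in> S" if "a \<in> S" using *[OF 0 that] by simp
 show "a + b \<in> S" if "a \<in> S" "b \<in> S" using *[OF that(1) *[OF 0 that(2)]] by simp
qed

lemma subgrp_sum: "subgrp S ==> (!!x. x \<in> I ==> f x \<in> S) ==> sum f I \<in> S"
 by (induction I rule: infinite_finite_induct) (auto intro: subgrpD)

text \<open>Spanning by descending products: working modulo \<open>J\<close>, the sets
 \<open>S\<^sub>0 = C\<close>, \<open>S\<^sub>i\<^sub>+\<^sub>1 = \<tau> S\<^sub>i + S\<^sub>i\<close> (with \<open>\<tau>\<close> the operator of index \<open>c i\<close>) are stable under all
 operators except the one of index \<open>c i\<close>; hence the last one is stable under all of them.\<close>

locale span_chain =
 fixes J D :: "'v::ab_group_add set" and Pl :: "('v => 'v) set" and ta :: "nat => 'v => 'v"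
  and N :: nat and c :: "nat => nat" and C :: "'v set"
 assumes J: "subgrp J" and D: "subgrp D" and JD: "J \<subseteq> D"
  and Pl: "p \<in> Pl ==> x \<in> D ==> p x \<in> D" "p \<in> Pl ==> x \<in> D ==> y \<in> D ==> p (x - y) = p x - p y"
   "p \<in> Pl ==> x \<in> J ==> p x \<in> J"
  and ta: "1 \<le> l ==> l \<le> N ==> x \<in> D ==> ta l x \<in> D"
   "1 \<le> l ==> l \<le> N ==> x \<in> D ==> y \<in> D ==> ta l (x - y) = ta l x - ta l y"
   "1 \<le> l ==> l \<le> N ==> x \<in> J ==> ta l x \<in> J"
  and far: "1 \<le> k ==> k \<le> N ==> 1 \<le> l ==> l \<le> N ==> k + 1 < l \<or> l + 1 < k ==> y \<in> D ==>
   ta k (ta l y) - ta l (ta k y) \<in> J"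
  and sq: "1 \<le> k ==> k \<le> N ==> \<exists>p\<in>Pl. \<exists>q\<in>Pl. \<forall>y\<in>D. ta k (ta k y) - (p (ta k y) + q y) \<in> J"
  and braid: "1 \<le> k ==> k \<le> N ==> 1 \<le> l ==> l \<le> N ==> k + 1 = l \<or> l + 1 = k ==>
   \<exists>p\<in>Pl. \<exists>q\<in>Pl. \<exists>r\<in>Pl. \<forall>y\<in>D.
    ta l (ta k (ta l y)) - (ta k (ta l (ta k y)) + (p (ta k y) + q (ta l y) + r y)) \<in> J"
  and poly: "1 \<le> k ==> k \<le> N ==> p \<in> Pl ==>
   \<exists>p'\<in>Pl. \<exists>p''\<in>Pl. \<forall>y\<in>D. p (ta k y) - (ta k (p' y) + p'' y) \<in> J"
  and c: "i < N ==> 1 \<le> c i \<and> c i \<le> N"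
  and c_adj: "i < N ==> 1 \<le> l ==> l \<le> N ==> l + 1 = c i \<or> c i + 1 = l ==>
   (i > 0 \<and> l = c (i - 1)) \<or> (Suc i < N \<and> l = c (Suc i))"
  and c_inj: "i < N ==> j < N ==> c i = c j ==> i = j"
  and c_far: "i < N ==> Suc j < i ==> c i + 1 < c j \<or> c j + 1 < c i"
  and C: "subgrp C" "J \<subseteq> C" "C \<subseteq> D" "p \<in> Pl ==> x \<in> C ==> p x \<in> C"
  and C_stab: "1 \<le> l ==> l \<le> N ==> N > 0 ==> l ~= c 0 ==> x \<in> C ==> ta l x \<in> C"
begin

definition cl :: "'v set => bool" where
 "cl S \<longleftrightarrow> subgrp S \<and> J \<subseteq> S \<and> S \<subseteq> D \<and> (\<forall>p\<in>Pl. \<forall>x\<in>S. p x \<in> S)"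

definition nx :: "nat => 'v set => 'v set" where
 "nx k S = {ta k y + y' | y y'. y \<in> S \<and> y' \<in> S}"

abbreviation stab :: "nat => 'v set => bool" where
 "stab l S \<equiv> \<forall>x\<in>S. ta l x \<in> S"

lemma add_D: assumes "1 \<le> l" "l \<le> N" "x \<in> D" "y \<in> D" shows "ta l (x + y) = ta l x + ta l y"
proof -
 have m: "ta l (- y) = - ta l y"
  using ta(2)[OF assms(1,2) subgrpD(1)[OF D] assms(4)] ta(2)[OF assms(1,2,4,4)] by simp
 then show ?thesis using ta(2)[OF assms(1-3) subgrpD(3)[OF D assms(4)]] by simp
qed

lemma Pl_add: assumes "p \<in> Pl" "x \<in> D" "y \<in> D" shows "p (x + y) = p x + p y"
proof -
 have m: "p (- y) = - p y"
  using Pl(2)[OF assms(1) subgrpD(1)[OF D] assms(3)] Pl(2)[OF assms(1,3,3)] by simp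
 then show ?thesis using Pl(2)[OF assms(1,2) subgrpD(3)[OF D assms(3)]] by simp
qed

lemma cong_mem: "subgrp S ==> J \<subseteq> S ==> a - b \<in> J ==> b \<in> S ==> a \<in> S"
 using subgrpD(4)[of S "a - b" b] by auto

lemma clD: "cl S ==> subgrp S" "cl S ==> J \<subseteq> S" "cl S ==> x \<in> S ==> x \<in> D" "cl S ==> p \<in> Pl ==> x \<in> S ==> p x \<in> S"
 by (auto simp: cl_def)

lemma ta_0: "1 \<le> k ==> k \<le> N ==> ta k 0 = 0"
 using ta(2)[of k 0 0] subgrpD(1)[OF D] by simp

lemma nx_sup: "1 \<le> k ==> k \<le> N ==> cl S ==> S \<subseteq> nx k S"
 unfolding nx_def using ta_0 subgrpD(1)[OF clD(1)] by force

lemma nx_ta: "cl S ==> y \<in> S ==> ta k y \<in> nx k S"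
 unfolding nx_def using subgrpD(1)[OF clD(1)] by force

lemma nx_cl:
 assumes k: "1 \<le> k" "k \<le> N" and S: "cl S"
 shows "cl (nx k S)"
proof -
 have sg: "subgrp (nx k S)"
  unfolding subgrp_def
 proof (intro conjI ballI)
  show "0 \<in> nx k S" using nx_sup[OF k S] subgrpD(1)[OF clD(1)[OF S]] by blast
  fix a b assume "a \<in> nx k S" "b \<in> nx k S"
  then obtain y1 y1' y2 y2' where *: "a = ta k y1 + y1'" "b = ta k y2 + y2'" "y1 \<in> S" "y1' \<in> S" "y2 \<in> S" "y2' \<in> S"
   unfolding nx_def by blast
  then have "a - b = ta k (y1 - y2) + (y1' - y2')" using ta(2)[OF k] clD(3)[OF S] by (simp add: algebra_simps)
  then show "a - b \<in> nx k S" unfolding nx_def using * subgrpD(2)[OF clD(1)[OF S]] by blast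
 qed
 have JS: "J \<subseteq> nx k S" using nx_sup[OF k S] clD(2)[OF S] by blast
 have DS: "nx k S \<subseteq> D" unfolding nx_def using clD(3)[OF S] ta(1)[OF k] subgrpD(4)[OF D] by blast
 moreover have "p x \<in> nx k S" if p: "p \<in> Pl" and x: "x \<in> nx k S" for p x
 proof -
  obtain y y' where y: "x = ta k y + y'" "y \<in> S" "y' \<in> S" using x unfolding nx_def by blast
  have yD: "y \<in> D" "y' \<in> D" "ta k y \<in> D" using y clD(3)[OF S] ta(1)[OF k] by auto
  obtain p' p'' where p': "p' \<in> Pl" "p'' \<in> Pl" "p (ta k y) - (ta k (p' y) + p'' y) \<in> J"
   using poly[OF k p] yD by blast
  then have "p (ta k y) \<in> nx k S"
   by (intro cong_mem[OF sg JS p'(3)]) (use clD(4)[OF S] y in \<open>auto simp: nx_def\<close>)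
  moreover have "p y' \<in> nx k S" using clD(4)[OF S p] y nx_sup[OF k S] by auto
  ultimately show ?thesis using subgrpD(4)[OF sg] Pl_add[OF p yD(3,2)] y(1) by simp
 qed
 ultimately show ?thesis using sg JS unfolding cl_def by auto
qed

lemma nx_stab_same:
 assumes k: "1 \<le> k" "k \<le> N" and S: "cl S"
 shows "stab k (nx k S)"
proof
 fix x assume "x \<in> nx k S"
 then obtain y y' where y: "x = ta k y + y'" "y \<in> S" "y' \<in> S" unfolding nx_def by blast
 note n = clD(1,2)[OF nx_cl[OF k S]]
 have yD: "y \<in> D" "y' \<in> D" "ta k y \<in> D" using y clD(3)[OF S] ta(1)[OF k] by auto
 obtain p q where "p \<in> Pl" "q \<in> Pl" and J: "ta k (ta k y) - (p (ta k y) + q y) \<in> J"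
  using sq[OF k] yD by blast
 then have "ta k (ta k y) \<in> nx k S"
  using nx_sup[OF k S] nx_ta[OF S y(2)] y clD(4)[OF S] clD(4)[OF nx_cl[OF k S]]
  by (intro cong_mem[OF n J] subgrpD(4)[OF n(1)]) auto
 then show "ta k x \<in> nx k S"
  using y nx_ta[OF S y(3)] subgrpD(4)[OF n(1)] add_D[OF k yD(3,2)] by simp
qed

lemma nx_stab_far:
 assumes k: "1 \<le> k" "k \<le> N" and l: "1 \<le> l" "l \<le> N" "k + 1 < l \<or> l + 1 < k" and S: "cl S" "stab l S"
 shows "stab l (nx k S)"
proof
 fix x assume "x \<in> nx k S"
 then obtain y y' where y: "x = ta k y + y'" "y \<in> S" "y' \<in> S" unfolding nx_def by blast
 note n = clD(1,2)[OF nx_cl[OF k S(1)]]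
 have yD: "y \<in> D" "y' \<in> D" "ta k y \<in> D" using y clD(3)[OF S(1)] ta(1)[OF k] by auto
 have J1: "ta l (ta k y) - ta k (ta l y) \<in> J" using far[OF l(1,2) k] l yD by auto
 have "ta k (ta l y) \<in> nx k S" using nx_ta[OF S(1)] S(2) y by auto
 then have "ta l (ta k y) \<in> nx k S" by (rule cong_mem[OF n J1])
 moreover have "ta l y' \<in> nx k S" using y S nx_sup[OF k S(1)] by auto
 ultimately show "ta l x \<in> nx k S"
  using y subgrpD(4)[OF n(1)] add_D[OF l(1,2) yD(3,2)] by simp
qed

text \<open>By the braid relation \<open>ta l (ta k (ta l z))\<close> is
  \<open>ta k (ta l (ta k z))\<close> up to lower terms, and \<open>ta k z\<close> stays in
  \<open>S\<close>. Stability under a neighbouring index thus returns after two further steps of the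
  chain.\<close>

lemma nx_stab_adj:
 assumes k: "1 \<le> k" "k \<le> N" and l: "1 \<le> l" "l \<le> N" "k + 1 = l \<or> l + 1 = k" and S: "cl S" "stab k S"
 shows "stab l (nx k (nx l S))"
proof
 let ?S1 = "nx l S" let ?S2 = "nx k ?S1"
 note c1 = nx_cl[OF l(1,2) S(1)] note c2 = nx_cl[OF k c1]
 note s1 = nx_sup[OF l(1,2) S(1)] note s2 = nx_sup[OF k c1]
 fix x assume "x \<in> ?S2"
 then obtain y y' where y: "x = ta k y + y'" "y \<in> ?S1" "y' \<in> ?S1" unfolding nx_def[of k] by blast
 then obtain z z' where z: "y = ta l z + z'" "z \<in> S" "z' \<in> S" unfolding nx_def by blast
 have D': "z \<in> D" "z' \<in> D" "y' \<in> D" "ta l z \<in> D" "ta k z' \<in> D" "ta k (ta l z) \<in> D" "ta k y \<in> D"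
  using z y clD(3)[OF S(1)] clD(3)[OF c1] ta(1)[OF k] ta(1)[OF l(1,2)] by auto
 obtain p q r where P: "p \<in> Pl" "q \<in> Pl" "r \<in> Pl"
  and J: "ta l (ta k (ta l z)) - (ta k (ta l (ta k z)) + (p (ta k z) + q (ta l z) + r z)) \<in> J"
  using braid[OF k l] D' by blast
 have kz: "ta k z \<in> S" "ta k z' \<in> S" using S z by auto
 have "ta k (ta l (ta k z)) \<in> ?S2" using nx_ta[OF c1 nx_ta[OF S(1) kz(1)]] .
 moreover have "p (ta k z) \<in> ?S2" using clD(4)[OF S(1) P(1) kz(1)] s1 s2 by blast
 moreover have "q (ta l z) \<in> ?S2" using clD(4)[OF c1 P(2) nx_ta[OF S(1) z(2)]] s2 by blast
 moreover have "r z \<in> ?S2" using clD(4)[OF S(1) P(3) z(2)] s1 s2 by blast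
 ultimately have 1: "ta l (ta k (ta l z)) \<in> ?S2"
  by (intro cong_mem[OF clD(1,2)[OF c2] J] subgrpD(4)[OF clD(1)[OF c2]])
 have 2: "ta l (ta k z') \<in> ?S2" using nx_ta[OF S(1) kz(2)] s2 by blast
 have 3: "ta l y' \<in> ?S2" using nx_stab_same[OF l(1,2) S(1)] y s2 by blast
 have "ta l x = ta l (ta k (ta l z)) + ta l (ta k z') + ta l y'"
  using y(1) z(1) D' by (simp add: add_D[OF k] add_D[OF l(1,2)] subgrpD(4)[OF D])
 then show "ta l x \<in> ?S2" using 1 2 3 subgrpD(4)[OF clD(1)[OF c2]] by simp
qed

primrec SS :: "nat => 'v set" where
 "SS 0 = C" | "SS (Suc i) = nx (c i) (SS i)"

lemma SS_cl: "i \<le> N ==> cl (SS i)"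
proof (induction i)
 case 0
 show ?case unfolding cl_def using C by simp
next
 case (Suc i)
 then show ?case using c[of i] nx_cl by simp
qed

text \<open>The index \<open>c j\<close> just added is covered by the quadratic relation, a distant
  one by commutation. A neighbour of \<open>c j\<close> other than the next index must be the
  preceding one, and then the braid relation is applied to the last two steps.\<close>

lemma SS_stab: "i \<le> N ==> 1 \<le> l ==> l \<le> N ==> (i < N ==> l ~= c i) ==> stab l (SS i)"
proof (induction i arbitrary: l rule: less_induct)
 case (less i)
 show ?case
 proof (cases i)
  case 0
  then show ?thesis using C_stab less.prems by auto
 next
  case (Suc j)
  then have j: "j < N" and ck: "1 \<le> c j" "c j \<le> N" using less.prems c[of j] by auto
  have cj: "cl (SS j)" using SS_cl j by simp
  consider "l = c j" | "l ~= c j" "c j + 1 < l \<or> l + 1 < c j" | "l + 1 = c j \<or> c j + 1 = l" by linarith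
  then show ?thesis
  proof cases
   case 1
   then show ?thesis using nx_stab_same[OF ck cj] Suc by simp
  next
   case 2
   then have "stab l (SS j)" using less.IH[of j l] less.prems Suc j by auto
   then show ?thesis using nx_stab_far[OF ck less.prems(2,3) 2(2) cj] Suc by simp
  next
   case 3
   then have "j > 0 \<and> l = c (j - 1)" using c_adj[OF j less.prems(2,3)] less.prems Suc by auto
   then obtain m where m: "j = Suc m" "l = c m" by (cases j) auto
   have "stab (c j) (SS m)"
    using less.IH[of m "c j"] m Suc j ck c_inj[of j m] by auto
   moreover have "c j + 1 = l \<or> l + 1 = c j" using 3 by auto
   ultimately show ?thesis
    using nx_stab_adj[OF ck less.prems(2,3), of "SS m"] SS_cl[of m] m Suc j by simp
  qed
 qed
qed

lemma SS_full: "1 \<le> l ==> l \<le> N ==> x \<in> SS N ==> ta l x \<in> SS N"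
 using SS_stab[of N l] by auto

lemma C_SS: "x \<in> C ==> i \<le> N ==> x \<in> SS i"
proof (induction i)
 case (Suc i)
 then show ?case using nx_sup[of "c i" "SS i"] SS_cl[of i] c[of i] by auto
qed simp

primrec chain :: "nat => 'v => 'v" where
 "chain 0 x = x" | "chain (Suc i) x = ta (c i) (chain i x)"

lemma chain_D: "x \<in> D ==> i \<le> N ==> chain i x \<in> D"
 by (induction i) (use ta(1) c in auto)

lemma chain_far: "i < N ==> m < i ==> x \<in> D ==> ta (c i) (chain m x) - chain m (ta (c i) x) \<in> J"
proof (induction m)
 case 0
 then show ?case using subgrpD(1)[OF J] by simp
next
 case (Suc m)
 have ci: "1 \<le> c i" "c i \<le> N" and cm: "1 \<le> c m" "c m \<le> N" using c[of i] c[of m] Suc.prems by auto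
 have D': "chain m x \<in> D" "chain m (ta (c i) x) \<in> D" "ta (c i) (chain m x) \<in> D"
  using chain_D ta(1)[OF ci] Suc.prems by auto
 have "ta (c i) (ta (c m) (chain m x)) - ta (c m) (ta (c i) (chain m x)) \<in> J"
  using far[OF ci cm _ D'(1)] c_far[of i m] Suc.prems by auto
 moreover have "ta (c m) (ta (c i) (chain m x) - chain m (ta (c i) x)) \<in> J"
  using ta(3)[OF cm] Suc by auto
 then have "ta (c m) (ta (c i) (chain m x)) - ta (c m) (chain m (ta (c i) x)) \<in> J"
  using ta(2)[OF cm D'(3,2)] by simp
 ultimately show ?case using subgrpD(4)[OF J] by fastforce
qed

lemma SS_chain: "i \<le> N ==> x \<in> SS i ==> \<exists>f. (\<forall>k. f k \<in> C) \<and> x - (\<Sum>k\<le>i. chain k (f k)) \<in> J"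
proof (induction i arbitrary: x)
 case 0
 then show ?case using subgrpD(1)[OF J] by (intro exI[of _ "\<lambda>_. x"]) auto
next
 case (Suc i)
 then obtain y y' where x: "x = ta (c i) y + y'" and y: "y \<in> SS i" "y' \<in> SS i" by (auto simp: nx_def)
 have i: "i < N" and ci: "1 \<le> c i" "c i \<le> N" using Suc.prems c[of i] by auto
 obtain f g where f: "\<forall>k. f k \<in> C" "y - (\<Sum>k\<le>i. chain k (f k)) \<in> J"
  and g: "\<forall>k. g k \<in> C" "y' - (\<Sum>k\<le>i. chain k (g k)) \<in> J"
  using Suc.IH[OF _ y(1)] Suc.IH[OF _ y(2)] i by auto
 have fD: "f k \<in> D" "g k \<in> D" for k using f g C(3) by auto
 have chD: "chain k (f k) \<in> D" "chain k (g k) \<in> D" if "k \<le> N" for k using chain_D fD that by auto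
 have sumD: "(\<Sum>k\<in>K. chain k (f k)) \<in> D" if "\<forall>k\<in>K. k \<le> N" for K using that chD by (intro subgrp_sum[OF D]) auto
 have ta_sum: "ta (c i) (\<Sum>k\<in>K. chain k (f k)) = (\<Sum>k\<in>K. ta (c i) (chain k (f k)))" if "finite K" "\<forall>k\<in>K. k \<le> N" for K
  using that
 proof (induction K rule: finite_induct)
  case (insert a K)
  then show ?case using add_D[OF ci chD(1)[of a] sumD[of K]] by simp
 qed (simp add: ta_0[OF ci])
 have yD: "y \<in> D" using clD(3)[OF SS_cl y(1)] i by simp
 \<comment> \<open>The summand of length i becomes one of length i + 1. Past a shorter chain
   \<open>ta (c i)\<close> commutes into the coefficient, which stays in \<open>C\<close> because
   \<open>c i\<close> differs from \<open>c 0\<close>.\<close>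
 let ?h = "\<lambda>k. if k = Suc i then f i else if k < i then ta (c i) (f k) + g k else g k"
 have chain_add: "chain k (u + v) = chain k u + chain k v" if "k \<le> N" "u \<in> D" "v \<in> D" for k u v
  using that
 proof (induction k)
  case (Suc k)
  then show ?case using c[of k] chain_D[of u k] chain_D[of v k] add_D[of "c k"] by simp
 qed simp
 have "ta (c i) y - (\<Sum>k\<le>i. ta (c i) (chain k (f k))) \<in> J"
  using ta(3)[OF ci f(2)] ta(2)[OF ci yD sumD[of "{..i}"]] ta_sum[of "{..i}"] i by auto
 moreover have "(\<Sum>k<i. ta (c i) (chain k (f k))) - (\<Sum>k<i. chain k (ta (c i) (f k))) \<in> J"
  unfolding sum_subtractf[symmetric] using chain_far[OF i _ fD(1)] by (intro subgrp_sum[OF J]) auto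
 moreover have "(\<Sum>k\<le>Suc i. chain k (?h k)) = ta (c i) (chain i (f i)) + chain i (g i) +
   (\<Sum>k<i. chain k (ta (c i) (f k))) + (\<Sum>k<i. chain k (g k))"
 proof -
  have "(\<Sum>k\<le>Suc i. chain k (?h k)) = (\<Sum>k<i. chain k (?h k)) + chain i (g i) + ta (c i) (chain i (f i))"
   by (simp flip: lessThan_Suc_atMost)
  also have "(\<Sum>k<i. chain k (?h k)) = (\<Sum>k<i. chain k (ta (c i) (f k)) + chain k (g k))"
   using i fD ta(1)[OF ci] by (intro sum.cong) (auto simp: chain_add)
  finally show ?thesis by (simp add: sum.distrib algebra_simps)
 qed
 ultimately have "x - (\<Sum>k\<le>Suc i. chain k (?h k)) \<in> J"
  using g(2) x unfolding lessThan_Suc_atMost[symmetric]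
 proof -
  assume a: "ta (c i) y - (\<Sum>k<Suc i. ta (c i) (chain k (f k))) \<in> J"
   "(\<Sum>k<i. ta (c i) (chain k (f k))) - (\<Sum>k<i. chain k (ta (c i) (f k))) \<in> J"
   "(\<Sum>k<Suc (Suc i). chain k (?h k)) = ta (c i) (chain i (f i)) + chain i (g i) +
   (\<Sum>k<i. chain k (ta (c i) (f k))) + (\<Sum>k<i. chain k (g k))"
   "y' - (\<Sum>k<Suc i. chain k (g k)) \<in> J"
  have "x - (\<Sum>k<Suc (Suc i). chain k (?h k)) =
   (ta (c i) y - (\<Sum>k<Suc i. ta (c i) (chain k (f k)))) +
   ((\<Sum>k<i. ta (c i) (chain k (f k))) - (\<Sum>k<i. chain k (ta (c i) (f k)))) +
   (y' - (\<Sum>k<Suc i. chain k (g k)))"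
   unfolding a(3) x by simp
  then show "x - (\<Sum>k<Suc (Suc i). chain k (?h k)) \<in> J"
   using subgrpD(4)[OF J subgrpD(4)[OF J a(1,2)] a(4)] by (simp only:)
 qed
 moreover have "?h k \<in> C" for k
 proof -
  have "ta (c i) (f k) \<in> C" if "k < i"
   using C_stab[OF ci] f(1) c_inj[of i 0] i that by auto
  then show ?thesis using f(1) g(1) subgrpD(4)[OF C(1)] by simp
 qed
 ultimately show ?case by (intro exI[of _ ?h] conjI allI)
qed

end

text \<open>A lift of a parabolic subalgebra to the free algebra; for empty \<open>K\<close> it
  covers polynomials and idempotents only.\<close>

definition alg :: "nat => nat set => ('i, 'k::comm_ring_1) fa set" where
 "alg n K = FAV (\<lambda>g. vgen n g \<and> (\<forall>l. g = T l --> l \<in> K))"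

context fixes n :: nat and K :: "nat set" begin
lemmas alg_intros = FAV_intros[where V = "\<lambda>g. vgen n g \<and> (\<forall>l. g = T l --> l \<in> K)", folded alg_def]
lemmas alg_induct [consumes 1, case_names zero word add] =
 FAV_induct[where V = "\<lambda>g. vgen n g \<and> (\<forall>l. g = T l --> l \<in> K)", folded alg_def]
lemmas alg_fw = FAV_fw[where V = "\<lambda>g. vgen n g \<and> (\<forall>l. g = T l --> l \<in> K)", folded alg_def]
end

lemma alg_mono: "f \<in> alg n K ==> K \<subseteq> L ==> f \<in> alg n L"
 unfolding alg_def by (erule FAV_mono) auto

lemma alg_FA: "f \<in> alg n K ==> f \<in> FA n"
 unfolding alg_def FA_FAV by (erule FAV_mono) auto

lemma FA_alg: "{1..<n} \<subseteq> K ==> FA n = alg n K"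
 unfolding alg_def FA_FAV
proof (intro equalityI subsetI; erule FAV_mono)
 show "vgen n g \<and> (\<forall>l. g = T l --> l \<in> K)" if "{1..<n} \<subseteq> K" "vgen n g" for g :: "'a gen"
  using that by (cases g) auto
qed simp

lemma rideal_sub: "S \<subseteq> FA n ==> f \<in> rideal (FA n) S ==> f \<in> FA n"
 by (erule rideal.induct) (auto intro: FA_intros)

lemma rideal_fmul:
 assumes "f \<in> rideal (FA n) S" "a \<in> FA n"
 shows "fmul a f \<in> rideal (FA n) S" "fmul f a \<in> rideal (FA n) S"
 using assms(1)
proof (induction rule: rideal.induct)
 case (rid_gen s c d)
 { case 1 show ?case using rideal.rid_gen[OF rid_gen(1) FA_fmul[OF assms(2) rid_gen(2)] rid_gen(3)]
   by (simp add: fmul_assoc) }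
 { case 2 show ?case using rideal.rid_gen[OF rid_gen(1,2) FA_fmul[OF rid_gen(3) assms(2)]]
   by (simp add: fmul_assoc) }
qed (auto simp: fmul_add_left fmul_add_right intro: rideal.intros)

lemma subgrp_rideal: "subgrp (rideal (FA n) S)"
 unfolding subgrp_def
proof (intro conjI ballI)
 fix a b assume ab: "a \<in> rideal (FA n) S" "b \<in> rideal (FA n) S"
 have "fmul (- fone) b \<in> rideal (FA n) S"
  using ab by (intro rideal_fmul FA_intros)
 then have "- b \<in> rideal (FA n) S" by (simp add: fmul_minus)
 from rideal.rid_add[OF ab(1) this] show "a - b \<in> rideal (FA n) S" by simp
qed (rule rideal.intros)

lemma rideal_mem: "s \<in> S ==> s \<in> rideal (FA n) S"
 using rideal.rid_gen[of s S fone "FA n" fone] by simp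

lemma rideal_mono: "S \<subseteq> S' ==> rideal (FA n) S \<subseteq> rideal (FA n) S'"
proof
 fix x assume S: "S \<subseteq> S'" and "x \<in> rideal (FA n) S"
 from this(2) show "x \<in> rideal (FA n) S'"
  by induction (use S in \<open>auto intro: rideal.intros\<close>)
qed

lemma sw_Iseqs: "nu \<in> Iseqs n ==> sw k nu \<in> Iseqs n" by (simp add: Iseqs_def)

section \<open>The defining relations hold for the operators\<close>

context klr begin

abbreviation JJ :: "nat => ('i, 'k) fa set" where "JJ n \<equiv> Jrel t w n"

lemma rels_FA: "rels t w n \<subseteq> FA n"
 unfolding rels_def
 by (intro Un_least subsetI)
   (auto simp: sidx_def Iseqs_def split: if_splits intro!: FA_intros)

lemmas J_subgrp = subgrp_rideal[of n "rels t w n" for n, folded Jrel_def]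
lemmas J_fmul = rideal_fmul[of _ n "rels t w n" for n, folded Jrel_def]
lemmas J_rels = rideal_mem[of _ "rels t w n" n for n, folded Jrel_def]
lemmas J_FA = rideal_sub[OF rels_FA, folded Jrel_def]

lemma rh_evp2: "1 \<le> a ==> a \<le> n ==> 1 \<le> b ==> b \<le> n ==> rh (evp p [xx a, xx b]) = po (ev [a, b] p)"
 and rh_evp3: "1 \<le> a ==> a \<le> n ==> 1 \<le> b ==> b \<le> n ==> 1 \<le> c ==> c \<le> n ==>
  rh (evp p [xx a, xx b, xx c]) = po (ev [a, b, c] p)"
 using rh_evp[of "[a, b]" n p] rh_evp[of "[a, b, c]" n p] by auto

lemma FA_evp2: "1 \<le> a ==> a \<le> n ==> 1 \<le> b ==> b \<le> n ==> evp p [xx a, xx b] \<in> FA n"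
 and FA_evp3: "1 \<le> a ==> a \<le> n ==> 1 \<le> b ==> b \<le> n ==> 1 \<le> c ==> c \<le> n ==>
  evp p [xx a, xx b, xx c] \<in> FA n"
 by (auto intro!: FA_intros)

lemma Eo_Eo: "Eo nu * Eo mu = (if nu = mu then Eo nu else 0)"
 by (rule op_eqI) (auto simp: fun_apply)

lemma rho_rels: "rels t w n \<subseteq> {f. rho n f = 0}"
proof -
 note h = rho_def rh_diff[of _ n] rh_fmul[of _ n] rh_add[of _ n] rh_minus[of _ n] rh_sum[of _ _ n] FA_intros FA_evp2 FA_evp3 rh_simps(3)
 show ?thesis
  unfolding rels_def
  apply (intro Un_least subsetI CollectI; (elim CollectE exE conjE)?)
  subgoal by (auto simp: h Iseqs_def Eo_Eo)
  subgoal
  proof -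
   have "(\<Sum>nu\<in>Iseqs n. ee nu) \<in> (FA n :: ('i, 'k) fa set)"
    by (intro FA_intros) (auto simp: Iseqs_def)
   moreover have "rh (\<Sum>nu\<in>Iseqs n. ee nu) = pr n"
    by (subst rh_sum[of _ _ n]) (auto simp: Iseqs_def intro!: FA_gen simp flip: sum_Eo)
   ultimately show "x \<in> {(\<Sum>nu\<in>Iseqs n. ee nu) - fone} ==> rho n x = 0" for x
    by (simp add: rho_def rh_diff[of _ n] right_diff_distrib)
  qed
  subgoal by (simp add: h po_commute)
  subgoal by (simp add: h Iseqs_def Eo_commute)
  subgoal by (simp add: h Iseqs_def To_Eo)
  subgoal for s k l using To_far[of k l] by (simp add: h)
  subgoal for s k nu
   using To_sq[of k nu] by (simp add: h Iseqs_def rh_evp2[of _ n] ev_p2 QQ_def)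
  subgoal for s k l nu
   using To_X_rel[of k nu l] by (simp add: h Iseqs_def rh_evp2[of _ n] ev_p2 PP_def sidx_def split: if_splits)
  subgoal for s k nu
  proof -
   assume s: "s = fmul (fmul (fmul (tt (k+1)) (tt k)) (tt (k+1)) - fmul (fmul (tt k) (tt (k+1))) (tt k)) (ee nu) -
    (if nth1 nu k = nth1 nu (k+2) \<and> nth1 nu k ~= nth1 nu (k+1)
     then fmul (fmul (evp (p2 (w (nth1 nu k)) 0 1) [xx k, xx (k+2)])
             (evp (Qbar (t (nth1 nu k) (nth1 nu (k+1)))) [xx k, xx (k+1), xx (k+2)])) (ee nu)
     else if nth1 nu k = nth1 nu (k+1) \<and> nth1 nu (k+1) = nth1 nu (k+2)
     then fmul (fmul (evp (Pbar1 (w (nth1 nu k))) [xx k, xx (k+1), xx (k+2)]) (tt k)) (ee nu)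
      + fmul (fmul (evp (Pbar2 (w (nth1 nu k))) [xx k, xx (k+1), xx (k+2)]) (tt (k+1))) (ee nu)
     else 0)" (is "s = ?L - ?R") and k: "1 \<le> k" "k + 1 < n" and nu: "nu \<in> Iseqs n"
   have F: "tt k \<in> FA n" "tt (k + 1) \<in> FA n" "ee nu \<in> FA n" "xx k \<in> FA n" "xx (k + 1) \<in> FA n" "xx (k + 2) \<in> FA n"
    using k nu by (auto simp: Iseqs_def intro!: FA_gen)
   have ev3: "evp p [xx k, xx (k+1), xx (k+2)] \<in> FA n" "rh (evp p [xx k, xx (k+1), xx (k+2)]) = po (ev [k, k+1, k+2] p)" for p
    using k by (auto intro!: FA_evp3 rh_evp3[of _ n])
   have ev2: "evp p [xx k, xx (k+2)] \<in> FA n" "rh (evp p [xx k, xx (k+2)]) = po (ev [k, k+2] p)" for p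
    using k by (auto intro!: FA_evp2 rh_evp2[of _ n])
   note h2 = rh_diff[of _ n] rh_fmul[of _ n] rh_add[of _ n] FA_fmul FA_add FA_diff F ev3 ev2 FA_0 rh_simps(3) gop.simps rh_gen
   have RF: "?R \<in> FA n" by (simp only: FA_fmul FA_add FA_0 F ev3(1) ev2(1) simp_thms split: if_splits)
   have L: "rh ?L = (To (k+1) * To k * To (k+1) - To k * To (k+1) * To k) * Eo nu"
    by (simp only: h2)
   have R: "rh ?R = (if nth1 nu k = nth1 nu (k+2) \<and> nth1 nu k ~= nth1 nu (k+1)
     then po (ev [k, k+2] (p2 (w (nth1 nu k)) 0 1)) * po (ev [k, k+1, k+2] (Qbar (t (nth1 nu k) (nth1 nu (k+1))))) * Eo nu
     else if nth1 nu k = nth1 nu (k+1) \<and> nth1 nu (k+1) = nth1 nu (k+2)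
     then po (ev [k, k+1, k+2] (Pbar1 (w (nth1 nu k)))) * To k * Eo nu
      + po (ev [k, k+1, k+2] (Pbar2 (w (nth1 nu k)))) * To (k+1) * Eo nu
     else 0)"
    unfolding if_distrib[of rh] by (intro if_cong refl; simp only: h2)
   have "rh ?L = rh ?R"
   proof -
    have num: "k + 1 = Suc k" "k + 2 = Suc (Suc k)" by simp_all
    have ev02: "ev [k, Suc (Suc k)] (p2 (w a) 0 1) = PP a k (Suc (Suc k))" for a
     by (simp add: ev_p2 PP_def)
    have k': "1 \<le> k" "Suc k < length nu" using k nu by (auto simp: Iseqs_def)
    show ?thesis
     unfolding L R unfolding num ev02 po_mult To_braid[OF k'] by (intro if_cong refl conj_cong)
   qed
   moreover have "?L \<in> FA n" by (intro FA_fmul FA_diff F)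
   ultimately show "rho n s = 0" unfolding s rho_def rh_diff[OF \<open>?L \<in> FA n\<close> RF] by simp
  qed
  done
qed

lemma rho_J: "f \<in> JJ n ==> rho n f = 0"
 unfolding Jrel_def
proof (induction rule: rideal.induct)
 case (rid_gen s a b)
 then have "s \<in> FA n" "rho n s = 0" using rels_FA rho_rels by auto
 with rid_gen show ?case by (simp add: rho_fmul FA_intros)
next
 case (rid_add x y)
 then show ?case using rideal_sub[OF rels_FA] by (simp add: rho_add)
qed simp

section \<open>Congruence modulo the relations, and polynomials moved across crossings\<close>

definition cg :: "nat => ('i, 'k) fa => ('i, 'k) fa => bool" where
 "cg n f g \<longleftrightarrow> f - g \<in> JJ n"

lemma cg_refl [simp]: "cg n f f" using subgrpD(1)[OF J_subgrp] by (simp add: cg_def)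

lemma cg_sym: "cg n f g ==> cg n g f"
 unfolding cg_def using subgrpD(3)[OF J_subgrp, of "f - g"] by simp

lemma cg_trans [trans]: "cg n f g ==> cg n g h ==> cg n f h"
 unfolding cg_def using subgrpD(4)[OF J_subgrp, of "f - g" n "g - h"] by simp

lemma cg_add: "cg n f g ==> cg n f' g' ==> cg n (f + f') (g + g')"
 unfolding cg_def using subgrpD(4)[OF J_subgrp, of "f - g" n "f' - g'"] by (simp add: algebra_simps)

lemma cg_minus: "cg n f g ==> cg n (- f) (- g)"
 unfolding cg_def using subgrpD(3)[OF J_subgrp, of "f - g" n] by simp

lemma cg_diff: "cg n f g ==> cg n f' g' ==> cg n (f - f') (g - g')"
 using cg_add[OF _ cg_minus] by fastforce

lemma cg_sum: "(!!x. x \<in> S ==> cg n (f x) (g x)) ==> cg n (sum f S) (sum g S)"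
 unfolding cg_def sum_subtractf[symmetric] by (rule subgrp_sum[OF J_subgrp])

lemma cg_mult: "cg n f g ==> a \<in> FA n ==> cg n (fmul a f) (fmul a g)" "cg n f g ==> a \<in> FA n ==> cg n (fmul f a) (fmul g a)"
 unfolding cg_def using J_fmul[of "f - g" n a] by (auto simp: fmul_diff_left fmul_diff_right)

lemma cg_rho: "cg n f g ==> f \<in> FA n ==> g \<in> FA n ==> rho n f = rho n g"
 using rho_J[of "f - g" n] by (simp add: cg_def rho_diff)

lemma cg_zero_iff: "cg n f 0 \<longleftrightarrow> f \<in> JJ n" by (simp add: cg_def)

lemma cg_rels: "f - g \<in> rels t w n ==> cg n f g"
 unfolding cg_def by (rule J_rels)

lemma FA_ee: "nu \<in> Iseqs n ==> ee nu \<in> FA n" and FA_xx: "1 \<le> k ==> k \<le> n ==> xx k \<in> FA n"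
 and FA_tt: "1 \<le> l ==> l < n ==> tt l \<in> FA n"
 by (auto simp: Iseqs_def intro!: FA_gen)

lemma cg_one: "cg n (\<Sum>nu\<in>Iseqs n. ee nu) fone"
 by (rule cg_rels) (simp add: rels_def)

lemma cg_split: "f \<in> FA n ==> cg n (\<Sum>nu\<in>Iseqs n. fmul f (ee nu)) f"
 using cg_mult(1)[OF cg_one, of f n] by (simp add: fmul_sum_right)

lemma cg_tt_ee: "1 \<le> l ==> l < n ==> nu \<in> Iseqs n ==> cg n (fmul (tt l) (ee nu)) (fmul (ee (sw l nu)) (tt l))"
 by (rule cg_rels) (unfold rels_def, blast)

abbreviation "Po n \<equiv> (alg n {} :: ('i, 'k) fa set)"

lemma Po_ee: "nu \<in> Iseqs n ==> ee nu \<in> Po n" and Po_xx: "1 \<le> k ==> k \<le> n ==> xx k \<in> Po n"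
 by (auto simp: Iseqs_def intro!: alg_intros)

text \<open>The shape of the error terms in the quadratic and braid relations, with polynomial
  coefficients on the left here and on the right in \<open>RM\<close>. Two slots are provided
  because the braid relation for equal colours involves both crossings.\<close>

definition LM :: "nat => ('i, 'k) fa => ('i, 'k) fa => ('i, 'k) fa set" where
 "LM n a b = {f \<in> FA n. \<exists>p\<in>Po n. \<exists>q\<in>Po n. \<exists>r\<in>Po n. cg n f (fmul p a + fmul q b + r)}"

definition RM :: "nat => ('i, 'k) fa => ('i, 'k) fa => ('i, 'k) fa set" where
 "RM n a b = {f \<in> FA n. \<exists>p\<in>Po n. \<exists>q\<in>Po n. \<exists>r\<in>Po n. cg n f (fmul a p + fmul b q + r)}"

lemma LM_cong: "cg n f g ==> f \<in> FA n ==> g \<in> LM n a b ==> f \<in> LM n a b"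
 unfolding LM_def by (blast intro: cg_trans)

lemma RM_cong: "cg n f g ==> f \<in> FA n ==> g \<in> RM n a b ==> f \<in> RM n a b"
 unfolding RM_def by (blast intro: cg_trans)

lemma LM_add: "f \<in> LM n a b ==> g \<in> LM n a b ==> f + g \<in> LM n a b"
proof -
 assume "f \<in> LM n a b" "g \<in> LM n a b"
 then obtain p q r p' q' r' where P: "p \<in> Po n" "q \<in> Po n" "r \<in> Po n" "p' \<in> Po n" "q' \<in> Po n" "r' \<in> Po n"
  and f: "f \<in> FA n" "cg n f (fmul p a + fmul q b + r)" and g: "g \<in> FA n" "cg n g (fmul p' a + fmul q' b + r')"
  unfolding LM_def by blast
 have "cg n (f + g) (fmul (p + p') a + fmul (q + q') b + (r + r'))"
  using cg_add[OF f(2) g(2)] by (simp add: fmul_add_left add_ac)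
 then show ?thesis unfolding LM_def using P f g alg_intros(1) FA_add by blast
qed

lemma RM_add: "f \<in> RM n a b ==> g \<in> RM n a b ==> f + g \<in> RM n a b"
proof -
 assume "f \<in> RM n a b" "g \<in> RM n a b"
 then obtain p q r p' q' r' where P: "p \<in> Po n" "q \<in> Po n" "r \<in> Po n" "p' \<in> Po n" "q' \<in> Po n" "r' \<in> Po n"
  and f: "f \<in> FA n" "cg n f (fmul a p + fmul b q + r)" and g: "g \<in> FA n" "cg n g (fmul a p' + fmul b q' + r')"
  unfolding RM_def by blast
 have "cg n (f + g) (fmul a (p + p') + fmul b (q + q') + (r + r'))"
  using cg_add[OF f(2) g(2)] by (simp add: fmul_add_right add_ac)
 then show ?thesis unfolding RM_def using P f g alg_intros(1) FA_add by blast
qed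

lemma LM_pol: "f \<in> LM n a b ==> p \<in> Po n ==> fmul p f \<in> LM n a b"
proof -
 assume "f \<in> LM n a b" and p: "p \<in> Po n"
 then obtain p' q r where P: "p' \<in> Po n" "q \<in> Po n" "r \<in> Po n"
  and f: "f \<in> FA n" "cg n f (fmul p' a + fmul q b + r)" unfolding LM_def by blast
 have "cg n (fmul p f) (fmul (fmul p p') a + fmul (fmul p q) b + fmul p r)"
  using cg_mult(1)[OF f(2) alg_FA[OF p]] by (simp add: fmul_add_right fmul_assoc)
 then show ?thesis unfolding LM_def using P f p alg_intros(4) FA_fmul alg_FA by blast
qed

lemma RM_pol: "f \<in> RM n a b ==> p \<in> Po n ==> fmul f p \<in> RM n a b"
proof -
 assume "f \<in> RM n a b" and p: "p \<in> Po n"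
 then obtain p' q r where P: "p' \<in> Po n" "q \<in> Po n" "r \<in> Po n"
  and f: "f \<in> FA n" "cg n f (fmul a p' + fmul b q + r)" unfolding RM_def by blast
 have "cg n (fmul f p) (fmul a (fmul p' p) + fmul b (fmul q p) + fmul r p)"
  using cg_mult(2)[OF f(2) alg_FA[OF p]] by (simp add: fmul_add_left fmul_assoc)
 then show ?thesis unfolding RM_def using P f p alg_intros(4) FA_fmul alg_FA by blast
qed

lemma LM_base: "a \<in> FA n ==> a \<in> LM n a b" "b \<in> FA n ==> b \<in> LM n a b" "r \<in> Po n ==> r \<in> LM n a b"
proof -
 have z: "0 \<in> Po n" "fone \<in> Po n" by (intro alg_intros)+
 have "cg n a (fmul fone a + fmul 0 b + 0)" "cg n b (fmul 0 a + fmul fone b + 0)" "cg n r (fmul 0 a + fmul 0 b + r)" by simp_all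
 then show "a \<in> FA n ==> a \<in> LM n a b" "b \<in> FA n ==> b \<in> LM n a b" "r \<in> Po n ==> r \<in> LM n a b"
  unfolding LM_def using z alg_FA by blast+
qed

lemma RM_base: "a \<in> FA n ==> a \<in> RM n a b" "b \<in> FA n ==> b \<in> RM n a b" "r \<in> Po n ==> r \<in> RM n a b"
proof -
 have z: "0 \<in> Po n" "fone \<in> Po n" by (intro alg_intros)+
 have "cg n a (fmul a fone + fmul b 0 + 0)" "cg n b (fmul a 0 + fmul b fone + 0)" "cg n r (fmul a 0 + fmul b 0 + r)" by simp_all
 then show "a \<in> FA n ==> a \<in> RM n a b" "b \<in> FA n ==> b \<in> RM n a b" "r \<in> Po n ==> r \<in> RM n a b"
  unfolding RM_def using z alg_FA by blast+
qed

lemma LM_sum: "(!!x. x \<in> S ==> f x \<in> LM n a b) ==> sum f S \<in> LM n a b"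
 by (induction S rule: infinite_finite_induct)
   (auto intro: LM_add LM_base(3) alg_intros)

lemma RM_sum: "(!!x. x \<in> S ==> f x \<in> RM n a b) ==> sum f S \<in> RM n a b"
 by (induction S rule: infinite_finite_induct)
   (auto intro: RM_add RM_base(3) alg_intros)

text \<open>The relations are imposed after multiplication by e(nu), with coefficients that depend
  on nu. Since the e(nu) sum to 1, the separate expressions combine into one.\<close>

lemma LM_split: "f \<in> FA n ==> (!!nu. nu \<in> Iseqs n ==> fmul f (ee nu) \<in> LM n a b) ==> f \<in> LM n a b"
 by (rule LM_cong[OF cg_sym[OF cg_split]]) (auto intro: LM_sum)

lemma RM_split: "f \<in> FA n ==> (!!nu. nu \<in> Iseqs n ==> fmul f (ee nu) \<in> RM n a b) ==> f \<in> RM n a b"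
 by (rule RM_cong[OF cg_sym[OF cg_split]]) (auto intro: RM_sum)

lemma Po_Pcase: "1 \<le> k ==> k < n ==> nu \<in> Iseqs n ==>
  (if l = k \<and> nth1 nu k = nth1 nu (k+1)
     then - fmul (evp (p2 (w (nth1 nu k)) 0 1) [xx k, xx (k+1)]) (ee nu)
     else if l = k + 1 \<and> nth1 nu k = nth1 nu (k+1)
     then fmul (evp (p2 (w (nth1 nu k)) 0 1) [xx k, xx (k+1)]) (ee nu)
     else 0) \<in> Po n"
 by (auto simp: Iseqs_def intro!: alg_intros)

lemma cg_tt_xx:
 assumes "1 \<le> k" "k < n" "1 \<le> l" "l \<le> n" "nu \<in> Iseqs n"
 shows "\<exists>r\<in>Po n. cg n (fmul (fmul (tt k) (xx l)) (ee nu)) (fmul (fmul (xx (sidx k l)) (tt k)) (ee nu) + r)"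
proof (rule bexI[OF _ Po_Pcase[OF assms(1,2,5), of l]])
 have "fmul (fmul (tt k) (xx l) - fmul (xx (sidx k l)) (tt k)) (ee nu) -
    (if l = k \<and> nth1 nu k = nth1 nu (k+1)
     then - fmul (evp (p2 (w (nth1 nu k)) 0 1) [xx k, xx (k+1)]) (ee nu)
     else if l = k + 1 \<and> nth1 nu k = nth1 nu (k+1)
     then fmul (evp (p2 (w (nth1 nu k)) 0 1) [xx k, xx (k+1)]) (ee nu)
     else 0) \<in> rels t w n"
  unfolding rels_def by (rule UnI1, rule UnI2, rule CollectI) (use assms in blast)
 from J_rels[OF this]
 show "cg n (fmul (fmul (tt k) (xx l)) (ee nu)) (fmul (fmul (xx (sidx k l)) (tt k)) (ee nu) +
    (if l = k \<and> nth1 nu k = nth1 nu (k+1)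
     then - fmul (evp (p2 (w (nth1 nu k)) 0 1) [xx k, xx (k+1)]) (ee nu)
     else if l = k + 1 \<and> nth1 nu k = nth1 nu (k+1)
     then fmul (evp (p2 (w (nth1 nu k)) 0 1) [xx k, xx (k+1)]) (ee nu)
     else 0))"
  unfolding cg_def fmul_diff_left diff_diff_eq .
qed

lemma tt_gen_LM:
 assumes k: "1 \<le> k" "k < n" and g: "vgen n g" "\<forall>l. g ~= T l"
 shows "fmul (tt k) (fgen g) \<in> LM n (tt k) b"
proof (cases g)
 case (E nu)
 then have nu: "nu \<in> Iseqs n" using g by (simp add: Iseqs_def)
 show ?thesis unfolding E
  by (rule LM_cong[OF cg_tt_ee[OF k nu]])
    (auto intro!: FA_fmul FA_tt FA_ee k nu LM_pol LM_base(1) Po_ee sw_Iseqs)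
next
 case (X l)
 then have l: "1 \<le> l" "l \<le> n" and l': "1 \<le> sidx k l" "sidx k l \<le> n" using g k by (auto simp: sidx_def)
 show ?thesis unfolding X
 proof (rule LM_split)
  fix nu :: "'i list" assume nu: "nu \<in> Iseqs n"
  obtain r where r: "r \<in> Po n" "cg n (fmul (fmul (tt k) (xx l)) (ee nu)) (fmul (fmul (xx (sidx k l)) (tt k)) (ee nu) + r)"
   using cg_tt_xx[OF k l nu] by blast
  have "fmul (tt k) (ee nu) \<in> LM n (tt k) b"
   by (rule LM_cong[OF cg_tt_ee[OF k nu]])
     (auto intro!: FA_fmul FA_tt FA_ee k nu LM_pol LM_base(1) Po_ee sw_Iseqs)
  from LM_add[OF LM_pol[OF this Po_xx[OF l']] LM_base(3)[OF r(1)]]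
  have mem: "fmul (fmul (xx (sidx k l)) (tt k)) (ee nu) + r \<in> LM n (tt k) b" by (simp add: fmul_assoc)
  show "fmul (fmul (tt k) (xx l)) (ee nu) \<in> LM n (tt k) b"
   by (rule LM_cong[OF r(2) _ mem]) (intro FA_fmul FA_tt FA_xx FA_ee k l nu)
 qed (intro FA_fmul FA_tt FA_xx k l)
qed (use g in auto)

lemma gen_tt_RM:
 assumes k: "1 \<le> k" "k < n" and g: "vgen n g" "\<forall>l. g ~= T l"
 shows "fmul (fgen g) (tt k) \<in> RM n (tt k) b"
proof (cases g)
 case (E nu)
 then have nu: "nu \<in> Iseqs n" using g by (simp add: Iseqs_def)
 have "cg n (fmul (ee nu) (tt k)) (fmul (tt k) (ee (sw k nu)))"
  using cg_sym[OF cg_tt_ee[OF k sw_Iseqs[OF nu, of k]]] nu k by (simp add: Iseqs_def)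
 then show ?thesis unfolding E
  by (rule RM_cong)
    (auto intro!: FA_fmul FA_tt FA_ee k nu RM_pol RM_base(1) Po_ee sw_Iseqs)
next
 case (X l)
 let ?l = "sidx k l"
 have l: "1 \<le> l" "l \<le> n" and l': "1 \<le> ?l" "?l \<le> n" using X g k by (auto simp: sidx_def)
 show ?thesis unfolding X
 proof (rule RM_split)
  fix nu :: "'i list" assume nu: "nu \<in> Iseqs n"
  obtain r where r: "r \<in> Po n" "cg n (fmul (fmul (tt k) (xx ?l)) (ee nu)) (fmul (fmul (xx l) (tt k)) (ee nu) + r)"
   using cg_tt_xx[OF k l' nu] by auto
  have c: "cg n (fmul (fmul (xx l) (tt k)) (ee nu)) (fmul (tt k) (fmul (xx ?l) (ee nu)) + (- r))"
   using cg_sym[OF cg_add[OF r(2) cg_refl[of n "- r"]]] by (simp add: fmul_assoc)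
  have mem: "fmul (tt k) (fmul (xx ?l) (ee nu)) + (- r) \<in> RM n (tt k) b"
   by (intro RM_add[OF RM_pol[OF RM_base(1)] RM_base(3)] FA_tt k alg_intros(3,4) Po_xx Po_ee l' nu r)
  show "fmul (fmul (xx l) (tt k)) (ee nu) \<in> RM n (tt k) b"
   by (rule RM_cong[OF c _ mem]) (intro FA_fmul FA_tt FA_xx FA_ee k l nu)
 qed (intro FA_fmul FA_tt FA_xx k l)
qed (use g in auto)

end

context klr begin

lemma fsmul_fmul: "fsmul c f = fmul (fsmul c fone) f" "fsmul c f = fmul f (fsmul c fone)"
 by (simp_all add: fmul_fsmul)

lemma Po_scalar: "fsmul c fone \<in> Po n" by (intro alg_intros)

lemma LM_fsmul: "f \<in> LM n a b ==> fsmul c f \<in> LM n a b"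
 unfolding fsmul_fmul(1)[of c f] by (rule LM_pol[OF _ Po_scalar])

lemma RM_fsmul: "f \<in> RM n a b ==> fsmul c f \<in> RM n a b"
 unfolding fsmul_fmul(2)[of c f] by (rule RM_pol[OF _ Po_scalar])

lemma fw_Cons: "fw (g # u) = fmul (fgen g) (fw u)" and fw_snoc: "fw (u @ [g]) = fmul (fw u) (fgen g)"
 by (simp_all add: fgen_fw fw_mult)

lemma gen_Po: "vgen n g ==> \<forall>l. g ~= T l ==> fgen g \<in> Po n"
 by (auto intro!: alg_intros)

lemma LMI: "f \<in> FA n ==> p \<in> Po n ==> q \<in> Po n ==> r \<in> Po n ==>
  cg n f (fmul p a + fmul q b + r) ==> f \<in> LM n a b"
 and RMI: "f \<in> FA n ==> p \<in> Po n ==> q \<in> Po n ==> r \<in> Po n ==>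
  cg n f (fmul a p + fmul b q + r) ==> f \<in> RM n a b"
 unfolding LM_def RM_def by blast+

lemma LM_absorb: assumes "f \<in> LM n a a" shows "f \<in> LM n a b"
proof -
 obtain p q r where P: "p \<in> Po n" "q \<in> Po n" "r \<in> Po n" "f \<in> FA n" "cg n f (fmul p a + fmul q a + r)"
  using assms unfolding LM_def by blast
 then have "cg n f (fmul (p + q) a + fmul 0 b + r)" by (simp add: fmul_add_left)
 then show ?thesis by (rule LMI[OF P(4) alg_intros(1)[OF P(1,2)] alg_intros(12) P(3)])
qed

lemma RM_absorb: assumes "f \<in> RM n a a" shows "f \<in> RM n a b"
proof -
 obtain p q r where P: "p \<in> Po n" "q \<in> Po n" "r \<in> Po n" "f \<in> FA n" "cg n f (fmul a p + fmul a q + r)"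
  using assms unfolding RM_def by blast
 then have "cg n f (fmul a (p + q) + fmul b 0 + r)" by (simp add: fmul_add_right)
 then show ?thesis by (rule RMI[OF P(4) alg_intros(1)[OF P(1,2)] alg_intros(12) P(3)])
qed

text \<open>Induction on the word: moving its first letter across leaves multiples of the crossing
  plus a polynomial, and both can be carried past the remaining letters.\<close>

lemma tt_Po_LM:
 assumes k: "1 \<le> k" "k < n" and p: "p \<in> Po n"
 shows "fmul (tt k) p \<in> LM n (tt k) b"
 using p
proof (induction p rule: alg_induct)
 case zero
 show ?case by (simp, intro LM_base alg_intros)
next
 case (word c u)
 have "fmul (tt k) (fw u) \<in> LM n (tt k) (tt k)" using word
 proof (induction u)
  case Nil
  show ?case by (simp add: fone_fw[symmetric], intro LM_base FA_tt k)
 next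
  case (Cons g u)
  then have g: "vgen n g" "\<forall>l. g ~= T l" and u: "fw u \<in> Po n"
   by (auto intro!: alg_fw)
  have uL: "fmul (tt k) (fw u) \<in> LM n (tt k) (tt k)" using Cons by auto
  obtain p q r where P: "p \<in> Po n" "q \<in> Po n" "r \<in> Po n"
   and c: "cg n (fmul (tt k) (fgen g)) (fmul p (tt k) + fmul q (tt k) + r)"
   using tt_gen_LM[OF k g, of "tt k"] unfolding LM_def by blast
  have c2: "cg n (fmul (tt k) (fw (g # u))) (fmul p (fmul (tt k) (fw u)) + fmul q (fmul (tt k) (fw u)) + fmul r (fw u))"
   using cg_mult(2)[OF c alg_FA[OF u]] by (simp add: fw_Cons fmul_assoc fmul_add_left)
  show ?case
   by (rule LM_cong[OF c2 _ LM_add[OF LM_add[OF LM_pol[OF uL P(1)] LM_pol[OF uL P(2)]] LM_base(3)[OF alg_intros(4)[OF P(3) u]]]])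
     (unfold fw_Cons, intro FA_fmul FA_tt k FA_gen g alg_FA[OF u])
 qed
 then have "fmul (tt k) (fw u) \<in> LM n (tt k) b" by (rule LM_absorb)
 from LM_fsmul[OF this] show ?case by (simp add: fmul_fsmul)
next
 case (add f g)
 then show ?case by (simp add: fmul_add_right LM_add)
qed

lemma Po_tt_RM:
 assumes k: "1 \<le> k" "k < n" and p: "p \<in> Po n"
 shows "fmul p (tt k) \<in> RM n (tt k) b"
 using p
proof (induction p rule: alg_induct)
 case zero
 show ?case by (simp, intro RM_base alg_intros)
next
 case (word c u)
 have "fmul (fw u) (tt k) \<in> RM n (tt k) (tt k)" using word
 proof (induction u rule: rev_induct)
  case Nil
  show ?case by (simp add: fone_fw[symmetric], intro RM_base FA_tt k)
 next
  case (snoc g u)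
  then have g: "vgen n g" "\<forall>l. g ~= T l" and u: "fw u \<in> Po n"
   by (auto intro!: alg_fw)
  have uL: "fmul (fw u) (tt k) \<in> RM n (tt k) (tt k)" using snoc by auto
  obtain p q r where P: "p \<in> Po n" "q \<in> Po n" "r \<in> Po n"
   and c: "cg n (fmul (fgen g) (tt k)) (fmul (tt k) p + fmul (tt k) q + r)"
   using gen_tt_RM[OF k g, of "tt k"] unfolding RM_def by blast
  have c2: "cg n (fmul (fw (u @ [g])) (tt k)) (fmul (fmul (fw u) (tt k)) p + fmul (fmul (fw u) (tt k)) q + fmul (fw u) r)"
   using cg_mult(1)[OF c alg_FA[OF u]] by (simp add: fw_snoc fmul_assoc fmul_add_right)
  show ?case
   by (rule RM_cong[OF c2 _ RM_add[OF RM_add[OF RM_pol[OF uL P(1)] RM_pol[OF uL P(2)]] RM_base(3)[OF alg_intros(4)[OF u P(3)]]]])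
     (unfold fw_snoc, intro FA_fmul FA_tt k FA_gen g alg_FA[OF u])
 qed
 then have "fmul (fw u) (tt k) \<in> RM n (tt k) b" by (rule RM_absorb)
 from RM_fsmul[OF this] show ?case by (simp add: fmul_fsmul)
next
 case (add f g)
 then show ?case by (simp add: fmul_add_left RM_add)
qed

lemma tt_ee_LM: "1 \<le> k ==> k < n ==> nu \<in> Iseqs n ==> fmul (tt k) (ee nu) \<in> LM n (tt k) b"
 by (rule tt_gen_LM) (auto simp: Iseqs_def)

lemma LM_comm: "LM n a b = LM n b a"
proof -
 have "LM n a b \<subseteq> LM n b a" for a b
 proof
  fix f assume "f \<in> LM n a b"
  then obtain p q r where "p \<in> Po n" "q \<in> Po n" "r \<in> Po n" "f \<in> FA n" "cg n f (fmul q b + fmul p a + r)"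
   unfolding LM_def by (auto simp: add.commute)
  then show "f \<in> LM n b a" unfolding LM_def by blast
 qed
 then show ?thesis by blast
qed

lemma RM_comm: "RM n a b = RM n b a"
proof -
 have "RM n a b \<subseteq> RM n b a" for a b
 proof
  fix f assume "f \<in> RM n a b"
  then obtain p q r where "p \<in> Po n" "q \<in> Po n" "r \<in> Po n" "f \<in> FA n" "cg n f (fmul b q + fmul a p + r)"
   unfolding RM_def by (auto simp: add.commute)
  then show "f \<in> RM n b a" unfolding RM_def by blast
 qed
 then show ?thesis by blast
qed

lemma LM_RM:
 assumes "1 \<le> k" "k < n" "1 \<le> l" "l < n" "f \<in> LM n (tt k) (tt l)"
 shows "f \<in> RM n (tt k) (tt l)"
proof -
 obtain p q r where P: "p \<in> Po n" "q \<in> Po n" "r \<in> Po n" "f \<in> FA n" "cg n f (fmul p (tt k) + fmul q (tt l) + r)"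
  using assms(5) unfolding LM_def by blast
 have "fmul p (tt k) + fmul q (tt l) + r \<in> RM n (tt k) (tt l)"
  by (rule RM_add[OF RM_add[OF Po_tt_RM[OF assms(1,2) P(1)]
   Po_tt_RM[OF assms(3,4) P(2), of "tt k", unfolded RM_comm[of n "tt l" "tt k"]]] RM_base(3)[OF P(3)]])
 from RM_cong[OF P(5,4) this] show ?thesis .
qed

lemma tt_sq_LM:
 assumes k: "1 \<le> k" "k < n"
 shows "fmul (tt k) (tt k) \<in> LM n (tt k) b"
proof (rule LM_split)
 fix nu :: "'i list" assume nu: "nu \<in> Iseqs n"
 let ?r = "if nth1 nu k = nth1 nu (k+1)
     then fmul (fmul (evp (dP (w (nth1 nu k))) [xx k, xx (k+1)]) (tt k)) (ee nu)
     else fmul (evp (p2 (t (nth1 nu k) (nth1 nu (k+1))) 0 1) [xx k, xx (k+1)]) (ee nu)"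
 have "fmul (fmul (tt k) (tt k)) (ee nu) - ?r \<in> rels t w n"
  unfolding rels_def by (rule UnI1, rule UnI1, rule UnI2, rule CollectI) (use k nu in blast)
 from cg_rels[OF this] have c: "cg n (fmul (fmul (tt k) (tt k)) (ee nu)) ?r" .
 have ev: "evp p [xx k, xx (k+1)] \<in> Po n" for p :: "'k mpoly"
  using k by (auto intro!: alg_intros)
 have mem: "?r \<in> LM n (tt k) b"
  using LM_pol[OF tt_ee_LM[OF k nu] ev] LM_base(3)[OF alg_intros(4)[OF ev Po_ee[OF nu]]]
  by (simp add: fmul_assoc)
 show "fmul (fmul (tt k) (tt k)) (ee nu) \<in> LM n (tt k) b"
  by (rule LM_cong[OF c _ mem]) (intro FA_fmul FA_tt FA_ee k nu)
qed (intro FA_fmul FA_tt k)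

lemma braid_LM:
 assumes k: "1 \<le> k" "k + 1 < n"
 shows "fmul (fmul (tt (k+1)) (tt k)) (tt (k+1)) - fmul (fmul (tt k) (tt (k+1))) (tt k) \<in> LM n (tt k) (tt (k+1))"
  (is "?f \<in> _")
proof (rule LM_split)
 have k': "1 \<le> k" "k < n" "1 \<le> k + 1" using k by auto
 fix nu :: "'i list" assume nu: "nu \<in> Iseqs n"
 let ?r = "if nth1 nu k = nth1 nu (k+2) \<and> nth1 nu k ~= nth1 nu (k+1)
     then fmul (fmul (evp (p2 (w (nth1 nu k)) 0 1) [xx k, xx (k+2)])
             (evp (Qbar (t (nth1 nu k) (nth1 nu (k+1)))) [xx k, xx (k+1), xx (k+2)])) (ee nu)
     else if nth1 nu k = nth1 nu (k+1) \<and> nth1 nu (k+1) = nth1 nu (k+2)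
     then fmul (fmul (evp (Pbar1 (w (nth1 nu k))) [xx k, xx (k+1), xx (k+2)]) (tt k)) (ee nu)
      + fmul (fmul (evp (Pbar2 (w (nth1 nu k))) [xx k, xx (k+1), xx (k+2)]) (tt (k+1))) (ee nu)
     else 0"
 have "fmul ?f (ee nu) - ?r \<in> rels t w n"
  unfolding rels_def by (rule UnI2, rule CollectI) (use k nu in blast)
 from cg_rels[OF this] have c: "cg n (fmul ?f (ee nu)) ?r" .
 have x: "xx k \<in> Po n" "xx (k+1) \<in> Po n" "xx (k+2) \<in> Po n" by (intro Po_xx; use k in simp)+
 have ev: "evp p [xx k, xx (k+1), xx (k+2)] \<in> Po n" "evp p [xx k, xx (k+2)] \<in> Po n" for p :: "'k mpoly"
  using x by (auto intro!: alg_intros(9))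
 have 1: "fmul (fmul (evp p [xx k, xx (k+2)]) (evp q [xx k, xx (k+1), xx (k+2)])) (ee nu) \<in> LM n (tt k) (tt (k+1))" for p q
  by (intro LM_base(3) alg_intros(4) ev Po_ee nu)
 have 2: "fmul (fmul (evp p [xx k, xx (k+1), xx (k+2)]) (tt k)) (ee nu) \<in> LM n (tt k) (tt (k+1))" for p
  unfolding fmul_assoc by (intro LM_pol ev tt_ee_LM k' nu)
 have 3: "fmul (fmul (evp p [xx k, xx (k+1), xx (k+2)]) (tt (k+1))) (ee nu) \<in> LM n (tt k) (tt (k+1))" for p
  unfolding fmul_assoc LM_comm[of n "tt k"] by (intro LM_pol ev tt_ee_LM k k' nu)
 have 4: "0 \<in> LM n (tt k) (tt (k+1))" by (intro LM_base(3) alg_intros)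
 have mem: "?r \<in> LM n (tt k) (tt (k+1))"
  by (simp only: 1 2 3 4 LM_add simp_thms split: if_splits)
 show "fmul ?f (ee nu) \<in> LM n (tt k) (tt (k+1))"
  by (rule LM_cong[OF c _ mem]) (intro FA_fmul FA_diff FA_tt FA_ee k k' nu)
qed (intro FA_fmul FA_diff FA_tt k; use k in simp)

lemma LM_neg: "f \<in> LM n a b ==> - f \<in> LM n a b"
proof -
 have "- f = fsmul (- 1) f" by (auto simp: fsmul_def fun_apply)
 then show "f \<in> LM n a b ==> - f \<in> LM n a b" by (simp add: LM_fsmul)
qed

lemma braid_adj_LM:
 assumes k: "1 \<le> k" "k < n" "1 \<le> l" "l < n" "k + 1 = l \<or> l + 1 = k"
 shows "fmul (fmul (tt l) (tt k)) (tt l) - fmul (fmul (tt k) (tt l)) (tt k) \<in> LM n (tt k) (tt l)"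
proof (cases "k + 1 = l")
 case True
 then show ?thesis using braid_LM[of k n] k by auto
next
 case False
 then have k': "k = l + 1" using k by auto
 from LM_neg[OF braid_LM[of l n]] show ?thesis
  unfolding k' LM_comm[of n "tt (l + 1)"] using k k' by (simp only: minus_diff_eq)
qed

lemma tt_far: "1 \<le> k ==> k < n ==> 1 \<le> l ==> l < n ==> k + 1 < l \<or> l + 1 < k ==>
  cg n (fmul (tt k) (tt l)) (fmul (tt l) (tt k))"
 by (rule cg_rels, unfold rels_def, rule UnI1, rule UnI1, rule UnI1, rule UnI2, rule CollectI) blast

text \<open>The conditions that \<open>span_chain\<close> puts on the order of the crossings. They
  hold for the ascending and the descending enumeration of 1, ..., N, whose base algebras omit tau_1
  and tau_N respectively and so belong to the two embeddings.\<close>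

definition chain_ok :: "nat => (nat => nat) => bool" where
 "chain_ok N c \<longleftrightarrow> (\<forall>i<N. 1 \<le> c i \<and> c i \<le> N) \<and>
   (\<forall>i<N. \<forall>l. 1 \<le> l \<and> l \<le> N \<and> (l + 1 = c i \<or> c i + 1 = l) -->
    (i > 0 \<and> l = c (i - 1)) \<or> (Suc i < N \<and> l = c (Suc i))) \<and>
   (\<forall>i<N. \<forall>j<N. c i = c j --> i = j) \<and>
   (\<forall>i<N. \<forall>j. Suc j < i --> c i + 1 < c j \<or> c j + 1 < c i)"

lemma chain_ok_up: "chain_ok N Suc"
 by (auto simp: chain_ok_def)

lemma chain_ok_down: "chain_ok N (\<lambda>i. N - i)"
 unfolding chain_ok_def by (intro conjI allI impI) (simp_all, linarith+)

text \<open>Closing \<open>alg n K\<close> under congruence yields a base set that contains the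
  ideal of relations, as \<open>span_chain\<close> requires.\<close>

definition Cb :: "nat => nat set => ('i, 'k) fa set" where
 "Cb n K = {f \<in> FA n. \<exists>g\<in>alg n K. cg n f g}"

lemma Cb_props:
 "subgrp (Cb n K)" "JJ n \<subseteq> Cb n K" "Cb n K \<subseteq> FA n"
 "f \<in> alg n K ==> x \<in> Cb n K ==> fmul f x \<in> Cb n K" "f \<in> alg n K ==> x \<in> Cb n K ==> fmul x f \<in> Cb n K"
proof -
 show "subgrp (Cb n K)" unfolding subgrp_def
 proof (intro conjI ballI)
  show "0 \<in> Cb n K" unfolding Cb_def using alg_intros(12)[of n K] by (auto intro!: bexI[of _ 0])
  fix a b assume "a \<in> Cb n K" "b \<in> Cb n K"
  then show "a - b \<in> Cb n K" unfolding Cb_def using FA_diff cg_diff alg_intros(2) by blast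
 qed
 show "JJ n \<subseteq> Cb n K"
 proof
  fix f assume "f \<in> JJ n"
  then show "f \<in> Cb n K" unfolding Cb_def using J_FA cg_zero_iff alg_intros(12)[of n K] by blast
 qed
 show "f \<in> alg n K ==> x \<in> Cb n K ==> fmul f x \<in> Cb n K"
  unfolding Cb_def using FA_fmul[OF alg_FA] cg_mult(1)[OF _ alg_FA] alg_intros(4) by blast
 show "f \<in> alg n K ==> x \<in> Cb n K ==> fmul x f \<in> Cb n K"
  unfolding Cb_def using FA_fmul[OF _ alg_FA] cg_mult(2)[OF _ alg_FA] alg_intros(4) by blast
qed (auto simp: Cb_def)

lemma tt_alg: "1 \<le> l ==> l < n ==> l \<in> K ==> tt l \<in> alg n K"
 by (rule alg_intros) simp

lemma Po_alg: "p \<in> Po n ==> p \<in> alg n K" by (erule alg_mono) simp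

lemma left_chain:
 assumes N: "N < n" and c: "chain_ok N c"
 shows "span_chain (JJ n) (FA n) (fmul ` Po n) (\<lambda>l. fmul (tt l)) N c (Cb n ({1..N} - {c 0}))"
proof
 have sub: "1 \<le> l ==> l \<le> N ==> tt l \<in> FA n" for l using N by (intro FA_tt) auto
 show "subgrp (JJ n)" by (rule J_subgrp)
 show "subgrp (FA n)" unfolding subgrp_def by (auto intro: FA_diff)
 show "JJ n \<subseteq> FA n" using J_FA by blast
 show "p x \<in> FA n" if "p \<in> fmul ` Po n" "x \<in> FA n" for p x using that by (auto intro: FA_fmul alg_FA)
 show "p (x - y) = p x - p y" if "p \<in> fmul ` Po n" for p x y using that by (auto simp: fmul_diff_right)
 show "p x \<in> JJ n" if "p \<in> fmul ` Po n" "x \<in> JJ n" for p x using that by (auto intro: J_fmul alg_FA)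
 show "fmul (tt l) x \<in> FA n" if "1 \<le> l" "l \<le> N" "x \<in> FA n" for l x using sub that by (auto intro: FA_fmul)
 show "fmul (tt l) (x - y) = fmul (tt l) x - fmul (tt l) y" for l x y by (rule fmul_diff_right)
 show "fmul (tt l) x \<in> JJ n" if "1 \<le> l" "l \<le> N" "x \<in> JJ n" for l x using sub that by (auto intro: J_fmul)
 show "fmul (tt k) (fmul (tt l) y) - fmul (tt l) (fmul (tt k) y) \<in> JJ n"
  if "1 \<le> k" "k \<le> N" "1 \<le> l" "l \<le> N" "k + 1 < l \<or> l + 1 < k" "y \<in> FA n" for k l y
  using cg_mult(2)[OF tt_far that(6), of k l] that N by (simp add: cg_def fmul_assoc)
 show "\<exists>p\<in>fmul ` Po n. \<exists>q\<in>fmul ` Po n. \<forall>y\<in>FA n. fmul (tt k) (fmul (tt k) y) - (p (fmul (tt k) y) + q y) \<in> JJ n"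
  if k: "1 \<le> k" "k \<le> N" for k
 proof -
  have kn: "k < n" using k N by simp
  obtain p q r where P: "p \<in> Po n" "q \<in> Po n" "r \<in> Po n" "cg n (fmul (tt k) (tt k)) (fmul p (tt k) + fmul q (tt k) + r)"
   using tt_sq_LM[OF k(1) kn, of "tt k"] unfolding LM_def by blast
  have "fmul (tt k) (fmul (tt k) y) - (fmul (p + q) (fmul (tt k) y) + fmul r y) \<in> JJ n" if "y \<in> FA n" for y
   using cg_mult(2)[OF P(4) that] by (simp add: cg_def fmul_assoc fmul_add_left)
  then show ?thesis using alg_intros(1)[OF P(1,2)] P(3) by blast
 qed
 show "\<exists>p\<in>fmul ` Po n. \<exists>q\<in>fmul ` Po n. \<exists>r\<in>fmul ` Po n. \<forall>y\<in>FA n.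
   fmul (tt l) (fmul (tt k) (fmul (tt l) y)) - (fmul (tt k) (fmul (tt l) (fmul (tt k) y)) +
    (p (fmul (tt k) y) + q (fmul (tt l) y) + r y)) \<in> JJ n"
  if k: "1 \<le> k" "k \<le> N" "1 \<le> l" "l \<le> N" "k + 1 = l \<or> l + 1 = k" for k l
 proof -
  have kn: "k < n" "l < n" using k N by auto
  obtain p q r where P: "p \<in> Po n" "q \<in> Po n" "r \<in> Po n"
   "cg n (fmul (fmul (tt l) (tt k)) (tt l) - fmul (fmul (tt k) (tt l)) (tt k)) (fmul p (tt k) + fmul q (tt l) + r)"
   using braid_adj_LM[OF k(1) kn(1) k(3) kn(2) k(5)] unfolding LM_def by blast
  have "fmul (tt l) (fmul (tt k) (fmul (tt l) y)) - (fmul (tt k) (fmul (tt l) (fmul (tt k) y)) +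
    (fmul p (fmul (tt k) y) + fmul q (fmul (tt l) y) + fmul r y)) \<in> JJ n" if "y \<in> FA n" for y
   using cg_mult(2)[OF P(4) that] by (simp add: cg_def fmul_assoc fmul_add_left fmul_diff_left algebra_simps)
  then show ?thesis using P(1-3) by blast
 qed
 show "\<exists>p'\<in>fmul ` Po n. \<exists>p''\<in>fmul ` Po n. \<forall>y\<in>FA n. p (fmul (tt k) y) - (fmul (tt k) (p' y) + p'' y) \<in> JJ n"
  if k: "1 \<le> k" "k \<le> N" and p: "p \<in> fmul ` Po n" for k p
 proof -
  have kn: "k < n" using k N by simp
  obtain p0 where p0: "p0 \<in> Po n" "p = fmul p0" using p by blast
  obtain p q r where P: "p \<in> Po n" "q \<in> Po n" "r \<in> Po n" "cg n (fmul p0 (tt k)) (fmul (tt k) p + fmul (tt k) q + r)"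
   using Po_tt_RM[OF k(1) kn p0(1), of "tt k"] unfolding RM_def by blast
  have "fmul p0 (fmul (tt k) y) - (fmul (tt k) (fmul (p + q) y) + fmul r y) \<in> JJ n" if "y \<in> FA n" for y
   using cg_mult(2)[OF P(4) that] by (simp add: cg_def fmul_assoc fmul_add_left fmul_add_right)
  then show ?thesis unfolding p0 using alg_intros(1)[OF P(1,2)] P(3) by blast
 qed
 show "p x \<in> Cb n ({1..N} - {c 0})" if "p \<in> fmul ` Po n" "x \<in> Cb n ({1..N} - {c 0})" for p x
  using that Cb_props(4)[OF Po_alg] by blast
 show "fmul (tt l) x \<in> Cb n ({1..N} - {c 0})" if "1 \<le> l" "l \<le> N" "N > 0" "l ~= c 0" "x \<in> Cb n ({1..N} - {c 0})" for l x
  using that N by (intro Cb_props(4) tt_alg) auto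
qed (use c in \<open>auto simp: chain_ok_def Cb_props\<close>)

lemma right_chain:
 assumes N: "N < n" and c: "chain_ok N c"
 shows "span_chain (JJ n) (FA n) ((\<lambda>p y. fmul y p) ` Po n) (\<lambda>l y. fmul y (tt l)) N c (Cb n ({1..N} - {c 0}))"
proof
 let ?P = "(\<lambda>p y. fmul y p) ` Po n"
 have sub: "1 \<le> l ==> l \<le> N ==> tt l \<in> FA n" for l using N by (intro FA_tt) auto
 show "subgrp (JJ n)" by (rule J_subgrp)
 show "subgrp (FA n)" unfolding subgrp_def by (auto intro: FA_diff)
 show "JJ n \<subseteq> FA n" using J_FA by blast
 show "p x \<in> FA n" if "p \<in> ?P" "x \<in> FA n" for p x using that by (auto intro: FA_fmul alg_FA)
 show "p (x - y) = p x - p y" if "p \<in> ?P" for p x y using that by (auto simp: fmul_diff_left)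
 show "p x \<in> JJ n" if "p \<in> ?P" "x \<in> JJ n" for p x using that by (auto intro: J_fmul alg_FA)
 show "fmul x (tt l) \<in> FA n" if "1 \<le> l" "l \<le> N" "x \<in> FA n" for l x using sub that by (auto intro: FA_fmul)
 show "fmul (x - y) (tt l) = fmul x (tt l) - fmul y (tt l)" for l x y by (rule fmul_diff_left)
 show "fmul x (tt l) \<in> JJ n" if "1 \<le> l" "l \<le> N" "x \<in> JJ n" for l x using sub that by (auto intro: J_fmul)
 show "fmul (fmul y (tt l)) (tt k) - fmul (fmul y (tt k)) (tt l) \<in> JJ n"
  if "1 \<le> k" "k \<le> N" "1 \<le> l" "l \<le> N" "k + 1 < l \<or> l + 1 < k" "y \<in> FA n" for k l y
  using cg_mult(1)[OF tt_far that(6), of l k] that N by (auto simp: cg_def fmul_assoc)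
 show "\<exists>p\<in>?P. \<exists>q\<in>?P. \<forall>y\<in>FA n. fmul (fmul y (tt k)) (tt k) - (p (fmul y (tt k)) + q y) \<in> JJ n"
  if k: "1 \<le> k" "k \<le> N" for k
 proof -
  have kn: "k < n" using k N by simp
  obtain p q r where P: "p \<in> Po n" "q \<in> Po n" "r \<in> Po n" "cg n (fmul (tt k) (tt k)) (fmul (tt k) p + fmul (tt k) q + r)"
   using LM_RM[OF k(1) kn k(1) kn tt_sq_LM[OF k(1) kn]] unfolding RM_def by blast
  have "fmul (fmul y (tt k)) (tt k) - (fmul (fmul y (tt k)) (p + q) + fmul y r) \<in> JJ n" if "y \<in> FA n" for y
   using cg_mult(1)[OF P(4) that] by (simp add: cg_def fmul_assoc fmul_add_right)
  then show ?thesis using alg_intros(1)[OF P(1,2)] P(3)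
   by (intro bexI[of _ "\<lambda>y. fmul y (p + q)"] bexI[of _ "\<lambda>y. fmul y r"] ballI imageI)
 qed
 show "\<exists>p\<in>?P. \<exists>q\<in>?P. \<exists>r\<in>?P. \<forall>y\<in>FA n.
   fmul (fmul (fmul y (tt l)) (tt k)) (tt l) - (fmul (fmul (fmul y (tt k)) (tt l)) (tt k) +
    (p (fmul y (tt k)) + q (fmul y (tt l)) + r y)) \<in> JJ n"
  if k: "1 \<le> k" "k \<le> N" "1 \<le> l" "l \<le> N" "k + 1 = l \<or> l + 1 = k" for k l
 proof -
  have kn: "k < n" "l < n" using k N by auto
  obtain p q r where P: "p \<in> Po n" "q \<in> Po n" "r \<in> Po n"
   "cg n (fmul (fmul (tt l) (tt k)) (tt l) - fmul (fmul (tt k) (tt l)) (tt k)) (fmul (tt k) p + fmul (tt l) q + r)"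
   using LM_RM[OF k(1) kn(1) k(3) kn(2) braid_adj_LM[OF k(1) kn(1) k(3) kn(2) k(5)]] unfolding RM_def by blast
  have "fmul (fmul (fmul y (tt l)) (tt k)) (tt l) - (fmul (fmul (fmul y (tt k)) (tt l)) (tt k) +
    (fmul (fmul y (tt k)) p + fmul (fmul y (tt l)) q + fmul y r)) \<in> JJ n" if "y \<in> FA n" for y
   using cg_mult(1)[OF P(4) that] by (simp add: cg_def fmul_assoc fmul_add_right fmul_diff_right algebra_simps)
  then show ?thesis using P(1-3)
   by (intro bexI[of _ "\<lambda>y. fmul y p"] bexI[of _ "\<lambda>y. fmul y q"] bexI[of _ "\<lambda>y. fmul y r"] ballI imageI)
 qed
 show "\<exists>p'\<in>?P. \<exists>p''\<in>?P. \<forall>y\<in>FA n. p (fmul y (tt k)) - (fmul (p' y) (tt k) + p'' y) \<in> JJ n"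
  if k: "1 \<le> k" "k \<le> N" and p: "p \<in> ?P" for k p
 proof -
  have kn: "k < n" using k N by simp
  obtain p0 where p0: "p0 \<in> Po n" "p = (\<lambda>y. fmul y p0)" using p by blast
  obtain p q r where P: "p \<in> Po n" "q \<in> Po n" "r \<in> Po n" "cg n (fmul (tt k) p0) (fmul p (tt k) + fmul q (tt k) + r)"
   using tt_Po_LM[OF k(1) kn p0(1), of "tt k"] unfolding LM_def by blast
  have "fmul (fmul y (tt k)) p0 - (fmul (fmul y (p + q)) (tt k) + fmul y r) \<in> JJ n" if "y \<in> FA n" for y
   using cg_mult(1)[OF P(4) that] by (simp add: cg_def fmul_assoc fmul_add_left fmul_add_right)
  then show ?thesis unfolding p0 using alg_intros(1)[OF P(1,2)] P(3)
   by (intro bexI[of _ "\<lambda>y. fmul y (p + q)"] bexI[of _ "\<lambda>y. fmul y r"] ballI imageI)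
 qed
 show "p x \<in> Cb n ({1..N} - {c 0})" if "p \<in> ?P" "x \<in> Cb n ({1..N} - {c 0})" for p x
  using that Cb_props(5)[OF Po_alg] by blast
 show "fmul x (tt l) \<in> Cb n ({1..N} - {c 0})" if "1 \<le> l" "l \<le> N" "N > 0" "l ~= c 0" "x \<in> Cb n ({1..N} - {c 0})" for l x
  using that N by (intro Cb_props(5) tt_alg) auto
qed (use c in \<open>auto simp: chain_ok_def Cb_props\<close>)

end

section \<open>Linear independence of chains by iterated commutators\<close>

lemma commute_mult: "p * a = a * p ==> p * b = b * p ==> p * (a * b) = a * b * (p :: 'r::ring_1)"
 by (metis mult.assoc)

lemma commute_diff: "p * a = a * p ==> p * b = b * p ==> p * (a - b) = (a - b) * (p :: 'r::ring_1)"
 by (simp add: algebra_simps)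

text \<open>Linear independence of descending products: applying
 \<open>Y \<mapsto> Y z\<^sub>0 - z\<^sub>l Y\<close> for \<open>l = 0, ..., k - 1\<close> annihilates the shorter products and turns the one
 of length \<open>k\<close> into a product of intertwiners.\<close>

locale ad_chain =
 fixes N :: nat and tau z :: "nat => 'r::ring_1" and pj :: 'r
 assumes far: "i < N ==> l < i ==> tau i * z l = z l * tau i"
  and inter: "i < N ==> (tau i * z i - z i * tau i) * z i = z (Suc i) * (tau i * z i - z i * tau i)"
  and inj: "i < N ==> pj * y = y ==> (tau i * z i - z i * tau i) * y = 0 ==> y = 0"
  and pj: "i < N ==> pj * tau i = tau i * pj" "i < N ==> pj * z i = z i * pj"
begin

primrec ch :: "nat => 'r" where
 "ch 0 = 1" | "ch (Suc k) = tau k * ch k"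

primrec W :: "nat => 'r => 'r" where
 "W 0 y = y" | "W (Suc l) y = W l y * z 0 - z l * W l y"

primrec Y :: "nat => 'r" where
 "Y 0 = 1" | "Y (Suc k) = (tau k * z k - z k * tau k) * Y k"

lemma W_mult: "c * z 0 = z 0 * c ==> W l (y * c) = W l y * c"
 by (induction l) (simp_all add: left_diff_distrib mult.assoc)

lemma W_add: "W l (x + y) = W l x + W l y" and W_0: "W l 0 = 0"
 by (induction l) (simp_all add: algebra_simps)

lemma W_sum: "W l (sum f S) = (\<Sum>x\<in>S. W l (f x))"
 by (induction S rule: infinite_finite_induct) (simp_all add: W_add W_0)

lemma W_tau: "i < N ==> l \<le> i ==> W l (tau i * y) = tau i * W l y"
proof (induction l)
 case (Suc l)
 then have "z l * (tau i * W l y) = tau i * (z l * W l y)"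
  using far[of i l] by (simp flip: mult.assoc)
 then show ?case using Suc by (simp add: right_diff_distrib mult.assoc)
qed simp

lemma Y_z: "k \<le> N ==> Y k * z 0 = z k * Y k"
 by (induction k) (simp_all add: mult.assoc, simp add: inter flip: mult.assoc)

lemma W_ch: "k \<le> N ==> W k (ch k) = Y k"
proof (induction k)
 case (Suc k)
 then have "W k (tau k * ch k) = tau k * Y k" by (simp add: W_tau)
 then show ?case using Y_z[of k] Suc.prems by (simp add: left_diff_distrib mult.assoc)
qed simp

lemma W_short: "k \<le> N ==> k < l ==> W l (ch k) = 0"
proof (induction l)
 case (Suc l)
 then show ?case using W_ch[of k] Y_z[of k] by (cases "l = k") auto
qed simp

lemma Y_pj: "k \<le> N ==> pj * Y k = Y k * pj"
proof (induction k)
 case (Suc k)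
 have "pj * (tau k * z k - z k * tau k) = (tau k * z k - z k * tau k) * pj"
  using pj[of k] Suc.prems by (intro commute_diff commute_mult) auto
 from commute_mult[OF this] Suc show ?case by simp
qed simp

lemma Y_inj: "k \<le> N ==> pj * y = y ==> Y k * y = 0 ==> y = 0"
proof (induction k)
 case (Suc k)
 have "pj * (Y k * y) = Y k * pj * y" using Y_pj[of k] Suc.prems by (simp flip: mult.assoc)
 then have "pj * (Y k * y) = Y k * y" using Suc.prems by (simp add: mult.assoc)
 then have "Y k * y = 0" using inj[of k "Y k * y"] Suc.prems by (simp add: mult.assoc)
 then show ?case using Suc by simp
qed simp

text \<open>The coefficients commute with \<open>z 0\<close>, so \<open>W\<close> acts on the chains
  only. The top coefficient vanishes because \<open>Y\<close> is injective on the image of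
  \<open>pj\<close>, and induction removes the others.\<close>

lemma indep:
 assumes "m \<le> N" "!!k. k \<le> m ==> c k * z 0 = z 0 * c k" "!!k. k \<le> m ==> pj * c k = c k"
  and "(\<Sum>k\<le>m. ch k * c k) = 0" "k \<le> m"
 shows "c k = 0"
 using assms
proof (induction m)
 case 0
 then show ?case by simp
next
 case (Suc m)
 have "W (Suc m) (\<Sum>k\<le>Suc m. ch k * c k) = (\<Sum>k\<le>Suc m. W (Suc m) (ch k) * c k)"
  unfolding W_sum using Suc.prems(2) by (intro sum.cong refl W_mult) auto
 also have "... = (\<Sum>k\<le>m. W (Suc m) (ch k) * c k) + W (Suc m) (ch (Suc m)) * c (Suc m)" by simp
 also have "(\<Sum>k\<le>m. W (Suc m) (ch k) * c k) = 0"
  using W_short Suc.prems(1) by (intro sum.neutral) (auto simp del: W.simps)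
 finally have "Y (Suc m) * c (Suc m) = 0"
  using W_ch[OF Suc.prems(1)] Suc.prems(4) W_0 by simp
 then have top: "c (Suc m) = 0" using Y_inj Suc.prems by blast
 show ?case
 proof (cases "k = Suc m")
  case False
  then show ?thesis using Suc.IH Suc.prems top by auto
 qed (use top in simp)
qed

end

section \<open>Chains of crossings: spanning and independence\<close>

context klr begin

text \<open>For \<open>c = Suc\<close> this is tau_k ... tau_1, and for \<open>c r = n - r\<close>
  it is tau_{n-k+1} ... tau_n: lifts of the minimal representatives of the cosets of S_n in S_{n+1},
  where S_n permutes the last or the first n strands. \<open>tchr\<close> is the product in the
  opposite order.\<close>

definition tch :: "(nat => nat) => nat => ('i, 'k) fa" where
 "tch c k = fw (map (\<lambda>r. T (c r)) (rev [0..<k]))"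

definition tchr :: "(nat => nat) => nat => ('i, 'k) fa" where
 "tchr c k = fw (map (\<lambda>r. T (c r)) [0..<k])"

lemma tch_simps: "tch c 0 = fone" "tch c (Suc k) = fmul (tt (c k)) (tch c k)"
 and tchr_simps: "tchr c 0 = fone" "tchr c (Suc k) = fmul (tchr c k) (tt (c k))"
 by (simp_all add: tch_def tchr_def fone_fw fw_Cons fw_snoc)

lemma chain_okD: assumes "chain_ok N c" "i < N" shows "1 \<le> c i \<and> c i \<le> N"
proof -
 have "\<forall>i<N. 1 \<le> c i \<and> c i \<le> N" using assms(1) unfolding chain_ok_def by (elim conjE)
 with assms(2) show ?thesis by blast
qed

lemma FA_tch: "N < n ==> chain_ok N c ==> k \<le> N ==> tch c k \<in> FA n \<and> tchr c k \<in> FA n"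
proof (induction k)
 case (Suc k)
 then have "1 \<le> c k" "c k < n" using chain_okD[of N c k] by auto
 then show ?case using Suc by (auto simp: tch_simps tchr_simps intro!: FA_fmul FA_tt)
qed (simp add: tch_simps tchr_simps)

lemma alg_words:
 assumes K: "f \<in> alg n K" and S: "subgrp S"
  and sc: "!!a. fsmul a fone \<in> S" and gen: "!!g x. vgen n g ==> (\<forall>l. g = T l --> l \<in> K) ==> x \<in> S ==> fmul (fgen g) x \<in> S"
 shows "f \<in> S"
 using K
proof (induction rule: alg_induct)
 case (word a u)
 then show ?case
 proof (induction u)
  case (Cons g u)
  then have "fmul (fgen g) (fsmul a (fw u)) \<in> S" by (intro gen) auto
  then show ?case by (simp add: fw_Cons fmul_fsmul)
 qed (simp add: sc flip: fone_fw)
qed (use S subgrpD in auto)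

lemma alg_words_right:
 assumes K: "f \<in> alg n K" and S: "subgrp S"
  and sc: "!!a. fsmul a fone \<in> S" and gen: "!!g x. vgen n g ==> (\<forall>l. g = T l --> l \<in> K) ==> x \<in> S ==> fmul x (fgen g) \<in> S"
 shows "f \<in> S"
 using K
proof (induction rule: alg_induct)
 case (word a u)
 then show ?case
 proof (induction u rule: rev_induct)
  case (snoc g u)
  then have "fmul (fsmul a (fw u)) (fgen g) \<in> S" by (intro gen) auto
  then show ?case by (simp add: fw_snoc fmul_fsmul)
 qed (simp add: sc flip: fone_fw)
qed (use S subgrpD in auto)

lemma Cb_scalar: "fsmul a fone \<in> Cb n K"
 unfolding Cb_def using Po_alg[OF Po_scalar, of a n K] alg_FA[OF Po_scalar, of a n]
 by (auto intro!: bexI[of _ "fsmul a fone"])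

lemma Cb_choice:
 assumes "\<forall>k. h k \<in> Cb n K"
 obtains g where "!!k. g k \<in> alg n K" "!!k. cg n (h k) (g k)"
proof -
 have "\<forall>k. \<exists>g. g \<in> alg n K \<and> cg n (h k) g" using assms unfolding Cb_def by blast
 then obtain g where "\<forall>k. g k \<in> alg n K \<and> cg n (h k) (g k)" by metis
 then show ?thesis using that by blast
qed

text \<open>The spanning half of a basis theorem over the subalgebra without the crossing
  \<open>c 0\<close>; independence of the same chains is obtained in the representation.\<close>

lemma left_span:
 assumes N: "N < n" and c: "chain_ok N c" and f: "f \<in> alg n {1..N}"
 shows "\<exists>h. (\<forall>k. h k \<in> alg n ({1..N} - {c 0})) \<and> cg n f (\<Sum>k\<le>N. fmul (tch c k) (h k))"
proof -
 note c_ok = c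
 interpret span_chain "JJ n" "FA n" "fmul ` Po n" "\<lambda>l. fmul (tt l)" N c "Cb n ({1..N} - {c 0})"
  by (rule left_chain[OF N c])
 have cl: "cl (SS N)" by (rule SS_cl) simp
 have "f \<in> SS N"
 proof (rule alg_words[OF f clD(1)[OF cl]])
  show "fsmul a fone \<in> SS N" for a by (rule C_SS[OF Cb_scalar]) simp
  show "fmul (fgen g) x \<in> SS N" if "vgen n g" "\<forall>l. g = T l --> l \<in> {1..N}" "x \<in> SS N" for g x
  proof (cases "\<exists>l. g = T l")
   case True
   then show ?thesis using SS_full that by auto
  next
   case False
   then show ?thesis using clD(4)[OF cl, of "fmul (fgen g)"] gen_Po that by blast
  qed
 qed
 then obtain h where h: "\<forall>k. h k \<in> Cb n ({1..N} - {c 0})" "f - (\<Sum>k\<le>N. chain k (h k)) \<in> JJ n"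
  using SS_chain[of N f] by blast
 obtain g where g: "!!k. g k \<in> alg n ({1..N} - {c 0})" "!!k. cg n (h k) (g k)"
  using Cb_choice[OF h(1)] by blast
 have ch: "chain k x = fmul (tch c k) x" for k x
  by (induction k) (simp_all add: tch_simps fmul_assoc)
 have "cg n f (\<Sum>k\<le>N. fmul (tch c k) (h k))" using h(2) by (simp add: cg_def ch)
 also have "cg n ... (\<Sum>k\<le>N. fmul (tch c k) (g k))"
  using FA_tch[OF N c_ok] by (intro cg_sum cg_mult g) auto
 finally show ?thesis using g(1) by blast
qed

lemma right_span:
 assumes N: "N < n" and c: "chain_ok N c" and f: "f \<in> alg n {1..N}"
 shows "\<exists>h. (\<forall>k. h k \<in> alg n ({1..N} - {c 0})) \<and> cg n f (\<Sum>k\<le>N. fmul (h k) (tchr c k))"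
proof -
 note c_ok = c
 interpret span_chain "JJ n" "FA n" "(\<lambda>p y. fmul y p) ` Po n" "\<lambda>l y. fmul y (tt l)" N c "Cb n ({1..N} - {c 0})"
  by (rule right_chain[OF N c])
 have cl: "cl (SS N)" by (rule SS_cl) simp
 have "f \<in> SS N"
 proof (rule alg_words_right[OF f clD(1)[OF cl]])
  show "fsmul a fone \<in> SS N" for a by (rule C_SS[OF Cb_scalar]) simp
  show "fmul x (fgen g) \<in> SS N" if "vgen n g" "\<forall>l. g = T l --> l \<in> {1..N}" "x \<in> SS N" for g x
  proof (cases "\<exists>l. g = T l")
   case True
   then show ?thesis using SS_full that by auto
  next
   case False
   then have "(\<lambda>y. fmul y (fgen g)) \<in> (\<lambda>p y. fmul y p) ` Po n" using gen_Po that by auto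
   from clD(4)[OF cl this that(3)] show ?thesis .
  qed
 qed
 then obtain h where h: "\<forall>k. h k \<in> Cb n ({1..N} - {c 0})" "f - (\<Sum>k\<le>N. chain k (h k)) \<in> JJ n"
  using SS_chain[of N f] by blast
 obtain g where g: "!!k. g k \<in> alg n ({1..N} - {c 0})" "!!k. cg n (h k) (g k)"
  using Cb_choice[OF h(1)] by blast
 have ch: "chain k x = fmul x (tchr c k)" for k x
  by (induction k) (simp_all add: tchr_simps fmul_assoc)
 have "cg n f (\<Sum>k\<le>N. fmul (h k) (tchr c k))" using h(2) by (simp add: cg_def ch)
 also have "cg n ... (\<Sum>k\<le>N. fmul (g k) (tchr c k))"
  using FA_tch[OF N c_ok] by (intro cg_sum cg_mult g) auto
 finally show ?thesis using g(1) by blast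
qed

lemma rh_alg_Xo:
 assumes "f \<in> alg n K" "!!l. l \<in> K ==> m ~= l \<and> m ~= Suc l"
 shows "rh f * Xo m = Xo m * rh f"
 using assms(1)
proof (induction rule: alg_induct)
 case (word a u)
 have "wop u * Xo m = Xo m * wop u" using word
 proof (induction u)
  case (Cons g u)
  then have IH: "wop u * Xo m = Xo m * wop u" by auto
  have "gop g * Xo m = Xo m * gop g"
  proof (cases g)
   case (T l)
   then show ?thesis using Cons.prems assms(2)[of l] To_Xo[of m l] by auto
  qed (simp_all add: po_commute Eo_commute)
  then have "gop g * wop u * Xo m = Xo m * (gop g * wop u)"
   by (simp add: mult.assoc IH) (simp flip: mult.assoc)
  then show ?case by simp
 qed simp
 then show ?case by (simp add: rh_simps mult.assoc) (simp add: po_commute flip: mult.assoc)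
next
 case (add f g)
 then show ?case using rh_add[OF alg_FA alg_FA, of f n K g] by (simp add: distrib_left distrib_right)
qed (simp add: rh_simps)

lemma pr_rho: "pr n * rho n f = rho n f" by (simp add: rho_def flip: mult.assoc)

lemma rho_pr: "f \<in> FA n ==> rho n f * pr n = rho n f"
 by (simp add: rho_def mult.assoc pr_rh) (simp flip: mult.assoc)

lemma pr_po: "pr n * po p = po p * pr n"
 by (simp add: pr_def po_def dg_commute)

lemma rho_alg_Xo:
 assumes "f \<in> alg n K" "!!l. l \<in> K ==> m ~= l \<and> m ~= Suc l"
 shows "rho n f * Xo m = Xo m * rho n f"
proof -
 have "rho n f * Xo m = pr n * Xo m * rh f"
  using rh_alg_Xo[OF assms] by (simp add: rho_def mult.assoc)
 then show ?thesis by (simp add: pr_po rho_def mult.assoc)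
qed

text \<open>In each component \<open>Th k\<close> is a transposition of the variables followed by
  multiplication with a regular polynomial. The projection confines \<open>y\<close> to sequences of
  length n, on which the crossing exists.\<close>

lemma Th_inj: "1 \<le> k ==> k < n ==> pr n * y = y ==> Th k * y = 0 ==> y = 0"
proof (rule op_eqI)
 fix f :: "('i, 'k) vec" and mu :: "'i list"
 assume k: "1 \<le> k" "k < n" and y: "pr n * y = y" and z: "Th k * y = 0"
 show "ap y f mu = ap 0 f mu"
 proof (cases "length mu = n")
  case True
  have "ap (Th k * y) f (sw k mu) = 0" using z by (simp add: fun_apply)
  then have "cc (nth1 (sw k mu) k) (nth1 (sw k mu) (Suc k)) k (Suc k) * sp k (ap y f mu) = 0"
   using True k by (simp add: ap_Go)
  then have "sp k (ap y f mu) = 0" using regular_cc[of k "Suc k"] unfolding regular_def by auto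
  then have "sp k (sp k (ap y f mu)) = 0" by simp
  then show ?thesis by (simp only: sp_sp) (simp add: fun_apply)
 next
  case False
  have "ap y f mu = ap (pr n * y) f mu" using y by simp
  then show ?thesis using False by (simp add: fun_apply)
 qed
qed

lemma Th_Xo: "Th k * Xo k = Xo (Suc k) * Th k" "Th k * Xo (Suc k) = Xo k * Th k"
 by (simp_all add: Go_po)

text \<open>The crossings descend from tau_j, and the commutators start from x_{j+1}, the variable
  of a strand which the coefficients do not cross.\<close>

lemma ad_down: "j < n ==> ad_chain j (\<lambda>i. To (j - i)) (\<lambda>i. Xo (Suc j - i)) (pr n)"
proof
 assume j: "j < n"
 fix i assume i: "i < j"
 then obtain k where k: "j - i = Suc k" by (metis Suc_diff_Suc)
 have S: "Suc j - i = Suc (j - i)" "Suc j - Suc i = j - i" using i by auto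
 have th: "To (j - i) * Xo (Suc j - i) - Xo (Suc j - i) * To (j - i) = Th (j - i)"
  unfolding S by (rule Th_eq) (use k in simp)
 show "To (j - i) * Xo (Suc j - l) = Xo (Suc j - l) * To (j - i)" if "l < i" for l
  by (rule To_Xo) (use that i in auto)
 show "(To (j - i) * Xo (Suc j - i) - Xo (Suc j - i) * To (j - i)) * Xo (Suc j - i) =
   Xo (Suc j - Suc i) * (To (j - i) * Xo (Suc j - i) - Xo (Suc j - i) * To (j - i))"
  unfolding th unfolding S by (rule Th_Xo)
 show "y = 0" if "pr n * y = y" "(To (j - i) * Xo (Suc j - i) - Xo (Suc j - i) * To (j - i)) * y = 0" for y
  using that i j unfolding th by (intro Th_inj[of "j - i" n y]) auto
qed (simp_all add: pr_To pr_po)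

lemma ad_up: "j < n ==> ad_chain j (\<lambda>i. To (Suc i)) (\<lambda>i. Xo (Suc i)) (pr n)"
proof
 assume j: "j < n"
 fix i assume i: "i < j"
 have th: "To (Suc i) * Xo (Suc i) - Xo (Suc i) * To (Suc i) = - Th (Suc i)"
  by (rule Th_eq') simp
 show "To (Suc i) * Xo (Suc l) = Xo (Suc l) * To (Suc i)" if "l < i" for l
  by (rule To_Xo) (use that i in auto)
 show "(To (Suc i) * Xo (Suc i) - Xo (Suc i) * To (Suc i)) * Xo (Suc i) =
   Xo (Suc (Suc i)) * (To (Suc i) * Xo (Suc i) - Xo (Suc i) * To (Suc i))"
  unfolding th by (simp add: Th_Xo)
 show "y = 0" if "pr n * y = y" "(To (Suc i) * Xo (Suc i) - Xo (Suc i) * To (Suc i)) * y = 0" for y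
  using that i j unfolding th by (intro Th_inj[of "Suc i" n y]) auto
qed (simp_all add: pr_To pr_po)

end

section \<open>Faithfulness\<close>

context klr begin

text \<open>Normal words of the polynomial part: sorting the variables and leaving exactly one
  idempotent makes them a spanning set on which the action can be read off.\<close>

definition NW :: "nat => 'i gen list set" where
 "NW n = {map X ks @ [E nu] | ks nu. sorted ks \<and> set ks \<subseteq> {1..n} \<and> nu \<in> Iseqs n}"

definition NF :: "nat => ('i, 'k) fa set" where
 "NF n = {f \<in> FA n. \<exists>g. fsupp g \<and> (\<forall>u. g u ~= 0 --> u \<in> NW n) \<and> cg n f g}"

lemma NWI: "sorted ks ==> set ks \<subseteq> {1..n} ==> nu \<in> Iseqs n ==> map X ks @ [E nu] \<in> NW n"
 unfolding NW_def by blast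

lemma map_X_eq [simp]: "map X ks = map X ls \<longleftrightarrow> ks = ls"
 by (rule inj_map_eq_map) (simp add: inj_on_def)

lemma NW_FA: "fsupp g ==> (\<forall>u. g u ~= 0 --> u \<in> NW n) ==> g \<in> FA n"
 unfolding FA_FAV FAV_iff NW_def by (fastforce simp: Iseqs_def)

lemma NF_subgrp: "subgrp (NF n)"
 unfolding subgrp_def
proof (intro conjI ballI)
 show "0 \<in> NF n" unfolding NF_def by (auto intro!: exI[of _ 0] simp: fsupp_def fun_apply)
 fix a b assume "a \<in> NF n" "b \<in> NF n"
 then obtain g h where g: "a \<in> FA n" "fsupp g" "\<forall>u. g u ~= 0 --> u \<in> NW n" "cg n a g"
  and h: "b \<in> FA n" "fsupp h" "\<forall>u. h u ~= 0 --> u \<in> NW n" "cg n b h"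
  unfolding NF_def by blast
 have "fsupp (g - h)"
  by (rule fsupp_subset[of "{u. g u ~= 0} \<union> {u. h u ~= 0}"]) (use g h in \<open>auto simp: fsupp_def fun_apply\<close>)
 moreover have "\<forall>u. (g - h) u ~= 0 --> u \<in> NW n"
 proof (intro allI impI)
  fix u assume "(g - h) u ~= 0"
  then have "g u ~= 0 \<or> h u ~= 0" by (auto simp: fun_apply)
  then show "u \<in> NW n" using g(3) h(3) by blast
 qed
 ultimately show "a - b \<in> NF n"
  unfolding NF_def using FA_diff[OF g(1) h(1)] cg_diff[OF g(4) h(4)] by blast
qed

lemma NF_cong: "cg n f g ==> f \<in> FA n ==> g \<in> NF n ==> f \<in> NF n"
 unfolding NF_def by (blast intro: cg_trans)

lemma NF_word: "u \<in> NW n ==> fsmul a (fw u) \<in> NF n"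
proof -
 assume u: "u \<in> NW n"
 have "\<forall>v. fsmul a (fw u) v ~= 0 --> v \<in> NW n" using u by (auto simp: fsmul_def fw_def split: if_splits)
 moreover from this have "fsmul a (fw u) \<in> FA n" by (intro NW_FA fsupp_smul_fw)
 ultimately show ?thesis unfolding NF_def using fsupp_smul_fw cg_refl by blast
qed

lemma NF_mult:
 assumes p: "p \<in> FA n" and w: "!!u a. u \<in> NW n ==> fmul p (fsmul a (fw u)) \<in> NF n" and f: "f \<in> NF n"
 shows "fmul p f \<in> NF n"
proof -
 obtain g where g: "f \<in> FA n" "fsupp g" "\<forall>u. g u ~= 0 --> u \<in> NW n" "cg n f g"
  using f unfolding NF_def by blast
 have "fmul p g = (\<Sum>u\<in>{u. g u ~= 0}. fmul p (fsmul (g u) (fw u)))"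
  by (subst fsupp_expand[OF g(2)]) (rule fmul_sum_right)
 also have "... \<in> NF n" using g(3) w by (intro subgrp_sum[OF NF_subgrp]) auto
 finally show ?thesis using NF_cong[OF cg_mult(1)[OF g(4) p]] FA_fmul[OF p g(1)] by blast
qed

lemma cg_xx_xx: "1 \<le> k ==> k \<le> n ==> 1 \<le> l ==> l \<le> n ==> cg n (fmul (xx k) (xx l)) (fmul (xx l) (xx k))"
 by (rule cg_rels, unfold rels_def, rule UnI1, rule UnI1, rule UnI1, rule UnI1, rule UnI1, rule UnI1, rule UnI2, rule CollectI) blast

lemma cg_xx_ee: "1 \<le> k ==> k \<le> n ==> nu \<in> Iseqs n ==> cg n (fmul (xx k) (ee nu)) (fmul (ee nu) (xx k))"
 by (rule cg_rels, unfold rels_def, rule UnI1, rule UnI1, rule UnI1, rule UnI1, rule UnI1, rule UnI2, rule CollectI) blast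

lemma cg_ee_ee: "nu \<in> Iseqs n ==> mu \<in> Iseqs n ==> cg n (fmul (ee nu) (ee mu)) (if nu = mu then ee nu else 0)"
 by (rule cg_rels, unfold rels_def, rule UnI1, rule UnI1, rule UnI1, rule UnI1, rule UnI1, rule UnI1, rule UnI1, rule UnI1, rule CollectI) blast

lemma FA_Xs: "set ks \<subseteq> {1..n} ==> fw (map X ks) \<in> FA n"
 by (rule FA_fw) auto

lemma cg_insort: "1 \<le> k ==> k \<le> n ==> set ks \<subseteq> {1..n} ==>
 cg n (fw (X k # map X ks)) (fw (map X (insort k ks)))"
proof (induction ks)
 case (Cons a ks)
 show ?case
 proof (cases "k \<le> a")
  case False
  have "cg n (fmul (fmul (xx k) (xx a)) (fw (map X ks))) (fmul (fmul (xx a) (xx k)) (fw (map X ks)))"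
   using Cons.prems by (intro cg_mult(2) cg_xx_xx FA_Xs) auto
  moreover have "cg n (fmul (xx a) (fw (X k # map X ks))) (fmul (xx a) (fw (map X (insort k ks))))"
   using Cons by (intro cg_mult(1) FA_xx) auto
  ultimately show ?thesis using False
   by (simp add: fw_Cons fmul_assoc) (rule cg_trans)
 qed simp
qed simp

lemma cg_ee_Xs: "nu \<in> Iseqs n ==> set ks \<subseteq> {1..n} ==>
 cg n (fmul (ee nu) (fw (map X ks))) (fmul (fw (map X ks)) (ee nu))"
proof (induction ks)
 case Nil
 then show ?case by (simp flip: fone_fw)
next
 case (Cons k ks)
 have "cg n (fmul (fmul (ee nu) (xx k)) (fw (map X ks))) (fmul (fmul (xx k) (ee nu)) (fw (map X ks)))"
  using Cons.prems by (intro cg_mult(2) cg_sym[OF cg_xx_ee] FA_Xs) auto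
 moreover have "cg n (fmul (xx k) (fmul (ee nu) (fw (map X ks)))) (fmul (xx k) (fmul (fw (map X ks)) (ee nu)))"
  using Cons by (intro cg_mult(1) FA_xx) auto
 ultimately show ?case by (simp add: fw_Cons fmul_assoc) (rule cg_trans)
qed

lemma NF_gen:
 assumes g: "vgen n g" "\<forall>l. g ~= T l" and u: "u \<in> NW n"
 shows "fmul (fgen g) (fsmul a (fw u)) \<in> NF n"
proof -
 obtain ks nu where u: "u = map X ks @ [E nu]" "sorted ks" "set ks \<subseteq> {1..n}" "nu \<in> Iseqs n"
  using u unfolding NW_def by blast
 have FA: "fmul (fgen g) (fsmul a (fw u)) \<in> FA n"
  using g u by (intro FA_fmul FA_gen FA_fsmul FA_fw) (auto simp: Iseqs_def)
 show ?thesis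
 proof (cases g)
  case (X k)
  then have k: "1 \<le> k" "k \<le> n" using g by auto
  have "cg n (fmul (fw (X k # map X ks)) (fsmul a (ee nu))) (fmul (fw (map X (insort k ks))) (fsmul a (ee nu)))"
   using k u by (intro cg_mult(2) cg_insort FA_fsmul FA_ee) auto
  then have c: "cg n (fmul (fgen g) (fsmul a (fw u))) (fsmul a (fw (map X (insort k ks) @ [E nu])))"
   by (simp add: X u fw_Cons fw_snoc fmul_fsmul fmul_assoc)
  have "map X (insort k ks) @ [E nu] \<in> NW n"
   using u k by (intro NWI) (auto simp: sorted_insort set_insort_key)
  from NF_cong[OF c FA NF_word[OF this]] show ?thesis .
 next
  case (E mu)
  then have mu: "mu \<in> Iseqs n" using g by (simp add: Iseqs_def)
  have "cg n (fmul (fmul (ee mu) (fw (map X ks))) (fsmul a (ee nu))) (fmul (fmul (fw (map X ks)) (ee mu)) (fsmul a (ee nu)))"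
   using mu u by (intro cg_mult(2) cg_ee_Xs FA_fsmul FA_ee) auto
  moreover have "cg n (fmul (fsmul a (fw (map X ks))) (fmul (ee mu) (ee nu)))
    (fmul (fsmul a (fw (map X ks))) (if mu = nu then ee mu else 0))"
   using mu u by (intro cg_mult(1) cg_ee_ee FA_fsmul FA_Xs) auto
  ultimately have c: "cg n (fmul (fgen g) (fsmul a (fw u))) (fmul (fsmul a (fw (map X ks))) (if mu = nu then ee mu else 0))"
   unfolding E u(1) map_append list.map(2) fw_snoc fmul_fsmul fmul_assoc by (rule cg_trans)
  have "fmul (fsmul a (fw (map X ks))) (if mu = nu then ee mu else 0) \<in> NF n"
  proof (cases "mu = nu")
   case True
   have "fsmul a (fw u) \<in> NF n" by (rule NF_word) (unfold u(1), intro NWI u)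
   then show ?thesis using True by (simp add: u fw_snoc fmul_fsmul)
  qed (simp add: subgrpD(1)[OF NF_subgrp])
  from NF_cong[OF c FA this] show ?thesis .
 qed (use g in auto)
qed

lemma Po_NF: "f \<in> Po n ==> f \<in> NF n"
proof (erule alg_words[OF _ NF_subgrp])
 show "fsmul a fone \<in> NF n" for a
 proof (rule NF_cong[OF cg_sym])
  show "cg n (\<Sum>nu\<in>Iseqs n. fmul (fsmul a fone) (ee nu)) (fsmul a fone)"
   by (rule cg_split) (intro FA_fsmul FA_fone)
  show "fsmul a fone \<in> FA n" by (intro FA_fsmul FA_fone)
  have "fsmul a (fw ([] @ [E nu])) \<in> NF n" if "nu \<in> Iseqs n" for nu
   using NF_word[OF NWI[of "[]" n nu]] that by simp
  then show "(\<Sum>nu\<in>Iseqs n. fmul (fsmul a fone) (ee nu)) \<in> NF n"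
   by (intro subgrp_sum[OF NF_subgrp]) (simp add: fmul_fsmul fgen_fw)
 qed
 show "fmul (fgen g) x \<in> NF n" if "vgen n g" "\<forall>l. g = T l --> l \<in> {}" "x \<in> NF n" for g x
  by (rule NF_mult[OF FA_gen NF_gen that(3)]) (use that in auto)
qed

lemma wop_Xs: "wop (map X ks) = po (prod_list (map Vr ks))"
 by (induction ks) (simp_all add: po_mult)

lemma prod_list_Vr: "prod_list (map Vr ks) = Poly_Mapping.single (\<Sum>k\<leftarrow>ks. Poly_Mapping.single k 1) (1 :: 'k)"
 by (induction ks) (simp_all add: Vr_def mult_single single_one)

lemma lookup_exponent: "Poly_Mapping.lookup (\<Sum>k\<leftarrow>ks. Poly_Mapping.single k (1 :: nat)) l = count (mset ks) l"
 by (induction ks) (auto simp: lookup_add lookup_single when_def)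

lemma exponent_inj:
 assumes "sorted ks" "sorted ls" "(\<Sum>k\<leftarrow>ks. Poly_Mapping.single k (1 :: nat)) = (\<Sum>k\<leftarrow>ls. Poly_Mapping.single k 1)"
 shows "ks = ls"
proof -
 have "mset ks = mset ls" by (rule multiset_eqI) (metis assms(3) lookup_exponent)
 then show ?thesis using assms(1,2) by (metis properties_for_sort sorted_sort_id)
qed

text \<open>Applied to the constant function 1, a normal word gives its own monomial in the
  component of its idempotent and 0 elsewhere, so every coefficient of \<open>g\<close> can be
  recovered.\<close>

lemma NW_zero:
 assumes g: "fsupp g" "\<forall>u. g u ~= 0 --> u \<in> NW n" and z: "rho n g = 0"
 shows "g = 0"
proof (rule ccontr)
 assume "g ~= 0"
 then obtain u0 where "g u0 ~= 0" by (auto simp: fun_eq_iff fun_apply)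
 with g(2) obtain ks0 nu0 where u0: "u0 = map X ks0 @ [E nu0]" "sorted ks0" "nu0 \<in> Iseqs n"
  unfolding NW_def by blast
 let ?U = "{u. g u ~= 0}"
 let ?m = "\<Sum>k\<leftarrow>ks0. Poly_Mapping.single k (1 :: nat)"
 have "rh g = (\<Sum>u\<in>?U. po (cst (g u)) * wop u)" by (simp add: rh_def lext_def)
 moreover have "ap (rho n g) 1 nu0 = ap (rh g) 1 nu0"
  using u0 by (simp add: rho_def Iseqs_def)
 ultimately have "(\<Sum>u\<in>?U. ap (po (cst (g u)) * wop u) 1 nu0) = 0"
  using z by (simp add: ap_sum_left fun_apply)
 then have "Poly_Mapping.lookup (\<Sum>u\<in>?U. ap (po (cst (g u)) * wop u) 1 nu0) ?m = 0" by simp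
 then have "(\<Sum>u\<in>?U. Poly_Mapping.lookup (ap (po (cst (g u)) * wop u) 1 nu0) ?m) = 0"
  by (simp add: lookup_sum)
 moreover have "(\<Sum>u\<in>?U. Poly_Mapping.lookup (ap (po (cst (g u)) * wop u) 1 nu0) ?m) = (\<Sum>u\<in>?U. if u = u0 then g u0 else 0)"
 proof (rule sum.cong[OF refl])
  fix u assume "u \<in> ?U"
  then obtain ks nu where u: "u = map X ks @ [E nu]" "sorted ks" using g(2) unfolding NW_def by blast
  have "ap (po (cst (g u)) * wop u) 1 nu0 =
    (if nu0 = nu then Poly_Mapping.single (\<Sum>k\<leftarrow>ks. Poly_Mapping.single k 1) (g u) else 0)"
   by (simp add: u wop_append wop_Xs prod_list_Vr fun_apply cst_def mult_single)
  then show "Poly_Mapping.lookup (ap (po (cst (g u)) * wop u) 1 nu0) ?m = (if u = u0 then g u0 else 0)"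
   using exponent_inj[OF u(2) u0(2)] u u0 by (auto simp: lookup_single when_def)
 qed
 ultimately have "g u0 = 0" using g(1) \<open>g u0 ~= 0\<close> by (simp add: fsupp_def)
 then show False using \<open>g u0 ~= 0\<close> by simp
qed

lemma faithful_Po: "f \<in> Po n ==> rho n f = 0 ==> f \<in> JJ n"
proof -
 assume f: "f \<in> Po n" "rho n f = 0"
 obtain g where g: "fsupp g" "\<forall>u. g u ~= 0 --> u \<in> NW n" "cg n f g"
  using Po_NF[OF f(1)] unfolding NF_def by blast
 have "rho n g = 0" using cg_rho[OF g(3) alg_FA[OF f(1)] NW_FA[OF g(1,2)]] f(2) by simp
 then have "g = 0" using NW_zero g by blast
 then show ?thesis using g(3) cg_zero_iff by simp
qed

section \<open>From polynomials to all crossings\<close>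

definition chop :: "(nat => nat) => nat => ('i, 'k) op" where
 "chop c k = rh (tch c k)"

lemma chop_simps: "chop c 0 = 1" "chop c (Suc k) = To (c k) * chop c k"
 by (simp_all add: chop_def tch_def rh_fw)

lemma indep_down:
 assumes j: "j < n" and c: "!!k. k \<le> j ==> c k * Xo (Suc j) = Xo (Suc j) * c k" "!!k. k \<le> j ==> pr n * c k = c k"
  and s: "(\<Sum>k\<le>j. chop (\<lambda>i. j - i) k * c k) = 0" "k \<le> j"
 shows "c k = 0"
proof -
 interpret ad_chain j "\<lambda>i. To (j - i)" "\<lambda>i. Xo (Suc j - i)" "pr n" by (rule ad_down[OF j])
 have ch: "ch k = chop (\<lambda>i. j - i) k" for k by (induction k) (simp_all add: chop_simps)
 show ?thesis by (rule indep[of j c k]) (use c s in \<open>simp_all add: ch\<close>)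
qed

lemma indep_up:
 assumes j: "j < n" and c: "!!k. k \<le> j ==> c k * Xo 1 = Xo 1 * c k" "!!k. k \<le> j ==> pr n * c k = c k"
  and s: "(\<Sum>k\<le>j. chop Suc k * c k) = 0" "k \<le> j"
 shows "c k = 0"
proof -
 interpret ad_chain j "\<lambda>i. To (Suc i)" "\<lambda>i. Xo (Suc i)" "pr n" by (rule ad_up[OF j])
 have ch: "ch k = chop Suc k" for k by (induction k) (simp_all add: chop_simps)
 show ?thesis by (rule indep[of j c k]) (use c s in \<open>simp_all add: ch\<close>)
qed

lemma chop_pr: "chop c k * pr n = pr n * chop c k"
 by (induction k) (simp_all add: chop_simps mult.assoc, simp add: pr_To flip: mult.assoc)

lemma rho_tch: "rho n (tch c k) = pr n * chop c k"
 by (simp add: rho_def chop_def)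

lemma rho_tch_mult: "f \<in> FA n ==> tch c k \<in> FA n ==> rho n (fmul (tch c k) f) = chop c k * rho n f"
 by (simp add: rho_fmul rho_tch flip: chop_pr) (simp add: mult.assoc pr_rho)

text \<open>Without crossings, monomials are compared. In the step from j to j + 1 the descending
  chains span over the subalgebra with crossings up to j, whose elements commute with x_{j+2}.
  Independence of the chains makes the operators of the coefficients vanish, and the induction
  hypothesis applies to these.\<close>

theorem faithful_alg: "j < n ==> f \<in> alg n {1..j} ==> rho n f = 0 ==> f \<in> JJ n"
proof (induction j arbitrary: f)
 case 0
 then show ?case using faithful_Po by simp
next
 case (Suc j)
 let ?c = "\<lambda>i. Suc j - i"
 have K: "{1..Suc j} - {?c 0} = {1..j}" by auto
 obtain h where h: "!!k. h k \<in> alg n {1..j}" "cg n f (\<Sum>k\<le>Suc j. fmul (tch ?c k) (h k))"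
  using left_span[OF Suc.prems(1) chain_ok_down Suc.prems(2)] unfolding K by blast
 have tF: "tch ?c k \<in> FA n" if "k \<le> Suc j" for k
  using FA_tch[OF Suc.prems(1) chain_ok_down that] by blast
 have FA: "fmul (tch ?c k) (h k) \<in> FA n" if "k \<in> {..Suc j}" for k
  using tF[of k] alg_FA[OF h(1)] that by (intro FA_fmul) auto
 have "rho n f = (\<Sum>k\<le>Suc j. rho n (fmul (tch ?c k) (h k)))"
  using cg_rho[OF h(2) alg_FA[OF Suc.prems(2)] FA_sum[OF FA]] rho_sum[of "{..Suc j}", OF FA] by simp
 also have "... = (\<Sum>k\<le>Suc j. chop ?c k * rho n (h k))"
  using tF alg_FA[OF h(1)] by (intro sum.cong refl rho_tch_mult) auto
 finally have s: "(\<Sum>k\<le>Suc j. chop ?c k * rho n (h k)) = 0" using Suc.prems(3) by simp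
 have "rho n (h k) = 0" if "k \<le> Suc j" for k
 proof (rule indep_down[OF Suc.prems(1) _ _ s that])
  show "rho n (h k) * Xo (Suc (Suc j)) = Xo (Suc (Suc j)) * rho n (h k)" for k
   by (rule rho_alg_Xo[OF h(1)]) auto
 qed (rule pr_rho)
 then have "h k \<in> JJ n" if "k \<le> Suc j" for k using Suc.IH Suc.prems(1) h(1) that by auto
 then have "(\<Sum>k\<le>Suc j. fmul (tch ?c k) (h k)) \<in> JJ n"
  using tF by (intro subgrp_sum[OF J_subgrp] J_fmul) auto
 then show ?case using h(2) cg_zero_iff cg_trans by blast
qed

theorem faithful: "f \<in> FA n ==> f \<in> JJ n \<longleftrightarrow> rho n f = 0"
proof
 assume f: "f \<in> FA n" "rho n f = 0"
 have "FA n = (alg n {1..n - 1} :: ('i, 'k) fa set)" by (rule FA_alg) auto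
 then have "f \<in> alg n {1..n - 1}" using f(1) by simp
 moreover have "FA 0 = (Po 0 :: ('i, 'k) fa set)" by (rule FA_alg) auto
 ultimately show "f \<in> JJ n"
  using faithful_alg[of "n - 1" n f] faithful_Po[of f n] f by (cases n) auto
qed (rule rho_J)

end

section \<open>The two embeddings of the smaller algebra\<close>

lemma sw_snoc: "1 \<le> l ==> l < length nu ==> sw l (nu @ [i]) = sw l nu @ [i]"
 by (cases l) (auto simp: sw_def nth_append list_update_append)

lemma nth1_snoc: "1 \<le> l ==> l \<le> length nu ==> nth1 (nu @ [i]) l = nth1 nu l"
 by (auto simp: nth1_def nth_append)

lemma sw_Cons: "1 \<le> l ==> l < length nu ==> sw (Suc l) (i # nu) = i # sw l nu"
 by (cases l) (auto simp: sw_def)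

lemma nth1_Cons: "1 \<le> l ==> nth1 (i # nu) (Suc l) = nth1 nu l"
 by (cases l) (auto simp: nth1_def)

text \<open>The renaming of variables when the first strand is moved to the last place;
  \<open>cyci\<close> is its inverse.\<close>

definition cyc :: "nat => nat => nat" where
 "cyc n j = (if j = 1 then n + 1 else if 2 \<le> j \<and> j \<le> n + 1 then j - 1 else j)"

definition cyci :: "nat => nat => nat" where
 "cyci n j = (if j = n + 1 then 1 else if 1 \<le> j \<and> j \<le> n then j + 1 else j)"

lemma cyc_cyci [simp]: "cyc n (cyci n j) = j" "cyci n (cyc n j) = j"
 by (auto simp: cyc_def cyci_def)

text \<open>The operator acts on the first strands and ignores the last one, whose colour has to be
  \<open>i\<close>. This realizes the embedding e(nu) to e(nu, i) on operators.\<close>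

lift_definition iot :: "'i => ('i, 'k::comm_ring_1) op => ('i, 'k) op" is
 "\<lambda>i F f mu. if mu ~= [] \<and> last mu = i then F (\<lambda>nu. f (nu @ [i])) (butlast mu) else 0"
proof -
 fix i and F :: "('i, 'k) vec => ('i, 'k) vec"
 assume "(\<forall>f g. F (f + g) = F f + F g) \<and> (\<forall>c f. F (\<lambda>mu. cst c * f mu) = (\<lambda>mu. cst c * F f mu))"
 then have F: "F (\<lambda>nu. f nu + g nu) = F f + F g" "F (\<lambda>mu. cst c * f mu) = (\<lambda>mu. cst c * F f mu)" for f g c
  by (auto simp: plus_fun_def)
 show "?thesis i F" by (auto simp: fun_eq_iff fun_apply F)
qed

text \<open>\<open>Sg\<close> and \<open>Si\<close> are inverse to each other up to the projections
  to sequences that end or start with \<open>i\<close>. They relabel strands without any crossing,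
  and conjugation by them turns the embedding at the first strands into the one at the last
  strands.\<close>

lift_definition Sg :: "nat => 'i => ('i, 'k::comm_ring_1) op" is
 "\<lambda>n i f mu. if length mu = Suc n \<and> last mu = i then sub (\<lambda>j. Vr (cyc n j)) (f (i # butlast mu)) else 0"
 by (auto simp: fun_eq_iff fun_apply sub.add sub.mult)

lift_definition Si :: "nat => 'i => ('i, 'k::comm_ring_1) op" is
 "\<lambda>n i f mu. if length mu = Suc n \<and> hd mu = i then sub (\<lambda>j. Vr (cyci n j)) (f (tl mu @ [i])) else 0"
 by (auto simp: fun_eq_iff fun_apply sub.add sub.mult)

lemmas ap_iot = iot.rep_eq
lemmas ap_Sg = Sg.rep_eq
lemmas ap_Si = Si.rep_eq

definition Lp :: "nat => 'i => ('i, 'k::comm_ring_1) op" where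
 "Lp n i = dg (\<lambda>mu. if length mu = Suc n \<and> last mu = i then 1 else 0)"

definition Hp :: "nat => 'i => ('i, 'k::comm_ring_1) op" where
 "Hp n i = dg (\<lambda>mu. if length mu = Suc n \<and> hd mu = i then 1 else 0)"

lemma ap_Lp [simp]: "ap (Lp n i) f mu = (if length mu = Suc n \<and> last mu = i then f mu else 0)"
 and ap_Hp [simp]: "ap (Hp n i) f mu = (if length mu = Suc n \<and> hd mu = i then f mu else 0)"
 by (simp_all add: Lp_def Hp_def)

lemma iot_add: "iot i (A + B) = iot i A + iot i B" and iot_diff: "iot i (A - B) = iot i A - iot i B"
 and iot_0 [simp]: "iot i 0 = 0"
 by (rule op_eqI; simp add: ap_iot fun_apply)+

lemma iot_sum: "iot i (sum f S) = (\<Sum>x\<in>S. iot i (f x))"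
 by (induction S rule: infinite_finite_induct) (simp_all add: iot_add)

lemma iot_mult: "iot i (A * B) = iot i A * iot i B"
 by (rule op_eqI) (simp add: ap_iot)

lemma iot_inj: "iot i A = 0 ==> A = 0"
proof (rule op_eqI)
 fix f :: "('a, 'b) vec" and mu
 assume "iot i A = 0"
 then have "ap (iot i A) (\<lambda>mu. f (butlast mu)) (mu @ [i]) = 0" by (simp add: fun_apply)
 then show "ap A f mu = ap 0 f mu" by (simp add: ap_iot fun_apply)
qed

lemma SgSi: "Sg n i * Si n i = Lp n i"
proof (rule op_eqI)
 fix f :: "('a, 'b) vec" and mu :: "'a list"
 have "butlast mu @ [last mu] = mu" if "mu ~= []" using that by simp
 then show "ap (Sg n i * Si n i) f mu = ap (Lp n i) f mu"
  by (cases "mu = []") (auto simp: ap_Sg ap_Si sub_sub)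
qed

lemma SiSg: "Si n i * Sg n i = Hp n i"
proof (rule op_eqI)
 fix f :: "('a, 'b) vec" and mu :: "'a list"
 show "ap (Si n i * Sg n i) f mu = ap (Hp n i) f mu"
  by (cases mu) (auto simp: ap_Sg ap_Si sub_sub)
qed

lemma Si_Lp: "Si n i * Lp n i = Si n i" "Hp n i * Si n i = Si n i" "Lp n i * Sg n i = Sg n i" "Sg n i * Hp n i = Sg n i"
 by (rule op_eqI; auto simp: ap_Sg ap_Si fun_apply)+

lemma Lp_idem [simp]: "Lp n i * Lp n i = Lp n i" "Hp n i * Hp n i = Hp n i"
 by (rule op_eqI; auto)+

text \<open>The operator counterpart of \<open>xi\<close> cut down to sequences starting with
  \<open>i\<close>; the exact relation is \<open>rho_xi\<close>.\<close>

definition xio :: "nat => 'i => ('i, 'k::comm_ring_1) op => ('i, 'k) op" where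
 "xio n i A = Si n i * iot i A * Sg n i"

lemma xio_add: "xio n i (A + B) = xio n i A + xio n i B" and xio_diff: "xio n i (A - B) = xio n i A - xio n i B"
 and xio_0 [simp]: "xio n i 0 = 0"
 by (simp_all add: xio_def iot_add iot_diff distrib_left distrib_right left_diff_distrib right_diff_distrib)

lemma po_Lp: "po p * Lp n i = Lp n i * po p" "po p * Hp n i = Hp n i * po p"
 by (simp_all add: Lp_def Hp_def po_def dg_commute)

lemma Si_po: "po p * Si n i = Si n i * po (sub (\<lambda>j. Vr (cyc n j)) p)"
 by (rule op_eqI) (auto simp: ap_Si sub.mult sub_sub)

lemma Sg_po: "po p * Sg n i = Sg n i * po (sub (\<lambda>j. Vr (cyci n j)) p)"
 by (rule op_eqI) (auto simp: ap_Sg sub.mult sub_sub)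

text \<open>Taking the coefficient of a power of one variable is itself linear. As an operator it
  separates the powers of that variable from operators that do not involve it.\<close>

lift_definition Ko :: "nat => nat => ('i, 'k::comm_ring_1) op" is
 "\<lambda>m r f mu. coeff (uni m (f mu)) r"
 by (auto simp: fun_eq_iff fun_apply uni.add uni.mult)

lemmas ap_Ko = Ko.rep_eq

lemma uni_sp: "sidx l m = m ==> coeff (uni m (sp l p)) r = sp l (coeff (uni m p) r)"
proof (induction p arbitrary: r rule: mpoly_induct)
 case (Vr j)
 have "sidx l j = m \<longleftrightarrow> j = m" using Vr by (metis sidx_sidx)
 then show ?case using Vr by (auto simp: uni_Vr coeff_pCons split: nat.splits)
qed (simp_all add: uni.add sub.add uni.mult sub.mult coeff_mult sub.sum coeff_pCons split: nat.splits)

lemma uni_free_Vr: "a ~= m ==> coeff (uni m (Vr a * p)) r = Vr a * coeff (uni m p) r"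
 by (simp add: uni.mult uni_Vr)

lemma sum_const_poly: "[:sum f S:] = (\<Sum>x\<in>S. [:f x:])"
proof (induction S rule: infinite_finite_induct)
 case (insert x S)
 have "[:f x + sum f S:] = [:f x:] + [:sum f S:]" by simp
 then show ?case using insert by simp
qed simp_all

lemma uni_coeff: "uni m (coeff (uni m p) r) = [:coeff (uni m p) r:]"
proof (induction p arbitrary: r rule: mpoly_induct)
 case (mult p q)
 have "uni m (coeff (uni m p) i * coeff (uni m q) j) = [:coeff (uni m p) i * coeff (uni m q) j:]" for i j
  by (simp add: uni.mult mult)
 then show ?case by (simp add: uni.mult[of _ p] coeff_mult uni.sum sum_const_poly)
next
 case (add p q)
 then show ?case by (simp add: uni.add)
qed (auto simp: uni_Vr coeff_pCons split: nat.splits)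

lemma uni_p2_free: "a ~= m ==> b ~= m ==> uni m (p2 w a b) = [:p2 w a b:]"
 unfolding p2_eq by (simp add: uni.sum uni.mult uni.power uni_Vr poly_const_pow sum_const_poly mult_ac)

lemma uni_expand: "p = (\<Sum>s\<le>degree (uni m p). Vr m ^ s * coeff (uni m p) s)"
 using poly_uni[of m p] unfolding poly_altdef by (simp add: mult.commute)

section \<open>Images of subalgebras and their compatibility with the embeddings\<close>

context klr begin

text \<open>By faithfulness the image of the whole of \<open>FA n\<close> is a copy of R(n), so
  computations can be carried out among operators.\<close>

definition OA :: "nat => nat set => ('i, 'k) op set" where
 "OA n K = rho n ` alg n K"

lemma OA_subgrp: "subgrp (OA n K)"
 unfolding subgrp_def OA_def
proof (intro conjI ballI)
 show "0 \<in> rho n ` alg n K" using alg_intros(12)[of n K] by (intro image_eqI[of _ _ 0]) auto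
 fix a b assume "a \<in> rho n ` alg n K" "b \<in> rho n ` alg n K"
 then obtain f g where "f \<in> alg n K" "g \<in> alg n K" "a = rho n f" "b = rho n g" by blast
 then show "a - b \<in> rho n ` alg n K"
  using alg_intros(2)[of f n K g] rho_diff[of f n g] alg_FA[of f n K] alg_FA[of g n K] by (intro image_eqI[of _ _ "f - g"]) auto
qed

lemma OA_mult: "a \<in> OA n K ==> b \<in> OA n K ==> a * b \<in> OA n K"
proof -
 assume "a \<in> OA n K" "b \<in> OA n K"
 then obtain f g where "f \<in> alg n K" "g \<in> alg n K" "a = rho n f" "b = rho n g" unfolding OA_def by blast
 then show "a * b \<in> OA n K"
  using alg_intros(4)[of f n K g] rho_fmul[of f n g] alg_FA[of f n K] alg_FA[of g n K] unfolding OA_def by (intro image_eqI[of _ _ "fmul f g"]) auto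
qed

lemma OA_gen: "vgen n g ==> (\<forall>l. g = T l --> l \<in> K) ==> pr n * gop g \<in> OA n K"
 unfolding OA_def by (rule image_eqI[of _ _ "fgen g"]) (auto simp: rho_def intro!: alg_intros)

lemma OA_pr: "pr n \<in> OA n K"
 unfolding OA_def by (rule image_eqI[of _ _ fone]) (auto simp: rho_def intro!: alg_intros)

lemma OA_scal: "po (cst c) * pr n \<in> OA n K"
proof -
 have "rho n (fsmul c fone) = po (cst c) * pr n"
  by (simp add: rho_def rh_fsmul[of _ n] pr_po)
 moreover have "fsmul c fone \<in> alg n K" by (intro alg_intros)
 ultimately show ?thesis unfolding OA_def by (metis image_eqI)
qed

lemma OA_unit: "a \<in> OA n K ==> pr n * a = a" "a \<in> OA n K ==> a * pr n = a"
 unfolding OA_def using rho_pr[OF alg_FA[of _ n K]] by (auto simp: pr_rho)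

lemma OA_induct [consumes 1, case_names diff scal gen]:
 assumes a: "a \<in> OA n K" and diff: "!!x y. x \<in> OA n K ==> y \<in> OA n K ==> P x ==> P y ==> P (x - y)"
  and scal: "!!c. P (po (cst c) * pr n)"
  and gen: "!!g x. vgen n g ==> (\<forall>l. g = T l --> l \<in> K) ==> x \<in> OA n K ==> P x ==> P (gop g * x)"
 shows "P a"
proof -
 let ?S = "{f \<in> alg n K. P (rho n f)}"
 obtain f where f: "f \<in> alg n K" "a = rho n f" using a unfolding OA_def by blast
 have "f \<in> ?S"
 proof (rule alg_words[OF f(1)])
  have r: "rho n x \<in> OA n K" if "x \<in> alg n K" for x using that unfolding OA_def by blast
  show "subgrp ?S"
   unfolding subgrp_def using diff r alg_intros(12)[of n K] scal[of 0] alg_intros(2)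
   by (auto simp: rho_diff alg_FA[of _ n K])
  have "rho n (fsmul c fone) = po (cst c) * pr n" for c
   by (simp add: rho_def rh_fsmul[of _ n] pr_po)
  then show "fsmul c fone \<in> ?S" for c using scal Po_alg[OF Po_scalar] by simp
  show "fmul (fgen g) x \<in> ?S" if g: "vgen n g" "\<forall>l. g = T l --> l \<in> K" and x: "x \<in> ?S" for g x
  proof -
   have xF: "x \<in> FA n" "fgen g \<in> (FA n :: ('i, 'k) fa set)"
    using x g alg_FA[of x n K] by (auto intro: FA_gen)
   have "rho n (fmul (fgen g) x) = pr n * gop g * rh x" using xF by (simp add: rho_def rh_fmul[of _ n] mult.assoc)
   also have "... = gop g * rho n x" by (simp add: pr_gop[symmetric] rho_def mult.assoc)
   finally show ?thesis using gen[OF g r] x g alg_intros(4)[of "fgen g" n K x] alg_intros(10)[where g = g and n = n and K = K] by auto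
  qed
 qed
 then show ?thesis using f by simp
qed

lemma iot_pr: "iot i (pr n) = Lp n i"
proof (rule op_eqI)
 fix f :: "('i, 'k) vec" and mu :: "'i list"
 show "ap (iot i (pr n)) f mu = ap (Lp n i) f mu"
  by (cases mu rule: rev_cases) (auto simp: ap_iot fun_apply)
qed

lemma iot_po: "iot i (po p * pr n) = po p * Lp n i"
proof (rule op_eqI)
 fix f :: "('i, 'k) vec" and mu :: "'i list"
 show "ap (iot i (po p * pr n)) f mu = ap (po p * Lp n i) f mu"
  by (cases mu rule: rev_cases) (auto simp: ap_iot fun_apply)
qed

lemma iot_po': "iot i (po p * a) = po p * iot i (a :: ('i, 'k) op)"
proof (rule op_eqI)
 fix f :: "('i, 'k) vec" and mu :: "'i list"
 show "ap (iot i (po p * a)) f mu = ap (po p * iot i a) f mu"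
  by (cases mu rule: rev_cases) (auto simp: ap_iot fun_apply)
qed

lemma iot_Eo: "iot i (Eo nu) = (Eo (nu @ [i]) :: ('i, 'k) op)"
proof (rule op_eqI)
 fix f :: "('i, 'k) vec" and mu :: "'i list"
 show "ap (iot i (Eo nu)) f mu = ap (Eo (nu @ [i])) f mu"
  by (cases mu rule: rev_cases) (auto simp: ap_iot fun_apply)
qed

lemma iot_To: "l < n ==> iot i (To l * pr n) = To l * Lp n i"
proof (rule op_eqI)
 fix f :: "('i, 'k) vec" and mu :: "'i list"
 assume "l < n"
 show "ap (iot i (To l * pr n)) f mu = ap (To l * Lp n i) f mu"
 proof (cases mu rule: rev_cases)
  case (snoc nu j)
  show ?thesis
  proof (cases "1 \<le> l \<and> length nu = n \<and> j = i")
   case True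
   then have "nth1 (nu @ [i]) l = nth1 nu l" "nth1 (nu @ [i]) (Suc l) = nth1 nu (Suc l)"
    "sw l (nu @ [i]) = sw l nu @ [i]"
    using \<open>l < n\<close> by (simp_all add: nth1_snoc sw_snoc)
   then show ?thesis using True snoc \<open>l < n\<close> by (simp add: ap_iot ap_To)
  next
   case False
   have "last (sw l (nu @ [j])) = j" if "1 \<le> l" "length nu = n"
    using sw_snoc[of l nu j] that \<open>l < n\<close> by simp
   then show ?thesis using False snoc \<open>l < n\<close> by (auto simp: ap_iot ap_To fun_apply)
  qed
 qed (simp add: ap_iot ap_To fun_apply)
qed

lemma iot_gop: "vgen n g ==> iot i (gop g * pr n) = rh (iota_gen i g) * Lp n i"
proof (cases g)
 case (E nu)
 assume "vgen n g"
 then have "Eo nu * pr n = (Eo nu :: ('i, 'k) op)" using E by (intro op_eqI) auto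
 moreover have "Eo (nu @ [i]) * Lp n i = (Eo (nu @ [i]) :: ('i, 'k) op)" using E \<open>vgen n g\<close> by (intro op_eqI) auto
 ultimately show ?thesis using E by (simp add: iot_Eo)
qed (auto simp: iot_po iot_To)

lemma FA_iota_gen: "vgen n g ==> iota_gen i g \<in> (FA (Suc n) :: ('i, 'k) fa set)"
 by (cases g) (auto intro!: FA_gen)

lemma iota_word: "iota n i (fsmul c (fw u)) =
  fsmul c (fmul (\<Sum>nu\<in>Iseqs n. ee (nu @ [i])) (fprod (map (iota_gen i) u)))"
 by (simp add: iota_def linext_simps fsmul_simps)

lemma iota_add: "f \<in> FA n ==> g \<in> FA n ==> iota n i (f + g) = iota n i f + iota n i g"
 unfolding iota_def by (rule linext_simps(1)) (auto simp: fsmul_simps FA_fsupp)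

lemma iota_0: "iota n i 0 = 0"
 unfolding iota_def by (rule linext_simps(3)) (simp_all add: fsmul_simps)

lemma FA_iota: "f \<in> FA n ==> iota n i f \<in> (FA (Suc n) :: ('i, 'k) fa set)"
proof (induction rule: FA_induct)
 case (word c u)
 show ?case unfolding iota_word using word
  by (intro FA_intros) (auto simp: Iseqs_def intro!: FA_gen FA_iota_gen)
qed (auto simp: iota_0 iota_add intro: FA_add)

lemma rh_sum_snoc: "rh (\<Sum>nu\<in>Iseqs n. ee (nu @ [i])) = Lp n i"
proof -
 have "rh (\<Sum>nu\<in>Iseqs n. ee (nu @ [i])) = (\<Sum>nu\<in>Iseqs n. iot i (Eo nu))"
  by (subst rh_sum[of _ _ "Suc n"]) (auto simp: Iseqs_def iot_Eo intro!: FA_gen)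
 then show ?thesis by (simp add: sum_Eo iot_pr flip: iot_sum)
qed

lemma pr_Lp: "pr (Suc n) * Lp n i = Lp n i" "Lp n i * pr (Suc n) = Lp n i"
 and pr_Hp: "pr (Suc n) * Hp n i = Hp n i" "Hp n i * pr (Suc n) = Hp n i"
 by (rule op_eqI; auto simp: fun_apply)+

lemma rho_iota: "f \<in> FA n ==> rho (Suc n) (iota n i f) = iot i (rho n f)"
proof (induction rule: FA_induct)
 case (word c u)
 have F1: "(\<Sum>nu\<in>Iseqs n. ee (nu @ [i])) \<in> (FA (Suc n) :: ('i, 'k) fa set)"
  by (intro FA_intros) (auto simp: Iseqs_def)
 have F2: "fprod (map (iota_gen i) u) \<in> (FA (Suc n) :: ('i, 'k) fa set)" if "\<forall>g\<in>set u. vgen n g" for u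
  using that FA_iota_gen by (intro FA_fprod) auto
 have "rh (fprod (map (iota_gen i) u)) * Lp n i = iot i (wop u * pr n)"
  using word
 proof (induction u)
  case Nil
  then show ?case by (simp add: fprod_def iot_pr)
 next
  case (Cons g u)
  then have g: "vgen n g" and u: "\<forall>g\<in>set u. vgen n g" by auto
  have "rh (fprod (map (iota_gen i) (g # u))) = rh (iota_gen i g) * rh (fprod (map (iota_gen i) u))"
   using rh_fmul[OF FA_iota_gen[OF g] F2[OF u]] by (simp add: fprod_def)
  then have "rh (fprod (map (iota_gen i) (g # u))) * Lp n i = rh (iota_gen i g) * iot i (wop u * pr n)"
   using Cons.IH[OF u] by (simp add: mult.assoc)
  also have "iot i (wop u * pr n) = Lp n i * iot i (wop u * pr n)"
   by (simp add: pr_wop flip: iot_pr iot_mult) (simp flip: mult.assoc)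
  also have "rh (iota_gen i g) * (Lp n i * iot i (wop u * pr n)) = iot i (gop g * pr n * (wop u * pr n))"
   unfolding mult.assoc[symmetric, of _ "Lp n i"] iot_gop[OF g, symmetric] by (rule iot_mult[symmetric])
  also have "gop g * pr n * (wop u * pr n) = wop (g # u) * pr n"
   by (simp add: mult.assoc pr_wop) (simp flip: mult.assoc)
  finally show ?case .
 qed note * = this
 have comm: "rh (fprod (map (iota_gen i) u)) * Lp n i = Lp n i * rh (fprod (map (iota_gen i) u))"
  using word
 proof (induction u)
  case (Cons g u)
  then have g: "vgen n g" and u: "\<forall>g\<in>set u. vgen n g" by auto
  have gc: "rh (iota_gen i g) * Lp n i = Lp n i * rh (iota_gen i g)"
  proof (cases g)
   case (T l)
   have "To l * Lp n i = Lp n i * (To l :: ('i, 'k) op)"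
   proof (rule op_eqI)
    fix f :: "('i, 'k) vec" and mu :: "'i list"
    show "ap (To l * Lp n i) f mu = ap (Lp n i * To l) f mu"
     using g T by (cases mu rule: rev_cases) (auto simp: ap_To fun_apply sw_snoc)
   qed
   then show ?thesis using T by simp
  qed (simp_all add: Lp_def Eo_def po_def dg_commute)
  have e: "rh (fprod (map (iota_gen i) (g # u))) = rh (iota_gen i g) * rh (fprod (map (iota_gen i) u))"
   using rh_fmul[OF FA_iota_gen[OF g] F2[OF u]] by (simp add: fprod_def)
  show ?case unfolding e using commute_mult[OF gc[symmetric] Cons.IH[OF u, symmetric]] by simp
 qed (simp add: fprod_def)
 have "rho (Suc n) (iota n i (fsmul c (fw u))) = pr (Suc n) * (po (cst c) * (Lp n i * rh (fprod (map (iota_gen i) u))))"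
  unfolding iota_word rho_def
  using rh_fsmul[OF FA_fmul[OF F1 F2[OF word]], of c] rh_fmul[OF F1 F2[OF word]] rh_sum_snoc by simp
 also have "... = po (cst c) * (pr (Suc n) * Lp n i * rh (fprod (map (iota_gen i) u)))"
  by (simp add: pr_po flip: mult.assoc)
 also have "... = po (cst c) * iot i (wop u * pr n)"
  using * comm by (simp add: pr_Lp)
 also have "... = iot i (rho n (fsmul c (fw u)))"
  by (simp add: iot_po'[symmetric] rho_def rh_simps pr_wop) (simp add: pr_po flip: mult.assoc)
 finally show ?case .
next
 case (add f g)
 then show ?case
  using rho_add[OF FA_iota FA_iota, of f n g i] by (simp add: iota_add rho_add iot_add)
qed (simp add: iota_0)

end

context klr begin

lemma FA_xi_gen: "vgen n g ==> xi_gen g \<in> (FA (Suc n) :: ('i, 'k) fa set)"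
 by (cases g) (auto intro!: FA_gen FA_sum)

lemma xi_word: "xi (fsmul c (fw u)) = fsmul c (fprod (map xi_gen u))"
 by (simp add: xi_def linext_simps fsmul_simps)

lemma xi_add: "f \<in> FA n ==> g \<in> FA n ==> xi (f + g) = xi f + (xi g :: ('i, 'k) fa)"
 unfolding xi_def by (rule linext_simps(1)) (auto simp: fsmul_simps FA_fsupp)

lemma xi_0: "xi 0 = (0 :: ('i, 'k) fa)"
 unfolding xi_def by (rule linext_simps(3)) (simp_all add: fsmul_simps)

lemma FA_fprod_xi: "\<forall>g\<in>set u. vgen n g ==> fprod (map xi_gen u) \<in> (FA (Suc n) :: ('i, 'k) fa set)"
 by (rule FA_fprod) (auto intro: FA_xi_gen)

lemma FA_xi: "f \<in> FA n ==> xi f \<in> (FA (Suc n) :: ('i, 'k) fa set)"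
proof (induction rule: FA_induct)
 case (word c u)
 then show ?case unfolding xi_word by (intro FA_fsmul FA_fprod_xi)
qed (auto simp: xi_0 xi_add intro: FA_add)

lemma iot_Lp: "A * pr n = A ==> iot i A * Lp n i = iot i A"
 by (simp flip: iot_pr iot_mult)

lemma Lp_iot: "pr n * A = A ==> Lp n i * iot i A = iot i A"
 by (simp flip: iot_pr iot_mult)

lemma xio_mult: "A * pr n = A ==> xio n i (A * B) = xio n i A * xio n i B"
proof -
 assume A: "A * pr n = A"
 have "xio n i A * xio n i B = Si n i * iot i A * (Sg n i * Si n i) * iot i B * Sg n i"
  by (simp add: xio_def mult.assoc)
 also have "... = Si n i * (iot i A * Lp n i) * iot i B * Sg n i" by (simp add: SgSi mult.assoc)
 finally show ?thesis by (simp add: iot_Lp[OF A] xio_def iot_mult mult.assoc)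
qed

lemma Hp_xio: "Hp n i * xio n i A = xio n i A" "xio n i A * Hp n i = xio n i A"
proof -
 have "Hp n i * xio n i A = (Hp n i * Si n i) * iot i A * Sg n i" "xio n i A * Hp n i = Si n i * iot i A * (Sg n i * Hp n i)"
  by (simp_all add: xio_def mult.assoc)
 then show "Hp n i * xio n i A = xio n i A" "xio n i A * Hp n i = xio n i A"
  by (simp_all only: Si_Lp) (simp_all add: xio_def)
qed

lemma xio_pr: "xio n i (pr n) = Hp n i"
 by (simp add: xio_def iot_pr Si_Lp SiSg)

lemma xio_po: "xio n i (po p * A) = po (sub (\<lambda>j. Vr (cyci n j)) p) * xio n i (A :: ('i, 'k) op)"
proof -
 have *: "po (sub (\<lambda>j. Vr (cyci n j)) p) * Si n i = Si n i * po p"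
  by (simp add: Si_po sub_sub)
 show ?thesis unfolding xio_def iot_po' mult.assoc[symmetric] * ..
qed

lemma xio_To:
 assumes l: "1 \<le> l" "l < n"
 shows "xio n i (To l * pr n) = To (Suc l) * Hp n i"
proof (rule op_eqI)
 fix f :: "('i, 'k) vec" and mu :: "'i list"
 have cyc_l: "cyci n l = Suc l" "cyci n (Suc l) = Suc (Suc l)" using l by (auto simp: cyci_def)
 have cs: "cyci n (sidx l j) = sidx (Suc l) (cyci n j)" for j using l by (auto simp: cyci_def sidx_def)
 have dd: "sub (\<lambda>j. Vr (cyci n j)) (dd l p) = dd (Suc l) (sub (\<lambda>j. Vr (cyci n j)) p)" for p :: "'k mpoly"
  by (rule dd_sub[where g = "cyci n"]) (simp_all add: cs cyc_l)
 have sp: "sub (\<lambda>j. Vr (cyci n j)) (sp l p) = sp (Suc l) (sub (\<lambda>j. Vr (cyci n j)) p)" for p :: "'k mpoly"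
  unfolding sub_sub by (rule sub_cong) (simp add: cs)
 have PQ: "sub (\<lambda>j. Vr (cyci n j)) (PP a l (Suc l)) = PP a (Suc l) (Suc (Suc l))"
  "sub (\<lambda>j. Vr (cyci n j)) (qq a b l (Suc l)) = qq a b (Suc l) (Suc (Suc l))" for a b
  using sub_p2[of l "Suc l" "\<lambda>j. Vr (cyci n j) :: 'k mpoly" "cyci n"]
  by (simp_all add: PP_def qq_def QQ_def cyc_l)
 show "ap (xio n i (To l * pr n)) f mu = ap (To (Suc l) * Hp n i) f mu"
 proof (cases mu)
  case (Cons j nu)
  show ?thesis
  proof (cases "length nu = n \<and> j = i")
   case True
   then have len: "length nu = n" by simp
   have "nth1 (i # nu) (Suc l) = nth1 nu l" "nth1 (i # nu) (Suc (Suc l)) = nth1 nu (Suc l)"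
    "sw (Suc l) (i # nu) = i # sw l nu" "sw l (nu @ [i]) = sw l nu @ [i]"
    using l len by (simp_all add: nth1_Cons sw_Cons sw_snoc)
   moreover have "cyci n (sidx l (cyc n j)) = sidx (Suc l) j" for j by (simp add: cs)
   ultimately show ?thesis using True Cons l
    by (simp add: xio_def ap_Si ap_Sg ap_iot ap_To sub.mult dd sp PQ sub_sub)
  next
   case False
   have "hd (sw (Suc l) (j # nu)) = j" if "length nu = n"
    using sw_Cons[of l nu j] that l by simp
   then show ?thesis using False Cons by (auto simp: xio_def ap_Si ap_To fun_apply)
  qed
 qed (simp add: xio_def ap_Si ap_To fun_apply)
qed

lemma xio_Eo: "length nu = n ==> xio n i (Eo nu) = (Eo (i # nu) :: ('i, 'k) op)"
proof (rule op_eqI)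
 fix f :: "('i, 'k) vec" and mu :: "'i list"
 assume "length nu = n"
 then show "ap (xio n i (Eo nu)) f mu = ap (Eo (i # nu)) f mu"
  by (cases mu) (auto simp: xio_def ap_Si ap_Sg ap_iot sub_sub fun_apply)
qed

lemma xio_gop: "vgen n g ==> xio n i (gop g * pr n) = rh (xi_gen g) * Hp n i"
proof (cases g)
 case (E nu)
 assume g: "vgen n g"
 then have 1: "Eo nu * pr n = (Eo nu :: ('i, 'k) op)" using E by (intro op_eqI) auto
 have 2: "rh (\<Sum>j\<in>UNIV. ee (j # nu)) = (\<Sum>j\<in>UNIV. Eo (j # nu))"
  using g E by (subst rh_sum[of _ _ "Suc n"]) (auto intro!: FA_gen)
 have 3: "Eo (j # nu) * Hp n i = (if j = i then Eo (i # nu) else 0 :: ('i, 'k) op)" for j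
  using g E by (intro op_eqI) (auto simp: fun_apply)
 show ?thesis using g E by (simp add: 1 2 3 xio_Eo sum_distrib_right)
next
 case (X k)
 assume "vgen n g"
 then have "cyci n k = Suc k" using X by (simp add: cyci_def)
 then show ?thesis using X by (simp add: xio_po xio_pr)
next
 case (T l)
 assume "vgen n g"
 then show ?thesis using T by (simp add: xio_To)
qed

lemma xi_gen_Hp: "vgen n g ==> rh (xi_gen g) * Hp n i = Hp n i * rh (xi_gen g)"
proof (cases g)
 case (E nu)
 assume g: "vgen n g"
 have "rh (\<Sum>j\<in>UNIV. ee (j # nu)) = (\<Sum>j\<in>UNIV. Eo (j # nu))"
  using g E by (subst rh_sum[of _ _ "Suc n"]) (auto intro!: FA_gen)
 then show ?thesis using E by (simp add: Hp_def Eo_commute sum_distrib_left sum_distrib_right)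
next
 case (T l)
 assume g: "vgen n g"
 have "To (Suc l) * Hp n i = Hp n i * (To (Suc l) :: ('i, 'k) op)"
 proof (rule op_eqI)
  fix f :: "('i, 'k) vec" and mu :: "'i list"
  show "ap (To (Suc l) * Hp n i) f mu = ap (Hp n i * To (Suc l)) f mu"
   using g T by (cases mu) (auto simp: ap_To fun_apply sw_Cons)
 qed
 then show ?thesis using T by simp
qed (simp add: Hp_def po_def dg_commute)

lemma rho_xi: "f \<in> FA n ==> rho (Suc n) (xi f) * Hp n i = xio n i (rho n f)"
proof (induction rule: FA_induct)
 case (word c u)
 have "rh (fprod (map xi_gen u)) * Hp n i = xio n i (wop u * pr n)"
  using word
 proof (induction u)
  case Nil
  then show ?case by (simp add: fprod_def xio_pr)
 next
  case (Cons g u)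
  then have g: "vgen n g" and u: "\<forall>g\<in>set u. vgen n g" by auto
  have "rh (fprod (map xi_gen (g # u))) = rh (xi_gen g) * rh (fprod (map xi_gen u))"
   using rh_fmul[OF FA_xi_gen[OF g] FA_fprod_xi[OF u]] by (simp add: fprod_def)
  then have "rh (fprod (map xi_gen (g # u))) * Hp n i = rh (xi_gen g) * (Hp n i * xio n i (wop u * pr n))"
   using Cons.IH[OF u] by (simp add: mult.assoc Hp_xio)
  also have "... = xio n i (gop g * pr n) * xio n i (wop u * pr n)"
   by (simp add: xio_gop[OF g] mult.assoc)
  also have "... = xio n i (gop g * pr n * (wop u * pr n))"
   by (rule xio_mult[symmetric]) (simp add: mult.assoc)
  also have "gop g * pr n * (wop u * pr n) = wop (g # u) * pr n"
   by (simp add: mult.assoc pr_wop) (simp flip: mult.assoc)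
  finally show ?case .
 qed
 then have "rho (Suc n) (xi (fsmul c (fw u))) * Hp n i = pr (Suc n) * (po (cst c) * xio n i (wop u * pr n))"
  unfolding xi_word rho_def using rh_fsmul[OF FA_fprod_xi[OF word], of c] by (simp add: mult.assoc)
 also have "... = pr (Suc n) * xio n i (po (cst c) * (wop u * pr n))"
  by (simp add: xio_po)
 also have "... = xio n i (po (cst c) * (wop u * pr n))"
  using Hp_xio(1)[of n i] by (metis mult.assoc pr_Hp(1))
 also have "... = xio n i (rho n (fsmul c (fw u)))"
  by (simp add: rho_def rh_simps pr_wop) (simp add: pr_po flip: mult.assoc)
 finally show ?case .
next
 case (add f g)
 then show ?case
  using rho_add[OF FA_xi FA_xi, of f n g] by (simp add: xi_add rho_add xio_add distrib_right)
qed (simp add: xi_0)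

text \<open>Expansion of the elements of a subalgebra in powers of a variable \<open>v\<close>, with coefficients in
 the image of a smaller algebra under an embedding \<open>om\<close>.\<close>

definition pexp :: "(('i, 'k) op => ('i, 'k) op) => nat => nat => (nat => ('i, 'k) op) => ('i, 'k) op" where
 "pexp om v M b = (\<Sum>m<M. po (Vr v ^ m) * om (b m))"

lemma pexp_extend: "om 0 = 0 ==> M \<le> M' ==> (\<forall>m\<ge>M. b m = 0) ==> pexp om v M b = pexp om v M' b"
 unfolding pexp_def by (rule sum.mono_neutral_left) auto

text \<open>A generator other than x_v either comes from the smaller algebra or annihilates the
  embedded elements, as an idempotent of the wrong colour does. The variable x_v only raises the
  power, and no crossing in \<open>K\<close> touches it.\<close>

lemma emb_span:
 assumes om: "!!a b. om (a - b) = om a - om b"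
  and scal: "!!c. po (cst c) * pr N * Q = om (po (cst c) * pr n)"
  and gen: "!!g. vgen N g ==> (\<forall>l. g = T l --> l \<in> K) ==> g ~= X v ==>
   (\<exists>g'. vgen n g' \<and> (\<forall>b\<in>OA n {1..<n}. gop g * om b = om (gop g' * b))) \<or>
   (\<forall>b\<in>OA n {1..<n}. gop g * om b = 0)"
  and K: "!!l. l \<in> K ==> v ~= l \<and> v ~= Suc l"
  and y: "y \<in> OA N K"
 shows "\<exists>M b. (\<forall>m. b m \<in> OA n {1..<n}) \<and> (\<forall>m\<ge>M. b m = 0) \<and> y * Q = pexp om v M b"
 using y
proof (induction y rule: OA_induct)
 have om0: "om 0 = 0" using om[of 0 0] by simp
 note Z = subgrpD(1)[OF OA_subgrp[of n "{1..<n}"]]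
 {
  case (diff x y)
  then obtain M b M' b' where b: "\<forall>m. b m \<in> OA n {1..<n}" "\<forall>m\<ge>M. b m = 0" "x * Q = pexp om v M b"
   and b': "\<forall>m. b' m \<in> OA n {1..<n}" "\<forall>m\<ge>M'. b' m = 0" "y * Q = pexp om v M' b'" by blast
  let ?M = "max M M'"
  have "pexp om v M b = pexp om v ?M b" "pexp om v M' b' = pexp om v ?M b'"
   by (rule pexp_extend; use om0 b b' in simp)+
  then have "(x - y) * Q = pexp om v ?M b - pexp om v ?M b'"
   using b(3) b'(3) by (simp add: left_diff_distrib)
  also have "... = pexp om v ?M (\<lambda>m. b m - b' m)"
   by (simp add: pexp_def om right_diff_distrib sum_subtractf)
  finally show ?case using b b' subgrpD(2)[OF OA_subgrp]
   by (intro exI[of _ ?M] exI[of _ "\<lambda>m. b m - b' m"]) auto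
 next
  case (scal c)
  have "po (cst c) * pr N * Q = pexp om v 1 (\<lambda>m. if m = 0 then po (cst c) * pr n else 0)"
   by (simp add: pexp_def assms(2))
  then show ?case using OA_scal Z by (intro exI[of _ 1] exI[of _ "\<lambda>m. if m = 0 then po (cst c) * pr n else 0"]) auto
 next
  case (gen g y)
  then obtain M b where b: "\<forall>m. b m \<in> OA n {1..<n}" "\<forall>m\<ge>M. b m = 0" "y * Q = pexp om v M b" by blast
  have g: "gop g * po (Vr v ^ m) = po (Vr v ^ m) * gop g" for m
  proof -
   have "gop g * Xo v = Xo v * gop g"
   proof (cases g)
    case (T l)
    then show ?thesis using gen(2) K[of l] To_Xo[of v l] by auto
   qed (simp_all add: po_commute Eo_commute)
   then show ?thesis
    by (induction m) (simp_all flip: po_mult mult.assoc, simp add: mult.assoc)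
  qed
  have e: "gop g * y * Q = (\<Sum>m<M. po (Vr v ^ m) * (gop g * om (b m)))"
   unfolding mult.assoc b(3) pexp_def sum_distrib_left by (intro sum.cong refl) (simp add: g flip: mult.assoc)
  show ?case
  proof (cases "g = X v")
   case True
   have "gop g * y * Q = (\<Sum>m<M. po (Vr v ^ Suc m) * om (b m))"
    unfolding e by (simp add: True po_mult mult_ac flip: mult.assoc)
   also have "... = pexp om v (Suc M) (\<lambda>m. if m = 0 then 0 else b (m - 1))"
    unfolding pexp_def sum.lessThan_Suc_shift by (simp add: om0)
   finally show ?thesis using b Z
    by (intro exI[of _ "Suc M"] exI[of _ "\<lambda>m. if m = 0 then 0 else b (m - 1)"]) auto
  next
   case False
   from assms(3)[OF gen(1,2) this] show ?thesis
   proof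
    assume "\<exists>g'. vgen n g' \<and> (\<forall>b\<in>OA n {1..<n}. gop g * om b = om (gop g' * b))"
    then obtain g' where g': "vgen n g'" "\<forall>b\<in>OA n {1..<n}. gop g * om b = om (gop g' * b)" by blast
    have "gop g' * b m \<in> OA n {1..<n}" for m
    proof -
     have "pr n * gop g' * b m \<in> OA n {1..<n}"
      using g'(1) b(1) by (intro OA_mult OA_gen) auto
     then show ?thesis using OA_unit(1)[OF spec[OF b(1)], of m] by (simp add: mult.assoc flip: pr_gop)
    qed
    moreover have "gop g * y * Q = pexp om v M (\<lambda>m. gop g' * b m)"
     unfolding e pexp_def using g'(2) b(1) by simp
    ultimately show ?thesis using b(2) by (intro exI[of _ M] exI[of _ "\<lambda>m. gop g' * b m"]) auto
   next
    assume "\<forall>b\<in>OA n {1..<n}. gop g * om b = 0"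
    then have "gop g * y * Q = pexp om v 0 (\<lambda>_. 0)" unfolding e using b(1) by (simp add: pexp_def)
    then show ?thesis using Z by (intro exI[of _ 0] exI[of _ "\<lambda>_. 0"]) auto
   qed
  qed
 }
qed

text \<open>Without tau_n nothing crosses the last strand. Once its colour is fixed, what acts is
  the smaller algebra and x_{n+1}.\<close>

lemma Lp_span:
 "y \<in> OA (Suc n) {1..<n} ==>
  \<exists>M b. (\<forall>m. b m \<in> OA n {1..<n}) \<and> (\<forall>m\<ge>M. b m = 0) \<and> y * Lp n i = pexp (iot i) (Suc n) M b"
proof (erule emb_span[rotated 4])
 show "po (cst c) * pr (Suc n) * Lp n i = iot i (po (cst c) * pr n)" for c
  by (simp add: iot_po mult.assoc pr_Lp)
 show "(\<exists>g'. vgen n g' \<and> (\<forall>b\<in>OA n {1..<n}. gop g * iot i b = iot i (gop g' * b))) \<or>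
   (\<forall>b\<in>OA n {1..<n}. gop g * iot i b = 0)"
  if g: "vgen (Suc n) g" "\<forall>l. g = T l --> l \<in> {1..<n}" "g ~= X (Suc n)" for g
 proof -
  have L: "gop g * iot i b = gop g * Lp n i * iot i b" if "b \<in> OA n {1..<n}" for b
   using Lp_iot[of n b i] OA_unit(1)[OF that] by (simp add: mult.assoc)
  have step: "\<forall>b\<in>OA n {1..<n}. gop g * iot i b = iot i (gop g' * b)"
   if "gop g * Lp n i = iot i (gop g' * pr n)" for g'
   using L that OA_unit(1)[of _ n "{1..<n}"] by (simp add: mult.assoc flip: iot_mult)
  show ?thesis
  proof (cases g)
   case (E nu)
   then have nu: "length nu = Suc n" "nu ~= []" using g by auto
   show ?thesis
   proof (cases "last nu = i")
    case True
    then have nu': "butlast nu @ [i] = nu" using nu by auto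
    have "Eo (butlast nu) * pr n = (Eo (butlast nu) :: ('i, 'k) op)" using nu by (intro op_eqI) auto
    moreover have "Eo nu * Lp n i = (Eo nu :: ('i, 'k) op)" using nu True by (intro op_eqI) auto
    ultimately have "gop g * Lp n i = iot i (gop (E (butlast nu)) * pr n)"
     using nu' E by (simp add: iot_Eo)
    from step[OF this] show ?thesis using nu by (intro disjI1 exI[of _ "E (butlast nu)"]) auto
   next
    case False
    then have "gop g * Lp n i = 0" using E nu by (intro op_eqI) (auto simp: fun_apply)
    then show ?thesis using L by auto
   qed
  next
   case (X k)
   have "gop g * Lp n i = iot i (gop (X k) * pr n)" using X by (simp add: iot_po)
   from step[OF this] show ?thesis using X g by (intro disjI1 exI[of _ "X k"]) auto
  next
   case (T l)
   have "gop g * Lp n i = iot i (gop (T l) * pr n)" using T g by (simp add: iot_To)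
   from step[OF this] show ?thesis using T g by (intro disjI1 exI[of _ "T l"]) auto
  qed
 qed
qed (auto simp: iot_diff)

text \<open>Without tau_1 the first strand is isolated; the remaining generators are those of the
  smaller algebra with indices shifted by one.\<close>

lemma Hp_span:
 "y \<in> OA (Suc n) {2..n} ==>
  \<exists>M b. (\<forall>m. b m \<in> OA n {1..<n}) \<and> (\<forall>m\<ge>M. b m = 0) \<and> y * Hp n i = pexp (xio n i) 1 M b"
proof (erule emb_span[rotated 4])
 show "po (cst c) * pr (Suc n) * Hp n i = xio n i (po (cst c) * pr n)" for c
  by (simp add: xio_po xio_pr mult.assoc pr_Hp)
 show "(\<exists>g'. vgen n g' \<and> (\<forall>b\<in>OA n {1..<n}. gop g * xio n i b = xio n i (gop g' * b))) \<or>
   (\<forall>b\<in>OA n {1..<n}. gop g * xio n i b = 0)"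
  if g: "vgen (Suc n) g" "\<forall>l. g = T l --> l \<in> {2..n}" "g ~= X 1" for g
 proof -
  have L: "gop g * xio n i b = gop g * Hp n i * xio n i b" for b
   by (simp add: mult.assoc Hp_xio)
  have step: "\<forall>b\<in>OA n {1..<n}. gop g * xio n i b = xio n i (gop g' * b)"
   if "gop g * Hp n i = xio n i (gop g' * pr n)" for g'
  proof
   fix b assume "b \<in> OA n {1..<n}"
   then have "gop g' * b = gop g' * pr n * b" by (simp add: mult.assoc OA_unit)
   then show "gop g * xio n i b = xio n i (gop g' * b)"
    using xio_mult[of "gop g' * pr n" n i b] L[of b] that by (simp add: mult.assoc)
  qed
  show ?thesis
  proof (cases g)
   case (E nu)
   then have nu: "length nu = Suc n" "nu ~= []" using g by auto
   show ?thesis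
   proof (cases "hd nu = i")
    case True
    then have nu': "i # tl nu = nu" using nu by auto
    have "Eo (tl nu) * pr n = (Eo (tl nu) :: ('i, 'k) op)" using nu by (intro op_eqI) auto
    moreover have "Eo nu * Hp n i = (Eo nu :: ('i, 'k) op)" using nu True by (intro op_eqI) auto
    ultimately have "gop g * Hp n i = xio n i (gop (E (tl nu)) * pr n)"
     using nu' E nu by (simp add: xio_Eo)
    from step[OF this] show ?thesis using nu by (intro disjI1 exI[of _ "E (tl nu)"]) auto
   next
    case False
    then have "gop g * Hp n i = 0" using E nu by (intro op_eqI) (auto simp: fun_apply)
    then show ?thesis using L by auto
   qed
  next
   case (X k)
   then have k: "2 \<le> k" "k \<le> Suc n" using g by auto
   then have "cyci n (k - 1) = k" by (auto simp: cyci_def)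
   then have "gop g * Hp n i = xio n i (gop (X (k - 1)) * pr n)" using X by (simp add: xio_po xio_pr)
   from step[OF this] show ?thesis using k by (intro disjI1 exI[of _ "X (k - 1)"]) auto
  next
   case (T l)
   then have l: "2 \<le> l" "l \<le> n" using g by auto
   then have "gop g * Hp n i = xio n i (gop (T (l - 1)) * pr n)" using T xio_To[of "l - 1" n i] by simp
   from step[OF this] show ?thesis using l by (intro disjI1 exI[of _ "T (l - 1)"]) auto
  qed
 qed
qed (auto simp: xio_diff)

lemma Ko_OA: "b \<in> OA n {1..<n} ==> Ko (Suc n) r * b = b * Ko (Suc n) r"
proof (induction b rule: OA_induct)
 case (diff x y)
 then show ?case by (simp add: algebra_simps)
next
 case (scal c)
 have "Ko (Suc n) r * pr n = pr n * (Ko (Suc n) r :: ('i, 'k) op)"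
  by (rule op_eqI) (simp add: ap_Ko)
 from commute_mult[OF po_cst_commute[symmetric] this] show ?case .
next
 case (gen g x)
 have "Ko (Suc n) r * gop g = gop g * Ko (Suc n) r"
 proof (cases g)
  case (E nu)
  show ?thesis unfolding E by (rule op_eqI) (simp add: ap_Ko)
 next
  case (X k)
  then have "k ~= Suc n" using gen by auto
  then show ?thesis unfolding X by (intro op_eqI) (simp add: ap_Ko uni_free_Vr)
 next
  case (T l)
  then have l: "l < n" using gen by auto
  have s: "sidx l (Suc n) = Suc n" using l by (simp add: sidx_def)
  have d: "coeff (uni (Suc n) (dd l p)) r = dd l (coeff (uni (Suc n) p) r)" for p :: "'k mpoly"
  proof (rule ddI[symmetric])
   have "uni (Suc n) (Vr l - Vr (Suc l)) = [:Vr l - Vr (Suc l) :: 'k mpoly:]" using l by (simp add: uni.diff uni_Vr)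
   then have "(Vr l - Vr (Suc l)) * coeff (uni (Suc n) (dd l p)) r = coeff (uni (Suc n) ((Vr l - Vr (Suc l)) * dd l p)) r"
    by (simp only: uni.mult) simp
   then show "(Vr l - Vr (Suc l)) * coeff (uni (Suc n) (dd l p)) r = sp l (coeff (uni (Suc n) p) r) - coeff (uni (Suc n) p) r"
    by (simp add: dd_eq uni.diff uni_sp[OF s])
  qed
  have q: "coeff (uni (Suc n) (PP a l (Suc l) * p)) r = PP a l (Suc l) * coeff (uni (Suc n) p) r"
   "coeff (uni (Suc n) (qq a b l (Suc l) * p)) r = qq a b l (Suc l) * coeff (uni (Suc n) p) r" for a b p
   using l by (simp_all add: uni.mult PP_def qq_def QQ_def uni_p2_free)
  show ?thesis unfolding T by (rule op_eqI) (simp add: ap_Ko ap_To q d uni_sp[OF s])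
 qed
 from commute_mult[OF this gen(4)] show ?case .
qed

lemma Ko_Vr: "(Ko v r :: ('i, 'k) op) * po (Vr v ^ m) = (if m \<le> r then Ko v (r - m) else 0)"
proof (rule op_eqI)
 fix f :: "('i, 'k) vec" and mu :: "'i list"
 show "ap (Ko v r * po (Vr v ^ m)) f mu = ap (if m \<le> r then Ko v (r - m) else 0) f mu"
  by (simp add: ap_Ko uni.mult uni.power uni_Vr coeff_monom_mult fun_apply flip: monom_altdef[of 1, simplified])
qed

lemma Ko_Ko: "(Ko v r :: ('i, 'k) op) * Ko v s = (if r = 0 then Ko v s else 0)"
proof (rule op_eqI)
 fix f :: "('i, 'k) vec" and mu :: "'i list"
 show "ap (Ko v r * Ko v s) f mu = ap (if r = 0 then Ko v s else 0) f mu"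
  by (simp add: ap_Ko uni_coeff fun_apply coeff_pCons split: nat.split)
qed

lemma OA_po_commute: "b \<in> OA n {1..<n} ==> b * po (Vr (Suc n) ^ m) = po (Vr (Suc n) ^ m) * b"
proof -
 assume "b \<in> OA n {1..<n}"
 then obtain f where "f \<in> alg n {1..<n}" "b = rho n f" unfolding OA_def by blast
 then have "b * Xo (Suc n) = Xo (Suc n) * b" using rho_alg_Xo[of f n "{1..<n}" "Suc n"] by auto
 then show ?thesis by (induction m) (simp_all flip: po_mult mult.assoc, simp add: mult.assoc)
qed

text \<open>There are only finitely many sequences of length n, so the degree in x_{n+1} is bounded
  on them and a function is a finite sum of powers times values of \<open>Ko\<close>. The operator
  \<open>b\<close> commutes with the powers and kills these values.\<close>

lemma Ko_zero: assumes b: "b \<in> OA n {1..<n}" and z: "!!s. b * Ko (Suc n) s = 0" shows "b = 0"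
proof (rule op_eqI)
 fix f :: "('i, 'k) vec" and mu :: "'i list"
 define g where "g = ap (pr n) f"
 define D where "D = Max ((\<lambda>nu. degree (uni (Suc n) (g nu))) ` Iseqs n)"
 have "g = (\<Sum>s\<le>D. ap (po (Vr (Suc n) ^ s) * Ko (Suc n) s) g)"
 proof
  fix nu
  show "g nu = (\<Sum>s\<le>D. ap (po (Vr (Suc n) ^ s) * Ko (Suc n) s) g) nu"
  proof (cases "nu \<in> Iseqs n")
   case True
   then have D: "degree (uni (Suc n) (g nu)) \<le> D" unfolding D_def by (intro Max_ge) auto
   have "g nu = (\<Sum>s\<le>degree (uni (Suc n) (g nu)). Vr (Suc n) ^ s * coeff (uni (Suc n) (g nu)) s)"
    by (rule uni_expand)
   also have "... = (\<Sum>s\<le>D. Vr (Suc n) ^ s * coeff (uni (Suc n) (g nu)) s)"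
    using D by (intro sum.mono_neutral_left) (auto simp: coeff_eq_0)
   finally show ?thesis by (simp add: fun_sum_apply ap_Ko)
  next
   case False
   then show ?thesis by (simp add: g_def Iseqs_def fun_sum_apply ap_Ko)
  qed
 qed
 then have "ap b g = (\<Sum>s\<le>D. ap (b * (po (Vr (Suc n) ^ s) * Ko (Suc n) s)) g)"
  by (metis (no_types, lifting) ap_sum ap_simps(4) sum.cong)
 also have "... = (\<Sum>s\<le>D. ap (po (Vr (Suc n) ^ s) * (b * Ko (Suc n) s)) g)"
  by (intro sum.cong refl) (simp add: OA_po_commute[OF b] flip: mult.assoc)
 also have "... = 0" by (simp add: z)
 finally have "ap (b * pr n) f mu = 0" by (simp add: g_def fun_apply)
 then show "ap b f mu = ap 0 f mu" using OA_unit(2)[OF b] by (simp add: fun_apply)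
qed

text \<open>\<open>Ko (Suc n) m\<close> on the left alone would still leave the terms with k < m.
  Placing \<open>Ko (Suc n) s\<close> on the right makes the argument free of x_{n+1}, and then only
  k = m survives.\<close>

lemma pexp_indep_iot:
 assumes b: "!!m. b m \<in> OA n {1..<n}" and z: "pexp (iot i) (Suc n) M b = 0" and m: "m < M"
 shows "b m = 0"
proof -
 have "iot i (\<Sum>m<M. po (Vr (Suc n) ^ m) * b m) = 0"
  using z by (simp add: pexp_def iot_sum iot_po')
 then have z': "(\<Sum>m<M. po (Vr (Suc n) ^ m) * b m) = 0" by (rule iot_inj)
 have "b m * Ko (Suc n) s = 0" for s
 proof -
  have "0 = Ko (Suc n) m * (\<Sum>m<M. po (Vr (Suc n) ^ m) * b m) * Ko (Suc n) s" using z' by simp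
  also have "... = (\<Sum>k<M. (Ko (Suc n) m * po (Vr (Suc n) ^ k)) * b k * Ko (Suc n) s)"
   by (simp add: sum_distrib_left sum_distrib_right mult.assoc)
  also have "... = (\<Sum>k<M. if k = m then b m * Ko (Suc n) s else 0)"
  proof (intro sum.cong refl)
   fix k
   have "Ko (Suc n) (m - k) * b k * Ko (Suc n) s = b k * (Ko (Suc n) (m - k) * Ko (Suc n) s)"
    by (simp add: Ko_OA[OF b] mult.assoc)
   then show "Ko (Suc n) m * po (Vr (Suc n) ^ k) * b k * Ko (Suc n) s = (if k = m then b m * Ko (Suc n) s else 0)"
    by (auto simp: Ko_Vr Ko_Ko)
  qed
  finally show ?thesis using m by simp
 qed
 then show ?thesis by (rule Ko_zero[OF b])
qed

text \<open>Conjugation by \<open>Sg\<close> and \<open>Si\<close> replaces x_1 by x_{n+1} and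
  \<open>xio\<close> by \<open>iot\<close>.\<close>

lemma pexp_indep_xio:
 assumes b: "!!m. b m \<in> OA n {1..<n}" and z: "pexp (xio n i) 1 M b = 0" and m: "m < M"
 shows "b m = 0"
proof (rule pexp_indep_iot[OF b _ m])
 have *: "Sg n i * (po (Vr 1 ^ m) * xio n i (b m)) * Si n i = po (Vr (Suc n) ^ m) * iot i (b m)" for m
 proof -
  have "cyci n (Suc n) = 1" by (simp add: cyci_def)
  then have eq: "Sg n i * po (Vr 1 ^ m) = po (Vr (Suc n) ^ m) * Sg n i" by (simp add: Sg_po sub.power)
  have "Sg n i * (po (Vr 1 ^ m) * xio n i (b m)) * Si n i =
    (Sg n i * po (Vr 1 ^ m)) * (Si n i * iot i (b m) * Sg n i * Si n i)"
   by (simp only: xio_def mult.assoc)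
  also have "... = po (Vr (Suc n) ^ m) * ((Sg n i * Si n i) * iot i (b m) * (Sg n i * Si n i))"
   by (simp only: eq mult.assoc)
  also have "... = po (Vr (Suc n) ^ m) * iot i (b m)"
   using Lp_iot[of n "b m" i] iot_Lp[of "b m" n i] OA_unit[OF b] by (simp add: SgSi)
  finally show ?thesis .
 qed
 have "Sg n i * pexp (xio n i) 1 M b * Si n i = pexp (iot i) (Suc n) M b"
  unfolding pexp_def sum_distrib_left sum_distrib_right * ..
 then show "pexp (iot i) (Suc n) M b = 0" using z by simp
qed

end

section \<open>Free modules and division with remainder\<close>

text \<open>A right module over \<open>B\<close> (acting through \<open>om\<close>) which is free on the elements \<open>t k * X m\<close>,
 and its reduction modulo an ideal \<open>I\<close> of \<open>B\<close>.\<close>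

locale fpres =
 fixes A B I :: "'r::ring_1 set" and om :: "'r => 'r" and X t :: "nat => 'r" and n :: nat and u :: 'r
 assumes A: "subgrp A" "a \<in> A ==> a' \<in> A ==> a * a' \<in> A"
  and B: "subgrp B" "b \<in> B ==> b' \<in> B ==> b * b' \<in> B" "u \<in> B" "b \<in> B ==> u * b = b" "b \<in> B ==> b * u = b"
  and I: "subgrp I" "I \<subseteq> B" "b \<in> B ==> c \<in> I ==> b * c \<in> I" "b \<in> B ==> c \<in> I ==> c * b \<in> I"
  and om: "om (a - b) = om a - om b" "b \<in> B ==> b' \<in> B ==> om (b * b') = om b * om b'" "b \<in> B ==> om b \<in> A"
  and X: "X m * X l = X (m + l)" "b \<in> B ==> X m * om b = om b * X m"
  and tX: "k \<le> n ==> b \<in> B ==> t k * X m * om b \<in> A"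
  and span: "y \<in> A ==> y * om u = y ==>
   \<exists>M bb. (\<forall>k m. bb k m \<in> B) \<and> (\<forall>k m. m \<ge> M --> bb k m = 0) \<and> y = (\<Sum>k\<le>n. \<Sum>m<M. t k * X m * om (bb k m))"
  and indep: "(!!k m. bb k m \<in> B) ==> (\<Sum>k\<le>n. \<Sum>m<M. t k * X m * om (bb k m)) = 0 ==> k \<le> n ==> m < M ==> bb k m = 0"
begin

definition Y :: "'r set" where "Y = {y \<in> A. y * om u = y}"

definition ex :: "nat => (nat => nat => 'r) => 'r" where
 "ex M b = (\<Sum>k\<le>n. \<Sum>m<M. t k * X m * om (b k m))"

definition good :: "nat => (nat => nat => 'r) => 'r => bool" where
 "good M b y \<longleftrightarrow> (\<forall>k m. b k m \<in> B) \<and> (\<forall>k m. m \<ge> M --> b k m = 0) \<and> y = ex M b"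

text \<open>A choice is made because the degree bound \<open>M\<close> varies with \<open>y\<close>;
  by \<open>good_unique\<close> the coefficients on basis elements do not depend on it.\<close>

definition cf :: "'r => nat => nat => 'r" where
 "cf y = (SOME b. \<exists>M. good M b y)"

lemma om0 [simp]: "om 0 = 0" using om(1)[of 0 0] by simp

lemma om_add: "om (a + b) = om a + om b"
proof -
 have "om (- b) = - om b" using om(1)[of 0 b] by simp
 then show ?thesis using om(1)[of a "- b"] by simp
qed

lemma ex_extend: "M \<le> M' ==> (\<forall>k m. m \<ge> M --> b k m = 0) ==> ex M b = ex M' b"
 unfolding ex_def by (intro sum.cong refl sum.mono_neutral_left) auto

lemma good_cf: "y \<in> Y ==> \<exists>M. good M (cf y) y"
proof -
 assume "y \<in> Y"
 then have "\<exists>b M. good M b y" using span[of y] unfolding Y_def good_def ex_def by fast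
 then show ?thesis unfolding cf_def by (rule someI_ex)
qed

lemma cf_B: "y \<in> Y ==> cf y k m \<in> B"
 using good_cf by (auto simp: good_def)

lemma ex_diff: "ex M b - ex M b' = ex M (\<lambda>k m. b k m - b' k m)"
 by (simp add: ex_def om right_diff_distrib sum_subtractf)

lemma good_unique:
 assumes g: "good M b y" "good M' b' y" and k: "k \<le> n"
 shows "b k m = b' k m"
proof (cases "m < max M M'")
 case True
 have "ex (max M M') (\<lambda>k m. b k m - b' k m) = 0"
  using g ex_extend[of M "max M M'" b] ex_extend[of M' "max M M'" b'] by (simp add: good_def flip: ex_diff)
 then have "b k m - b' k m = 0"
  using g k True subgrpD(2)[OF B(1)] unfolding ex_def good_def by (intro indep[of "\<lambda>k m. b k m - b' k m" "max M M'"]) auto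
 then show ?thesis by simp
next
 case False
 then show ?thesis using g by (auto simp: good_def)
qed

lemma Y_subgrp: "subgrp Y"
 using A(1) unfolding Y_def subgrp_def by (auto simp: left_diff_distrib)

lemma cf_eqI: "y \<in> Y ==> good M b y ==> k \<le> n ==> cf y k m = b k m"
 using good_cf good_unique by blast

lemma tX_Y: "k \<le> n ==> b \<in> B ==> t k * X m * om b \<in> Y"
 using tX[of k b m] om(2)[of b u] B(3,5) by (simp add: Y_def mult.assoc)

lemma ex_Y: "(!!k m. b k m \<in> B) ==> ex M b \<in> Y"
 unfolding ex_def by (intro subgrp_sum[OF Y_subgrp] tX_Y) auto

lemma A_Y: "a \<in> A ==> y \<in> Y ==> a * y \<in> Y" and Y_om: "y \<in> Y ==> b \<in> B ==> y * om b \<in> Y"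
 using A(2) om(2)[of b u] om(3) B(3,5) by (auto simp: Y_def mult.assoc)

lemma cf_diff:
 assumes "y \<in> Y" "y' \<in> Y" "k \<le> n"
 shows "cf (y - y') k m = cf y k m - cf y' k m"
proof -
 obtain M M' where g: "good M (cf y) y" "good M' (cf y') y'" using good_cf assms by blast
 then have "good (max M M') (\<lambda>k m. cf y k m - cf y' k m) (y - y')"
  using ex_extend[of M "max M M'" "cf y"] ex_extend[of M' "max M M'" "cf y'"] subgrpD(2)[OF B(1)]
  by (auto simp: good_def ex_diff[symmetric])
 then show ?thesis using cf_eqI[of "y - y'"] subgrpD(2)[OF Y_subgrp] assms by simp
qed

lemma cf_0: "k \<le> n ==> cf 0 k m = 0"
 using cf_diff[of 0 0 k m] subgrpD(1)[OF Y_subgrp] by simp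

lemma cf_add: "y \<in> Y ==> y' \<in> Y ==> k \<le> n ==> cf (y + y') k m = cf y k m + cf y' k m"
 using cf_diff[of y "- y'" k m] cf_diff[of 0 y' k m] subgrpD[OF Y_subgrp] cf_0 by simp

lemma cf_sum: "(!!x. x \<in> S ==> f x \<in> Y) ==> k \<le> n ==> cf (sum f S) k m = (\<Sum>x\<in>S. cf (f x) k m)"
 by (induction S rule: infinite_finite_induct) (simp_all add: cf_0 cf_add subgrp_sum[OF Y_subgrp])

lemma cf_om:
 assumes "y \<in> Y" "b \<in> B" "k \<le> n"
 shows "y * om b \<in> Y" "cf (y * om b) k m = cf y k m * b"
proof -
 obtain M where g: "good M (cf y) y" using good_cf assms by blast
 have e: "y * om b = ex M (\<lambda>k m. cf y k m * b)"
 proof -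
  have "y = ex M (cf y)" using g by (simp add: good_def)
  then have "y * om b = (\<Sum>k\<le>n. \<Sum>m<M. t k * X m * om (cf y k m)) * om b" by (simp add: ex_def)
  then show ?thesis using om(2)[OF cf_B[OF assms(1)] assms(2)] by (simp add: ex_def sum_distrib_right mult.assoc)
 qed
 have bB: "cf y k m * b \<in> B" for k m using B(2) cf_B assms by auto
 show Y: "y * om b \<in> Y" unfolding e using bB by (rule ex_Y)
 have "good M (\<lambda>k m. cf y k m * b) (y * om b)" using g bB e by (auto simp: good_def)
 from cf_eqI[OF Y this assms(3)] show "cf (y * om b) k m = cf y k m * b" .
qed

text \<open>Freeness turns the submodule \<open>Y\<close> times \<open>I\<close> into a condition on
  coefficients. The quotient of \<open>Y\<close> by \<open>Z\<close> will be K_0 or K_1.\<close>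

definition Z :: "'r set" where
 "Z = {y \<in> Y. \<forall>k\<le>n. \<forall>m. cf y k m \<in> I}"

lemma Z_Y: "y \<in> Z ==> y \<in> Y" by (simp add: Z_def)

lemma Z_subgrp: "subgrp Z"
 unfolding subgrp_def Z_def using subgrpD[OF Y_subgrp] subgrpD[OF I(1)] by (auto simp: cf_0 cf_diff)

lemma Z_om: "y \<in> Z ==> b \<in> B ==> y * om b \<in> Z"
 unfolding Z_def using cf_om I(4) by auto

lemma Y_om_I: "y \<in> Y ==> c \<in> I ==> y * om c \<in> Z"
 unfolding Z_def using cf_om[of y c] I(2,3) cf_B by auto

lemma A_om: "a \<in> A ==> b \<in> B ==> a * om b \<in> Y"
 using A(2) om(2)[of b u] om(3) B(3,5) by (auto simp: Y_def mult.assoc)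

lemma A_om_I: "a \<in> A ==> c \<in> I ==> a * om c \<in> Z"
 using Y_om_I[OF A_om[of a u], of c] om(2)[of u c] B(3,4) I(2) by (simp add: mult.assoc subset_iff)

text \<open>The basis expansion presents an element of \<open>Z\<close> as a sum of products
  \<open>a * om c\<close>, so additive statements about \<open>Z\<close> are checked on such
  products.\<close>

lemma Z_gen: "y \<in> Z ==> subgrp S ==> (!!a c. a \<in> Y ==> c \<in> I ==> a * om c \<in> S) ==> y \<in> S"
proof -
 assume y: "y \<in> Z" and S: "subgrp S" "!!a c. a \<in> Y ==> c \<in> I ==> a * om c \<in> S"
 obtain M where g: "good M (cf y) y" using good_cf Z_Y[OF y] by blast
 have "t k * X m * om (cf y k m) \<in> S" if "k \<le> n" for k m
 proof -
  have c: "cf y k m \<in> I" using y that by (simp add: Z_def)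
  then have "(t k * X m * om u) * om (cf y k m) \<in> S" using tX_Y[OF that B(3)] S(2) by blast
  moreover have "om u * om (cf y k m) = om (cf y k m)" using om(2)[of u "cf y k m"] B(3,4) I(2) c by auto
  ultimately show ?thesis by (simp add: mult.assoc)
 qed
 then have "ex M (cf y) \<in> S" unfolding ex_def by (intro subgrp_sum[OF S(1)]) auto
 then show ?thesis using g by (simp add: good_def)
qed

lemma A_Z: "a \<in> A ==> y \<in> Z ==> a * y \<in> Z"
proof -
 assume a: "a \<in> A" and y: "y \<in> Z"
 have "y \<in> {y. a * y \<in> Z}"
 proof (rule Z_gen[OF y])
  show "subgrp {y. a * y \<in> Z}" using subgrpD[OF Z_subgrp] by (simp add: subgrp_def right_diff_distrib)
  show "a' * om c \<in> {y. a * y \<in> Z}" if "a' \<in> Y" "c \<in> I" for a' c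
   using Y_om_I[OF A_Y[OF a that(1)] that(2)] by (simp add: mult.assoc)
 qed
 then show ?thesis by simp
qed

end

text \<open>Division with remainder by right multiplication with an element \<open>f\<close> that is, up to a unit,
 monic in the variable of \<open>X\<close>.\<close>

locale fpres_div = fpres +
 fixes f :: 'a and D :: nat and zz :: "nat => 'a" and w :: 'a
 assumes fY: "y \<in> Y ==> y * f \<in> Y" and fZ: "y \<in> Z ==> y * f \<in> Z"
  and f_comm: "b \<in> B ==> om b * f - f * om b \<in> Z" and uf: "om u * f = f"
  and fexp: "f = (\<Sum>l\<le>D. X l * om (zz l))" and zz: "zz l \<in> B"
  and w: "w \<in> B" "w * zz D = u" "zz D * w = u"
begin

text \<open>The coefficients of \<open>q\<close> stand to the right of the basis, and moving
  \<open>f\<close> to their left costs an element of \<open>Z\<close> by \<open>f_comm\<close>.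
  After that the powers of the variable multiply as for polynomials, with the coefficients of
  \<open>f\<close> on the left.\<close>

lemma cf_f:
 assumes q: "q \<in> Y" and k: "k \<le> n"
 shows "cf (q * f) k m - (\<Sum>l\<le>D. if l \<le> m then zz l * cf q k (m - l) else 0) \<in> I"
proof -
 obtain M where g: "good M (cf q) q" using good_cf q by blast
 define ql where "ql = (\<lambda>l. ex (M + l) (\<lambda>k m. if l \<le> m then zz l * cf q k (m - l) else 0))"
 have bB: "(if l \<le> m then zz l * cf q k (m - l) else 0) \<in> B" for l m k
  using zz B(2) cf_B[OF q] subgrpD(1)[OF B(1)] by simp
 have qlY: "ql l \<in> Y" for l unfolding ql_def using bB by (rule ex_Y)
 have "good (M + l) (\<lambda>k m. if l \<le> m then zz l * cf q k (m - l) else 0) (ql l)" for l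
  using g bB by (auto simp: good_def ql_def)
 then have cql: "cf (ql l) k m = (if l \<le> m then zz l * cf q k (m - l) else 0)" for l
  using cf_eqI[OF qlY _ k] by blast
 have ql_eq: "ql l = (\<Sum>k\<le>n. \<Sum>m<M. t k * X m * (X l * om (zz l)) * om (cf q k m))" for l
 proof -
  have "(\<Sum>m<M + l. t k * X m * om (if l \<le> m then zz l * cf q k (m - l) else 0)) =
   (\<Sum>m<M. t k * X m * (X l * om (zz l)) * om (cf q k m))" for k
  proof -
   have "(\<Sum>m<M + l. t k * X m * om (if l \<le> m then zz l * cf q k (m - l) else 0)) =
    (\<Sum>m\<in>{l..<M + l}. t k * X m * om (zz l * cf q k (m - l)))"
    by (rule sum.mono_neutral_cong_right) auto
   also have "... = (\<Sum>m<M. t k * X (m + l) * om (zz l * cf q k m))"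
    by (rule sum.reindex_bij_witness[of _ "\<lambda>m. m + l" "\<lambda>m. m - l"]) auto
   also have "... = (\<Sum>m<M. t k * X m * (X l * om (zz l)) * om (cf q k m))"
    using om(2)[OF zz cf_B[OF q]] by (intro sum.cong refl) (simp add: mult.assoc flip: X(1))
   finally show ?thesis .
  qed
  then show ?thesis unfolding ql_def ex_def by simp
 qed
 have sum_ql: "(\<Sum>l\<le>D. ql l) = (\<Sum>k\<le>n. \<Sum>m<M. t k * X m * f * om (cf q k m))"
 proof -
  have "(\<Sum>k\<le>n. \<Sum>m<M. t k * X m * f * om (cf q k m)) =
   (\<Sum>k\<le>n. \<Sum>m<M. \<Sum>l\<le>D. t k * X m * (X l * om (zz l)) * om (cf q k m))"
   by (subst fexp) (simp add: sum_distrib_left sum_distrib_right)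
  also have "... = (\<Sum>k\<le>n. \<Sum>l\<le>D. \<Sum>m<M. t k * X m * (X l * om (zz l)) * om (cf q k m))"
   by (intro sum.cong refl sum.swap)
  also have "... = (\<Sum>l\<le>D. ql l)" unfolding ql_eq by (rule sum.swap)
  finally show ?thesis by simp
 qed
 have "q * f - (\<Sum>l\<le>D. ql l) = (\<Sum>k\<le>n. \<Sum>m<M. t k * X m * (om (cf q k m) * f - f * om (cf q k m)))"
 proof -
  have "q = (\<Sum>k\<le>n. \<Sum>m<M. t k * X m * om (cf q k m))" using g by (simp add: good_def ex_def)
  from arg_cong[OF this, of "\<lambda>y. y * f"] have "q * f = (\<Sum>k\<le>n. \<Sum>m<M. t k * X m * om (cf q k m) * f)"
   unfolding sum_distrib_right .
  then show ?thesis unfolding sum_ql by (simp add: sum_subtractf right_diff_distrib mult.assoc)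
 qed
 also have "... \<in> Z"
 proof (intro subgrp_sum[OF Z_subgrp])
  fix k m assume k: "k \<in> {..n}"
  let ?z = "om (cf q k m) * f - f * om (cf q k m)"
  have "om u * ?z = ?z"
   using uf om(2)[OF B(3) cf_B[OF q], of k m] B(4)[OF cf_B[OF q], of k m]
   by (simp add: right_diff_distrib flip: mult.assoc)
  then have "t k * X m * ?z = (t k * X m * om u) * ?z" by (simp add: mult.assoc)
  also have "... \<in> Z" using A_Z[OF tX[OF _ B(3)] f_comm[OF cf_B[OF q]]] k by simp
  finally show "t k * X m * ?z \<in> Z" .
 qed
 finally have "cf (q * f - (\<Sum>l\<le>D. ql l)) k m \<in> I" using k by (simp add: Z_def)
 moreover have "cf (q * f - (\<Sum>l\<le>D. ql l)) k m = cf (q * f) k m - (\<Sum>l\<le>D. cf (ql l) k m)"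
  using fY[OF q] qlY k by (simp add: cf_diff cf_sum subgrp_sum[OF Y_subgrp])
 ultimately show ?thesis by (simp add: cql)
qed

definition low :: "'a => bool" where
 "low r \<longleftrightarrow> (\<forall>k\<le>n. \<forall>m\<ge>D. cf r k m \<in> I)"

text \<open>Descending induction on the degree: modulo \<open>I\<close> the coefficient of
  \<open>q * f\<close> in degree m + D is \<open>zz D\<close> times that of \<open>q\<close> in
  degree m plus contributions of higher coefficients of \<open>q\<close>, and \<open>zz D\<close> is
  invertible.\<close>

lemma div_unique:
 assumes q: "q \<in> Y" and r: "r \<in> Y" "low r" and z: "q * f + r \<in> Z"
 shows "q \<in> Z"
proof -
 have top: "cf (q * f) k m \<in> I" if "k \<le> n" "m \<ge> D" for k m
 proof -
  have "cf (q * f + r) k m \<in> I" "cf r k m \<in> I" using z r that by (auto simp: Z_def low_def)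
  then show ?thesis using cf_add[OF fY[OF q] r(1) that(1)] subgrpD(2)[OF I(1)] by fastforce
 qed
 obtain M where g: "good M (cf q) q" using good_cf q by blast
 have "cf q k m \<in> I" if k: "k \<le> n" for k m
 proof (induction "M - m" arbitrary: m rule: less_induct)
  case less
  show ?case
  proof (cases "m \<ge> M")
   case True
   then show ?thesis using g subgrpD(1)[OF I(1)] by (auto simp: good_def)
  next
   case False
   let ?s = "\<lambda>l. if l \<le> m + D then zz l * cf q k (m + D - l) else 0"
   have "cf (q * f) k (m + D) - (cf (q * f) k (m + D) - (\<Sum>l\<le>D. ?s l)) \<in> I"
    using subgrpD(2)[OF I(1) top[OF k, of "m + D"] cf_f[OF q k, of "m + D"]] by simp
   then have all: "(\<Sum>l\<le>D. ?s l) \<in> I" by simp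
   have low: "(\<Sum>l<D. ?s l) \<in> I"
   proof (intro subgrp_sum[OF I(1)])
    fix l assume l: "l \<in> {..<D}"
    then have "M - (m + D - l) < M - m" using False by auto
    then have "cf q k (m + D - l) \<in> I" by (rule less)
    then show "?s l \<in> I" using I(3)[OF zz] l by auto
   qed
   have "(\<Sum>l\<le>D. ?s l) - (\<Sum>l<D. ?s l) = zz D * cf q k m"
    by (simp add: lessThan_Suc_atMost[symmetric])
   with subgrpD(2)[OF I(1) all low] have "zz D * cf q k m \<in> I" by simp
   then have "w * (zz D * cf q k m) \<in> I" using I(3)[OF w(1)] by blast
   then show ?thesis using w(2) B(4)[OF cf_B[OF q], of k m] by (simp flip: mult.assoc)
  qed
 qed
 then show ?thesis using q by (simp add: Z_def)
qed

lemma div_exists: "y \<in> Y ==> \<exists>q\<in>Y. \<exists>r\<in>Y. low r \<and> y - q * f - r \<in> Z"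
proof -
 assume y: "y \<in> Y"
 have "\<exists>q\<in>Y. \<exists>r\<in>Y. low r \<and> y - q * f - r \<in> Z"
  if "y \<in> Y" "\<forall>k\<le>n. \<forall>m\<ge>M. cf y k m \<in> I" for M y
  using that
 proof (induction M arbitrary: y)
  case 0
  then show ?case using subgrpD(1)[OF Y_subgrp] subgrpD(1)[OF Z_subgrp]
   by (intro bexI[of _ 0] bexI[of _ y]) (auto simp: low_def)
 next
  case (Suc M)
  show ?case
  proof (cases "M < D")
   case True
   then have "low y" using Suc.prems by (auto simp: low_def)
   then show ?thesis using subgrpD(1)[OF Y_subgrp] subgrpD(1)[OF Z_subgrp] Suc.prems(1)
    by (intro bexI[of _ 0] bexI[of _ y]) auto
  next
   case False
   \<comment> \<open>One step of long division: \<open>zz D * w = u\<close> makes the product of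
     this term with \<open>f\<close> have the coefficient of \<open>y\<close> in degree M as its top
     coefficient.\<close>
   define b where "b = (\<lambda>k m. if m = M - D then w * cf y k M else 0)"
   have bB: "b k m \<in> B" for k m
    using B(2)[OF w(1)] cf_B[OF Suc.prems(1)] subgrpD(1)[OF B(1)] by (simp add: b_def)
   define q0 where "q0 = ex (Suc (M - D)) b"
   have q0: "q0 \<in> Y" unfolding q0_def using bB by (rule ex_Y)
   have "good (Suc (M - D)) b q0" using bB by (auto simp: good_def q0_def b_def)
   then have cq0: "cf q0 k m = b k m" if "k \<le> n" for k m using cf_eqI[OF q0 _ that] by blast
   let ?y = "y - q0 * f"
   have yY: "?y \<in> Y" using subgrpD(2)[OF Y_subgrp Suc.prems(1) fY[OF q0]] .
   have "cf ?y k m \<in> I" if k: "k \<le> n" and m: "m \<ge> M" for k m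
   proof -
    let ?s = "\<lambda>l. if l \<le> m then zz l * cf q0 k (m - l) else 0"
    have s: "(\<Sum>l\<le>D. ?s l) = (\<Sum>l\<le>D. if l = D then (if m = M then zz D * (w * cf y k M) else 0) else 0)"
     using m False by (intro sum.cong refl) (auto simp: cq0[OF k] b_def)
    have "zz D * (w * cf y k M) = cf y k M"
     using w(3) B(4)[OF cf_B[OF Suc.prems(1)]] by (simp flip: mult.assoc)
    then have s': "(\<Sum>l\<le>D. ?s l) = (if m = M then cf y k M else 0)" unfolding s by simp
    have e: "cf ?y k m = (cf y k m - (\<Sum>l\<le>D. ?s l)) - (cf (q0 * f) k m - (\<Sum>l\<le>D. ?s l))"
     using cf_diff[OF Suc.prems(1) fY[OF q0] k] by simp
    have "cf y k m - (\<Sum>l\<le>D. ?s l) \<in> I"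
     unfolding s' using Suc.prems(2) k m subgrpD(1)[OF I(1)] by (cases "m = M") auto
    then show ?thesis unfolding e using subgrpD(2)[OF I(1) _ cf_f[OF q0 k]] by blast
   qed
   then obtain q r where qr: "q \<in> Y" "r \<in> Y" "low r" "?y - q * f - r \<in> Z"
    using Suc.IH[OF yY] by blast
   then have "y - (q0 + q) * f - r \<in> Z" by (simp add: distrib_right diff_diff_eq)
   then show ?thesis using qr subgrpD(4)[OF Y_subgrp q0 qr(1)] by blast
  qed
 qed
 moreover obtain M where "good M (cf y) y" using good_cf y by blast
 then have "\<forall>k\<le>n. \<forall>m\<ge>M. cf y k m \<in> I" using subgrpD(1)[OF I(1)] by (auto simp: good_def)
 ultimately show ?thesis using y by blast
qed

text \<open>Quotients are unique only modulo \<open>Z\<close>. The chosen one is additive and linear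
  up to \<open>Z\<close>, which suffices on the quotient modules.\<close>

definition quo :: "'a => 'a" where
 "quo y = (SOME q. q \<in> Y \<and> (\<exists>r\<in>Y. low r \<and> y - q * f - r \<in> Z))"

lemma quo: "y \<in> Y ==> quo y \<in> Y \<and> (\<exists>r\<in>Y. low r \<and> y - quo y * f - r \<in> Z)"
 unfolding quo_def by (rule someI_ex) (use div_exists in blast)

lemma low_diff: "r \<in> Y ==> r' \<in> Y ==> low r ==> low r' ==> low (r - r')"
 unfolding low_def using subgrpD(2)[OF I(1)] by (auto simp: cf_diff)

lemma quo_eqI:
 assumes y: "y \<in> Y" and q: "q \<in> Y" "r \<in> Y" "low r" "y - q * f - r \<in> Z"
 shows "quo y - q \<in> Z"
proof -
 obtain r' where r': "quo y \<in> Y" "r' \<in> Y" "low r'" "y - quo y * f - r' \<in> Z" using quo[OF y] by blast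
 have "(y - q * f - r) - (y - quo y * f - r') \<in> Z" using subgrpD(2)[OF Z_subgrp q(4) r'(4)] .
 moreover have "(y - q * f - r) - (y - quo y * f - r') = (quo y - q) * f + (r' - r)" by (simp add: algebra_simps)
 ultimately have "(quo y - q) * f + (r' - r) \<in> Z" by simp
 then show ?thesis
  by (rule div_unique[OF subgrpD(2)[OF Y_subgrp r'(1) q(1)] subgrpD(2)[OF Y_subgrp r'(2) q(2)]
   low_diff[OF r'(2) q(2) r'(3) q(3)]])
qed

lemma quo_diff: "y \<in> Y ==> y' \<in> Y ==> quo (y - y') - (quo y - quo y') \<in> Z"
proof -
 assume y: "y \<in> Y" "y' \<in> Y"
 obtain r r' where r: "quo y \<in> Y" "r \<in> Y" "low r" "y - quo y * f - r \<in> Z"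
  and r': "quo y' \<in> Y" "r' \<in> Y" "low r'" "y' - quo y' * f - r' \<in> Z" using quo y by blast
 have "(y - quo y * f - r) - (y' - quo y' * f - r') \<in> Z" using subgrpD(2)[OF Z_subgrp r(4) r'(4)] .
 moreover have "(y - quo y * f - r) - (y' - quo y' * f - r') = (y - y') - (quo y - quo y') * f - (r - r')"
  by (simp add: algebra_simps)
 ultimately have "(y - y') - (quo y - quo y') * f - (r - r') \<in> Z" by simp
 then show ?thesis
  by (rule quo_eqI[OF subgrpD(2)[OF Y_subgrp y] subgrpD(2)[OF Y_subgrp r(1) r'(1)]
   subgrpD(2)[OF Y_subgrp r(2) r'(2)] low_diff[OF r(2) r'(2) r(3) r'(3)]])
qed

lemma quo_om: "y \<in> Y ==> b \<in> B ==> quo (y * om b) - quo y * om b \<in> Z"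
proof -
 assume y: "y \<in> Y" and b: "b \<in> B"
 obtain r where r: "quo y \<in> Y" "r \<in> Y" "low r" "y - quo y * f - r \<in> Z" using quo y by blast
 have rY: "r * om b \<in> Y" "quo y * om b \<in> Y" "y * om b \<in> Y" using Y_om r y b by auto
 have 1: "(y - quo y * f - r) * om b \<in> Z" using Z_om[OF r(4) b] .
 have 2: "quo y * (om b * f - f * om b) \<in> Z" using A_Z[OF _ f_comm[OF b]] r(1) by (simp add: Y_def)
 have "y * om b - quo y * om b * f - r * om b = (y - quo y * f - r) * om b - quo y * (om b * f - f * om b)"
  by (simp add: algebra_simps)
 then have "y * om b - quo y * om b * f - r * om b \<in> Z" using subgrpD(2)[OF Z_subgrp 1 2] by simp
 moreover have "low (r * om b)" using r(3) cf_om(2)[OF r(2) b] I(4)[OF b] by (simp add: low_def)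
 ultimately show ?thesis by (intro quo_eqI[OF rY(3,2,1)])
qed

lemma low_0: "low 0" unfolding low_def using subgrpD(1)[OF I(1)] by (simp add: cf_0)

lemma quo_f: "y \<in> Y ==> quo (y * f) - y \<in> Z"
 using quo_eqI[of "y * f" y 0] fY low_0 subgrpD(1)[OF Y_subgrp] subgrpD(1)[OF Z_subgrp] by simp

lemma quo_Z: "y \<in> Z ==> quo y \<in> Z"
 using quo_eqI[of y 0 0] low_0 subgrpD(1)[OF Y_subgrp] Z_Y by simp

end

section \<open>The modules before and after the map\<close>

lemma Iseq_count: "nu \<in> Iseq b \<longleftrightarrow> (\<forall>j. count_list nu j = b j)"
proof -
 have "length (filter (\<lambda>x. x = j) nu) = count_list nu j" for j by (induction nu) auto
 then show ?thesis by (simp add: Iseq_def)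
qed

lemma Iseq_sw: "1 \<le> l ==> l < length nu ==> sw l nu \<in> Iseq b \<longleftrightarrow> nu \<in> Iseq b"
 using mset_eq_length_filter[OF mset_swap[of l nu "l - 1"]] by (simp add: Iseq_count sw_def)

lemma Iseq_length: "nu \<in> Iseq b ==> length nu = (\<Sum>j\<in>UNIV. b (j :: 'i::finite))"
 using sum_count_set[of nu "UNIV :: 'i set"] by (simp add: Iseq_count)

lemma Iseq_snoc: "nu @ [i] \<in> Iseq (b(i := b i + 1)) \<longleftrightarrow> nu \<in> Iseq b"
 and Iseq_Cons: "i # nu \<in> Iseq (b(i := b i + 1)) \<longleftrightarrow> nu \<in> Iseq b"
 by (auto simp: Iseq_count split: if_splits)

definition bl :: "'i list set => ('i, 'k::comm_ring_1) op" where
 "bl S = dg (\<lambda>mu. if mu \<in> S then 1 else 0)"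

lemma ap_bl [simp]: "ap (bl S) f mu = (if mu \<in> S then f mu else 0)"
 by (simp add: bl_def)

lemma bl_idem [simp]: "bl S * bl S = bl S"
 by (rule op_eqI) simp

lemma bl_sum: "finite S ==> bl S = (\<Sum>nu\<in>S. Eo nu)"
 by (rule op_eqI) (simp add: ap_sum_left)

context klr begin

lemma bl_To:
 assumes "S \<subseteq> Iseqs m" "!!l nu. 1 \<le> l ==> l < length nu ==> sw l nu \<in> S \<longleftrightarrow> nu \<in> S"
 shows "To l * bl S = bl S * To l"
 by (rule op_eqI) (use assms(2)[of l] in \<open>auto simp: ap_To\<close>)

text \<open>A set of sequences stable under all transpositions gives an idempotent that commutes
  with every crossing; this covers both block idempotents that occur.\<close>

lemma bl_commute:
 assumes S: "S \<subseteq> Iseqs m" "!!l nu. 1 \<le> l ==> l < length nu ==> sw l nu \<in> S \<longleftrightarrow> nu \<in> S"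
  and x: "x \<in> OA m K"
 shows "x * bl S = bl S * x"
 using x
proof (induction rule: OA_induct)
 case (diff x y)
 then show ?case by (simp add: left_diff_distrib right_diff_distrib)
next
 case (scal c)
 have "pr m * bl S = bl S * pr m" unfolding pr_def bl_def by (rule dg_commute)
 then show ?case by (metis mult.assoc po_cst_commute)
next
 case (gen g x)
 have "gop g * bl S = bl S * gop g"
  by (cases g) (simp_all add: bl_To[OF S], simp_all add: bl_def Eo_commute(1) po_commute(2))
 have "gop g * x * bl S = gop g * bl S * x" by (simp only: mult.assoc gen(4))
 then show ?case by (simp only: \<open>gop g * bl S = bl S * gop g\<close> mult.assoc)
qed

lemma pr_po_left: "pr m * (po p * x) = po p * (pr m * x)"
 and po_left_commute: "po p * (po q * x) = po q * (po p * x)"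
 by (rule op_eqI, simp add: mult.left_commute)+

lemma pr_bl: "S \<subseteq> Iseqs m ==> pr m * bl S = bl S" "S \<subseteq> Iseqs m ==> bl S * pr m = bl S"
 by (rule op_eqI, auto simp: Iseqs_def)+

lemma bl_OA: "S \<subseteq> Iseqs m ==> (bl S :: ('i, 'k) op) \<in> OA m K"
proof -
 assume S: "S \<subseteq> Iseqs m"
 have "(bl S :: ('i, 'k) op) = pr m * bl S" using pr_bl(1)[OF S] by simp
 also have "... = (\<Sum>nu\<in>S. pr m * gop (E nu))"
  by (simp add: bl_sum[OF finite_subset[OF S finite_Iseqs]] sum_distrib_left)
 finally show ?thesis using S by (simp only:) (intro subgrp_sum[OF OA_subgrp] OA_gen, auto simp: Iseqs_def)
qed

lemma rho_sum_ee: "S \<subseteq> Iseqs m ==> rho m (\<Sum>nu\<in>S. ee nu :: ('i, 'k) fa) = bl S"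
proof -
 assume S: "S \<subseteq> Iseqs m"
 then have "rho m (\<Sum>nu\<in>S. ee nu :: ('i, 'k) fa) = pr m * (\<Sum>nu\<in>S. Eo nu)"
  unfolding rho_def by (subst rh_sum[of _ _ m]) (auto intro: FA_ee)
 also have "... = pr m * bl S" by (simp add: bl_sum[OF finite_subset[OF S finite_Iseqs]])
 finally show ?thesis using pr_bl[OF S] by simp
qed

lemma OA_FA: "{1..<m} \<subseteq> K ==> OA m K = rho m ` FA m"
 unfolding OA_def using FA_alg[of m K, where ?'a = 'i and ?'b = 'k] by simp

lemma FA_aL: "(aL hL a m p :: ('i, 'k) fa) \<in> FA m"
 unfolding aL_def by (auto intro!: FA_intros FA_ee)

lemma po_OA: "1 \<le> v ==> v \<le> m ==> po (Vr v ^ s) * pr m \<in> OA m K"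
proof (induction s)
 case 0
 then show ?case by (simp add: OA_pr)
next
 case (Suc s)
 have "pr m * gop (X v) \<in> OA m K" using Suc.prems by (intro OA_gen) auto
 from OA_mult[OF this Suc.IH[OF Suc.prems]] have "pr m * po (Vr v) * (po (Vr v ^ s) * pr m) \<in> OA m K" by simp
 moreover have "pr m * po (Vr v) * (po (Vr v ^ s) * pr m) = po (Vr v ^ Suc s) * pr m"
  by (rule op_eqI) (simp add: mult.assoc)
 ultimately show ?case by simp
qed

lemma chop_OA: "chain_ok j c ==> j < m ==> k \<le> j ==> chop c k * pr m \<in> OA m {1..<m}"
 using FA_tch[of j m c k] OA_FA[of m "{1..<m}"] rho_tch[of m c k] chop_pr[of c k m] by simp (metis image_eqI)

lemma Hp_OA: "(Hp n i :: ('i, 'k) op) \<in> OA (Suc n) K"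
proof -
 have "(Hp n i :: ('i, 'k) op) = bl {nu. length nu = Suc n \<and> hd nu = i}" by (rule op_eqI) simp
 then show ?thesis using bl_OA[of "{nu. length nu = Suc n \<and> hd nu = i}" "Suc n" K] by (simp add: Iseqs_def subset_iff)
qed

lemma iot_OA: "x \<in> OA n {1..<n} ==> iot i x \<in> OA (Suc n) {1..<Suc n}"
 using OA_FA[of n "{1..<n}"] OA_FA[of "Suc n" "{1..<Suc n}"] by (auto simp flip: rho_iota intro: FA_iota)

lemma xio_OA: "x \<in> OA n {1..<n} ==> xio n i x \<in> OA (Suc n) {1..<Suc n}"
proof -
 assume "x \<in> OA n {1..<n}"
 then obtain f where f: "f \<in> FA n" "x = rho n f" using OA_FA[of n "{1..<n}"] by auto
 have "rho (Suc n) (xi f) * Hp n i \<in> OA (Suc n) {1..<Suc n}"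
  by (intro OA_mult Hp_OA) (use OA_FA[of "Suc n" "{1..<Suc n}"] FA_xi[OF f(1)] in blast)
 then show ?thesis using f by (simp add: rho_xi)
qed

lemma iot_po_commute: "x \<in> OA n {1..<n} ==> iot i x * po (Vr (Suc n) ^ m) = po (Vr (Suc n) ^ m) * iot i x"
proof -
 assume x: "x \<in> OA n {1..<n}"
 have "iot i x * po (Vr (Suc n) ^ m) = iot i (x * pr n) * Lp n i * po (Vr (Suc n) ^ m)"
  using OA_unit[OF x] iot_Lp[of x n i] by simp
 also have "... = iot i x * iot i (po (Vr (Suc n) ^ m) * pr n)"
  using OA_unit[OF x] by (simp add: iot_po po_Lp mult.assoc)
 also have "... = iot i (x * po (Vr (Suc n) ^ m) * pr n)" by (simp add: iot_mult mult.assoc)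
 also have "... = iot i (po (Vr (Suc n) ^ m) * (x * pr n))" by (simp add: OA_po_commute[OF x] mult.assoc)
 finally show ?thesis using OA_unit[OF x] by (simp add: iot_po')
qed

lemma cyci_power: "sub (\<lambda>j. Vr (cyci n j)) (Vr (Suc n) ^ m) = Vr 1 ^ m"
 by (simp add: sub.power) (simp add: sub_def cyci_def)

lemma xio_po_commute: "x \<in> OA n {1..<n} ==> xio n i x * po (Vr 1 ^ m) = po (Vr 1 ^ m) * xio n i x"
proof -
 assume x: "x \<in> OA n {1..<n}"
 have "xio n i x * po (Vr 1 ^ m) = Si n i * (iot i x * po (Vr (Suc n) ^ m)) * Sg n i"
  using Sg_po[of "Vr (Suc n) ^ m :: 'k mpoly" n i] unfolding xio_def cyci_power by (simp only: mult.assoc)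
 also have "... = xio n i (po (Vr (Suc n) ^ m) * x)"
  by (simp add: iot_po_commute[OF x] iot_po' xio_def)
 finally show ?thesis by (simp add: xio_po cyci_power)
qed

end

locale klr_cyc = klr +
 fixes hL :: "'a => int" and ca :: "'a => nat => 'b" and n :: nat and i :: 'a and bt :: "'a => nat"
 assumes sum_bt: "(\<Sum>j\<in>UNIV. bt j) = n" and ca0: "ca j 0 = 1"
begin

abbreviation "N \<equiv> Suc n"

text \<open>The dictionary for the abstract modules: \<open>eB\<close> is e(beta), \<open>BB\<close>
  is R(beta), \<open>II\<close> its cyclotomic ideal, so that \<open>BB\<close> modulo
  \<open>II\<close> is R^Lambda(beta), and \<open>AA\<close> is R(n+1), all realized by
  operators.\<close>

definition eB :: "('a, 'b) op" where "eB = bl (Iseq bt)"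
definition BB :: "('a, 'b) op set" where "BB = {x \<in> OA n {1..<n}. x * eB = x}"
definition II :: "('a, 'b) op set" where "II = {rho n f * eB | f. f \<in> JL t w hL ca n}"
definition AA :: "('a, 'b) op set" where "AA = OA N {1..<N}"

lemma Iseq_bt: "Iseq bt \<subseteq> Iseqs n"
 using Iseq_length[of _ bt] sum_bt by (auto simp: Iseqs_def)

lemma eB_commute: "x \<in> OA n K ==> x * eB = eB * x"
 unfolding eB_def by (rule bl_commute[OF Iseq_bt]) (simp_all add: Iseq_sw)

lemma eB_OA: "eB \<in> OA n K" unfolding eB_def by (rule bl_OA[OF Iseq_bt])

lemma JL_FA: "f \<in> JL t w hL ca n ==> f \<in> FA n"
 unfolding JL_def using rels_FA FA_aL by (intro rideal_sub) auto

lemma BB_mem: "b \<in> BB ==> b \<in> OA n {1..<n}" by (simp add: BB_def)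

lemma II_BB: "II \<subseteq> BB"
proof
 fix x assume "x \<in> II"
 then obtain f where f: "f \<in> FA n" "x = rho n f * eB" using JL_FA by (auto simp: II_def)
 have "rho n f \<in> OA n {1..<n}" using f OA_FA[of n "{1..<n}"] by blast
 then have "x \<in> OA n {1..<n}" unfolding f using eB_OA by (rule OA_mult)
 then show "x \<in> BB" unfolding f BB_def eB_def by (simp add: mult.assoc)
qed

lemma II_ideal: "subgrp II" "b \<in> BB ==> c \<in> II ==> b * c \<in> II" "b \<in> BB ==> c \<in> II ==> c * b \<in> II"
proof -
 have J: "subgrp (JL t w hL ca n)" unfolding JL_def by (rule subgrp_rideal)
 show "subgrp II" unfolding subgrp_def
 proof (intro conjI ballI)
  have "rho n 0 * eB \<in> II" unfolding II_def using subgrpD(1)[OF J] by blast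
  then show "0 \<in> II" by simp
  fix x y assume "x \<in> II" "y \<in> II"
  then obtain f g where fg: "f \<in> JL t w hL ca n" "g \<in> JL t w hL ca n" "x = rho n f * eB" "y = rho n g * eB"
   by (auto simp: II_def)
  have "x - y = rho n (f - g) * eB" using fg(1,2)[THEN JL_FA] unfolding fg(3,4) by (simp add: rho_diff left_diff_distrib)
  then show "x - y \<in> II" unfolding II_def using subgrpD(2)[OF J fg(1,2)] by blast
 qed
 assume b: "b \<in> BB" and c: "c \<in> II"
 obtain f where f: "f \<in> JL t w hL ca n" "c = rho n f * eB" using c by (auto simp: II_def)
 obtain g where g: "g \<in> FA n" "b = rho n g" using b OA_FA[of n "{1..<n}"] by (auto simp: BB_def)
 have m: "fmul g f \<in> JL t w hL ca n" "fmul f g \<in> JL t w hL ca n"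
  using rideal_fmul[OF _ g(1)] f(1) unfolding JL_def by blast+
 have "b * c = rho n (fmul g f) * eB" using f g by (simp add: rho_fmul JL_FA mult.assoc)
 then show "b * c \<in> II" unfolding II_def using m(1) by blast
 have "c * b = rho n (fmul f g) * eB"
  using f(1) g(1) unfolding f(2) by (simp add: rho_fmul JL_FA mult.assoc g(2)[symmetric] eB_commute[OF BB_mem[OF b]])
 then show "c * b \<in> II" unfolding II_def using m(2) by blast
qed

text \<open>Both freeness statements have this proof. Chains span over the subalgebra without one
  crossing, that subalgebra expands in powers of the variable of the strand left alone, and the two
  independence statements combine because this variable commutes with the coefficients.\<close>

lemma fpres_klr:
 assumes om1: "!!a b. om (a - b) = om a - om b"
  and om2: "!!a b. a \<in> OA n {1..<n} ==> om (a * b) = om a * om b"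
  and omA: "!!b. b \<in> OA n {1..<n} ==> om b \<in> AA"
  and v: "1 \<le> v" "v \<le> N" and omv: "!!b m. b \<in> OA n {1..<n} ==> om b * po (Vr v ^ m) = po (Vr v ^ m) * om b"
  and ch: "chain_ok n ch"
  and spQ: "!!y. y \<in> OA N ({1..n} - {ch 0}) ==>
   \<exists>M b. (\<forall>m. b m \<in> OA n {1..<n}) \<and> (\<forall>m\<ge>M. b m = 0) \<and> y * om (pr n) = pexp om v M b"
  and indc: "!!c k. (!!k. k \<le> n ==> c k * Xo v = Xo v * c k) ==> (!!k. k \<le> n ==> pr N * c k = c k) ==>
   (\<Sum>k\<le>n. chop ch k * c k) = 0 ==> k \<le> n ==> c k = 0"
  and indp: "!!b M m. (!!m. b m \<in> OA n {1..<n}) ==> pexp om v M b = 0 ==> m < M ==> b m = 0"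
 shows "fpres AA BB II om (\<lambda>m. po (Vr v ^ m)) (chop ch) n eB"
proof
 show "subgrp AA" unfolding AA_def by (rule OA_subgrp)
 show "a * a' \<in> AA" if "a \<in> AA" "a' \<in> AA" for a a' using that OA_mult by (auto simp: AA_def)
 show "subgrp BB" using subgrpD[OF OA_subgrp] unfolding BB_def subgrp_def by (auto simp: left_diff_distrib)
 show "b * b' \<in> BB" if "b \<in> BB" "b' \<in> BB" for b b' using that OA_mult by (auto simp: BB_def mult.assoc)
 show "eB \<in> BB" using eB_OA by (simp add: BB_def) (simp add: eB_def)
 show "eB * b = b" "b * eB = b" if "b \<in> BB" for b using that eB_commute by (auto simp: BB_def)
 show "subgrp II" "II \<subseteq> BB" by (rule II_ideal II_BB)+
 show "b * c \<in> II" "c * b \<in> II" if "b \<in> BB" "c \<in> II" for b c using II_ideal that by auto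
 show "om (a - b) = om a - om b" for a b by (rule om1)
 show "om (b * b') = om b * om b'" if "b \<in> BB" "b' \<in> BB" for b b' using om2 that by (simp add: BB_def)
 show "om b \<in> AA" if "b \<in> BB" for b using omA that by (simp add: BB_def)
 show "po (Vr v ^ m) * po (Vr v ^ l) = (po (Vr v ^ (m + l)) :: ('a, 'b) op)" for m l by (simp add: po_mult power_add)
 show "po (Vr v ^ m) * om b = om b * po (Vr v ^ m)" if "b \<in> BB" for b m using omv that by (simp add: BB_def)
 have omN: "om b = pr N * om b" if "b \<in> BB" for b using omA[OF BB_mem[OF that]] OA_unit by (simp add: AA_def)
 show "chop ch k * po (Vr v ^ m) * om b \<in> AA" if k: "k \<le> n" and b: "b \<in> BB" for k m b
 proof -
  have "(chop ch k * pr N) * (po (Vr v ^ m) * pr N) * om b \<in> AA"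
   using OA_mult[OF OA_mult[OF chop_OA[OF ch lessI k] po_OA[OF v]] omA[OF BB_mem[OF b], unfolded AA_def]]
   unfolding AA_def .
  moreover have "(chop ch k * pr N) * (po (Vr v ^ m) * pr N) * om b = chop ch k * po (Vr v ^ m) * om b"
   by (simp only: mult.assoc pr_po_left omN[OF b, symmetric])
  ultimately show ?thesis by simp
 qed
 show "\<exists>M bb. (\<forall>k m. bb k m \<in> BB) \<and> (\<forall>k m. m \<ge> M --> bb k m = 0) \<and>
   y = (\<Sum>k\<le>n. \<Sum>m<M. chop ch k * po (Vr v ^ m) * om (bb k m))"
  if y: "y \<in> AA" "y * om eB = y" for y
 proof -
  have om0: "om 0 = 0" using om1[of 0 0] by simp
  obtain f where f: "f \<in> alg N {1..n}" "y = rho N f" using y(1) by (auto simp: AA_def OA_def atLeastLessThanSuc_atLeastAtMost)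
  obtain h where h: "!!k. h k \<in> alg N ({1..n} - {ch 0})" "cg N f (\<Sum>k\<le>n. fmul (tch ch k) (h k))"
   using left_span[OF lessI ch f(1)] by blast
  have hF: "h k \<in> FA N" for k using alg_FA[OF h(1)] .
  have tF: "tch ch k \<in> FA N" if "k \<le> n" for k using FA_tch[OF lessI ch that] by simp
  have "y = rho N (\<Sum>k\<le>n. fmul (tch ch k) (h k))"
   unfolding f(2) by (rule cg_rho[OF h(2) alg_FA[OF f(1)]]) (intro FA_sum FA_fmul hF tF, simp)
  also have "... = (\<Sum>k\<le>n. chop ch k * rho N (h k))"
   using hF tF by (subst rho_sum) (auto intro!: FA_fmul simp: rho_tch_mult)
  finally have yh: "y = (\<Sum>k\<le>n. chop ch k * rho N (h k))" .
  have "\<forall>k. \<exists>M b. (\<forall>m. b m \<in> OA n {1..<n}) \<and> (\<forall>m\<ge>M. b m = 0) \<and> rho N (h k) * om (pr n) = pexp om v M b"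
   using spQ h(1) by (auto simp: OA_def)
  then obtain M b where b: "!!k m. b k m \<in> OA n {1..<n}" "!!k m. m \<ge> M k ==> b k m = 0"
   "!!k. rho N (h k) * om (pr n) = pexp om v (M k) (b k)" by metis
  define bb where "bb = (\<lambda>k m. if k \<le> n then b k m * eB else 0)"
  define M' where "M' = (\<Sum>k\<le>n. M k)"
  have M': "M k \<le> M'" if "k \<le> n" for k unfolding M'_def using that by (intro member_le_sum) auto
  have bB: "bb k m \<in> BB" for k m
   using OA_mult[OF b(1) eB_OA] subgrpD(1)[OF OA_subgrp] by (auto simp: bb_def BB_def mult.assoc) (simp add: eB_def)
  have "rho N (h k) * om eB = (\<Sum>m<M'. po (Vr v ^ m) * om (bb k m))" if k: "k \<le> n" for k
  proof -
   have "om eB = om (pr n) * om eB" using om2[OF OA_pr[of n "{1..<n}"], of eB] OA_unit[OF eB_OA] by simp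
   from this[symmetric] have "rho N (h k) * om eB = pexp om v (M k) (b k) * om eB"
    by (simp only: b(3)[symmetric] mult.assoc)
   also have "pexp om v (M k) (b k) = pexp om v M' (b k)" by (rule pexp_extend) (use om0 M'[OF k] b(2) in auto)
   finally show ?thesis using k om2[OF b(1)] by (simp add: pexp_def sum_distrib_right mult.assoc bb_def)
  qed
  then have "y * om eB = (\<Sum>k\<le>n. \<Sum>m<M'. chop ch k * po (Vr v ^ m) * om (bb k m))"
   unfolding yh by (simp add: sum_distrib_right sum_distrib_left mult.assoc)
  moreover have "bb k m = 0" if "m \<ge> M'" for k m
  proof (cases "k \<le> n")
   case True
   then show ?thesis using b(2)[of k m] M'[of k] that by (simp add: bb_def)
  qed (simp add: bb_def)
  ultimately show ?thesis using bB y(2) by (intro exI[of _ M'] exI[of _ bb]) simp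
 qed
 show "bb k m = 0" if bb: "!!k m. bb k m \<in> BB" and z: "(\<Sum>k\<le>n. \<Sum>m<M. chop ch k * po (Vr v ^ m) * om (bb k m)) = 0"
  and k: "k \<le> n" and m: "m < M" for bb M k m
 proof -
  have "pexp om v M (bb k) = 0"
  proof (rule indc[where c = "\<lambda>k. pexp om v M (bb k)"])
   show "pexp om v M (bb k) * Xo v = Xo v * pexp om v M (bb k)" for k
   proof -
    have e: "om (bb k m) * Xo v = Xo v * om (bb k m)" for m using omv[OF BB_mem[OF bb], of k m 1] by simp
    have "po (Vr v ^ m) * om (bb k m) * Xo v = Xo v * (po (Vr v ^ m) * om (bb k m))" for m
     by (simp only: mult.assoc e po_left_commute[of "Vr v ^ m" "Vr v"])
    then show ?thesis by (simp add: pexp_def sum_distrib_right sum_distrib_left)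
   qed
   show "pr N * pexp om v M (bb k) = pexp om v M (bb k)" for k
    unfolding pexp_def sum_distrib_left
    by (intro sum.cong refl) (simp only: pr_po_left omN[OF bb, symmetric])
   show "(\<Sum>k\<le>n. chop ch k * pexp om v M (bb k)) = 0"
    using z by (simp add: pexp_def sum_distrib_left mult.assoc)
   show "k \<le> n" by (rule k)
  qed
  then show ?thesis by (rule indp[OF BB_mem[OF bb] _ m])
 qed
qed

text \<open>The side of K_0: representatives tau_{n-k+1} ... tau_n, and the variable x_{n+1} of the
  added last strand.\<close>

sublocale K0: fpres AA BB II "iot i" "\<lambda>m. po (Vr N ^ m)" "chop (\<lambda>r. n - r)" n eB
proof (rule fpres_klr)
 show "\<exists>M b. (\<forall>m. b m \<in> OA n {1..<n}) \<and> (\<forall>m\<ge>M. b m = 0) \<and> y * iot i (pr n) = pexp (iot i) N M b"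
  if "y \<in> OA N ({1..n} - {n - 0})" for y
 proof -
  have "{1..n} - {n - 0} = {1..<n}" by auto
  then show ?thesis using Lp_span[of y n i] that by (simp add: iot_pr)
 qed
 show "c k = 0" if "!!k. k \<le> n ==> c k * Xo N = Xo N * c k" "!!k. k \<le> n ==> pr N * c k = c k"
  "(\<Sum>k\<le>n. chop (\<lambda>r. n - r) k * c k) = 0" "k \<le> n" for c k
  using indep_down[of n N c k] that by simp
qed (use iot_diff iot_mult iot_OA iot_po_commute chain_ok_down pexp_indep_iot[of _ n i] in \<open>auto simp: AA_def\<close>)

text \<open>The side of K_1: representatives tau_k ... tau_1, and the variable x_1 of the added
  first strand.\<close>

sublocale K1: fpres AA BB II "xio n i" "\<lambda>m. po (Vr 1 ^ m)" "chop Suc" n eB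
proof (rule fpres_klr)
 show "\<exists>M b. (\<forall>m. b m \<in> OA n {1..<n}) \<and> (\<forall>m\<ge>M. b m = 0) \<and> y * xio n i (pr n) = pexp (xio n i) 1 M b"
  if "y \<in> OA N ({1..n} - {Suc 0})" for y
 proof -
  have "{1..n} - {Suc 0} = {2..n}" by auto
  then show ?thesis using Hp_span[of y n i] that by (simp only: xio_pr)
 qed
 show "c k = 0" if "!!k. k \<le> n ==> c k * Xo 1 = Xo 1 * c k" "!!k. k \<le> n ==> pr N * c k = c k"
  "(\<Sum>k\<le>n. chop Suc k * c k) = 0" "k \<le> n" for c k
  using indep_up[of n N c k] that by simp
 show "xio n i (a * b) = xio n i a * xio n i b" if "a \<in> OA n {1..<n}" for a b
  using OA_unit[OF that] by (simp add: xio_mult)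
 show "xio n i b \<in> AA" if "b \<in> OA n {1..<n}" for b using xio_OA[OF that] by (simp add: AA_def)
 show "chain_ok n Suc" by (rule chain_ok_up)
 show "b m = 0" if "!!m. b m \<in> OA n {1..<n}" "pexp (xio n i) 1 M b = 0" "m < M" for b M m
  by (rule pexp_indep_xio[OF that])
qed (simp_all only: xio_diff xio_po_commute le_refl le_simps)

text \<open>The defining relations act by zero, so among operators the generator a(x_1) of the
  cyclotomic ideal is the only one left.\<close>

lemma II_induct:
 assumes x: "x \<in> II" and S: "subgrp S"
  and g: "!!p q. p \<in> OA n {1..<n} ==> q \<in> OA n {1..<n} ==> p * rho n (aL hL ca n 1) * q * eB \<in> S"
 shows "x \<in> S"
proof -
 obtain f where f: "f \<in> JL t w hL ca n" "x = rho n f * eB" using x by (auto simp: II_def)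
 from f(1) have "f \<in> FA n \<and> rho n f * eB \<in> S"
  unfolding JL_def
 proof induction
  case rid_zero
  then show ?case using subgrpD(1)[OF S] by simp
 next
  case (rid_gen s a b)
  then have s: "s \<in> FA n" using rels_FA FA_aL by auto
  have ab: "rho n a \<in> OA n {1..<n}" "rho n b \<in> OA n {1..<n}" using rid_gen OA_FA[of n "{1..<n}"] by auto
  have "rho n (fmul (fmul a s) b) * eB = rho n a * rho n s * rho n b * eB" using rid_gen s by (simp add: rho_fmul FA_fmul)
  moreover have "rho n s = 0 \<or> s = aL hL ca n 1" using rid_gen(1) rho_rels by auto
  ultimately have "rho n (fmul (fmul a s) b) * eB \<in> S" using g[OF ab] subgrpD(1)[OF S] by auto
  then show ?case using rid_gen s by (simp add: FA_fmul)
 next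
  case (rid_add x y)
  then show ?case using subgrpD(4)[OF S] by (simp add: rho_add FA_add distrib_right)
 qed
 then show ?thesis using f by simp
qed

end

text \<open>The operators act on polynomials in infinitely many variables, but only x_1, ..., x_n
  belong to R(n). The clauses match the way a polynomial is later moved through a product, one
  variable at a time.\<close>

inductive_set pvars :: "nat => 'k::comm_ring_1 mpoly set" for n where
 pvars_cst: "cst c \<in> pvars n"
| pvars_var: "1 \<le> j ==> j \<le> n ==> p \<in> pvars n ==> Vr j * p \<in> pvars n"
| pvars_scal: "p \<in> pvars n ==> cst c * p \<in> pvars n"
| pvars_add: "p \<in> pvars n ==> q \<in> pvars n ==> p + q \<in> pvars n"

lemma pvars_mult: "p \<in> pvars n ==> q \<in> pvars n ==> p * q \<in> pvars n"
 by (induction p rule: pvars.induct) (auto simp: mult.assoc distrib_right intro: pvars.intros)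

lemma pvars_1: "1 \<in> pvars n" using pvars_cst[of 1 n] by simp

lemma pvars_0: "0 \<in> pvars n" using pvars_cst[of 0 n] by simp

lemma pvars_Vr: "1 \<le> j ==> j \<le> n ==> Vr j \<in> pvars n"
 using pvars_var[OF _ _ pvars_1] by simp

lemma pvars_power: "p \<in> pvars n ==> p ^ m \<in> pvars n"
 by (induction m) (auto intro: pvars_1 pvars_mult)

lemma pvars_prod: "(!!x. x \<in> S ==> f x \<in> pvars n) ==> prod f S \<in> pvars n"
 by (induction S rule: infinite_finite_induct) (auto intro: pvars_1 pvars_mult)

lemma pvars_uminus: "p \<in> pvars n ==> - p \<in> pvars n"
proof -
 assume "p \<in> pvars n"
 then have "cst (- 1) * p \<in> pvars n" by (rule pvars_scal)
 then show ?thesis by (simp add: ring_hom_fun.uminus[OF ring_hom_cst])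
qed

lemma pvars_diff: "p \<in> pvars n ==> q \<in> pvars n ==> p - q \<in> pvars n"
 using pvars_add[of p n "- q"] pvars_uminus[of q n] by simp

lemma sub_pvars: "(!!j. v j \<in> pvars n) ==> sub v p \<in> pvars n"
proof (rule mpoly_add_induct[OF ring_hom_cst, where P = "\<lambda>p. sub v p \<in> pvars n"])
 assume v: "!!j. v j \<in> pvars n"
 fix m and c :: 'a
 have "insm v m \<in> pvars n" unfolding insm_def by (intro pvars_prod pvars_power v)
 then show "sub v (Poly_Mapping.single m c) \<in> pvars n" by (simp add: ins_single ring_hom_cst pvars_scal)
qed (simp add: sub.add pvars_add)

lemma ev_pvars: "set ks \<subseteq> {1..n} ==> ev ks p \<in> pvars n"
 unfolding ev_def by (rule sub_pvars) (auto intro!: pvars_1 pvars_Vr simp: subset_iff)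

lemma p2_pvars: "1 \<le> a ==> a \<le> n ==> 1 \<le> b ==> b \<le> n ==> p2 w a b \<in> pvars n"
 using ev_pvars[of "[a, b]" n "p2 w 0 1"] by (simp add: ev_p2)

lemma commute_prod_list: "(!!y. y \<in> set ys ==> x * y = y * x) ==> x * prod_list ys = prod_list ys * (x :: 'r::monoid_mult)"
proof (induction ys)
 case (Cons y ys)
 then have 1: "x * prod_list ys = prod_list ys * x" and 2: "x * y = y * x" by auto
 have "x * (y * prod_list ys) = y * (x * prod_list ys)" by (simp add: 2 flip: mult.assoc)
 then show ?case by (simp add: 1 mult.assoc)
qed simp

text \<open>The position of the \<open>k\<close>-th variable after moving the first one past \<open>m\<close> others.\<close>

primrec sx :: "nat => nat => nat" where
 "sx 0 k = k" | "sx (Suc m) k = sidx (Suc m) (sx m k)"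

text \<open>The effect on a polynomial of passing \<open>Psi m\<close>, which moves the first strand
  behind m others.\<close>

primrec spc :: "nat => 'k::comm_ring_1 mpoly => 'k mpoly" where
 "spc 0 p = p" | "spc (Suc m) p = sp (Suc m) (spc m p)"

lemma sx_eq: "1 \<le> k ==> sx m k = (if k = 1 then Suc m else if k \<le> Suc m then k - 1 else k)"
 by (induction m) (auto simp: sidx_def)

lemma spc_simps: "spc m (p * q) = spc m p * spc m q" "spc m (p - q) = spc m p - spc m q"
 "spc m (- p) = - spc m p" "spc m (Vr k) = Vr (sx m k)"
 by (induction m) (simp_all add: sub.mult sub.diff sub.uminus)

text \<open>The colours seen while the strand of colour \<open>i\<close> has m of the others to its
  left, running from (i, nu) to (nu, i).\<close>

definition cycl :: "nat => 'i list => 'i => 'i list" where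
 "cycl m nu i = take m nu @ i # drop m nu"

lemma length_cycl [simp]: "length (cycl m nu i) = Suc (length nu)"
 by (simp add: cycl_def)

lemma cycl_0: "cycl 0 nu i = i # nu" and cycl_full: "cycl (length nu) nu i = nu @ [i]"
 by (simp_all add: cycl_def)

lemma nth1_cycl: "1 \<le> k ==> k \<le> Suc (length nu) ==> m \<le> length nu ==>
 nth1 (cycl m nu i) k = (if k = Suc m then i else if k \<le> m then nth1 nu k else nth1 nu (k - 1))"
 unfolding cycl_def nth1_def by (auto simp: nth_append min_def nth_Cons' numeral_2_eq_2)

lemma sw_cycl: "m < length nu ==> sw (Suc m) (cycl m nu i) = cycl (Suc m) nu i"
 by (rule nth1_eqI) (auto simp: nth1_sw nth1_cycl sidx_def)

section \<open>Products of crossings and of intertwiners\<close>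

context klr begin

lemma PP_pvars: "1 \<le> a ==> a \<le> n ==> 1 \<le> b ==> b \<le> n ==> PP i a b \<in> pvars n"
 and QQ_pvars: "1 \<le> a ==> a \<le> n ==> 1 \<le> b ==> b \<le> n ==> QQ i j a b \<in> pvars n"
 by (simp_all add: PP_def QQ_def p2_pvars)

lemma Th_op: "1 \<le> j ==> Th j = To j * Xo (Suc j) - Xo (Suc j) * To j"
 by (simp add: Th_eq)

lemma To_Th_far: "1 \<le> j ==> k + 1 < j \<or> j + 1 < k ==> To k * Th j = Th j * To k"
 by (simp only: Th_op) (intro commute_diff commute_mult, auto intro!: To_far To_Xo)

definition tau :: "nat => nat => ('i, 'k) op" where
 "tau a b = prod_list (map To [a..<b])"

text \<open>This is theta_m ... theta_1. It carries the first strand past m others without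
  correction terms, whereas the product of the crossings does so only up to lower terms.\<close>

primrec Psi :: "nat => ('i, 'k) op" where
 "Psi 0 = 1" | "Psi (Suc m) = Th (Suc m) * Psi m"

lemma tau_same [simp]: "tau a a = 1" by (simp add: tau_def)

lemma tau_split: "a \<le> b ==> b \<le> c ==> tau a c = tau a b * tau b c"
 unfolding tau_def by (metis le_Suc_ex map_append prod_list.append upt_add_eq_append)

lemma tau_Suc: "a \<le> b ==> tau a (Suc b) = tau a b * To b"
 by (simp add: tau_def)

lemma tau_Suc': "a < b ==> tau a b = To a * tau (Suc a) b"
 by (simp add: tau_def upt_rec)

lemma tau_commute: "(!!l. a \<le> l ==> l < b ==> x * To l = To l * x) ==> x * tau a b = tau a b * x"
 unfolding tau_def by (rule commute_prod_list) auto

lemma tau_tau: "b < c ==> tau a b * tau c d = tau c d * tau a b"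
proof (rule tau_commute)
 fix l assume "b < c" "c \<le> l" "l < d"
 then show "tau a b * To l = To l * tau a b" by (intro tau_commute[symmetric] To_far) auto
qed

lemma tau_Xo: "j < a \<or> b < j ==> Xo j * tau a b = tau a b * Xo j"
 by (rule tau_commute) (auto intro!: To_Xo[symmetric])

lemma tau_pr: "tau a b * pr m = pr m * tau a b"
 by (rule tau_commute[symmetric]) (simp add: pr_To)

lemma tau_OA: "1 \<le> a ==> b \<le> m ==> (!!l. a \<le> l ==> l < b ==> l \<in> K) ==> tau a b * pr m \<in> OA m K"
proof (induction b)
 case (Suc b)
 show ?case
 proof (cases "a \<le> b")
  case True
  have "pr m * gop (T b) \<in> OA m K" using Suc.prems True by (intro OA_gen) auto
  then have "(tau a b * pr m) * (pr m * To b) \<in> OA m K" using Suc.prems by (intro OA_mult[OF Suc.IH]) auto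
  moreover have "(tau a b * pr m) * (pr m * To b) = tau a (Suc b) * pr m"
   using tau_Suc[OF True] pr_To[of b m] by (simp add: mult.assoc) (simp flip: mult.assoc)
  ultimately show ?thesis by simp
 qed (simp add: tau_def OA_pr)
qed (simp add: tau_def OA_pr)

lemma tau_Eo: "length nu = n ==> m \<le> n ==> tau (Suc m) (Suc n) * Eo (nu @ [i]) = Eo (cycl m nu i) * tau (Suc m) (Suc n)"
proof (induction "n - m" arbitrary: m)
 case 0
 then show ?case by (simp flip: cycl_full)
next
 case (Suc r)
 then have IH: "tau (Suc (Suc m)) (Suc n) * Eo (nu @ [i]) = Eo (cycl (Suc m) nu i) * tau (Suc (Suc m)) (Suc n)" by auto
 have "sw (Suc m) (cycl (Suc m) nu i) = cycl m nu i"
  using sw_cycl[of m nu i] sw_sw[of "Suc m" "cycl m nu i"] Suc by auto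
 then have e: "To (Suc m) * Eo (cycl (Suc m) nu i) = Eo (cycl m nu i) * To (Suc m)"
  using To_Eo[of "Suc m" "cycl (Suc m) nu i"] Suc by simp
 have t: "tau (Suc m) (Suc n) = To (Suc m) * tau (Suc (Suc m)) (Suc n)" using Suc by (intro tau_Suc') auto
 show ?case unfolding t mult.assoc IH by (simp only: e flip: mult.assoc)
qed

lemma Psi_Eo: "m \<le> length nu ==> Psi m * Eo (i # nu) = Eo (cycl m nu i) * Psi m"
proof (induction m)
 case (Suc m)
 then have IH: "Psi m * Eo (i # nu) = Eo (cycl m nu i) * Psi m" by simp
 have e: "Th (Suc m) * Eo (cycl m nu i) = Eo (cycl (Suc m) nu i) * Th (Suc m)"
  using Go_Eo[of "Suc m" "cycl m nu i" cc] sw_cycl[of m nu i] Suc by simp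
 show ?case unfolding Psi.simps mult.assoc IH by (simp only: e flip: mult.assoc)
qed (simp add: cycl_0)

lemma Psi_po: "Psi m * po p = po (spc m p) * Psi m"
proof (induction m)
 case (Suc m)
 show ?case unfolding Psi.simps mult.assoc Suc by (simp add: Go_po flip: mult.assoc)
qed simp

text \<open>Distant intertwiners commute with the crossing, and the two adjacent ones are handled by
  \<open>Th_braid\<close>.\<close>

lemma Psi_To: "1 \<le> k ==> k < m ==> To k * Psi m = Psi m * To (Suc k)"
proof (induction m)
 case (Suc m)
 show ?case
 proof (cases "k < m")
  case True
  then have "To k * Th (Suc m) = Th (Suc m) * To k" using Suc by (intro To_Th_far) auto
  then have "To k * Psi (Suc m) = Th (Suc m) * (To k * Psi m)" by (simp flip: mult.assoc)
  then show ?thesis using Suc True by (simp add: mult.assoc)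
 next
  case False
  then have "k = m" using Suc by simp
  then obtain r where r: "m = Suc r" "k = Suc r" using Suc by (cases m) auto
  have c: "To (Suc (Suc r)) * Psi r = Psi r * To (Suc (Suc r))"
  proof -
   have "To (Suc (Suc r)) * Psi q = Psi q * To (Suc (Suc r))" if "q \<le> r" for q
    using that by (induction q) (auto intro!: commute_mult To_Th_far)
   then show ?thesis by simp
  qed
  have "To k * Psi (Suc m) = To (Suc r) * (Th (Suc (Suc r)) * Th (Suc r)) * Psi r" by (simp add: r mult.assoc)
  also have "... = Th (Suc (Suc r)) * Th (Suc r) * (To (Suc (Suc r)) * Psi r)"
   using Th_braid[of "Suc r"] by (simp add: mult.assoc)
  finally show ?thesis by (simp add: c r mult.assoc)
 qed
qed simp

text \<open>The polynomial by which tau_m theta_m (x_m - x_{m+1}) acts up to multiples of theta_m.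
  The sign for distinct colours arises because tau_m exchanges the two variables in the linear
  factor of theta_m.\<close>

definition UU :: "'i => 'i => nat => nat => 'k mpoly" where
 "UU i j a b = (if i = j then PP i a b * PP i b a else - ((Vr a - Vr b) ^ 2 * QQ i j a b))"

lemma spc_PP: "spc m (PP i a b) = PP i (sx m a) (sx m b)" and spc_QQ: "spc m (QQ i j a b) = QQ i j (sx m a) (sx m b)"
 by (induction m) (simp_all add: sp_PP sp_QQ)

lemma spc_UU: "spc m (UU i j a b) = UU i j (sx m a) (sx m b)"
 by (simp add: UU_def spc_PP spc_QQ spc_simps power2_eq_square)

text \<open>The operator \<open>To m * Th m\<close> is invertible up to \<open>Th m\<close> after multiplication with a difference of variables.\<close>

lemma To_Th_diff:
 assumes m: "1 \<le> m" "m < length mu"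
 defines "a \<equiv> nth1 mu m" and "b \<equiv> nth1 mu (Suc m)"
 shows "To m * Th m * po (Vr m - Vr (Suc m)) * Eo mu =
  (po (UU a b m (Suc m)) + po (if a = b then PP a m (Suc m) else 0) * Th m) * Eo mu"
proof (rule op_eqI)
 fix f :: "('i, 'k) vec" and nu :: "'i list"
 let ?x = "Vr m :: 'k mpoly" and ?y = "Vr (Suc m) :: 'k mpoly"
 show "ap (To m * Th m * po (?x - ?y) * Eo mu) f nu =
  ap ((po (UU a b m (Suc m)) + po (if a = b then PP a m (Suc m) else 0) * Th m) * Eo mu) f nu"
 proof (cases "1 \<le> m \<and> m < length nu")
  case False
  then have "nu ~= mu" using m by auto
  then show ?thesis using False by (auto simp: ap_To ap_Go)
 next
  case nu: True
  have sn: "sw m nu = mu \<longleftrightarrow> nu = sw m mu" using nu m by (metis sw_sw)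
  have n1: "nth1 (sw m nu) m = nth1 nu (Suc m)" "nth1 (sw m nu) (Suc m) = nth1 nu m" using nu by (auto simp: nth1_sw)
  show ?thesis
  proof (cases "nth1 nu m = nth1 nu (Suc m)")
   case True
   then have s: "sw m nu = nu" using nu sw_same by blast
   let ?P = "PP (nth1 nu m) m (Suc m)" and ?P' = "PP (nth1 nu m) (Suc m) m"
   have d: "dd m (?P * sp m ((?x - ?y) * f nu)) = ?P' * f nu + ?P * sp m (f nu)"
    by (rule ddI) (simp add: sub.mult sub.diff sp_PP algebra_simps)
   show ?thesis
   proof (cases "nu = mu")
    case True
    have "a = b" using \<open>nth1 nu m = nth1 nu (Suc m)\<close> unfolding a_def b_def True .
    then show ?thesis
     using nu \<open>nth1 nu m = nth1 nu (Suc m)\<close> s d True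
     by (simp add: ap_To ap_Go cc_def UU_def a_def) (simp add: algebra_simps)
   next
    case False
    then show ?thesis using nu s \<open>nth1 nu m = nth1 nu (Suc m)\<close> by (simp add: ap_To ap_Go)
   qed
  next
   case False
   show ?thesis
   proof (cases "nu = mu")
    case True
    then have ab: "a ~= b" "nth1 nu m = a" "nth1 nu (Suc m) = b" using False by (auto simp: a_def b_def)
    have q: "qq a b m (Suc m) * qq b a (Suc m) m = QQ a b m (Suc m)" by (rule qq_qq[OF ab(1)])
    have "ap (To m * Th m * po (?x - ?y) * Eo mu) f nu =
     qq a b m (Suc m) * ((?y - ?x) * qq b a (Suc m) m * ((?x - ?y) * f nu))"
     using nu False ab n1 True
     by (simp add: ap_To ap_Go cc_def sub.mult sub.diff sp_qq)
    also have "... = - ((?x - ?y) ^ 2 * (qq a b m (Suc m) * qq b a (Suc m) m)) * f nu"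
     by (simp add: power2_eq_square algebra_simps)
    finally show ?thesis using ab True by (simp add: q UU_def)
   next
    case nm: False
    have ne: "sw m nu ~= mu \<or> a ~= b"
     using False n1 by (auto simp: a_def b_def)
    show ?thesis using nu False nm n1 ne by (auto simp: ap_To ap_Go)
   qed
  qed
 qed
qed

end

lemma left_comm: "a * b = b * a ==> a * (b * x) = b * (a * (x :: 'r::semigroup_mult))"
 by (simp flip: mult.assoc)

section \<open>The element a(x_1) tau_1 ... tau_n\<close>

context klr_cyc begin

definition apoly :: "'a => nat => 'b mpoly" where
 "apoly j p = (\<Sum>k\<le>nat (hL j). cst (ca j k) * Vr p ^ (nat (hL j) - k))"

definition aop :: "nat => ('a, 'b) op" where
 "aop p = dg (\<lambda>mu. apoly (nth1 mu p) p)"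

definition cP :: "('a, 'b) op" where "cP = aop 1 * tau 1 N"

lemma sp_apoly: "sp l (apoly j p) = apoly j (sidx l p)"
 by (simp add: apoly_def sub.sum sub.mult sub.power)

lemma ap_aop [simp]: "ap (aop p) f mu = apoly (nth1 mu p) p * f mu" by (simp add: aop_def)

lemma rho_aL: "1 \<le> p ==> p \<le> m ==> rho m (aL hL ca m p) = pr m * aop p"
proof -
 assume p: "1 \<le> p" "p \<le> m"
 let ?g = "\<lambda>nu. \<Sum>k\<le>nat (hL (nth1 nu p)). fsmul (ca (nth1 nu p) k) (fpow (xx p) (nat (hL (nth1 nu p)) - k)) :: ('a, 'b) fa"
 have gF: "?g nu \<in> FA m" for nu using p by (auto intro!: FA_intros FA_xx)
 have rg: "rh (?g nu) = po (apoly (nth1 nu p) p)" for nu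
  unfolding apoly_def po_sum
  by (subst rh_sum[of _ _ m]) (use p in \<open>auto intro!: FA_intros FA_xx sum.cong simp: rh_fsmul[OF FA_fpow[OF FA_xx[OF p]]] rh_fpow[OF FA_xx[OF p]] po_power po_mult\<close>)
 have "rho m (aL hL ca m p) = (\<Sum>nu\<in>Iseqs m. rho m (fmul (?g nu) (ee nu)))"
  unfolding aL_def using p gF by (simp add: rho_sum FA_fmul FA_ee)
 also have "... = (\<Sum>nu\<in>Iseqs m. pr m * (po (apoly (nth1 nu p) p) * Eo nu))"
  using gF by (intro sum.cong refl) (simp add: rho_def rh_fmul[of _ m] FA_ee rg)
 also have "... = pr m * aop p * (\<Sum>nu\<in>Iseqs m. Eo nu)"
  unfolding sum_distrib_left by (intro sum.cong refl) (simp add: mult.assoc aop_def dg_Eo)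
 also have "... = pr m * aop p" unfolding sum_Eo by (rule op_eqI) simp
 finally show ?thesis .
qed

lemma aop_commute: "aop p * dg h = dg h * aop p" "aop p * po q = po q * aop p" "aop p * Eo nu = Eo nu * aop p"
 "aop p * pr m = pr m * aop p"
 unfolding aop_def po_def Eo_def pr_def by (rule dg_commute)+

lemma To_aop: "2 \<le> l ==> To l * aop 1 = aop 1 * To l"
 by (rule op_eqI) (auto simp: ap_To nth1_sw sub.mult sp_apoly dd_sym_mult mult.left_commute)

lemma Th_aop: "2 \<le> l ==> aop 1 * Th l = Th l * aop 1"
 by (rule op_eqI) (auto simp: ap_Go nth1_sw sub.mult sp_apoly mult.left_commute)

lemma Th1_aop: "aop 1 * Th 1 = Th 1 * aop 2"
 by (rule op_eqI) (auto simp: ap_Go nth1_sw sub.mult sp_apoly mult.left_commute numeral_2_eq_2)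

lemma tau_aop: "2 \<le> l ==> aop 1 * tau l m = tau l m * aop 1"
 by (rule tau_commute) (rule To_aop[symmetric], simp)

text \<open>Of the factors of \<open>Psi m\<close> only the last one, theta_1, touches the first
  strand, and it turns a(x_1) into a(x_2).\<close>

lemma Psi_aop: "1 \<le> m ==> aop 1 * Psi m = Psi m * aop 2"
proof (induction m rule: dec_induct)
 case base
 show ?case using Th1_aop by simp
next
 case (step m)
 then have "aop 1 * Th (Suc m) = Th (Suc m) * aop 1" by (intro Th_aop) simp
 from left_comm[OF this] show ?case by (simp only: Psi.simps mult.assoc step(3))
qed

lemma OA_aop: "x \<in> OA m {2..<m} ==> x * aop 1 = aop 1 * x"
proof (induction rule: OA_induct)
 case (diff x y)
 then show ?case by (simp add: left_diff_distrib right_diff_distrib)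
next
 case (scal c)
 show ?case by (simp only: mult.assoc aop_commute(4)[symmetric] left_comm[OF aop_commute(2)])
next
 case (gen g x)
 have "gop g * aop 1 = aop 1 * gop g"
  using gen(1,2) by (cases g) (simp_all only: gop.simps aop_commute To_aop[OF _] atLeastLessThan_iff simp_thms)
 from left_comm[OF this] show ?case by (simp only: mult.assoc gen(4))
qed

lemma aL_rho: "rho n (aL hL ca n 1) = (if 1 \<le> n then pr n * aop 1 else 0)"
 using rho_aL[of 1 n] by (simp add: aL_def)

lemma iot_aop: "1 \<le> n ==> iot i (pr n * aop 1) = aop 1 * Lp n i"
 by (rule op_eqI) (auto simp: ap_iot nth1_def nth_butlast Suc_le_eq)

lemma Eo_BB: "nu \<in> Iseq bt ==> Eo nu \<in> BB"
proof -
 assume nu: "nu \<in> Iseq bt"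
 then have "length nu = n" using Iseq_bt by (auto simp: Iseqs_def)
 then have "pr n * gop (E nu) \<in> OA n {1..<n}" by (intro OA_gen) auto
 moreover have "pr n * Eo nu = Eo nu" "Eo nu * eB = Eo nu" using nu \<open>length nu = n\<close> by (auto intro!: op_eqI simp: eB_def)
 ultimately show ?thesis by (simp add: BB_def)
qed

lemma eB_sum: "eB = (\<Sum>nu\<in>Iseq bt. Eo nu)"
 unfolding eB_def by (rule bl_sum[OF finite_subset[OF Iseq_bt finite_Iseqs]])

lemma len_bt: "nu \<in> Iseq bt ==> length nu = n"
 using Iseq_bt by (auto simp: Iseqs_def)

lemma xio_sum: "xio n i (sum f S) = (\<Sum>x\<in>S. xio n i (f x))"
 by (induction S rule: infinite_finite_induct) (simp_all add: xio_add)

lemma iot_eB: "iot i eB = (\<Sum>nu\<in>Iseq bt. Eo (nu @ [i]))"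
 and xio_eB: "xio n i eB = (\<Sum>nu\<in>Iseq bt. Eo (i # nu))"
 unfolding eB_sum by (simp_all add: iot_sum xio_sum iot_Eo xio_Eo len_bt)

lemma BB_unit: "x \<in> BB ==> pr n * x = x" "x \<in> BB ==> x * pr n = x" "x \<in> BB ==> x * eB = x" "x \<in> BB ==> eB * x = x"
 using OA_unit K0.B(4) by (auto simp: BB_def)

lemma BB_left: "y \<in> OA n {1..<n} ==> x \<in> BB ==> y * x \<in> BB"
 using OA_mult by (auto simp: BB_def mult.assoc)

lemma Lp_iot_BB: "x \<in> BB ==> Lp n i * iot i x = iot i x"
 using BB_unit by (intro Lp_iot)

lemma po_BB: "1 \<le> v ==> v \<le> n ==> x \<in> BB ==> po (Vr v) * x \<in> BB"
 using BB_left[OF po_OA[of v n 1 "{1..<n}"], of x] BB_unit(1)[of x] by (simp add: mult.assoc)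

lemma To_BB: "1 \<le> l ==> l < n ==> x \<in> BB ==> To l * x \<in> BB"
proof -
 assume l: "1 \<le> l" "l < n" and x: "x \<in> BB"
 have "pr n * gop (T l) \<in> OA n {1..<n}" using l by (intro OA_gen) auto
 from BB_left[OF this x] show ?thesis using BB_unit(1)[OF x] by (simp add: mult.assoc flip: pr_To)
qed

lemma iot_To_BB: "1 \<le> l ==> l < n ==> x \<in> BB ==> iot i (To l * x) = To l * iot i x"
 using iot_mult[of i "To l * pr n" x] by (simp add: mult.assoc BB_unit iot_To Lp_iot_BB)

lemma iot_tau: "1 \<le> a ==> b \<le> n ==> x \<in> BB ==> tau a b * x \<in> BB \<and> iot i (tau a b * x) = tau a b * iot i x"
proof (induction "b - a" arbitrary: a)
 case 0
 then show ?case by (simp add: tau_def)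
next
 case (Suc r)
 then have t: "tau a b = To a * tau (Suc a) b" by (intro tau_Suc') auto
 have "tau (Suc a) b * x \<in> BB \<and> iot i (tau (Suc a) b * x) = tau (Suc a) b * iot i x" using Suc by auto
 then show ?case unfolding t mult.assoc using Suc To_BB[of a] iot_To_BB[of a] by simp
qed

text \<open>For n >= 1 the first strand belongs to the embedded R(beta), and there a(x_1) is the
  generator of the cyclotomic ideal. For n = 0 the first strand is the added one.\<close>

lemma aop_iot_I: "1 \<le> n ==> x \<in> BB ==> \<exists>c\<in>II. aop 1 * iot i x = iot i c"
proof
 assume n: "1 \<le> n" and x: "x \<in> BB"
 have "aop 1 * iot i x = iot i (pr n * aop 1) * iot i x" by (simp only: iot_aop[OF n] mult.assoc Lp_iot_BB[OF x])
 moreover have r: "rho n (aL hL ca n 1) = pr n * aop 1" using n by (simp only: aL_rho if_True)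
 ultimately show "aop 1 * iot i x = iot i (rho n (aL hL ca n 1) * x)" by (simp only: iot_mult)
 have m: "aL hL ca n 1 \<in> JL t w hL ca n" unfolding JL_def by (rule rideal_mem) simp
 obtain g where g: "g \<in> FA n" "x = rho n g" using x OA_FA[of n "{1..<n}"] by (auto simp: BB_def)
 have "rho n (aL hL ca n 1) * x = rho n (fmul (aL hL ca n 1) g) * eB"
  using BB_unit(3)[OF x] g by (simp add: rho_fmul FA_aL mult.assoc)
 moreover have "fmul (aL hL ca n 1) g \<in> JL t w hL ca n" using rideal_fmul(2)[OF _ g(1)] m unfolding JL_def by blast
 ultimately show "rho n (aL hL ca n 1) * x \<in> II" unfolding II_def by blast
qed

lemma tau_AA: "1 \<le> a ==> b \<le> N ==> x \<in> AA ==> tau a b * x \<in> AA"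
 using OA_mult[OF tau_OA[of a b N "{1..<N}"], of x] OA_unit(1)[of x N "{1..<N}"] by (simp add: AA_def mult.assoc)

lemma po_AA: "1 \<le> v ==> v \<le> N ==> x \<in> AA ==> po (Vr v) * x \<in> AA"
 using OA_mult[OF po_OA[of v N 1 "{1..<N}"], of x] OA_unit(1)[of x N "{1..<N}"] by (simp add: AA_def mult.assoc)

lemma iot_AA: "x \<in> BB ==> iot i x \<in> AA" and xio_AA: "x \<in> BB ==> xio n i x \<in> AA"
 by (simp_all add: K0.om K1.om)

lemma iot_I_Z0: "c \<in> II ==> iot i c \<in> K0.Z"
 using K0.Y_om_I[OF K0.A_om[OF iot_AA[OF K0.B(3)] K0.B(3)], of c] K0.om(2)[OF K0.B(3), of c] K0.om(2)[OF K0.B(3) K0.B(3)]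
  BB_unit II_BB by (simp add: subset_iff K0.B(3))

lemma Z0_tau: "1 \<le> a ==> b \<le> N ==> y \<in> K0.Z ==> tau a b * y \<in> K0.Z"
 and Z0_po: "1 \<le> v ==> v \<le> N ==> y \<in> K0.Z ==> po (Vr v) * y \<in> K0.Z"
 and Z0_cst: "y \<in> K0.Z ==> po (cst c) * y \<in> K0.Z"
proof -
 have u: "pr N * y = y" if "y \<in> K0.Z" for y using K0.Z_Y[OF that] OA_unit(1)[of y N "{1..<N}"] unfolding K0.Y_def unfolding AA_def by simp
 have p: "pr N \<in> AA" by (simp add: AA_def OA_pr)
 show "tau a b * y \<in> K0.Z" if "1 \<le> a" "b \<le> N" "y \<in> K0.Z"
  using K0.A_Z[OF tau_AA[OF that(1,2) p] that(3)] u[OF that(3)] by (simp add: mult.assoc)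
 show "po (Vr v) * y \<in> K0.Z" if "1 \<le> v" "v \<le> N" "y \<in> K0.Z"
  using K0.A_Z[OF po_AA[OF that(1,2) p] that(3)] u[OF that(3)] by (simp add: mult.assoc)
 show "po (cst c) * y \<in> K0.Z" if "y \<in> K0.Z"
  using K0.A_Z[OF _ that, of "po (cst c) * pr N"] OA_scal[of c N] u[OF that] by (simp add: mult.assoc AA_def)
qed

text \<open>Whatever polynomial is inserted at a place where the two products \<open>V\<close>, \<open>U\<close> of intertwiners commute,
 it can be moved out to the left or to the right.\<close>

lemma split_Z0:
 assumes k: "a \<le> k" "k < c" "k \<le> n" "a \<le> n" "2 \<le> c" "1 \<le> n" and p: "p \<in> pvars N" and x: "x \<in> BB"
 shows "aop 1 * (tau 1 a * (po p * (tau c N * iot i x))) \<in> K0.Z"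
 using p x
proof (induction p arbitrary: x)
 case (pvars_cst s)
 \<comment> \<open>A crossing between the two products is missing, so they commute. Then a(x_1) and
   the crossings before the gap act inside the embedded R(beta), where the result lies in the
   cyclotomic ideal.\<close>
 have ac: "tau 1 a * tau c N = tau c N * tau 1 a" using k by (intro tau_tau) auto
 have "aop 1 * (tau 1 a * (po (cst s) * (tau c N * iot i x))) = po (cst s) * (aop 1 * (tau 1 a * tau c N) * iot i x)"
  by (simp only: mult.assoc left_comm[OF po_cst_commute[of s "tau 1 a", symmetric]]
   left_comm[OF po_cst_commute[of s "aop 1", symmetric]])
 also have "... = po (cst s) * (tau c N * (aop 1 * (tau 1 a * iot i x)))"
  unfolding ac by (simp only: mult.assoc left_comm[OF tau_aop[OF k(5), of N]])
 also have "... \<in> K0.Z"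
 proof -
  obtain z where "z \<in> II" "aop 1 * (tau 1 a * iot i x) = iot i z"
   using aop_iot_I[OF k(6), of "tau 1 a * x"] iot_tau[OF le_refl k(4) pvars_cst] by auto
  then show ?thesis using k by (intro Z0_cst Z0_tau) (auto simp: iot_I_Z0)
 qed
 finally show ?case .
next
 case (pvars_var j p)
 show ?case
 \<comment> \<open>A variable x_j with j <= k passes the crossings after the gap and is absorbed on
   the right by R(beta); otherwise it passes those before the gap and leaves on the left.\<close>
 proof (cases "j \<le> k")
  case True
  have c: "Xo j * tau c N = tau c N * Xo j" using True k by (intro tau_Xo) auto
  have "po (Vr j * p) = (po p * Xo j :: ('a, 'b) op)" by (simp add: po_mult mult.commute)
  then have "po (Vr j * p) * (tau c N * iot i x) = po p * (tau c N * iot i (Xo j * x))"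
   by (simp only: mult.assoc left_comm[OF c] iot_po')
  moreover have "Xo j * x \<in> BB" using pvars_var True k by (intro po_BB) auto
  ultimately show ?thesis using pvars_var(4)[of "Xo j * x"] by simp
 next
  case False
  have c: "tau 1 a * Xo j = Xo j * tau 1 a" using False k by (intro tau_Xo[symmetric]) auto
  have "aop 1 * (tau 1 a * (po (Vr j * p) * (tau c N * iot i x))) =
   Xo j * (aop 1 * (tau 1 a * (po p * (tau c N * iot i x))))"
   by (simp only: mult.assoc po_mult[symmetric] left_comm[OF c] left_comm[OF aop_commute(2)[of 1 "Vr j"]])
  also have "... \<in> K0.Z" by (rule Z0_po[OF pvars_var(1,2) pvars_var(4)[OF pvars_var(5)]])
  finally show ?thesis .
 qed
next
 case (pvars_scal p s)
 have "aop 1 * (tau 1 a * (po (cst s * p) * (tau c N * iot i x))) =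
  po (cst s) * (aop 1 * (tau 1 a * (po p * (tau c N * iot i x))))"
  by (simp only: po_mult[symmetric] mult.assoc left_comm[OF po_cst_commute[of s "tau 1 a", symmetric]]
   left_comm[OF po_cst_commute[of s "aop 1", symmetric]])
 also have "... \<in> K0.Z" by (rule Z0_cst[OF pvars_scal(2)[OF pvars_scal(3)]])
 finally show ?case .
next
 case (pvars_add p q)
 then show ?case using subgrpD(4)[OF K0.Z_subgrp] by (simp add: distrib_right distrib_left flip: po_add)
qed

end

section \<open>The map is a bimodule homomorphism\<close>

context klr_cyc begin

lemma AA_mult: "x \<in> AA ==> y \<in> AA ==> x * y \<in> AA" unfolding AA_def by (rule OA_mult)

lemma AA_pr: "pr N \<in> AA" unfolding AA_def by (rule OA_pr)

lemma AA_unit: "x \<in> AA ==> pr N * x = x" "x \<in> AA ==> x * pr N = x"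
 unfolding AA_def by (rule OA_unit, assumption)+

lemma AA_rho: "AA = rho N ` FA N"
 unfolding AA_def by (rule OA_FA) simp

lemma AA_right: assumes x: "x \<in> AA" and z: "z * pr N = pr N * z" "pr N * z \<in> AA" shows "x * z \<in> AA"
proof -
 have "x * z = x * (pr N * z)" by (simp add: AA_unit(2)[OF x] flip: mult.assoc)
 then show ?thesis using AA_mult[OF x z(2)] by simp
qed

lemma Z0_Eo: "y \<in> K0.Z ==> length nu = N ==> Eo nu * y \<in> K0.Z"
proof -
 assume y: "y \<in> K0.Z" and nu: "length nu = N"
 have "pr N * gop (E nu) \<in> AA" unfolding AA_def using nu by (intro OA_gen) auto
 moreover have "pr N * Eo nu = Eo nu" using nu by (auto intro!: op_eqI)
 ultimately show ?thesis using K0.A_Z y by simp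
qed

lemma Eo_iot: "nu \<in> Iseq bt ==> Eo nu * x = (x :: ('a, 'b) op) ==> Eo (nu @ [i]) * iot i x = iot i x"
proof -
 assume x: "Eo nu * x = x"
 have "iot i (Eo nu * x) = Eo (nu @ [i]) * iot i x" by (simp only: iot_mult iot_Eo)
 then show ?thesis by (simp only: x)
qed

lemma cycl_tau_iot:
 assumes "nu \<in> Iseq bt" "Eo nu * x = x" "m \<le> n"
 shows "Eo (cycl m nu i) * (tau (Suc m) N * iot i x) = tau (Suc m) N * iot i x"
proof -
 have "tau (Suc m) N * (Eo (nu @ [i]) * iot i x) = Eo (cycl m nu i) * (tau (Suc m) N * iot i x)"
  by (simp only: mult.assoc[symmetric] tau_Eo[OF len_bt[OF assms(1)] assms(3)])
 then show ?thesis by (simp only: Eo_iot[OF assms(1,2)])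
qed

text \<open>The errors produced by the relations depend on the colours, so an element of R(beta) is
  first decomposed by the idempotents e(nu).\<close>

lemma BB_split:
 assumes S: "subgrp S" and x: "x \<in> BB" and h: "!!a b. h (a + b) = h a + h b" "h 0 = 0"
  and c: "!!nu x. nu \<in> Iseq bt ==> x \<in> BB ==> Eo nu * x = x ==> h x \<in> S"
 shows "h x \<in> S"
proof -
 have hs: "h (sum f U) = (\<Sum>u\<in>U. h (f u))" for f and U :: "'a list set"
  by (induction U rule: infinite_finite_induct) (simp_all add: h)
 have "x = (\<Sum>nu\<in>Iseq bt. Eo nu * x)" using BB_unit(4)[OF x] by (simp add: eB_sum sum_distrib_right)
 from arg_cong[OF this, of h] have "h x = (\<Sum>nu\<in>Iseq bt. h (Eo nu * x))" by (simp only: hs)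
 also have "... \<in> S"
  by (intro subgrp_sum[OF S] c) (auto intro: BB_left[OF BB_mem[OF Eo_BB] x] simp: Eo_Eo simp flip: mult.assoc)
 finally show ?thesis .
qed

text \<open>The variable passes every crossing but tau_k. There the relation replaces tau_k by a
  polynomial, which breaks the chain, and \<open>split_Z0\<close> applies at this gap.\<close>

lemma X_err:
 assumes k: "1 \<le> k" "k \<le> n" and x: "x \<in> BB"
 shows "(Xo (Suc k) * cP - cP * Xo k) * iot i x \<in> K0.Z"
proof (rule BB_split[OF K0.Z_subgrp x])
 fix nu x assume nu: "nu \<in> Iseq bt" and x: "x \<in> BB" "Eo nu * x = x"
 let ?e = "cycl k nu i"
 have t: "tau 1 N = tau 1 k * To k * tau (Suc k) N"
  using tau_split[of 1 k N] tau_Suc'[of k N] k by (simp add: mult.assoc)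
 have c1: "Xo (Suc k) * tau 1 k = tau 1 k * Xo (Suc k)" by (rule tau_Xo) simp
 have c2: "Xo k * tau (Suc k) N = tau (Suc k) N * Xo k" by (rule tau_Xo) simp
 have "(Xo (Suc k) * cP - cP * Xo k) * iot i x =
  aop 1 * (tau 1 k * ((Xo (Suc k) * To k - To k * Xo k) * (tau (Suc k) N * iot i x)))"
  unfolding cP_def t by (simp only: mult.assoc left_diff_distrib right_diff_distrib left_comm[OF c1]
   left_comm[OF c2[symmetric]] left_comm[OF aop_commute(2)[symmetric, of "Vr (Suc k)"]])
 also have "tau (Suc k) N * iot i x = Eo ?e * (tau (Suc k) N * iot i x)"
  by (rule cycl_tau_iot[OF nu x(2) k(2), symmetric])
 also have "(Xo (Suc k) * To k - To k * Xo k) * (Eo ?e * (tau (Suc k) N * iot i x)) =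
  po (if nth1 ?e k = nth1 ?e (Suc k) then PP (nth1 ?e k) k (Suc k) else 0) * (Eo ?e * (tau (Suc k) N * iot i x))"
 proof -
  have "(Xo (Suc k) * To k - To k * Xo k) * Eo ?e = - ((To k * Xo k - Xo (Suc k) * To k) * Eo ?e)"
   by (simp add: left_diff_distrib)
  also have "... = po (if nth1 ?e k = nth1 ?e (Suc k) then PP (nth1 ?e k) k (Suc k) else 0) * Eo ?e"
   using To_X_rel[of k ?e k] k len_bt[OF nu] by simp
  finally show ?thesis by (simp flip: mult.assoc)
 qed
 also have "Eo ?e * (tau (Suc k) N * iot i x) = tau (Suc k) N * iot i x"
  by (rule cycl_tau_iot[OF nu x(2) k(2)])
 also have "aop 1 * (tau 1 k * (po (if nth1 ?e k = nth1 ?e (Suc k) then PP (nth1 ?e k) k (Suc k) else 0) *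
   (tau (Suc k) N * iot i x))) \<in> K0.Z"
  using k PP_pvars[of k N "Suc k"] pvars_0 x(1) by (intro split_Z0[where k = k]) auto
 finally show "(Xo (Suc k) * cP - cP * Xo k) * iot i x \<in> K0.Z" .
qed (simp_all add: iot_add distrib_left)

text \<open>The crossing commutes with the chain except at tau_k tau_{k+1}. The braid error there is
  a combination of 1, tau_k and tau_{k+1} with polynomial coefficients, and every such term leaves a
  gap in the chain.\<close>

lemma T_err:
 assumes k: "1 \<le> k" "k < n" and x: "x \<in> BB"
 shows "(To (Suc k) * cP - cP * To k) * iot i x \<in> K0.Z"
proof (rule BB_split[OF K0.Z_subgrp x])
 fix nu x assume nu: "nu \<in> Iseq bt" and x: "x \<in> BB" "Eo nu * x = x"
 let ?e = "cycl (Suc k) nu i" and ?U = "tau (Suc (Suc k)) N"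
 let ?B = "To (Suc k) * To k * To (Suc k) - To k * To (Suc k) * To k"
 have t: "tau 1 N = tau 1 k * (To k * (To (Suc k) * ?U))"
  using tau_split[of 1 k N] tau_Suc'[of k N] tau_Suc'[of "Suc k" N] k by simp
 have c1: "To (Suc k) * tau 1 k = tau 1 k * To (Suc k)" by (intro tau_commute To_far) auto
 have c2: "To k * ?U = ?U * To k" by (intro tau_commute To_far) auto
 have c3: "To (Suc k) * aop 1 = aop 1 * To (Suc k)" using k by (intro To_aop) auto
 have "(To (Suc k) * cP - cP * To k) * iot i x = aop 1 * (tau 1 k * (?B * (?U * iot i x)))"
  unfolding cP_def t by (simp only: mult.assoc left_diff_distrib right_diff_distrib left_comm[OF c1]
   left_comm[OF c2[symmetric]] left_comm[OF c3])
 also have e: "?U * iot i x = Eo ?e * (?U * iot i x)"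
  using k by (intro cycl_tau_iot[OF nu x(2), symmetric]) auto
 also have "aop 1 * (tau 1 k * (?B * (Eo ?e * (?U * iot i x)))) \<in> K0.Z"
 proof -
  have len: "Suc k < length ?e" using k len_bt[OF nu] by simp
  have pv: "ev [k, Suc k, Suc (Suc k)] p \<in> pvars N" "PP j k (Suc (Suc k)) \<in> pvars N" for p j
   using k by (auto intro!: ev_pvars PP_pvars)
  have Tx: "To k * x \<in> BB" "iot i (To k * x) = To k * iot i x" using To_BB[OF k x(1)] iot_To_BB[OF k x(1)] by auto
  have z: "aop 1 * (tau 1 k * (po p * (?U * iot i x))) \<in> K0.Z" if "p \<in> pvars N" for p
   using k x(1) that by (intro split_Z0[where k = k]) auto
  \<comment> \<open>The crossing tau_k commutes with the crossings after tau_{k+1} and is absorbed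
    by the element of R(beta) on the right.\<close>
  have z1: "aop 1 * (tau 1 k * (po p * (To k * (?U * iot i x)))) \<in> K0.Z" if "p \<in> pvars N" for p
  proof -
   have "aop 1 * (tau 1 k * (po p * (?U * iot i (To k * x)))) \<in> K0.Z"
    using k Tx(1) that by (intro split_Z0[where k = k]) auto
   then show ?thesis by (simp only: Tx(2) left_comm[OF c2])
  qed
  \<comment> \<open>Here tau_{k+1} joins the right part of the chain, so that only tau_k is
    missing.\<close>
  have z2: "aop 1 * (tau 1 k * (po p * (To (Suc k) * (?U * iot i x)))) \<in> K0.Z" if "p \<in> pvars N" for p
  proof -
   have "aop 1 * (tau 1 k * (po p * (tau (Suc k) N * iot i x))) \<in> K0.Z"
    using k x(1) that by (intro split_Z0[where k = k]) auto
   moreover have "tau (Suc k) N = To (Suc k) * ?U" using k by (intro tau_Suc') auto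
   ultimately show ?thesis by (simp only: mult.assoc)
  qed
  have e': "Eo ?e * (?U * iot i x) = ?U * iot i x" using e by simp
  show ?thesis
   unfolding mult.assoc[of ?B, symmetric] To_braid[OF k(1) len]
   using z[OF pvars_mult[OF pv(2,1)]] subgrpD(4)[OF K0.Z_subgrp z1[OF pv(1)] z2[OF pv(1)]] subgrpD(1)[OF K0.Z_subgrp]
   by (simp only: mult.assoc e' distrib_left distrib_right split: if_split) simp
 qed
 finally show "(To (Suc k) * cP - cP * To k) * iot i x \<in> K0.Z" .
qed (simp_all add: iot_add distrib_left)

lemma cP_Eo: "length nu = n ==> cP * Eo (nu @ [i]) = Eo (i # nu) * cP"
 unfolding cP_def using tau_Eo[of nu n 0 i] by (simp only: One_nat_def mult.assoc cycl_0 le0 simp_thms left_comm[OF aop_commute(3)])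

lemma cP_eps: "cP * iot i eB = xio n i eB * cP"
 unfolding iot_eB xio_eB sum_distrib_left sum_distrib_right by (intro sum.cong refl cP_Eo len_bt)

lemma iot_eB_BB: "x \<in> BB ==> iot i eB * iot i x = iot i x" "x \<in> BB ==> iot i x * iot i eB = iot i x"
 "x \<in> BB ==> xio n i eB * xio n i x = xio n i x" "x \<in> BB ==> xio n i x * xio n i eB = xio n i x"
 by (simp_all add: BB_unit K0.B(3) flip: K0.om(2) K1.om(2))

text \<open>The extra factor \<open>x\<close> keeps the induction on generators of \<open>y\<close>
  going: the commutation error of the generator appears in front of \<open>iot i (y * x)\<close>,
  the form in which \<open>X_err\<close> and \<open>T_err\<close> are stated.\<close>

lemma cP_comm:
 assumes y: "y \<in> OA n {1..<n}" and x: "x \<in> BB"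
 shows "xio n i y * (cP * iot i x) - cP * iot i (y * x) \<in> K0.Z"
 using y
proof (induction rule: OA_induct)
 case (diff y y')
 have "xio n i (y - y') * (cP * iot i x) - cP * iot i ((y - y') * x) =
  (xio n i y * (cP * iot i x) - cP * iot i (y * x)) - (xio n i y' * (cP * iot i x) - cP * iot i (y' * x))"
  by (simp add: xio_diff iot_diff left_diff_distrib right_diff_distrib)
 then show ?case using subgrpD(2)[OF K0.Z_subgrp diff(3,4)] by simp
next
 case (scal c)
 have 1: "cP * iot i x = xio n i eB * (cP * iot i x)"
 proof -
  have "cP * iot i x = cP * iot i eB * iot i x" by (simp only: mult.assoc iot_eB_BB(1)[OF x])
  then show ?thesis by (simp only: cP_eps mult.assoc)
 qed
 have "xio n i (po (cst c) * pr n) * (cP * iot i x) = po (cst c) * (Hp n i * (cP * iot i x))"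
  by (simp add: xio_po xio_pr mult.assoc)
 also have "... = po (cst c) * (cP * iot i x)"
 proof -
  have "Hp n i * (xio n i eB * (cP * iot i x)) = xio n i eB * (cP * iot i x)"
   by (simp only: Hp_xio(1) flip: mult.assoc)
  then show ?thesis by (simp only: 1[symmetric])
 qed
 also have "... = cP * iot i (po (cst c) * pr n * x)"
  by (simp add: mult.assoc iot_po' BB_unit(1)[OF x] left_comm[OF po_cst_commute])
 finally show ?case using subgrpD(1)[OF K0.Z_subgrp] by simp
next
 case (gen g y)
 have yx: "y * x \<in> BB" by (rule BB_left[OF gen(3) x])
 have step: "xio n i (gop g * y) * (cP * iot i x) - cP * iot i (gop g * y * x) \<in> K0.Z"
  if 1: "xio n i (gop g * y) = h * xio n i y" and 2: "iot i (gop g * (y * x)) = gop' * iot i (y * x)"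
   and 3: "!!z. z \<in> K0.Z ==> h * z \<in> K0.Z" and 4: "(h * cP - cP * gop') * iot i (y * x) \<in> K0.Z" for h gop'
 proof -
  have "xio n i (gop g * y) * (cP * iot i x) - cP * iot i (gop g * y * x) =
   h * (xio n i y * (cP * iot i x) - cP * iot i (y * x)) + (h * cP - cP * gop') * iot i (y * x)"
   unfolding mult.assoc[of "gop g"] 1 2 by (simp add: algebra_simps)
  then show ?thesis using subgrpD(4)[OF K0.Z_subgrp 3[OF gen(4)] 4] by simp
 qed
 show ?case
 proof (cases g)
  case (E nu)
  then have nu: "length nu = n" using gen by simp
  have p: "Eo nu * pr n = (Eo nu :: ('a, 'b) op)" using nu by (auto intro!: op_eqI)
  show ?thesis
  proof (rule step[of "Eo (i # nu)" "Eo (nu @ [i])"])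
   show "xio n i (gop g * y) = Eo (i # nu) * xio n i y" using E nu p by (simp add: xio_mult xio_Eo)
   show "iot i (gop g * (y * x)) = Eo (nu @ [i]) * iot i (y * x)" using E by (simp add: iot_mult iot_Eo)
   show "(Eo (i # nu) * cP - cP * Eo (nu @ [i])) * iot i (y * x) \<in> K0.Z"
    using cP_Eo[OF nu] subgrpD(1)[OF K0.Z_subgrp] by simp
  qed (use nu in \<open>simp add: Z0_Eo\<close>)
 next
  case (X k)
  then have k: "1 \<le> k" "k \<le> n" using gen by auto
  show ?thesis
  proof (rule step[of "Xo (Suc k)" "Xo k"])
   show "xio n i (gop g * y) = Xo (Suc k) * xio n i y" using X k by (simp add: xio_po cyci_def)
   show "iot i (gop g * (y * x)) = Xo k * iot i (y * x)" using X by (simp add: iot_po')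
   show "(Xo (Suc k) * cP - cP * Xo k) * iot i (y * x) \<in> K0.Z" by (rule X_err[OF k yx])
  qed (use k in \<open>simp add: Z0_po\<close>)
 next
  case (T l)
  then have l: "1 \<le> l" "l < n" using gen by auto
  have "xio n i (To l * pr n * y) = xio n i (To l * pr n) * xio n i y" by (rule xio_mult) (simp add: mult.assoc)
  then have 1: "xio n i (To l * y) = To (Suc l) * xio n i y"
   using OA_unit(1)[OF gen(3)] by (simp add: xio_To[OF l] mult.assoc Hp_xio)
  show ?thesis
  proof (rule step[of "To (Suc l)" "To l"])
   show "xio n i (gop g * y) = To (Suc l) * xio n i y" using T 1 by simp
   show "iot i (gop g * (y * x)) = To l * iot i (y * x)" using T iot_To_BB[OF l yx] by simp
   show "(To (Suc l) * cP - cP * To l) * iot i (y * x) \<in> K0.Z" by (rule T_err[OF l yx])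
   show "To (Suc l) * z \<in> K0.Z" if "z \<in> K0.Z" for z
    using Z0_tau[of "Suc l" "Suc (Suc l)" z] l that by (simp add: tau_Suc)
  qed
 qed
qed

lemma cP_comm': "x \<in> BB ==> xio n i x * cP - cP * iot i x \<in> K0.Z"
proof -
 assume x: "x \<in> BB"
 have "xio n i x * (cP * iot i eB) = xio n i x * cP"
  unfolding cP_eps by (simp only: iot_eB_BB(4)[OF x] flip: mult.assoc)
 then show ?thesis using cP_comm[OF BB_mem[OF x] K0.B(3)] by (simp only: BB_unit(3)[OF x])
qed

lemma cP_AA: "x \<in> AA ==> x * cP \<in> AA"
proof -
 assume x: "x \<in> AA"
 have "pr N * aop 1 \<in> AA" using rho_aL[of 1 N] FA_aL[of hL ca N 1] unfolding AA_rho by force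
 then have a: "x * aop 1 \<in> AA" by (intro AA_right[OF x]) (simp_all only: aop_commute)
 have "tau 1 N * pr N \<in> AA" unfolding AA_def by (rule tau_OA) auto
 then have "x * aop 1 * tau 1 N \<in> AA" by (intro AA_right[OF a]) (simp_all only: tau_pr)
 then show ?thesis by (simp only: cP_def mult.assoc)
qed

lemma cP_Y: "y \<in> K1.Y ==> y * cP \<in> K0.Y"
 using cP_AA[of y] unfolding K0.Y_def K1.Y_def by (simp add: mult.assoc cP_eps) (simp flip: mult.assoc)

text \<open>Well-definedness of P: an element of the cyclotomic ideal passes through
  \<open>cP\<close>, up to \<open>K0.Z\<close>, from one embedding to the other.\<close>

lemma cP_Z: "y \<in> K1.Z ==> y * cP \<in> K0.Z"
proof -
 assume y: "y \<in> K1.Z"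
 have "y \<in> {y. y * cP \<in> K0.Z}"
 proof (rule K1.Z_gen[OF y])
  show "subgrp {y. y * cP \<in> K0.Z}" using subgrpD[OF K0.Z_subgrp] by (simp add: subgrp_def left_diff_distrib)
  fix a c assume a: "a \<in> K1.Y" and c: "c \<in> II"
  have aA: "a \<in> AA" using a by (simp add: K1.Y_def)
  have "a * xio n i c * cP = a * (xio n i c * cP - cP * iot i c) + a * cP * iot i c" by (simp add: algebra_simps)
  also have "... \<in> K0.Z"
   using K0.A_Z[OF aA cP_comm'] K0.Y_om_I[OF cP_Y[OF a] c] II_BB c by (intro subgrpD(4)[OF K0.Z_subgrp]) auto
  finally show "a * xio n i c \<in> {y. y * cP \<in> K0.Z}" by simp
 qed
 then show ?thesis by simp
qed

lemma rho_tchr: "rho m (tchr Suc k) = pr m * tau 1 (Suc k)"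
proof -
 have "rh (tchr c k) = prod_list (map (\<lambda>r. To (c r)) [0..<k])" for c
  unfolding tchr_def rh_fw by (induction k) (simp_all add: wop_append)
 moreover have "map (\<lambda>r. To (Suc r)) [0..<k] = (map To [1..<Suc k] :: ('a, 'b) op list)"
  by (induction k) auto
 ultimately show ?thesis by (simp add: rho_def tau_def)
qed

text \<open>With \<open>q\<close> a sum of h_k tau_1 ... tau_k, the h_k avoid tau_1 and commute with
  a(x_1). For k < n the product a(x_1) tau_1 ... tau_k acts inside the embedded R(beta) and vanishes
  in K_0; the term k = n is a multiple of \<open>cP\<close>.\<close>

lemma image_cP:
 assumes q: "q \<in> AA"
 shows "\<exists>y\<in>K1.Y. aop 1 * q * iot i eB - y * cP \<in> K0.Z"
proof -
 obtain f where f: "f \<in> alg N {1..n}" "q = rho N f"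
  using q unfolding AA_def OA_def by (auto simp: atLeastLessThanSuc_atLeastAtMost)
 obtain h where h: "!!k. h k \<in> alg N ({1..n} - {Suc 0})" "cg N f (\<Sum>k\<le>n. fmul (h k) (tchr Suc k))"
  using right_span[OF lessI chain_ok_up f(1)] by blast
 have hF: "h k \<in> FA N" for k using alg_FA[OF h(1)] .
 have tF: "tchr Suc k \<in> FA N" if "k \<le> n" for k using FA_tch[OF lessI chain_ok_up that] by simp
 have hA: "rho N (h k) \<in> AA" for k unfolding AA_rho using hF by blast
 have hc: "aop 1 * rho N (h k) = rho N (h k) * aop 1" for k
 proof -
  have "{1..n} - {Suc 0} = {2..<N}" by auto
  then have "rho N (h k) \<in> OA N {2..<N}" using h(1)[of k] by (simp add: OA_def)
  then show ?thesis by (rule OA_aop[symmetric])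
 qed
 have "q = rho N (\<Sum>k\<le>n. fmul (h k) (tchr Suc k))"
  unfolding f(2) by (rule cg_rho[OF h(2) alg_FA[OF f(1)]]) (intro FA_sum FA_fmul hF tF, simp)
 also have "... = (\<Sum>k\<le>n. rho N (h k) * tau 1 (Suc k))"
  using hF tF AA_unit(2)[OF hA] by (subst rho_sum) (auto intro!: FA_fmul sum.cong simp: rho_fmul rho_tchr simp flip: mult.assoc)
 finally have q: "q = (\<Sum>k\<le>n. rho N (h k) * tau 1 (Suc k))" .
 let ?s = "\<lambda>k. rho N (h k) * (aop 1 * (tau 1 (Suc k) * iot i eB))"
 have "aop 1 * q * iot i eB = (\<Sum>k\<le>n. ?s k)"
  unfolding q by (simp only: sum_distrib_left sum_distrib_right mult.assoc left_comm[OF hc])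
 also have "... = (\<Sum>k<n. ?s k) + ?s n" by (simp flip: lessThan_Suc_atMost)
 also have "?s n = rho N (h n) * xio n i eB * cP" using cP_eps by (simp add: cP_def mult.assoc)
 finally have "aop 1 * q * iot i eB - rho N (h n) * xio n i eB * cP = (\<Sum>k<n. ?s k)" by simp
 also have "... \<in> K0.Z"
 proof (intro subgrp_sum[OF K0.Z_subgrp] K0.A_Z[OF hA])
  fix k assume k: "k \<in> {..<n}"
  then have n: "1 \<le> n" and k': "Suc k \<le> n" by auto
  obtain z where "z \<in> II" "aop 1 * (tau 1 (Suc k) * iot i eB) = iot i z"
   using aop_iot_I[OF n, of "tau 1 (Suc k) * eB"] iot_tau[OF le_refl k' K0.B(3)] by auto
  then show "aop 1 * (tau 1 (Suc k) * iot i eB) \<in> K0.Z" using iot_I_Z0 by simp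
 qed
 finally show ?thesis using K1.A_om[OF hA K0.B(3)] by blast
qed

end

section \<open>A left inverse of the map\<close>

context klr_cyc begin

text \<open>One difference for each crossing, as \<open>To_Th_diff\<close> requires. It is written
  with x_1 because it stands to the right of \<open>Psi\<close>, where the moving strand is still in
  first place.\<close>

definition Dp :: "nat => 'b mpoly" where "Dp m = (\<Prod>a\<in>{1..m}. Vr 1 - Vr (Suc a))"

text \<open>Right multiplication by it leads from K_0 back to K_1; built from intertwiners, it is
  linear over R(beta) without error.\<close>

definition GG :: "('a, 'b) op" where "GG = Psi n * po (Dp n)"

lemma Dp_simps: "Dp 0 = 1" "Dp (Suc m) = Dp m * (Vr 1 - Vr (Suc (Suc m)))"
 by (simp_all add: Dp_def prod.nat_ivl_Suc')

lemma Dp_pvars: "m \<le> n ==> Dp m \<in> pvars N"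
 unfolding Dp_def by (intro pvars_prod pvars_diff pvars_Vr) auto

lemma sp_Dp: "1 \<le> l ==> l < n ==> sp (Suc l) (Dp n) = Dp n"
proof -
 assume l: "1 \<le> l" "l < n"
 have "sp (Suc l) (Dp n) = (\<Prod>a\<in>{1..n}. Vr 1 - Vr (Suc (sidx l a)))"
  unfolding Dp_def sub.prod using l by (intro prod.cong refl) (auto simp: sub.diff sidx_def)
 also have "... = Dp n"
  unfolding Dp_def using l by (intro prod.reindex_bij_witness[of _ "sidx l" "sidx l"]) (auto simp: sidx_def)
 finally show ?thesis .
qed

lemma AA_To: "x \<in> AA ==> 1 \<le> l ==> l < N ==> x * To l \<in> AA"
 using OA_gen[of N "T l" "{1..<N}"] by - (rule AA_right, simp_all add: pr_To AA_def)

lemma AA_Xo: "x \<in> AA ==> 1 \<le> v ==> v \<le> N ==> x * Xo v \<in> AA"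
 using OA_gen[of N "X v" "{1..<N}"] by - (rule AA_right, simp_all add: pr_po AA_def)

lemma AA_po: "p \<in> pvars N ==> x \<in> AA ==> x * po p \<in> AA"
proof (induction p arbitrary: x rule: pvars.induct)
 case (pvars_cst c)
 have "pr N * po (cst c) \<in> AA" using OA_scal[of c N "{1..<N}"] by (simp add: pr_po AA_def)
 from AA_right[OF pvars_cst _ this] show ?case by (simp add: pr_po)
next
 case (pvars_var j p)
 then have "x * Xo j * po p \<in> AA" using AA_Xo by blast
 then show ?case by (simp only: po_mult mult.assoc)
next
 case (pvars_scal p c)
 have "pr N * po (cst c) \<in> AA" using OA_scal[of c N "{1..<N}"] by (simp add: pr_po AA_def)
 from AA_right[OF pvars_scal(3) _ this] have "x * po (cst c) \<in> AA" by (simp add: pr_po)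
 then have "x * po (cst c) * po p \<in> AA" by (rule pvars_scal(2))
 then show ?case by (simp only: po_mult mult.assoc)
next
 case (pvars_add p q)
 then show ?case using subgrpD(4)[OF K0.A(1)] by (simp add: distrib_left flip: po_add)
qed

lemma AA_Psi: "m \<le> n ==> x \<in> AA ==> x * Psi m \<in> AA"
proof (induction m arbitrary: x)
 case (Suc m)
 have "x * To (Suc m) * Xo (Suc (Suc m)) - x * Xo (Suc (Suc m)) * To (Suc m) \<in> AA"
  using Suc.prems by (intro subgrpD(2)[OF K0.A(1)] AA_To AA_Xo) auto
 then have "x * Th (Suc m) \<in> AA" by (simp add: Th_op right_diff_distrib mult.assoc)
 then have "x * Th (Suc m) * Psi m \<in> AA" using Suc by auto
 then show ?case by (simp only: Psi.simps mult.assoc)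
qed simp

lemma AA_GG: "x \<in> AA ==> x * GG \<in> AA"
 using AA_po[OF Dp_pvars[OF le_refl] AA_Psi[OF le_refl]] by (simp only: GG_def mult.assoc)

lemma Eo_Psi: "length nu = n ==> Eo (nu @ [i]) * Psi n = Psi n * Eo (i # nu)"
 using Psi_Eo[of n nu i] cycl_full[of nu i] by simp

lemma Lp_Psi: "Lp n i * Psi n = Psi n * Hp n i"
proof -
 have "Lp n i = (\<Sum>nu\<in>Iseqs n. Eo (nu @ [i]) :: ('a, 'b) op)" "Hp n i = (\<Sum>nu\<in>Iseqs n. Eo (i # nu) :: ('a, 'b) op)"
  unfolding iot_pr[of i n, symmetric] xio_pr[of n i, symmetric] sum_Eo[symmetric]
  by (simp_all add: iot_sum xio_sum iot_Eo) (simp add: xio_Eo Iseqs_def)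
 then show ?thesis
  by (simp only: sum_distrib_left sum_distrib_right) (intro sum.cong refl Eo_Psi, simp add: Iseqs_def)
qed

lemma iot_xio_gen:
 assumes g: "vgen n g" "\<forall>l. g = T l --> l \<in> {1..<n}"
 obtains h h' where "!!y. y \<in> OA n {1..<n} ==> iot i (gop g * y) = h * iot i y"
  "!!y. y \<in> OA n {1..<n} ==> xio n i (gop g * y) = h' * xio n i y"
  "h * Psi n = Psi n * h'" "h' * po (Dp n) = po (Dp n) * h'"
proof (cases g)
 case (E nu)
 then have nu: "length nu = n" using g by simp
 have p: "Eo nu * pr n = (Eo nu :: ('a, 'b) op)" using nu by (auto intro!: op_eqI)
 show thesis
  by (rule that[of "Eo (nu @ [i])" "Eo (i # nu)"])
    (use E nu p in \<open>simp_all add: iot_mult iot_Eo xio_mult xio_Eo Eo_Psi Eo_commute\<close>)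
next
 case (X k)
 then have k: "1 \<le> k" "k \<le> n" using g by auto
 have "Psi n * Xo (Suc k) = Xo k * Psi n" unfolding Psi_po using k by (simp add: spc_simps sx_eq)
 then show thesis
  by (intro that[of "Xo k" "Xo (Suc k)"]) (use X k in \<open>simp_all add: iot_po' xio_po cyci_def po_commute\<close>)
next
 case (T l)
 then have l: "1 \<le> l" "l < n" using g by auto
 show thesis
 proof (rule that[of "To l" "To (Suc l)"])
  fix y assume y: "y \<in> OA n {1..<n}"
  then have py: "pr n * y = y" by (rule OA_unit)
  have "iot i (To l * pr n * y) = iot i (To l * pr n) * iot i y" by (rule iot_mult)
  also have "... = To l * iot i y" unfolding iot_To[OF l(2)] mult.assoc Lp_iot[OF py] ..
  finally have "iot i (To l * pr n * y) = To l * iot i y" .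
  then show "iot i (gop g * y) = To l * iot i y" using T py by (simp add: mult.assoc)
  have "xio n i (To l * pr n * y) = xio n i (To l * pr n) * xio n i y" by (rule xio_mult) (simp add: mult.assoc)
  then show "xio n i (gop g * y) = To (Suc l) * xio n i y"
   using T py by (simp add: xio_To[OF l] mult.assoc Hp_xio)
 next
  show "To l * Psi n = Psi n * To (Suc l)" by (rule Psi_To[OF l])
  show "To (Suc l) * po (Dp n) = po (Dp n) * To (Suc l)" by (rule To_po[OF sp_Dp[OF l]])
 qed
qed

text \<open>\<open>Psi n\<close> intertwines the two embeddings, and \<open>Dp n\<close> is
  symmetric in the variables x_2, ..., x_{n+1} on which the shifted copy of R(beta) acts.\<close>

lemma iot_GG: "y \<in> OA n {1..<n} ==> iot i y * GG = GG * xio n i y"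
proof -
 assume y: "y \<in> OA n {1..<n}"
 then have "iot i y * Psi n = Psi n * xio n i y \<and> xio n i y * po (Dp n) = po (Dp n) * xio n i y"
 proof (induction rule: OA_induct)
  case (diff x y)
  then show ?case by (simp add: iot_diff xio_diff left_diff_distrib right_diff_distrib)
 next
  case (scal c)
  have 1: "iot i (po (cst c) * pr n) = po (cst c) * Lp n i" "xio n i (po (cst c) * pr n) = po (cst c) * Hp n i"
   by (simp_all add: iot_po xio_po xio_pr)
  have 2: "po (cst c) * Lp n i * Psi n = Psi n * (po (cst c) * Hp n i)"
   by (simp only: mult.assoc Lp_Psi left_comm[OF po_cst_commute[of c "Psi n"]])
  have 3: "po (cst c) * Hp n i * po (Dp n) = (po (Dp n) * (po (cst c) * Hp n i) :: ('a, 'b) op)"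
   by (simp only: mult.assoc po_Lp(2)[of "Dp n", symmetric] left_comm[OF po_commute(1)[of "cst c" "Dp n"]])
  show ?case unfolding 1 by (intro conjI 2 3)
 next
  case (gen g x)
  obtain h h' where h: "iot i (gop g * x) = h * iot i x" "xio n i (gop g * x) = h' * xio n i x"
   "h * Psi n = Psi n * h'" "h' * po (Dp n) = po (Dp n) * h'"
   using iot_xio_gen[OF gen(1,2)] gen(3) by metis
  show ?case unfolding h(1,2) mult.assoc conjunct1[OF gen(4)] conjunct2[OF gen(4)]
   by (simp only: h(3,4) flip: mult.assoc)
 qed
 then have 1: "iot i y * Psi n = Psi n * xio n i y" and 2: "xio n i y * po (Dp n) = po (Dp n) * xio n i y" by auto
 show ?thesis unfolding GG_def mult.assoc[symmetric] 1 unfolding mult.assoc 2 ..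
qed

lemma Z0_GG: "y \<in> K0.Z ==> y * GG \<in> K1.Z"
proof -
 assume y: "y \<in> K0.Z"
 have "y \<in> {y. y * GG \<in> K1.Z}"
 proof (rule K0.Z_gen[OF y])
  show "subgrp {y. y * GG \<in> K1.Z}" using subgrpD[OF K1.Z_subgrp] by (simp add: subgrp_def left_diff_distrib)
  fix a c assume a: "a \<in> K0.Y" and c: "c \<in> II"
  have "a * iot i c * GG = a * GG * xio n i c" using c II_BB BB_mem by (simp add: mult.assoc iot_GG subset_iff)
  then show "a * iot i c \<in> {y. y * GG \<in> K1.Z}" using K1.A_om_I[OF AA_GG c] a by (simp add: K0.Y_def)
 qed
 then show ?thesis by simp
qed

lemma Y0_GG: "y \<in> K0.Y ==> y * GG \<in> K1.Y"
proof -
 assume y: "y \<in> K0.Y"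
 have "y * GG * xio n i eB = y * iot i eB * GG" by (simp only: mult.assoc iot_GG[OF BB_mem[OF K0.B(3)]])
 then show ?thesis using y AA_GG unfolding K0.Y_def K1.Y_def by simp
qed

lemma Z1_Xo: "y \<in> K1.Z ==> 1 \<le> j ==> j \<le> N ==> y * Xo j \<in> K1.Z"
proof -
 assume y: "y \<in> K1.Z" and j: "1 \<le> j" "j \<le> N"
 show ?thesis
 proof (cases "j = 1")
  case True
  have "y \<in> {y. y * Xo 1 \<in> K1.Z}"
  proof (rule K1.Z_gen[OF y])
   show "subgrp {y. y * Xo 1 \<in> K1.Z}" using subgrpD[OF K1.Z_subgrp] by (simp add: subgrp_def left_diff_distrib)
   fix a c assume a: "a \<in> K1.Y" and c: "c \<in> II"
   have "xio n i c * Xo 1 = Xo 1 * xio n i c" using xio_po_commute[of c n i 1] c II_BB BB_mem by auto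
   then have "a * xio n i c * Xo 1 = a * Xo 1 * xio n i c" by (simp only: mult.assoc)
   moreover have "a * Xo 1 \<in> AA" using a by (intro AA_Xo) (auto simp: K1.Y_def)
   ultimately show "a * xio n i c \<in> {y. y * Xo 1 \<in> K1.Z}" using K1.A_om_I[OF _ c] by simp
  qed
  then show ?thesis using True by simp
 next
  case False
  then obtain k where k: "j = Suc k" "1 \<le> k" "k \<le> n" using j by (cases j) auto
  have x: "xio n i (Xo k * eB) = Xo j * xio n i eB" using k by (simp add: xio_po cyci_def)
  have c: "xio n i eB * Xo j = Xo j * xio n i eB"
   unfolding xio_eB sum_distrib_left sum_distrib_right by (simp add: Eo_commute)
  have "y * Xo j = y * xio n i eB * Xo j" using K1.Z_Y[OF y] by (simp add: K1.Y_def)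
  also have "... = y * xio n i (Xo k * eB)" by (simp only: mult.assoc c x)
  also have "... \<in> K1.Z" using K1.Z_om[OF y po_BB[OF k(2,3) K0.B(3)]] .
  finally show ?thesis .
 qed
qed

lemma Z1_cst: "y \<in> K1.Z ==> y * po (cst c) \<in> K1.Z"
proof -
 assume y: "y \<in> K1.Z"
 have pn: "pr N * y = y" using K1.Z_Y[OF y] AA_unit by (auto simp: K1.Y_def)
 have "y * po (cst c) = po (cst c) * y" by (rule po_cst_commute[symmetric])
 also have "... = (po (cst c) * pr N) * y" by (simp only: mult.assoc pn)
 finally have "y * po (cst c) = (po (cst c) * pr N) * y" .
 then show ?thesis using K1.A_Z[OF _ y, of "po (cst c) * pr N"] OA_scal[of c N "{1..<N}"] by (simp add: AA_def)
qed

lemma Z1_po: "p \<in> pvars N ==> y \<in> K1.Z ==> y * po p \<in> K1.Z"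
proof (induction p arbitrary: y rule: pvars.induct)
 case (pvars_cst c)
 then show ?case by (rule Z1_cst)
next
 case (pvars_var j p)
 then have "y * Xo j * po p \<in> K1.Z" using Z1_Xo by blast
 then show ?case by (simp only: po_mult mult.assoc)
next
 case (pvars_scal p c)
 then have "y * po (cst c) * po p \<in> K1.Z" using Z1_cst by blast
 then show ?case by (simp only: po_mult mult.assoc)
next
 case (pvars_add p q)
 then show ?case using subgrpD(4)[OF K1.Z_subgrp] by (simp add: distrib_left flip: po_add)
qed

lemma xio_tau: "1 \<le> a ==> b \<le> n ==> x \<in> BB ==> tau a b * x \<in> BB \<and> xio n i (tau a b * x) = tau (Suc a) (Suc b) * xio n i x"
proof (induction "b - a" arbitrary: a)
 case 0
 then show ?case by (simp add: tau_def)
next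
 case (Suc r)
 then have t: "tau a b = To a * tau (Suc a) b" "tau (Suc a) (Suc b) = To (Suc a) * tau (Suc (Suc a)) (Suc b)"
  by (intro tau_Suc', simp)+
 have IH: "tau (Suc a) b * x \<in> BB \<and> xio n i (tau (Suc a) b * x) = tau (Suc (Suc a)) (Suc b) * xio n i x" using Suc by auto
 have l: "1 \<le> a" "a < n" using Suc by auto
 have "xio n i (To a * z) = To (Suc a) * xio n i z" if z: "z \<in> BB" for z
 proof -
  have "xio n i (To a * pr n * z) = xio n i (To a * pr n) * xio n i z" by (rule xio_mult) (simp add: mult.assoc)
  then show ?thesis using BB_unit(1)[OF z] by (simp add: xio_To[OF l] mult.assoc Hp_xio)
 qed
 then show ?case unfolding t mult.assoc using IH To_BB[OF l] by simp
qed

lemma xio_aop: "1 \<le> n ==> x \<in> BB ==> xio n i (aop 1 * x) = aop 2 * xio n i x"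
proof -
 assume n: "1 \<le> n" and x: "x \<in> BB"
 have "xio n i (aop 1 * x) - aop 2 * xio n i x \<in> {0}"
 proof (rule BB_split[OF _ x])
  show "subgrp {0 :: ('a, 'b) op}" by (simp add: subgrp_def)
  fix nu and x :: "('a, 'b) op" assume nu: "nu \<in> Iseq bt" and x: "x \<in> BB" "Eo nu * x = x"
  have "aop 1 * x = aop 1 * Eo nu * x" by (simp only: mult.assoc x)
  also have "... = po (apoly (nth1 nu 1) 1) * x" unfolding aop_def dg_Eo by (simp only: mult.assoc x)
  finally have 1: "xio n i (aop 1 * x) = po (apoly (nth1 nu 1) 2) * xio n i x"
   using n by (simp add: xio_po apoly_def sub.sum sub.mult sub.power cyci_def numeral_2_eq_2)
  have "xio n i (Eo nu * x) = Eo (i # nu) * xio n i x"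
  proof -
   have p: "Eo nu * pr n = (Eo nu :: ('a, 'b) op)" using len_bt[OF nu] by (auto intro!: op_eqI)
   show ?thesis by (simp only: xio_mult[OF p] xio_Eo[OF len_bt[OF nu]])
  qed
  then have e: "Eo (i # nu) * xio n i x = xio n i x" by (simp only: x(2))
  have "aop 2 * xio n i x = aop 2 * Eo (i # nu) * xio n i x" by (simp only: mult.assoc e)
  also have "... = po (apoly (nth1 (i # nu) 2) 2) * xio n i x" unfolding aop_def dg_Eo by (simp only: mult.assoc e)
  also have "nth1 (i # nu) 2 = nth1 nu 1" by (simp add: nth1_def)
  finally show "xio n i (aop 1 * x) - aop 2 * xio n i x \<in> {0}" using 1 by simp
 qed (simp_all add: distrib_left xio_add)
 then show ?thesis by simp
qed

text \<open>The identity for the other embedding is pulled back to R(beta) by injectivity of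
  \<open>iot\<close> and then shifted, which turns a(x_1) into a(x_2).\<close>

lemma aop_xio_I: "m \<le> n ==> 1 \<le> m ==> x \<in> BB ==> \<exists>c\<in>II. aop 2 * (tau 2 (Suc m) * xio n i x) = xio n i c"
proof -
 assume m: "m \<le> n" "1 \<le> m" and x: "x \<in> BB"
 have tx: "tau 1 m * x \<in> BB" "xio n i (tau 1 m * x) = tau 2 (Suc m) * xio n i x"
  using xio_tau[OF le_refl m(1) x] by (simp_all add: numeral_2_eq_2)
 have n: "1 \<le> n" using m by simp
 obtain c where c: "c \<in> II" "aop 1 * iot i (tau 1 m * x) = iot i c" using aop_iot_I[OF n tx(1)] by blast
 have "iot i (pr n * aop 1 * (tau 1 m * x)) = iot i (pr n * aop 1) * iot i (tau 1 m * x)" by (rule iot_mult)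
 also have "... = iot i c" unfolding iot_aop[OF n] mult.assoc Lp_iot_BB[OF tx(1)] by (rule c(2))
 finally have "iot i (pr n * (aop 1 * (tau 1 m * x))) = iot i c" by (simp only: mult.assoc)
 then have "iot i (pr n * (aop 1 * (tau 1 m * x)) - c) = 0" unfolding iot_diff by simp
 then have "pr n * (aop 1 * (tau 1 m * x)) - c = 0" by (rule iot_inj)
 moreover have "pr n * (aop 1 * (tau 1 m * x)) = aop 1 * (tau 1 m * x)"
  by (simp only: left_comm[OF aop_commute(4)[symmetric]] BB_unit(1)[OF tx(1)])
 ultimately have "aop 1 * (tau 1 m * x) = c" by simp
 then have "xio n i c = aop 2 * (tau 2 (Suc m) * xio n i x)" using xio_aop[OF n tx(1)] tx(2) by simp
 then show ?thesis using c(1) by metis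
qed

text \<open>The polynomial that survives in the component e(i, nu): the cyclotomic polynomial of
  colour \<open>i\<close> and one factor for each strand passed so far.\<close>

definition FF :: "nat => 'a list => 'b mpoly" where
 "FF m nu = apoly i 1 * (\<Prod>a\<in>{1..m}. UU i (nth1 nu a) 1 (Suc a))"

lemma FF_simps: "FF 0 nu = apoly i 1" "FF (Suc m) nu = FF m nu * UU i (nth1 nu (Suc m)) 1 (Suc (Suc m))"
 by (simp_all add: FF_def prod.nat_ivl_Suc' mult.assoc)

lemma UU_pvars: "1 \<le> a ==> a \<le> m ==> 1 \<le> b ==> b \<le> m ==> UU j k a b \<in> pvars m"
 unfolding UU_def by (auto intro!: pvars_mult pvars_uminus pvars_power pvars_diff pvars_Vr PP_pvars QQ_pvars)

text \<open>Induction on the number of strands passed. The innermost pair tau_{m+1} theta_{m+1} is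
  resolved by \<open>To_Th_diff\<close>: the polynomial part moves to the right through
  \<open>Psi m\<close> and becomes the next factor, while the part that retains theta_{m+1} lies in
  \<open>K1.Z\<close>.\<close>

lemma component:
 assumes nu: "nu \<in> Iseq bt"
 shows "m \<le> n ==> aop 1 * tau 1 (Suc m) * Psi m * po (Dp m) * Eo (i # nu) - po (FF m nu) * Eo (i # nu) \<in> K1.Z"
proof (induction m)
 case 0
 have "aop 1 * Eo (i # nu) = po (FF 0 nu) * Eo (i # nu)" by (simp add: aop_def dg_Eo nth1_def FF_simps)
 then show ?case using subgrpD(1)[OF K1.Z_subgrp] by (simp add: Dp_simps)
next
 case (Suc m)
 let ?X = "aop 1 * tau 1 (Suc m)" and ?e = "cycl m nu i" and ?j = "nth1 nu (Suc m)" and ?E = "Eo (i # nu) :: ('a, 'b) op"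
 let ?U = "UU i ?j (Suc m) (Suc (Suc m))" and ?U' = "UU i ?j 1 (Suc (Suc m))"
 let ?P = "if i = ?j then PP i (Suc m) (Suc (Suc m)) else 0" and ?P' = "if i = ?j then PP i (Suc (Suc m)) 1 else 0"
 have mn: "m < length nu" using Suc len_bt[OF nu] by simp
 have n1: "nth1 ?e (Suc m) = i" "nth1 ?e (Suc (Suc m)) = ?j" using mn by (simp_all add: nth1_cycl)
 have EPsi: "Eo ?e * Psi m = Psi m * ?E" using Psi_Eo[of m nu i] mn by simp
 have cE: "po p * ?E = ?E * po p" for p by (simp add: Eo_commute)
 have d: "Psi m * po (Vr 1 - Vr (Suc (Suc m))) = po (Vr (Suc m) - Vr (Suc (Suc m))) * Psi m"
  unfolding Psi_po by (simp add: spc_simps sx_eq)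
 have "?X * To (Suc m) * Psi (Suc m) * po (Dp (Suc m)) * ?E =
  ?X * To (Suc m) * Th (Suc m) * (Psi m * po (Vr 1 - Vr (Suc (Suc m)))) * ?E * po (Dp m)"
  by (simp only: Psi.simps Dp_simps mult.commute[of "Dp m"] po_mult[symmetric] mult.assoc cE left_comm[OF cE])
 also have "... = ?X * (To (Suc m) * Th (Suc m) * po (Vr (Suc m) - Vr (Suc (Suc m))) * Eo ?e) * Psi m * po (Dp m)"
  by (simp only: d) (simp only: mult.assoc EPsi[symmetric])
 also have "... = ?X * ((po ?U + po ?P * Th (Suc m)) * Eo ?e) * Psi m * po (Dp m)"
  using To_Th_diff[of "Suc m" ?e] mn by (simp only: n1) simp
 also have "... = ?X * po ?U * Psi m * ?E * po (Dp m) + ?X * po ?P * Psi (Suc m) * ?E * po (Dp m)"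
  by (simp only: mult.assoc EPsi[symmetric] Psi.simps distrib_left distrib_right)
 finally have LHS: "?X * To (Suc m) * Psi (Suc m) * po (Dp (Suc m)) * ?E =
  ?X * po ?U * Psi m * ?E * po (Dp m) + ?X * po ?P * Psi (Suc m) * ?E * po (Dp m)" .
 have "po ?U * Psi m = Psi m * po ?U'" unfolding Psi_po by (simp add: spc_UU sx_eq)
 then have U: "po ?U * (Psi m * x) = Psi m * (po ?U' * x)" for x by (simp only: mult.assoc[symmetric])
 have "po ?P * Psi (Suc m) = Psi (Suc m) * po ?P'"
  unfolding Psi_po by (simp del: spc.simps Psi.simps add: spc_PP sx_eq)
    (metis Psi_po mult_zero_left mult_zero_right po_0)
 then have P: "po ?P * (Psi (Suc m) * x) = Psi (Suc m) * (po ?P' * x)" for x by (simp only: mult.assoc[symmetric])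
 have "?X * po ?U * Psi m * ?E * po (Dp m) = ?X * Psi m * po (Dp m) * ?E * po ?U'"
  by (simp only: mult.assoc U cE left_comm[OF cE] po_mult mult.commute[of "Dp m"])
 moreover have "po (FF (Suc m) nu) * ?E = po (FF m nu) * ?E * po ?U'"
  by (simp only: FF_simps mult.assoc cE left_comm[OF cE] po_mult)
 ultimately have 1: "?X * po ?U * Psi m * ?E * po (Dp m) - po (FF (Suc m) nu) * ?E =
   (?X * Psi m * po (Dp m) * ?E - po (FF m nu) * ?E) * po ?U'"
  by (simp only: left_diff_distrib)
 have 1: "?X * po ?U * Psi m * ?E * po (Dp m) - po (FF (Suc m) nu) * ?E \<in> K1.Z"
  unfolding 1 using Suc by (intro Z1_po UU_pvars) auto
 \<comment> \<open>In the term with theta_{m+1} only tau_1, ..., tau_m are left, so all of them pass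
   through the longer intertwiner and are shifted. Together with a(x_2) they form an element of the
   cyclotomic ideal of the shifted R(beta).\<close>
 have tP: "tau 1 k * Psi (Suc m) = Psi (Suc m) * tau 2 (Suc k)" if "k \<le> Suc m" for k
  using that
 proof (induction k)
  case (Suc k)
  show ?case
  proof (cases "k = 0")
   case False
   have "tau 1 (Suc k) * Psi (Suc m) = tau 1 k * (To k * Psi (Suc m))" using False by (simp only: tau_Suc mult.assoc)
   also have "To k * Psi (Suc m) = Psi (Suc m) * To (Suc k)" using False Suc by (intro Psi_To) auto
   also have "tau 1 k * (Psi (Suc m) * To (Suc k)) = tau 1 k * Psi (Suc m) * To (Suc k)" by (simp only: mult.assoc)
   also have "tau 1 k * Psi (Suc m) = Psi (Suc m) * tau 2 (Suc k)" using Suc by simp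
   also have "... * To (Suc k) = Psi (Suc m) * tau 2 (Suc (Suc k))"
    using tau_Suc[of 2 "Suc k"] False by (simp only: mult.assoc)
   finally show ?thesis .
  qed (simp add: tau_def)
 qed (simp add: tau_def)
 have "?X * Psi (Suc m) = aop 1 * Psi (Suc m) * tau 2 (Suc (Suc m))" using tP[of "Suc m"] by (simp only: mult.assoc order_refl)
 also have "... = Psi (Suc m) * (aop 2 * tau 2 (Suc (Suc m)))" using Psi_aop[of "Suc m"] by (simp only: mult.assoc)
 finally have XPsi: "?X * Psi (Suc m) = Psi (Suc m) * (aop 2 * tau 2 (Suc (Suc m)))" .
 have "?X * po ?P * Psi (Suc m) * ?E * po (Dp m) = (?X * Psi (Suc m)) * (?E * po (?P' * Dp m))"
  by (simp only: mult.assoc P cE left_comm[OF cE] po_mult)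
 also have "... = Psi (Suc m) * (aop 2 * (tau 2 (Suc (Suc m)) * ?E)) * po (?P' * Dp m)"
  unfolding XPsi by (simp only: mult.assoc)
 also have "... \<in> K1.Z"
 proof (rule Z1_po)
  show "?P' * Dp m \<in> pvars N" using Suc by (intro pvars_mult Dp_pvars) (auto intro!: PP_pvars pvars_0)
  obtain c where c: "c \<in> II" "aop 2 * (tau 2 (Suc (Suc m)) * ?E) = xio n i c"
   using aop_xio_I[OF Suc.prems _ Eo_BB[OF nu]] xio_Eo[OF len_bt[OF nu]] by auto
  have "Psi (Suc m) * xio n i c = pr N * Psi (Suc m) * xio n i c"
  proof -
   have "pr N * xio n i c = xio n i c" using c II_BB by (intro AA_unit K1.om) auto
   moreover have "pr N * Th l = Th l * pr N" if "1 \<le> l" for l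
    unfolding Th_op[OF that] by (intro commute_diff commute_mult) (simp_all add: pr_To pr_po)
   then have "pr N * Psi q = Psi q * pr N" for q
    by (induction q) (simp_all add: commute_mult)
   ultimately show ?thesis by (simp only: mult.assoc)
  qed
  then show "Psi (Suc m) * (aop 2 * (tau 2 (Suc (Suc m)) * ?E)) \<in> K1.Z"
   unfolding c using K1.A_om_I[OF AA_Psi[OF Suc.prems AA_pr] c(1)] by simp
 qed
 finally have 2: "?X * po ?P * Psi (Suc m) * ?E * po (Dp m) \<in> K1.Z" .
 have "tau 1 (Suc (Suc m)) = tau 1 (Suc m) * To (Suc m)" by (rule tau_Suc) simp
 then have t: "aop 1 * tau 1 (Suc (Suc m)) * Psi (Suc m) * po (Dp (Suc m)) * ?E =
  ?X * To (Suc m) * Psi (Suc m) * po (Dp (Suc m)) * ?E" by (simp only: mult.assoc)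
 have r: "a + b - c = (a - c) + b" for a b c :: "('a, 'b) op" by simp
 show ?case unfolding t LHS r by (rule subgrpD(4)[OF K1.Z_subgrp 1 2])
qed

definition ff :: "('a, 'b) op" where "ff = (\<Sum>nu\<in>Iseq bt. po (FF n nu) * Eo (i # nu))"

lemma cP_GG: "cP * GG * xio n i eB - ff \<in> K1.Z"
proof -
 have "cP * GG * xio n i eB - ff =
  (\<Sum>nu\<in>Iseq bt. aop 1 * tau 1 N * Psi n * po (Dp n) * Eo (i # nu) - po (FF n nu) * Eo (i # nu))"
  unfolding ff_def xio_eB cP_def GG_def by (simp add: sum_subtractf sum_distrib_left mult.assoc)
 also have "... \<in> K1.Z" by (intro subgrp_sum[OF K1.Z_subgrp] component) auto
 finally show ?thesis .
qed

end

section \<open>The polynomial is monic in x_1 up to a unit\<close>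

lemma sum_list_nth1: "(\<Sum>a\<in>{1..length nu}. g (nth1 nu a)) = sum_list (map g nu)"
 and prod_list_nth1: "(\<Prod>a\<in>{1..length nu}. h (nth1 nu a)) = (prod_list (map h nu) :: 'b::comm_monoid_mult)"
 for g :: "'a => 'c::comm_monoid_add"
proof -
 have s: "(\<Sum>a\<in>{1..length nu}. g (nth1 nu a)) = (\<Sum>a\<in>{0..<length nu}. g (nu ! a))"
  unfolding nth1_def by (rule sum.reindex_bij_witness[of _ Suc "\<lambda>a. a - 1"]) auto
 show "(\<Sum>a\<in>{1..length nu}. g (nth1 nu a)) = sum_list (map g nu)"
  unfolding s by (simp add: sum.list_conv_set_nth)
 have p: "(\<Prod>a\<in>{1..length nu}. h (nth1 nu a)) = (\<Prod>a\<in>{0..<length nu}. h (nu ! a))"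
  unfolding nth1_def by (rule prod.reindex_bij_witness[of _ Suc "\<lambda>a. a - 1"]) auto
 show "(\<Prod>a\<in>{1..length nu}. h (nth1 nu a)) = prod_list (map h nu)"
  unfolding p by (simp add: prod.list_conv_set_nth)
qed

context klr_cyc begin

text \<open>Polynomials that act through the shifted copy of R(n), such as those in x_2, ...,
  x_{n+1}. The coefficients of a polynomial in x_1 must be of this kind to be coefficients on
  K_1.\<close>

definition WW :: "'b mpoly set" where
 "WW = {p. (po (sub (\<lambda>j. Vr (cyc n j)) p) * pr n :: ('a, 'b) op) \<in> OA n {1..<n}}"

lemma WW_cst: "cst c \<in> WW" using OA_scal by (simp add: WW_def)

lemma WW_0: "0 \<in> WW" using subgrpD(1)[OF OA_subgrp] by (simp add: WW_def)

lemma WW_add: "p \<in> WW ==> q \<in> WW ==> p + q \<in> WW"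
 using subgrpD(4)[OF OA_subgrp] by (simp add: WW_def sub.add distrib_right flip: po_add)

lemma WW_sum: "(!!x. x \<in> S ==> f x \<in> WW) ==> sum f S \<in> WW"
 by (induction S rule: infinite_finite_induct) (simp_all add: WW_0 WW_add)

lemma WW_mult: "p \<in> WW ==> q \<in> WW ==> p * q \<in> WW"
proof -
 let ?s = "\<lambda>p. po (sub (\<lambda>j. Vr (cyc n j)) p) :: ('a, 'b) op"
 assume "p \<in> WW" "q \<in> WW"
 then have "(?s p * pr n) * (?s q * pr n) \<in> OA n {1..<n}" by (auto simp: WW_def intro: OA_mult)
 moreover have "(?s p * pr n) * (?s q * pr n) = ?s (p * q) * pr n"
  by (rule op_eqI) (simp add: sub.mult mult.assoc)
 ultimately show ?thesis by (simp add: WW_def)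
qed

lemma WW_Vr: "2 \<le> v ==> v \<le> N ==> Vr v \<in> WW"
 using po_OA[of "v - 1" n 1 "{1..<n}"] by (auto simp: WW_def cyc_def)

lemma WW_power: "p \<in> WW ==> p ^ m \<in> WW"
 using WW_cst[of 1] by (induction m) (simp_all add: WW_mult)

text \<open>\<open>D\<close> bounds the degree in x_1, and the coefficient at \<open>D\<close> is
  recorded rather than required to be nonzero; so products are covered even if zero divisors are
  present.\<close>

definition monP :: "nat => 'b => 'b mpoly => bool" where
 "monP D s F \<longleftrightarrow> (\<exists>P. (\<forall>l. coeff P l \<in> WW) \<and> (\<forall>l>D. coeff P l = 0) \<and> coeff P D = cst s \<and> poly P (Vr 1) = F)"

lemma monPI:
 assumes "!!l. c l \<in> WW" "!!l. l > D ==> c l = 0" "!!l. l > M ==> c l = 0" "c D = cst s"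
  and F: "F = (\<Sum>l\<le>M. c l * Vr 1 ^ l)"
 shows "monP D s F"
proof -
 let ?P = "\<Sum>l\<le>M. monom (c l) l"
 have "coeff ?P l = c l" for l using assms(3) by (auto simp: coeff_sum)
 moreover have "poly ?P (Vr 1) = F" by (simp add: F poly_sum poly_monom)
 ultimately show ?thesis unfolding monP_def using assms by (intro exI[of _ ?P]) auto
qed

lemma monP_mult: "monP D s F ==> monP D' s' F' ==> monP (D + D') (s * s') (F * F')"
proof -
 assume "monP D s F" "monP D' s' F'"
 then obtain P Q where P: "!!l. coeff P l \<in> WW" "!!l. l > D ==> coeff P l = 0" "coeff P D = cst s" "poly P (Vr 1) = F"
  and Q: "!!l. coeff Q l \<in> WW" "!!l. l > D' ==> coeff Q l = 0" "coeff Q D' = cst s'" "poly Q (Vr 1) = F'"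
  unfolding monP_def by blast
 have "coeff (P * Q) (D + D') = (\<Sum>j\<le>D + D'. if j = D then coeff P D * coeff Q D' else 0)"
  unfolding coeff_mult
 proof (intro sum.cong refl)
  fix j assume "j \<in> {..D + D'}"
  show "coeff P j * coeff Q (D + D' - j) = (if j = D then coeff P D * coeff Q D' else 0)"
   using P(2)[of j] Q(2)[of "D + D' - j"] by (cases j D rule: linorder_cases) auto
 qed
 then have "coeff (P * Q) (D + D') = cst (s * s')" by (simp add: P Q cst_mult)
 moreover have "coeff (P * Q) l = 0" if "l > D + D'" for l
  unfolding coeff_mult using that
 proof (intro sum.neutral ballI)
  fix j assume "j \<in> {..l}" "l > D + D'"
  then show "coeff P j * coeff Q (l - j) = 0" using P(2)[of j] Q(2)[of "l - j"] by (cases "j > D") auto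
 qed
 moreover have "coeff (P * Q) l \<in> WW" for l unfolding coeff_mult using P Q by (intro WW_sum WW_mult) auto
 ultimately show ?thesis unfolding monP_def using P Q by (intro exI[of _ "P * Q"]) auto
qed

lemma monP_cst: "monP 0 s (cst s)"
 by (rule monPI[of "\<lambda>l. if l = 0 then cst s else 0" 0 0]) (auto simp: WW_cst WW_0)

lemma monP_apoly: "monP (nat (hL i)) 1 (apoly i 1)"
proof (rule monPI[where M = "nat (hL i)" and c = "\<lambda>l. if l \<le> nat (hL i) then cst (ca i (nat (hL i) - l)) else 0"])
 show "apoly i 1 = (\<Sum>l\<le>nat (hL i). (if l \<le> nat (hL i) then cst (ca i (nat (hL i) - l)) else 0) * Vr 1 ^ l)"
  unfolding apoly_def
  by (rule sum.reindex_bij_witness[of _ "\<lambda>l. nat (hL i) - l" "\<lambda>l. nat (hL i) - l"]) auto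
qed (auto simp: WW_cst WW_0 ca0)

lemma monP_p2:
 assumes fin: "!!p q. p > m \<or> q > m ==> W p q = 0" and z: "!!q. q > 0 ==> W D q = 0" and top: "!!p q. p > D ==> W p q = 0"
  and v: "2 \<le> v" "v \<le> N"
 shows "monP D (W D 0) (p2 W 1 v)"
proof (rule monPI[where M = m and c = "\<lambda>p. \<Sum>q\<le>m. cst (W p q) * Vr v ^ q"])
 show "(\<Sum>q\<le>m. cst (W p q) * Vr v ^ q) \<in> WW" for p
  using v by (intro WW_sum WW_mult WW_cst WW_power WW_Vr)
 show "(\<Sum>q\<le>m. cst (W D q) * Vr v ^ q) = cst (W D 0)"
 proof -
  have "(\<Sum>q\<le>m. cst (W D q) * Vr v ^ q) = (\<Sum>q\<le>m. if q = 0 then cst (W D 0) else 0)"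
   using z by (intro sum.cong) auto
  then show ?thesis by simp
 qed
 show "p2 W 1 v = (\<Sum>p\<le>m. (\<Sum>q\<le>m. cst (W p q) * Vr v ^ q) * Vr 1 ^ p)"
 proof -
  have "p2 W 1 v = (\<Sum>p\<le>m. \<Sum>q\<le>m. cst (W p q) * Vr 1 ^ p * Vr v ^ q)"
   by (rule p2_eq_double) (rule fin)
  then show ?thesis unfolding sum_distrib_right by (simp only: mult_ac)
 qed
qed (use fin top in auto)

text \<open>\<open>ud\<close> and \<open>us\<close> are degree and top coefficient of
  \<open>UU i j\<close> in its first variable, left in the form that \<open>monP_mult\<close>
  produces: two factors \<open>P\<close>, or a sign, two linear factors and
  \<open>Q\<close>.\<close>

definition ud :: "'a => nat" where "ud j = (if i = j then pd i + pd i else 0 + (1 + 1 + qd i j))"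
definition us :: "'a => 'b" where "us j = (if i = j then w i (pd i) 0 * w i 0 (pd i) else (- 1) * (1 * 1 * t i j (qd i j) 0))"

lemma us_unit: "\<exists>s'. us j * s' = 1"
proof (cases "i = j")
 case True
 obtain a b where "w i (pd i) 0 * a = 1" "w i 0 (pd i) * b = 1" using w_unit by blast
 then have "(w i (pd i) 0 * w i 0 (pd i)) * (a * b) = 1" by (metis mult.commute mult.left_commute mult_1)
 moreover have "us j = w i (pd i) 0 * w i 0 (pd i)" unfolding us_def using True by simp
 ultimately show ?thesis by metis
next
 case False
 then obtain a where "t i j (qd i j) 0 * a = 1" using t_unit by blast
 then show ?thesis using False by (intro exI[of _ "- a"]) (simp add: us_def)
qed

lemma monP_UU: "2 \<le> v ==> v \<le> N ==> monP (ud j) (us j) (UU i j 1 v)"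
proof (cases "i = j")
 case True
 assume v: "2 \<le> v" "v \<le> N"
 have 1: "monP (pd i) (w i (pd i) 0) (PP i 1 v)"
  unfolding PP_def by (rule monP_p2[where m = "pd i", OF _ _ _ v]) (auto intro: w_high)
 \<comment> \<open>In the second factor P(x_v, x_1) the variable x_1 is in second place. With
   transposed coefficients its top coefficient is the other unit
   \<open>w i 0 (pd i)\<close>.\<close>
 have "monP (pd i) ((\<lambda>p q. w i q p) (pd i) 0) (p2 (\<lambda>p q. w i q p) 1 v)"
  by (rule monP_p2[where m = "pd i", OF _ _ _ v]) (auto intro: w_high)
 moreover have "p2 (\<lambda>p q. w i q p) 1 v = p2 (w i) v 1" by (rule p2_flip)
 ultimately have 2: "monP (pd i) (w i 0 (pd i)) (PP i v 1)" unfolding PP_def by (simp only:)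
 have "ud j = pd i + pd i" "us j = w i (pd i) 0 * w i 0 (pd i)" "UU i j 1 v = PP i 1 v * PP i v 1"
  unfolding ud_def us_def UU_def by (rule if_P[OF True])+
 then show ?thesis using monP_mult[OF 1 2] by (simp only:)
next
 case False
 assume v: "2 \<le> v" "v \<le> N"
 obtain m where m: "\<forall>p q. p > m \<or> q > m --> t i j p q = 0" using t_bound[OF False] by blast
 have 1: "monP (qd i j) (t i j (qd i j) 0) (QQ i j 1 v)"
  unfolding QQ_def by (rule monP_p2[where m = m, OF _ _ _ v]) (use m False in \<open>auto intro: t_lead t_high\<close>)
 have V: "- Vr v \<in> WW" using WW_mult[OF WW_cst[of "- 1"] WW_Vr[OF v]] by (simp add: ring_hom_fun.uminus[OF ring_hom_cst])
 have 2: "monP 1 1 (Vr 1 - Vr v)"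
  by (rule monPI[where M = 1 and c = "\<lambda>l. if l = 0 then - Vr v else if l = 1 then cst 1 else 0"])
    (auto simp: V WW_0 WW_cst[of 1, simplified])
 have 3: "UU i j 1 v = cst (- 1) * ((Vr 1 - Vr v) * (Vr 1 - Vr v) * QQ i j 1 v)"
  using False by (simp add: UU_def power2_eq_square ring_hom_fun.uminus[OF ring_hom_cst])
 show ?thesis unfolding 3 using monP_mult[OF monP_cst[of "- 1"] monP_mult[OF monP_mult[OF 2 2] 1]] False
  by (simp only: ud_def us_def if_False)
qed

lemma monP_prod: "m \<le> n ==> monP (nat (hL i) + (\<Sum>a\<in>{1..m}. ud (nth1 nu a))) (1 * (\<Prod>a\<in>{1..m}. us (nth1 nu a))) (FF m nu)"
proof (induction m)
 case 0
 then show ?case using monP_apoly by (simp add: FF_simps)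
next
 case (Suc m)
 have "monP (nat (hL i) + (\<Sum>a\<in>{1..m}. ud (nth1 nu a)) + ud (nth1 nu (Suc m)))
  (1 * (\<Prod>a\<in>{1..m}. us (nth1 nu a)) * us (nth1 nu (Suc m))) (FF (Suc m) nu)"
  unfolding FF_simps(2) using Suc by (intro monP_mult monP_UU) auto
 then show ?case by (simp add: prod.nat_ivl_Suc' ac_simps)
qed

text \<open>All sequences in \<open>Iseq bt\<close> are rearrangements of one multiset, so degree
  and unit are the same for each of them; division on the sum of the components needs this.\<close>

lemma ff_monic: "\<exists>D s s'. s * s' = 1 \<and> (\<forall>nu\<in>Iseq bt. monP D s (FF n nu))"
proof (cases "Iseq bt = {}")
 case True
 then show ?thesis by (intro exI[of _ 0] exI[of _ 1]) simp
next
 case False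
 then obtain nu0 where nu0: "nu0 \<in> Iseq bt" by blast
 let ?D = "nat (hL i) + sum_list (map ud nu0)" and ?s = "prod_list (map us nu0)"
 have "\<exists>s'. prod_list (map us mu) * s' = 1" for mu
 proof (induction mu)
  case (Cons x mu)
  then obtain a where a: "prod_list (map us mu) * a = 1" by blast
  obtain b where b: "us x * b = 1" using us_unit by blast
  have "us x * prod_list (map us mu) * (b * a) = (us x * b) * (prod_list (map us mu) * a)" by (simp add: ac_simps)
  then show ?case using a b by (auto intro!: exI[of _ "b * a"])
 qed simp
 then obtain s' where s': "?s * s' = 1" by blast
 have "monP ?D ?s (FF n nu)" if nu: "nu \<in> Iseq bt" for nu
 proof -
  have m: "mset nu = mset nu0" using nu nu0 by (intro multiset_eqI) (simp add: Iseq_count count_mset)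
  have "sum_list (map ud nu) = sum_list (map ud nu0)" "prod_list (map us nu) = ?s"
   using m by (metis mset_map sum_mset_sum_list) (metis m mset_map prod_mset_prod_list)
  then show ?thesis
   using monP_prod[OF le_refl, of nu] sum_list_nth1[where nu = nu and g = ud] prod_list_nth1[where nu = nu and h = us]
   by (simp add: len_bt[OF nu])
 qed
 then show ?thesis using s' by blast
qed

text \<open>With a common degree and unit, the coefficients for the various nu assemble over the
  idempotents e(nu) to elements of R(beta), and the top one is a unit scalar times e(beta).\<close>

lemma ff_Y: "ff \<in> K1.Y" and ff_expand:
 "\<exists>D zz ww. ff = (\<Sum>l\<le>D. po (Vr 1 ^ l) * xio n i (zz l)) \<and> (\<forall>l. zz l \<in> BB) \<and> ww \<in> BB \<and> ww * zz D = eB \<and> zz D * ww = eB"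
proof -
 obtain D s s' where s: "s * s' = 1" "!!nu. nu \<in> Iseq bt ==> monP D s (FF n nu)" using ff_monic by blast
 have "\<forall>nu\<in>Iseq bt. \<exists>P. (\<forall>l. coeff P l \<in> WW) \<and> (\<forall>l>D. coeff P l = 0) \<and> coeff P D = cst s \<and> poly P (Vr 1) = FF n nu"
  using s(2) unfolding monP_def by blast
 from bchoice[OF this] obtain P where P: "!!nu l. nu \<in> Iseq bt ==> coeff (P nu) l \<in> WW"
  "!!nu l. nu \<in> Iseq bt ==> l > D ==> coeff (P nu) l = 0" "!!nu. nu \<in> Iseq bt ==> coeff (P nu) D = cst s"
  "!!nu. nu \<in> Iseq bt ==> poly (P nu) (Vr 1) = FF n nu" by blast
 let ?c = "\<lambda>nu l. sub (\<lambda>j. Vr (cyc n j)) (coeff (P nu) l)"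
 define zz where "zz = (\<lambda>l. \<Sum>nu\<in>Iseq bt. po (?c nu l) * (Eo nu :: ('a, 'b) op))"
 have cE: "po (?c nu l) * Eo nu \<in> BB" if nu: "nu \<in> Iseq bt" for nu l
 proof -
  have "(po (?c nu l) * pr n) * Eo nu \<in> BB"
   using P(1)[OF nu, of l] Eo_BB[OF nu] by (intro BB_left) (simp_all add: WW_def)
  then show ?thesis using BB_unit(1)[OF Eo_BB[OF nu]] by (simp only: mult.assoc)
 qed
 have zzB: "zz l \<in> BB" for l unfolding zz_def using cE by (intro subgrp_sum[OF K0.B(1)]) auto
 have x: "xio n i (zz l) = (\<Sum>nu\<in>Iseq bt. po (coeff (P nu) l) * Eo (i # nu))" for l
  unfolding zz_def xio_sum by (intro sum.cong refl) (simp add: xio_po xio_Eo len_bt sub_sub)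
 have pP: "(\<Sum>l\<le>D. Vr 1 ^ l * coeff (P nu) l) = FF n nu" if nu: "nu \<in> Iseq bt" for nu
 proof -
  have "degree (P nu) \<le> D" using P(2)[OF nu] by (simp add: degree_le)
  then have "poly (P nu) (Vr 1) = (\<Sum>l\<le>D. coeff (P nu) l * Vr 1 ^ l)"
   unfolding poly_altdef by (intro sum.mono_neutral_left) (auto simp: coeff_eq_0)
  then show ?thesis using P(4)[OF nu] by (simp add: mult.commute)
 qed
 have "(\<Sum>l\<le>D. po (Vr 1 ^ l) * xio n i (zz l)) = (\<Sum>l\<le>D. \<Sum>nu\<in>Iseq bt. po (Vr 1 ^ l * coeff (P nu) l) * Eo (i # nu))"
  unfolding x sum_distrib_left by (intro sum.cong refl) (simp only: po_mult mult.assoc[symmetric])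
 also have "... = (\<Sum>nu\<in>Iseq bt. \<Sum>l\<le>D. po (Vr 1 ^ l * coeff (P nu) l) * Eo (i # nu))" by (rule sum.swap)
 also have "... = ff"
  unfolding ff_def sum_distrib_right[symmetric] po_sum[symmetric] by (intro sum.cong refl) (simp only: pP)
 finally have ex: "ff = (\<Sum>l\<le>D. po (Vr 1 ^ l) * xio n i (zz l))" by simp
 have "po (Vr 1 ^ l) * xio n i (zz l) \<in> K1.Y" for l
  using K1.tX_Y[of 0 "zz l" l] zzB by (simp add: chop_simps)
 then show "ff \<in> K1.Y" unfolding ex by (intro subgrp_sum[OF K1.Y_subgrp])
 have zD: "zz D = po (cst s) * eB" unfolding zz_def eB_sum sum_distrib_left using P(3) by (intro sum.cong refl) simp
 have wB: "po (cst s') * eB \<in> BB"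
  using BB_left[OF OA_scal[of s' n "{1..<n}"] K0.B(3)] BB_unit(1)[OF K0.B(3)] by (simp only: mult.assoc)
 have ss: "po (cst s) * po (cst s') = (1 :: ('a, 'b) op)" "po (cst s') * po (cst s) = (1 :: ('a, 'b) op)"
  using s(1) by (simp_all add: po_mult mult.commute flip: cst_mult)
 have e: "eB * eB = eB" using BB_unit(3)[OF K0.B(3)] .
 have "po (cst s') * eB * (po (cst s) * eB) = (po (cst s') * po (cst s)) * (eB * eB)"
  "po (cst s) * eB * (po (cst s') * eB) = (po (cst s) * po (cst s')) * (eB * eB)"
  by (simp_all only: mult.assoc left_comm[OF po_cst_commute[of s eB, symmetric]] left_comm[OF po_cst_commute[of s' eB, symmetric]])
 then have "po (cst s') * eB * zz D = eB" "zz D * (po (cst s') * eB) = eB" unfolding zD ss e by simp_all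
 then show "\<exists>D zz ww. ff = (\<Sum>l\<le>D. po (Vr 1 ^ l) * xio n i (zz l)) \<and> (\<forall>l. zz l \<in> BB) \<and> ww \<in> BB \<and> ww * zz D = eB \<and> zz D * ww = eB"
  using ex zzB wB by blast
qed

lemma Z1_ff: "y \<in> K1.Z ==> y * ff \<in> K1.Z"
proof -
 assume y: "y \<in> K1.Z"
 obtain D zz where z: "ff = (\<Sum>l\<le>D. po (Vr 1 ^ l) * xio n i (zz l))" "!!l. zz l \<in> BB" using ff_expand by blast
 have "y * ff = (\<Sum>l\<le>D. y * po (Vr 1 ^ l) * xio n i (zz l))" unfolding z(1) by (simp add: sum_distrib_left mult.assoc)
 also have "... \<in> K1.Z"
  using y z(2) by (intro subgrp_sum[OF K1.Z_subgrp] K1.Z_om Z1_po pvars_power pvars_Vr) auto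
 finally show ?thesis .
qed

text \<open>The polynomial itself is not inspected. \<open>cP\<close> commutes with R(beta) modulo
  \<open>Z\<close> and \<open>GG\<close> does so exactly, hence their product does, and
  \<open>ff\<close> is congruent to that product.\<close>

lemma ff_comm: "x \<in> BB ==> xio n i x * ff - ff * xio n i x \<in> K1.Z"
proof -
 assume x: "x \<in> BB"
 let ?e = "xio n i eB" and ?b = "xio n i x"
 let ?d = "cP * GG * ?e - ff"
 have 1: "?b * ?d - ?d * ?b \<in> K1.Z"
  by (intro subgrpD(2)[OF K1.Z_subgrp] K1.A_Z[OF xio_AA[OF x]] K1.Z_om[OF _ x] cP_GG)
 have 2: "(?b * cP - cP * iot i x) * GG * ?e \<in> K1.Z"
  by (intro K1.Z_om[OF Z0_GG[OF cP_comm'[OF x]] K0.B(3)])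
 have g: "iot i x * (GG * ?e) = GG * ?b"
 proof -
  have "iot i x * (GG * ?e) = iot i x * GG * ?e" by (simp only: mult.assoc)
  also have "... = GG * ?b" unfolding iot_GG[OF BB_mem[OF x]] mult.assoc iot_eB_BB(4)[OF x] ..
  finally show ?thesis .
 qed
 have "?b * ff - ff * ?b = (?b * cP - cP * iot i x) * GG * ?e - (?b * ?d - ?d * ?b)"
  by (simp only: left_diff_distrib right_diff_distrib mult.assoc g iot_eB_BB(3)[OF x]) simp
 then show ?thesis using subgrpD(2)[OF K1.Z_subgrp 2 1] by simp
qed

text \<open>Right multiplication by \<open>cP\<close> has a left inverse that is right linear, all modulo \<open>Z\<close>: multiply back with
 \<open>GG\<close> and divide by the monic element \<open>ff\<close>.\<close>

lemma left_inverse: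
 obtains L where "!!y. y \<in> K0.Y ==> L y \<in> K1.Y" "!!y. y \<in> K0.Z ==> L y \<in> K1.Z"
  "!!y y'. y \<in> K0.Y ==> y' \<in> K0.Y ==> L (y - y') - (L y - L y') \<in> K1.Z"
  "!!y x. y \<in> K0.Y ==> x \<in> BB ==> L (y * iot i x) - L y * xio n i x \<in> K1.Z"
  "!!y. y \<in> K1.Y ==> L (y * cP) - y \<in> K1.Z"
proof -
 obtain D zz ww where z: "ff = (\<Sum>l\<le>D. po (Vr 1 ^ l) * xio n i (zz l))" "!!l. zz l \<in> BB" "ww \<in> BB" "ww * zz D = eB" "zz D * ww = eB"
  using ff_expand by blast
 interpret q: fpres_div AA BB II "xio n i" "\<lambda>m. po (Vr 1 ^ m)" "chop Suc" n eB ff D zz ww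
 proof
  show "y * ff \<in> K1.Y" if "y \<in> K1.Y" for y using that ff_Y K1.A_Y by (simp add: K1.Y_def)
  show "y * ff \<in> K1.Z" if "y \<in> K1.Z" for y by (rule Z1_ff[OF that])
  show "xio n i b * ff - ff * xio n i b \<in> K1.Z" if "b \<in> BB" for b by (rule ff_comm[OF that])
  show "xio n i eB * ff = ff"
   unfolding z(1) sum_distrib_left
   by (intro sum.cong refl) (simp only: left_comm[OF K1.X(2)[OF K0.B(3), symmetric]] iot_eB_BB(3)[OF z(2)])
 qed (use z in auto)
 have YG: "y * GG * xio n i eB = y * GG" if "y \<in> K0.Y" for y using Y0_GG[OF that] by (simp add: K1.Y_def)
 show thesis
 proof (rule that[of "\<lambda>y. q.quo (y * GG)"])
  show "q.quo (y * GG) \<in> K1.Y" if "y \<in> K0.Y" for y using q.quo[OF Y0_GG[OF that]] by blast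
  show "q.quo (y * GG) \<in> K1.Z" if "y \<in> K0.Z" for y using q.quo_Z[OF Z0_GG[OF that]] .
  show "q.quo ((y - y') * GG) - (q.quo (y * GG) - q.quo (y' * GG)) \<in> K1.Z" if "y \<in> K0.Y" "y' \<in> K0.Y" for y y'
   using q.quo_diff[OF that[THEN Y0_GG]] by (simp only: left_diff_distrib)
  show "q.quo (y * iot i x * GG) - q.quo (y * GG) * xio n i x \<in> K1.Z" if "y \<in> K0.Y" "x \<in> BB" for y x
   using q.quo_om[OF Y0_GG[OF that(1)] that(2)] by (simp only: mult.assoc iot_GG[OF BB_mem[OF that(2)]])
  show "q.quo (y * cP * GG) - y \<in> K1.Z" if y: "y \<in> K1.Y" for y
  proof -
   have yA: "y \<in> AA" using y by (simp add: K1.Y_def)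
   have "y * cP * GG - y * ff = y * (cP * GG * xio n i eB - ff)"
    using YG[OF cP_Y[OF y]] by (simp add: right_diff_distrib mult.assoc)
   then have d: "y * cP * GG - y * ff \<in> K1.Z" using K1.A_Z[OF yA cP_GG] by simp
   have Y: "y * cP * GG \<in> K1.Y" "y * ff \<in> K1.Y" using Y0_GG[OF cP_Y[OF y]] q.fY[OF y] by auto
   have "q.quo (y * cP * GG - y * ff) - (q.quo (y * cP * GG - y * ff) - (q.quo (y * cP * GG) - q.quo (y * ff))) \<in> K1.Z"
    by (rule subgrpD(2)[OF K1.Z_subgrp q.quo_Z[OF d] q.quo_diff[OF Y]])
   then have 1: "q.quo (y * cP * GG) - q.quo (y * ff) \<in> K1.Z" by simp
   have e: "(a - b) + (b - c) = a - c" for a b c :: "('a, 'b) op" by simp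
   show ?thesis using subgrpD(4)[OF K1.Z_subgrp 1 q.quo_f[OF y]] unfolding e .
  qed
 qed
qed

end

section \<open>Projectivity\<close>

text \<open>The test modules for projectivity are arbitrary carriers with their operations given as
  functions, so finite sums in them are built directly.\<close>

primrec psum :: "('z => 'z => 'z) => 'z => (nat => 'z) => nat => 'z" where
 "psum pl z f 0 = z" | "psum pl z f (Suc K) = pl (psum pl z f K) (f K)"

locale rmod =
 fixes M :: "'z set" and pl :: "'z => 'z => 'z" and z :: 'z and ac :: "'z => ('i, 'k::comm_ring_1) fa => 'z"
  and Rc Ir :: "('i, 'k) fa set" and u :: "('i, 'k) fa"
 assumes rm: "is_rmod M pl z ac Rc Ir u" and zR: "0 \<in> Rc"
begin

lemma R: "z \<in> M" "\<forall>a\<in>M. \<forall>b\<in>M. pl a b \<in> M" "\<forall>a\<in>M. \<forall>r\<in>Rc. ac a r \<in> M"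
 "\<forall>a\<in>M. \<forall>b\<in>M. \<forall>c\<in>M. pl (pl a b) c = pl a (pl b c)" "\<forall>a\<in>M. \<forall>b\<in>M. pl a b = pl b a"
 "\<forall>a\<in>M. pl z a = a" "\<forall>a\<in>M. \<exists>b\<in>M. pl a b = z"
 "\<forall>a\<in>M. \<forall>b\<in>M. \<forall>r\<in>Rc. ac (pl a b) r = pl (ac a r) (ac b r)"
 "\<forall>a\<in>M. \<forall>r\<in>Rc. \<forall>s\<in>Rc. ac a (r + s) = pl (ac a r) (ac a s)"
 "\<forall>a\<in>M. \<forall>r\<in>Rc. \<forall>s\<in>Rc. ac (ac a r) s = ac a (fmul r s)"
 "\<forall>a\<in>M. \<forall>r\<in>Rc. \<forall>s\<in>Rc. r - s \<in> Ir --> ac a r = ac a s"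
 by (insert rm[unfolded is_rmod_def]) (elim conjE, assumption)+

lemmas mem = R(1) R(2)[rule_format] R(3)[rule_format] and assoc = R(4)[rule_format] and comm = R(5)[rule_format]
 and zl = R(6)[rule_format] and inv = R(7)[rule_format] and ac_pl = R(8)[rule_format] and ac_add = R(9)[rule_format]
 and ac_ac = R(10)[rule_format] and ac_cong = R(11)[rule_format]

lemma idem: "a \<in> M ==> pl a a = a ==> a = z"
proof -
 assume a: "a \<in> M" "pl a a = a"
 obtain b where b: "b \<in> M" "pl a b = z" using inv a by blast
 have "pl (pl a a) b = pl a (pl a b)" using assoc a b by blast
 then show ?thesis using a b zl comm mem(1) by metis
qed

lemma ac_0: "a \<in> M ==> ac a 0 = z"
proof (rule idem)
 assume a: "a \<in> M"
 show "ac a 0 \<in> M" using mem a zR by blast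
 show "pl (ac a 0) (ac a 0) = ac a 0" using ac_add[OF a zR zR] by simp
qed

lemma ac_Ir: "a \<in> M ==> s \<in> Rc ==> s \<in> Ir ==> ac a s = z"
 using ac_cong[of a s 0] ac_0 zR by simp

lemma ac_z: "s \<in> Rc ==> ac z s = z"
proof (rule idem)
 assume s: "s \<in> Rc"
 show "ac z s \<in> M" using mem s by blast
 show "pl (ac z s) (ac z s) = ac z s" using ac_pl[OF mem(1) mem(1) s] zl[OF mem(1)] by simp
qed

abbreviation ps :: "(nat => 'z) => nat => 'z" where "ps \<equiv> psum pl z"

lemma ps_M: "(!!j. f j \<in> M) ==> ps f K \<in> M"
 by (induction K) (simp_all add: mem)

lemma ps_pl: "(!!j. f j \<in> M) ==> (!!j. g j \<in> M) ==> ps (\<lambda>j. pl (f j) (g j)) K = pl (ps f K) (ps g K)"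
proof (induction K)
 case (Suc K)
 note m = ps_M[of f K, OF Suc.prems(1)] ps_M[of g K, OF Suc.prems(2)] Suc.prems(1)[of K] Suc.prems(2)[of K]
 have "pl (pl (ps f K) (ps g K)) (pl (f K) (g K)) = pl (ps f K) (pl (ps g K) (pl (f K) (g K)))"
  using m mem assoc by simp
 also have "pl (ps g K) (pl (f K) (g K)) = pl (f K) (pl (ps g K) (g K))"
  using m mem assoc comm by metis
 also have "pl (ps f K) (pl (f K) (pl (ps g K) (g K))) = pl (pl (ps f K) (f K)) (pl (ps g K) (g K))"
  using m mem assoc by simp
 finally show ?case using Suc by simp
qed (simp add: zl mem)

lemma ps_ac: "(!!j. f j \<in> M) ==> s \<in> Rc ==> ps (\<lambda>j. ac (f j) s) K = ac (ps f K) s"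
 by (induction K) (simp_all add: ac_z ac_pl ps_M)

lemma ps_extend: "K \<le> K' ==> (!!j. f j \<in> M) ==> (!!j. j \<ge> K ==> f j = z) ==> ps f K' = ps f K"
proof (induction K' rule: dec_induct)
 case (step m)
 have "pl (ps f K) z = ps f K" using ps_M[of f K] step.prems zl comm mem(1) by metis
 then show ?case using step by simp
qed simp

end

section \<open>From operators back to representatives in the free algebra\<close>

context klr_cyc begin

definition eb where "eb = (eblk bt :: ('a, 'b) fa)"
definition Rr where "Rr = {fmul eb s | s. s \<in> FA n}"
definition Ir where "Ir = JL t w hL ca n"

lemma eb: "eb \<in> FA n" "rho n eb = eB"
 using rho_sum_ee[OF Iseq_bt] Iseq_bt unfolding eb_def eblk_def eB_def by (auto intro!: FA_sum FA_ee)

lemma Rr_FA: "s \<in> Rr ==> s \<in> FA n" using eb by (auto simp: Rr_def intro: FA_fmul)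

lemma Rr_BB: "s \<in> Rr ==> rho n s \<in> BB"
proof -
 assume "s \<in> Rr"
 then obtain f where f: "f \<in> FA n" "s = fmul eb f" by (auto simp: Rr_def)
 have "rho n f \<in> OA n {1..<n}" using f OA_FA[of n "{1..<n}"] by blast
 then have "rho n f * eB \<in> BB" "rho n f * eB = eB * rho n f" using BB_left[OF _ K0.B(3)] eB_commute by auto
 then show ?thesis using f eb by (simp add: rho_fmul)
qed

lemma Rr_eB: "s \<in> Rr ==> rho n s * eB = rho n s" using BB_unit(3)[OF Rr_BB] .

lemma Rr_ops: "0 \<in> Rr" "r \<in> Rr ==> s \<in> Rr ==> r + s \<in> Rr" "r \<in> Rr ==> s \<in> FA n ==> fmul r s \<in> Rr" "eb \<in> Rr"
proof -
 have "0 = fmul eb 0" by simp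
 then show "0 \<in> Rr" unfolding Rr_def using FA_0 by blast
 show "r + s \<in> Rr" if "r \<in> Rr" "s \<in> Rr" using that by (auto simp: Rr_def simp flip: fmul_add_right intro: FA_add)
 show "fmul r s \<in> Rr" if "r \<in> Rr" "s \<in> FA n" using that by (auto simp: Rr_def fmul_assoc intro: FA_fmul)
 show "eb \<in> Rr" unfolding Rr_def using fone_mult(2)[of eb] FA_fone[of n] by (metis (mono_tags, lifting) mem_Collect_eq)
qed

lemma JJ_JL: "f \<in> JJ m ==> f \<in> JL t w hL ca m"
 unfolding Jrel_def JL_def using rideal_mono[of "rels t w m" "rels t w m \<union> {aL hL ca m 1}" m] by blast

text \<open>Faithfulness is what leads back: representatives with equal operators differ by an
  element of the ideal of relations.\<close>

lemma Ir_II: "s \<in> FA n ==> rho n s \<in> II ==> s \<in> Ir"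
proof -
 assume s: "s \<in> FA n" "rho n s \<in> II"
 then obtain f where f: "f \<in> JL t w hL ca n" "rho n s = rho n f * eB" by (auto simp: II_def)
 have fe: "fmul f eb \<in> JL t w hL ca n" using f eb rideal_fmul(2) unfolding JL_def by blast
 have "rho n (s - fmul f eb) = 0" using s f eb JL_FA by (simp add: rho_diff rho_fmul FA_fmul)
 then have "s - fmul f eb \<in> JL t w hL ca n" using s eb JL_FA[OF f(1)] by (intro JJ_JL) (simp add: faithful FA_diff FA_fmul)
 then have "(s - fmul f eb) + fmul f eb \<in> JL t w hL ca n"
  using fe unfolding JL_def by (rule rid_add)
 then show ?thesis by (simp add: Ir_def)
qed

lemma II_Ir: "s \<in> Ir ==> rho n s * eB \<in> II"
 unfolding II_def Ir_def by blast

lemma sc_exists: "x \<in> BB ==> \<exists>s\<in>Rr. rho n s = x"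
proof -
 assume x: "x \<in> BB"
 then obtain f where f: "f \<in> FA n" "x = rho n f" using OA_FA[of n "{1..<n}"] by (auto simp: BB_def)
 have "rho n (fmul eb f) = x" using f eb BB_unit(4)[OF x] by (simp add: rho_fmul)
 then show ?thesis using f unfolding Rr_def by blast
qed

end

text \<open>A quotient of a submodule of \<open>AA\<close>, seen as a subquotient of the free algebra.\<close>

locale qmod = klr_cyc +
 fixes Y Z :: "('a, 'b) op set" and om :: "('a, 'b) op => ('a, 'b) op" and em :: "('a, 'b) fa => ('a, 'b) fa"
 assumes Ysub: "subgrp Y" "Y \<subseteq> AA" and Zsub: "subgrp Z" "Z \<subseteq> Y"
  and left: "a \<in> AA ==> y \<in> Y ==> a * y \<in> Y" "a \<in> AA ==> y \<in> Z ==> a * y \<in> Z"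
  and right: "y \<in> Y ==> b \<in> BB ==> y * om b \<in> Y" "y \<in> Z ==> b \<in> BB ==> y * om b \<in> Z"
  and YI: "y \<in> Y ==> c \<in> II ==> y * om c \<in> Z" and Yu: "y \<in> Y ==> y * om eB = y"
  and om_diff: "om (a - b) = om a - om b" and om_mult: "b \<in> BB ==> b' \<in> BB ==> om (b * b') = om b * om b'"
  and em: "s \<in> FA n ==> em s \<in> FA N"
  and act: "f \<in> FA N ==> rho N f \<in> Y ==> s \<in> Rr ==> rho N (fmul f (em s)) = rho N f * om (rho n s)"
begin

definition Ms where "Ms = {y \<in> FA N. rho N y \<in> Y}"
definition Ns where "Ns = {y \<in> FA N. rho N y \<in> Z}"
definition actf where "actf y s = fmul y (em s)"

lemma om_add: "om (a + b) = om a + om b"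
 using om_diff[of "a + b" b] by (simp add: algebra_simps)

lemma Ms_FA: "y \<in> Ms ==> y \<in> FA N" and Ms_Y: "y \<in> Ms ==> rho N y \<in> Y" by (simp_all add: Ms_def)

lemma actf_rho: "y \<in> Ms ==> s \<in> Rr ==> rho N (actf y s) = rho N y * om (rho n s)"
 by (simp add: actf_def Ms_def act)

lemma actf_Ms: "y \<in> Ms ==> s \<in> Rr ==> actf y s \<in> Ms"
 using actf_rho[of y s] right(1) Rr_BB em Rr_FA by (auto simp: Ms_def actf_def intro: FA_fmul)

lemma Ms_ops: "0 \<in> Ms" "y \<in> Ms ==> y' \<in> Ms ==> y + y' \<in> Ms" "y \<in> Ms ==> - y \<in> Ms" "y \<in> Ms ==> y' \<in> Ms ==> y - y' \<in> Ms"
 using subgrpD[OF Ysub(1)] by (auto simp: Ms_def rho_add rho_minus rho_diff intro: FA_add FA_minus FA_diff)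

lemma Ms_left: "r \<in> FA N ==> y \<in> Ms ==> fmul r y \<in> Ms"
 using left(1) AA_rho by (auto simp: Ms_def rho_fmul intro: FA_fmul)

lemma Ns_I: "y \<in> FA N ==> y' \<in> FA N ==> rho N y - rho N y' \<in> Z ==> y - y' \<in> Ns"
 by (simp add: Ns_def rho_diff FA_diff)

lemma Ns_eqI: "y \<in> FA N ==> y' \<in> FA N ==> rho N y = rho N y' ==> y - y' \<in> Ns"
 using subgrpD(1)[OF Zsub(1)] by (intro Ns_I) simp_all

lemma qbimod:
 assumes Lc: "Lc \<subseteq> FA N"
 shows "is_qbimod Ms Ns actf Lc (JJ N) Rr Ir eb"
 unfolding is_qbimod_def
proof (intro conjI ballI impI)
 note Z = subgrpD[OF Zsub(1)]
 have L: "r \<in> FA N" if "r \<in> Lc" for r using Lc that by blast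
 show "Ns \<subseteq> Ms" using Zsub by (auto simp: Ns_def Ms_def)
 show "0 \<in> Ns" using Z by (simp add: Ns_def)
 show "a + b \<in> Ns" "- a \<in> Ns" if "a \<in> Ns" "b \<in> Ns" for a b
  using Z that by (auto simp: Ns_def rho_add rho_minus intro: FA_add FA_minus)
 show "a + b \<in> Ms" "- a \<in> Ms" if "a \<in> Ms" "b \<in> Ms" for a b using that Ms_ops by auto
 show "fmul r y \<in> Ms" if "y \<in> Ms" "r \<in> Lc" for y r using that L Ms_left by auto
 show "fmul r y \<in> Ns" if "y \<in> Ms" "r \<in> Lc" "y \<in> Ns" for y r
  using that L left(2) AA_rho by (auto simp: Ns_def rho_fmul intro: FA_fmul)
 show "fmul r y - fmul r' y \<in> Ns" if "y \<in> Ms" "r \<in> Lc" "r' \<in> Lc" "r - r' \<in> JJ N" for y r r'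
 proof -
  have "rho N r = rho N r'" using rho_J[OF that(4)] L that by (simp add: rho_diff)
  then show ?thesis using that L by (intro Ns_eqI) (auto intro: FA_fmul Ms_FA simp: rho_fmul Ms_FA)
 qed
 show aM: "actf y s \<in> Ms" if "y \<in> Ms" "s \<in> Rr" for y s using actf_Ms that by blast
 show "actf y s \<in> Ns" if "y \<in> Ms" "s \<in> Rr" "y \<in> Ns" for y s
  using actf_rho[OF that(1,2)] aM[OF that(1,2)] right(2) Rr_BB that by (auto simp: Ns_def Ms_FA)
 show "actf y s - actf y s' \<in> Ns" if "y \<in> Ms" "s \<in> Rr" "s' \<in> Rr" "s - s' \<in> Ir" for y s s'
 proof (rule Ns_I)
  have "rho n s - rho n s' = rho n (s - s') * eB"
   using that Rr_FA Rr_eB by (simp add: rho_diff left_diff_distrib)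
  then have "rho n s - rho n s' \<in> II" using II_Ir[OF that(4)] by simp
  from YI[OF Ms_Y[OF that(1)] this]
  show "rho N (actf y s) - rho N (actf y s') \<in> Z" using that by (simp add: actf_rho om_diff right_diff_distrib)
 qed (use aM that Ms_FA in auto)
 show "actf y eb - y \<in> Ns" if "y \<in> Ms" for y
  using that Rr_ops(4) aM Ms_FA Yu[OF Ms_Y[OF that]] by (intro Ns_eqI) (auto simp: actf_rho eb)
 show "actf (y + y') s - (actf y s + actf y' s) \<in> Ns" if "y \<in> Ms" "y' \<in> Ms" "s \<in> Rr" for y y' s
  using that aM Ms_ops Ms_FA by (intro Ns_eqI) (auto simp: actf_rho rho_add distrib_right intro: FA_add)
 show "actf y (s + s') - (actf y s + actf y s') \<in> Ns" if "y \<in> Ms" "s \<in> Rr" "s' \<in> Rr" for y s s'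
  using that aM Rr_ops Ms_FA Rr_FA by (intro Ns_eqI) (auto simp: actf_rho rho_add om_add distrib_left intro: FA_add)
 show "actf (actf y s) s' - actf y (fmul s s') \<in> Ns" if "y \<in> Ms" "s \<in> Rr" "s' \<in> Rr" for y s s'
  using that aM Rr_ops Ms_FA Rr_FA Rr_BB by (intro Ns_eqI) (auto simp: actf_rho rho_fmul om_mult mult.assoc)
 show "actf (fmul r y) s - fmul r (actf y s) \<in> Ns" if "y \<in> Ms" "r \<in> Lc" "s \<in> Rr" for y r s
  using that aM Ms_FA L Ms_left by (intro Ns_eqI) (auto simp: actf_rho rho_fmul mult.assoc intro: FA_fmul)
qed

text \<open>The dual basis criterion. The images of the generators \<open>bs\<close> are lifted to
  \<open>M\<close> and recombined with the coordinates \<open>cr\<close>. These need to be additive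
  and linear only modulo \<open>II\<close>, because \<open>II\<close> acts by zero on the test
  modules, and for each \<open>y\<close> almost all of them lie in \<open>II\<close>.\<close>

lemma qproj:
 fixes bs :: "nat => ('a, 'b) op" and cr :: "('a, 'b) op => nat => ('a, 'b) op"
 assumes bs: "!!j. bs j \<in> Y" and cr: "!!y j. y \<in> Y ==> cr y j \<in> BB"
  and cr_diff: "!!y y' j. y \<in> Y ==> y' \<in> Y ==> cr (y - y') j - (cr y j - cr y' j) \<in> II"
  and cr_om: "!!y b j. y \<in> Y ==> b \<in> BB ==> cr (y * om b) j - cr y j * b \<in> II"
  and cr_Z: "!!y j. y \<in> Z ==> cr y j \<in> II"
  and dual: "!!y. y \<in> Y ==> \<exists>K. (\<forall>j\<ge>K. cr y j \<in> II) \<and> y - (\<Sum>j<K. bs j * om (cr y j)) \<in> Z"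
 shows "qproj TYPE('z) Ms Ns actf Rr Ir eb"
 unfolding qproj_def
proof (intro allI impI, elim conjE)
 fix M :: "'z set" and pl z ac M' pl' z' ac' g h
 assume rM: "is_rmod M pl z ac Rr Ir eb" and rM': "is_rmod M' pl' z' ac' Rr Ir eb"
  and g: "mhom M pl ac M' pl' ac' Rr g" "g ` M = M'" and h: "qhom Ms Ns actf Rr M' pl' ac' h"
 interpret M: rmod M pl z ac Rr Ir eb by standard (use rM Rr_ops in auto)
 interpret M': rmod M' pl' z' ac' Rr Ir eb by standard (use rM' Rr_ops in auto)
 note Isub = subgrpD[OF II_ideal(1)]
 have cr_add: "cr (y + y') j - (cr y j + cr y' j) \<in> II" if "y \<in> Y" "y' \<in> Y" for y y' j
 proof -
  have "- (cr (y + y' - y') j - (cr (y + y') j - cr y' j)) \<in> II"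
   using cr_diff[of "y + y'" y' j] that subgrpD(4)[OF Ysub(1) that] Isub by blast
  then show ?thesis by (simp add: algebra_simps)
 qed
 have "\<exists>m\<in>Ms. rho N m = bs j" for j
 proof -
  have "bs j \<in> AA" using bs[of j] Ysub by blast
  then obtain f where "f \<in> FA N" "rho N f = bs j" unfolding AA_rho by auto
  then show ?thesis using bs[of j] unfolding Ms_def by auto
 qed
 then obtain ms where ms: "!!j. ms j \<in> Ms" "!!j. rho N (ms j) = bs j" by metis
 from h[unfolded qhom_def] have hM: "\<forall>y\<in>Ms. h y \<in> M'" by (elim conjE)
 have "\<exists>m\<in>M. g m = h (ms j)" for j
 proof -
  have "h (ms j) \<in> g ` M" using hM ms(1)[of j] g(2) by simp
  then obtain m where "h (ms j) = g m" "m \<in> M" by (rule imageE)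
  then show ?thesis by (intro bexI[of _ m]) simp_all
 qed
 then obtain m0 where m0: "!!j. m0 j \<in> M" "!!j. g (m0 j) = h (ms j)" by metis
 define sc where "sc = (\<lambda>y j. SOME s. s \<in> Rr \<and> rho n s = cr (rho N y) j)"
 have sc': "sc y j \<in> Rr \<and> rho n (sc y j) = cr (rho N y) j" if "y \<in> Ms" for y j
 proof -
  have "\<exists>s. s \<in> Rr \<and> rho n s = cr (rho N y) j" using sc_exists[OF cr[OF Ms_Y[OF that], of j]] by blast
  from someI_ex[OF this] show ?thesis by (simp only: sc_def)
 qed
 have sc: "sc y j \<in> Rr" "rho n (sc y j) = cr (rho N y) j" if "y \<in> Ms" for y j
  by (rule conjunct1[OF sc'[OF that]], rule conjunct2[OF sc'[OF that]])
 have scF: "sc y j \<in> FA n" if "y \<in> Ms" for y j using sc(1)[OF that] Rr_FA by blast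
 define K where "K = (\<lambda>y. SOME k. (\<forall>j\<ge>k. cr (rho N y) j \<in> II) \<and> rho N y - (\<Sum>j<k. bs j * om (cr (rho N y) j)) \<in> Z)"
 have K': "(\<forall>j\<ge>K y. cr (rho N y) j \<in> II) \<and> rho N y - (\<Sum>j<K y. bs j * om (cr (rho N y) j)) \<in> Z" if "y \<in> Ms" for y
  unfolding K_def by (rule someI_ex[OF dual[OF Ms_Y[OF that]]])
 have K: "y \<in> Ms ==> j \<ge> K y ==> cr (rho N y) j \<in> II"
  "y \<in> Ms ==> rho N y - (\<Sum>j<K y. bs j * om (cr (rho N y) j)) \<in> Z" for y j
  by (drule K', erule conjE, erule allE, erule mp, assumption) (drule K', erule conjE, assumption)
 define T where "T = (\<lambda>y j. ac (m0 j) (sc y j))"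
 have T: "T y j \<in> M" if "y \<in> Ms" for y j unfolding T_def using M.mem(3) m0 sc that by blast
 have ac_eq: "ac (m0 j) s = ac (m0 j) s'" if "s \<in> Rr" "s' \<in> Rr" "rho n s - rho n s' \<in> II" for s s' j
  using that m0 Rr_FA by (intro M.ac_cong Ir_II) (auto simp: rho_diff intro: FA_diff)
 have Tz: "T y j = z" if "y \<in> Ms" "j \<ge> K y" for y j
  unfolding T_def using K(1)[OF that] sc that scF by (intro M.ac_Ir m0 Ir_II) auto
 define h' where "h' = (\<lambda>y. psum pl z (T y) (K y))"
 have h'_eq: "h' y = psum pl z (T y) k" if "y \<in> Ms" "k \<ge> K y" for y k
  unfolding h'_def using that T Tz by (intro M.ps_extend[symmetric]) auto
 have "qhom Ms Ns actf Rr M pl ac h'"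
  unfolding qhom_def
 proof (intro conjI ballI impI)
  show "h' y \<in> M" if "y \<in> Ms" for y unfolding h'_def using that T by (intro M.ps_M)
  show "h' y = h' y'" if y: "y \<in> Ms" "y' \<in> Ms" "y - y' \<in> Ns" for y y'
  proof -
   let ?k = "max (K y) (K y')"
   have "T y j = T y' j" for j
   proof -
    have "rho N y - rho N y' \<in> Z" using y by (simp add: Ns_def rho_diff Ms_FA)
    then have 1: "cr (rho N y - rho N y') j \<in> II" by (rule cr_Z)
    have "cr (rho N y - rho N y') j - (cr (rho N y - rho N y') j - (cr (rho N y) j - cr (rho N y') j)) \<in> II"
     using Isub(2)[OF 1 cr_diff[OF Ms_Y[OF y(1)] Ms_Y[OF y(2)]]] .
    then show ?thesis unfolding T_def using y sc by (intro ac_eq) auto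
   qed
   then have "T y = T y'" by (rule ext)
   then show ?thesis using h'_eq[OF y(1), of ?k] h'_eq[OF y(2), of ?k] by simp
  qed
  show "h' (y + y') = pl (h' y) (h' y')" if y: "y \<in> Ms" "y' \<in> Ms" for y y'
  proof -
   let ?k = "max (K (y + y')) (max (K y) (K y'))"
   have yy: "y + y' \<in> Ms" using Ms_ops y by blast
   have "T (y + y') j = pl (T y j) (T y' j)" for j
   proof -
    have "T (y + y') j = ac (m0 j) (sc y j + sc y' j)"
     unfolding T_def using sc y yy Rr_ops(2) cr_add[OF Ms_Y[OF y(1)] Ms_Y[OF y(2)], of j] scF
     by (intro ac_eq) (auto simp: rho_add Ms_FA)
    then show ?thesis unfolding T_def using M.ac_add m0 sc y by simp
   qed
   then have "T (y + y') = (\<lambda>j. pl (T y j) (T y' j))" by (rule ext)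
   then show ?thesis using h'_eq[OF y(1), of ?k] h'_eq[OF y(2), of ?k] h'_eq[OF yy, of ?k]
    M.ps_pl[of "T y" "T y'" ?k] T y by simp
  qed
  show "h' (actf y s) = ac (h' y) s" if y: "y \<in> Ms" "s \<in> Rr" for y s
  proof -
   let ?k = "max (K (actf y s)) (K y)"
   have ay: "actf y s \<in> Ms" using actf_Ms y by blast
   have "T (actf y s) j = ac (T y j) s" for j
   proof -
    have "T (actf y s) j = ac (m0 j) (fmul (sc y j) s)"
     unfolding T_def using sc y ay Rr_ops(3) Rr_FA cr_om[OF Ms_Y[OF y(1)] Rr_BB[OF y(2)], of j] scF
     by (intro ac_eq) (auto simp: rho_fmul actf_rho)
    then show ?thesis unfolding T_def using M.ac_ac m0 sc y by simp
   qed
   then have "T (actf y s) = (\<lambda>j. ac (T y j) s)" by (rule ext)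
   then show ?thesis using h'_eq[OF y(1), of ?k] h'_eq[OF ay, of ?k] M.ps_ac[of "T y" s ?k] T y by simp
  qed
 qed
 moreover have "g (h' y) = h y" if y: "y \<in> Ms" for y
 proof -
  note hD = h[unfolded qhom_def]
  have gz: "g z = z'"
  proof (rule M'.idem)
   show "g z \<in> M'" using g M.mem(1) by blast
   show "pl' (g z) (g z) = g z" using g(1) M.mem(1) M.zl[OF M.mem(1)] unfolding mhom_def by metis
  qed
  have hz: "h 0 = z'"
  proof (rule M'.idem)
   show "h 0 \<in> M'" using hD Ms_ops(1) by blast
   show "pl' (h 0) (h 0) = h 0" using hD Ms_ops(1) by (metis add_0)
  qed
  have sM: "(\<Sum>j<k. actf (ms j) (sc y j)) \<in> Ms" for k
   by (induction k) (use Ms_ops actf_Ms ms sc y in auto)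
  have "g (psum pl z (T y) k) = h (\<Sum>j<k. actf (ms j) (sc y j))" for k
  proof (induction k)
   case (Suc k)
   have "g (pl (psum pl z (T y) k) (T y k)) = pl' (g (psum pl z (T y) k)) (g (T y k))"
    using g(1) T[OF y] M.ps_M[of "T y"] unfolding mhom_def by blast
   also have "g (T y k) = ac' (h (ms k)) (sc y k)"
    unfolding T_def using g(1) m0 sc y unfolding mhom_def by metis
   also have "... = h (actf (ms k) (sc y k))" using hD ms sc y by metis
   also have "pl' (g (psum pl z (T y) k)) ... = h ((\<Sum>j<k. actf (ms j) (sc y j)) + actf (ms k) (sc y k))"
    using hD Suc sM actf_Ms[OF ms(1) sc(1)[OF y]] by metis
   finally show ?case by simp
  qed (simp add: gz hz)
  then have "g (h' y) = h (\<Sum>j<K y. actf (ms j) (sc y j))" unfolding h'_def .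
  also have "... = h y"
  proof -
   have "rho N (\<Sum>j<K y. actf (ms j) (sc y j)) = (\<Sum>j<K y. bs j * om (cr (rho N y) j))"
    using actf_Ms[OF ms(1) sc(1)[OF y]] Ms_FA by (subst rho_sum) (auto simp: actf_rho ms sc y)
   then have "y - (\<Sum>j<K y. actf (ms j) (sc y j)) \<in> Ns"
    using K(2)[OF y] Ms_FA[OF y] Ms_FA[OF sM] by (intro Ns_I) auto
   then show ?thesis using hD y sM by metis
  qed
  finally show ?thesis .
 qed
 ultimately show "\<exists>h'. qhom Ms Ns actf Rr M pl ac h' \<and> (\<forall>y\<in>Ms. g (h' y) = h y)" by blast
qed

end

text \<open>The basis is indexed by pairs (k, m) with k < N; coding a pair as j = m N + k gives the
  single index that the projectivity criterion uses.\<close>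

lemma sum_div_mod:
 fixes F :: "nat => nat => 'c::comm_monoid_add"
 assumes N: "0 < N"
 shows "(\<Sum>j<M * N. F (j mod N) (j div N)) = (\<Sum>k<N. \<Sum>m<M. F k m)"
proof -
 have "(\<Sum>j\<in>{m * N..<m * N + N}. F (j mod N) (j div N)) = (\<Sum>k<N. F k m)" for m
 proof -
  have "(\<Sum>j\<in>{0 + m * N..<N + m * N}. F (j mod N) (j div N)) = (\<Sum>k\<in>{0..<N}. F ((k + m * N) mod N) ((k + m * N) div N))"
   by (rule sum.shift_bounds_nat_ivl)
  also have "... = (\<Sum>k\<in>{0..<N}. F k m)" using N by (intro sum.cong refl) simp
  finally show ?thesis by (simp add: add.commute atLeast0LessThan)
 qed
 then have "(\<Sum>j<M * N. F (j mod N) (j div N)) = (\<Sum>m<M. \<Sum>k<N. F k m)"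
  using sum.nat_group[of "\<lambda>j. F (j mod N) (j div N)" N M] by simp
 also have "... = (\<Sum>k<N. \<Sum>m<M. F k m)" by (rule sum.swap)
 finally show ?thesis .
qed

lemma sspan_subgrp:
 assumes "!!g. g \<in> G ==> - g \<in> G"
 shows "subgrp (sspan G)"
proof -
 have neg: "- x \<in> sspan G" if "x \<in> sspan G" for x
  using that
 proof induction
  case (ssp_add x y)
  then have "- x + - y \<in> sspan G" by (intro sspan.ssp_add)
  then show ?case by simp
 qed (use assms in \<open>auto intro: sspan.intros\<close>)
 have "a - b \<in> sspan G" if "a \<in> sspan G" "b \<in> sspan G" for a b
  using sspan.ssp_add[OF that(1) neg[OF that(2)]] by simp
 then show ?thesis unfolding subgrp_def using ssp_zero by blast
qed

section \<open>The modules of the statement described by operators\<close>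

context klr_cyc begin

lemma rho_ee: "length mu = m ==> rho m (ee mu) = Eo mu"
 unfolding rho_def by (auto intro!: op_eqI)

lemma Hp_rho_xi: "f \<in> FA n ==> Hp n i * rho N (xi f) = rho N (xi f) * Hp n i"
proof (induction rule: FA_induct)
 case zero
 show ?case by (simp add: xi_0)
next
 case (add f g)
 then show ?case by (simp add: xi_add rho_add FA_xi distrib_left distrib_right)
next
 case (word c u)
 have F: "fprod (map xi_gen v) \<in> (FA N :: ('a, 'b) fa set)" if "\<forall>g\<in>set v. vgen n g" for v
  using FA_fprod_xi[OF that] .
 have "Hp n i * rh (fprod (map xi_gen u)) = rh (fprod (map xi_gen u)) * Hp n i"
  using word
 proof (induction u)
  case (Cons g u)
  have e: "rh (fprod (map xi_gen (g # u))) = rh (xi_gen g) * rh (fprod (map xi_gen u))"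
   using F[of u] Cons.prems FA_xi_gen[of n g] by (simp add: fprod_def rh_fmul[of _ N])
  show ?case unfolding e using Cons xi_gen_Hp[of n g i] by (intro commute_mult) auto
 qed (simp add: fprod_def)
 then have "Hp n i * (pr N * (po (cst c) * rh (fprod (map xi_gen u)))) = pr N * (po (cst c) * rh (fprod (map xi_gen u))) * Hp n i"
  by (intro commute_mult) (simp_all add: pr_Hp po_cst_commute)
 then show ?case unfolding xi_word rho_def by (simp only: rh_fsmul[OF F[OF word]])
qed

abbreviation "ealf \<equiv> (eblk (bt(i := Suc (bt i))) :: ('a, 'b) fa)"

definition EE :: "('a, 'b) op" where "EE = bl (Iseq (bt(i := Suc (bt i))))"

lemma Iseq_all: "Iseq (bt(i := Suc (bt i))) \<subseteq> Iseqs N"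
proof
 fix nu assume "nu \<in> Iseq (bt(i := Suc (bt i)))"
 then have "length nu = (\<Sum>j\<in>UNIV. (bt(i := Suc (bt i))) j)" by (rule Iseq_length)
 also have "... = (\<Sum>j\<in>UNIV. bt j + (if j = i then 1 else 0))" by (intro sum.cong) auto
 also have "... = N" using sum_bt by (simp add: sum.distrib)
 finally show "nu \<in> Iseqs N" by (simp add: Iseqs_def)
qed

lemma ealf: "ealf \<in> FA N" "rho N ealf = EE"
 using rho_sum_ee[OF Iseq_all] Iseq_all unfolding eblk_def EE_def by (auto intro!: FA_sum FA_ee)

lemma EE_commute: "x \<in> AA ==> x * EE = EE * x"
 unfolding EE_def AA_def by (rule bl_commute[OF Iseq_all]) (simp_all add: Iseq_sw)

lemma EE_Eo: "mu \<in> Iseq (bt(i := Suc (bt i))) ==> EE * Eo mu = Eo mu"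
 unfolding EE_def by (auto intro!: op_eqI)

lemma EE_eB: "EE * iot i eB = iot i eB" "EE * xio n i eB = xio n i eB"
 unfolding iot_eB xio_eB sum_distrib_left
 using Iseq_snoc[of _ i bt] Iseq_Cons[of i _ bt] by (auto intro!: sum.cong EE_Eo)

abbreviation "gens em ep \<equiv> {fmul (fmul (fmul ealf r) (em (fmul (fmul (aL hL ca n 1) (eblk bt)) s))) ep | r s. r \<in> FA N \<and> s \<in> FA n} \<union> JJ N"

context
 fixes om :: "('a, 'b) op => ('a, 'b) op" and Xf tf :: "nat => ('a, 'b) op"
  and em :: "('a, 'b) fa => ('a, 'b) fa" and ep :: "('a, 'b) fa"
 assumes K: "fpres AA BB II om Xf tf n eB"
  and em: "!!x. x \<in> FA n ==> em x \<in> FA N" and ep: "ep \<in> FA N" "rho N ep = om eB"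
  and em_right: "!!x. x \<in> FA n ==> rho N (em x) * om eB = om (rho n x * eB)"
  and em_left: "!!x. x \<in> FA n ==> om eB * rho N (em x) = om (eB * rho n x)"
  and EE_om: "EE * om eB = om eB"
  and om_OA: "!!p. p \<in> OA n {1..<n} ==> om p \<in> AA" "!!p q. p \<in> OA n {1..<n} ==> om (p * q) = om p * om q"
begin

interpretation K: fpres AA BB II om Xf tf n eB by (rule K)

text \<open>K_0 and K_1 are treated together: \<open>em\<close> and \<open>ep\<close> are
  \<open>iota\<close> with e(beta, i), or \<open>xi\<close> with e(i, beta). The block idempotent
  commutes with everything and fixes \<open>om eB\<close>, so an element fixed by
  \<open>om eB\<close> on the right serves as its own representative.\<close>

lemma M_char: "{y \<in> FA N. \<exists>r\<in>FA N. y - fmul (fmul ealf r) ep \<in> JJ N} = {y \<in> FA N. rho N y \<in> K.Y}"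
proof (intro Collect_cong conj_cong refl iffI)
 fix y :: "('a, 'b) fa"
 assume y: "y \<in> FA N"
 have uA: "om eB \<in> AA" using K.om(3)[OF K.B(3)] .
 have rA: "rho N r \<in> AA" if "r \<in> FA N" for r using that unfolding AA_rho by blast
 have e: "rho N (fmul (fmul ealf r) ep) = rho N r * om eB" if r: "r \<in> FA N" for r
 proof -
  have "rho N (fmul (fmul ealf r) ep) = EE * rho N r * om eB" using r ealf ep by (simp add: rho_fmul FA_fmul)
  also have "... = rho N r * (EE * om eB)" unfolding EE_commute[OF rA[OF r], symmetric] by (simp only: mult.assoc)
  finally show ?thesis by (simp only: EE_om)
 qed
 show "rho N y \<in> K.Y" if H: "\<exists>r\<in>FA N. y - fmul (fmul ealf r) ep \<in> JJ N"
 proof -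
  obtain r where r: "r \<in> FA N" "y - fmul (fmul ealf r) ep \<in> JJ N" using H by blast
  have "rho N y = rho N r * om eB"
   using rho_J[OF r(2)] e[OF r(1)] r(1) y ealf ep by (simp add: rho_diff FA_fmul)
  then show ?thesis using K.A_om[OF rA[OF r(1)] K.B(3)] by simp
 qed
 assume "rho N y \<in> K.Y"
 then have "rho N (y - fmul (fmul ealf y) ep) = 0" using e[OF y] y ealf ep by (simp add: K.Y_def rho_diff FA_fmul)
 then have "y - fmul (fmul ealf y) ep \<in> JJ N" using y ealf ep by (subst faithful) (auto intro: FA_diff FA_fmul)
 then show "\<exists>r\<in>FA N. y - fmul (fmul ealf r) ep \<in> JJ N" using y by blast
qed

lemma gens_rho:
 assumes r: "r \<in> FA N" and s: "s \<in> FA n"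
 defines "g \<equiv> fmul (fmul (fmul ealf r) (em (fmul (fmul (aL hL ca n 1) (eblk bt)) s))) ep"
 shows "g \<in> FA N" "rho N g = rho N r * om (rho n (aL hL ca n 1) * rho n s * eB)" "rho n (aL hL ca n 1) * rho n s * eB \<in> II"
proof -
 let ?x = "fmul (fmul (aL hL ca n 1) (eblk bt)) s" and ?c = "rho n (aL hL ca n 1) * rho n s * eB"
 note ebf = eb[unfolded eb_def]
 have x: "?x \<in> FA n" using s ebf FA_aL by (intro FA_fmul)
 show "g \<in> FA N" unfolding g_def using r ealf ep em[OF x] by (intro FA_fmul)
 have sO: "rho n s \<in> OA n {1..<n}" using s OA_FA[of n "{1..<n}"] by blast
 have rx: "rho n ?x * eB = ?c"
 proof -
  have "rho n ?x * eB = rho n (aL hL ca n 1) * (eB * rho n s) * eB" using s ebf FA_aL by (simp add: rho_fmul FA_fmul mult.assoc)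
  then show ?thesis unfolding eB_commute[OF sO, symmetric] by (simp add: mult.assoc BB_unit(3)[OF K.B(3)])
 qed
 have "fmul (aL hL ca n 1) s \<in> JL t w hL ca n"
  unfolding JL_def by (intro rideal_fmul rideal_mem s) simp
 then have "rho n (fmul (aL hL ca n 1) s) * eB \<in> II" unfolding II_def by blast
 then show c: "?c \<in> II" using s by (simp add: rho_fmul FA_aL)
 then have cB: "?c \<in> BB" using II_BB by blast
 have rA: "rho N r \<in> AA" using r unfolding AA_rho by blast
 have "rho N g = EE * rho N r * (rho N (em ?x) * om eB)"
  unfolding g_def using r ealf ep em[OF x] by (simp add: rho_fmul FA_fmul mult.assoc)
 also have "... = rho N r * EE * om ?c" unfolding em_right[OF x] rx EE_commute[OF rA] ..
 also have "om ?c = om eB * om ?c" using K.om(2)[OF K.B(3) cB] BB_unit(4)[OF cB] by simp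
 also have "rho N r * EE * (om eB * om ?c) = rho N r * ((EE * om eB) * om ?c)" by (simp only: mult.assoc)
 also have "... = rho N r * (om eB * om ?c)" by (simp only: EE_om)
 also have "om eB * om ?c = om ?c" using K.om(2)[OF K.B(3) cB] BB_unit(4)[OF cB] by simp
 finally show "rho N g = rho N r * om ?c" .
qed

text \<open>\<open>Z\<close> is generated by products \<open>a * om c\<close>, and \<open>II\<close>
  by elements p a(x_1) q e(beta); the factor \<open>om p\<close> is absorbed into the left factor r
  of a generator. This settles the operators, and faithfulness accounts for the summand
  \<open>JJ N\<close> in the span.\<close>

lemma N_char: "sspan (gens em ep) = {y \<in> FA N. rho N y \<in> K.Z}"
proof
 let ?G = "gens em ep"
 have JF: "f \<in> FA N" if "f \<in> JJ N" for f using that rels_FA unfolding Jrel_def by (intro rideal_sub)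
 have GF: "g \<in> FA N \<and> rho N g \<in> K.Z" if "g \<in> ?G" for g
 proof (cases "g \<in> JJ N")
  case True
  then show ?thesis using JF rho_J subgrpD(1)[OF K.Z_subgrp] by simp
 next
  case False
  then obtain r s where rs: "r \<in> FA N" "s \<in> FA n" "g = fmul (fmul (fmul ealf r) (em (fmul (fmul (aL hL ca n 1) (eblk bt)) s))) ep"
   using \<open>g \<in> ?G\<close> False by auto
  have rA: "rho N r \<in> AA" using rs(1) unfolding AA_rho by (rule imageI)
  show ?thesis unfolding rs(3) gens_rho(2)[OF rs(1,2)]
   by (intro conjI gens_rho(1)[OF rs(1,2)] K.A_om_I[OF rA gens_rho(3)[OF rs(1,2)]])
 qed
 show sub: "sspan ?G \<subseteq> {y \<in> FA N. rho N y \<in> K.Z}"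
 proof
  fix y assume "y \<in> sspan ?G"
  then have "y \<in> FA N \<and> rho N y \<in> K.Z"
  proof induction
   case ssp_zero
   show ?case using subgrpD(1)[OF K.Z_subgrp] by simp
  next
   case (ssp_gen s)
   then show ?case by (rule GF)
  next
   case (ssp_add x y)
   then show ?case using subgrpD(4)[OF K.Z_subgrp] by (simp add: rho_add FA_add)
  qed
  then show "y \<in> {y \<in> FA N. rho N y \<in> K.Z}" by simp
 qed
 have neg: "- g \<in> ?G" if "g \<in> ?G" for g
 proof (cases "g \<in> JJ N")
  case True
  then show ?thesis by (intro UnI2 subgrpD(3)[OF J_subgrp])
 next
  case False
  then obtain r s where rs: "r \<in> FA N" "s \<in> FA n" "g = fmul (fmul (fmul ealf r) (em (fmul (fmul (aL hL ca n 1) (eblk bt)) s))) ep"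
   using \<open>g \<in> ?G\<close> False by auto
  have "- g = fmul (fmul (fmul ealf (- r)) (em (fmul (fmul (aL hL ca n 1) (eblk bt)) s))) ep"
   unfolding rs(3) by (simp only: fmul_minus)
  then show ?thesis using rs(1,2) FA_minus[OF rs(1)] by (intro UnI1 CollectI exI[of _ "- r"] exI[of _ s]) simp
 qed
 let ?S = "rho N ` sspan ?G"
 have G: "subgrp (sspan ?G)" using neg by (rule sspan_subgrp)
 have S: "subgrp ?S" unfolding subgrp_def
 proof (intro conjI ballI)
  show "0 \<in> ?S" using subgrpD(1)[OF G] rho_0[of N] by force
  fix a b assume "a \<in> ?S" "b \<in> ?S"
  then obtain f g where fg: "f \<in> sspan ?G" "g \<in> sspan ?G" "a = rho N f" "b = rho N g" by blast
  then have "a - b = rho N (f - g)" using sub by (subst rho_diff) auto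
  then show "a - b \<in> ?S" using subgrpD(2)[OF G fg(1,2)] by blast
 qed
 show "{y \<in> FA N. rho N y \<in> K.Z} \<subseteq> sspan ?G"
 proof
  fix y assume "y \<in> {y \<in> FA N. rho N y \<in> K.Z}"
  then have y: "y \<in> FA N" "rho N y \<in> K.Z" by auto
  have "rho N y \<in> ?S"
  proof (rule K.Z_gen[OF y(2) S])
   fix a c assume a: "a \<in> K.Y" and c: "c \<in> II"
   have "c \<in> {c. a * om c \<in> ?S}"
   proof (rule II_induct[OF c])
    show "subgrp {c. a * om c \<in> ?S}" using subgrpD(1,2)[OF S] by (simp add: subgrp_def K.om right_diff_distrib)
    fix p q assume pq: "p \<in> OA n {1..<n}" "q \<in> OA n {1..<n}"
    have "a * om p \<in> AA" using a om_OA(1)[OF pq(1)] by (intro AA_mult) (auto simp: K.Y_def)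
    then obtain r where r: "r \<in> FA N" "rho N r = a * om p" unfolding AA_rho by auto
    obtain s where s: "s \<in> FA n" "rho n s = q" using pq(2) OA_FA[of n "{1..<n}"] by auto
    have "a * om (p * rho n (aL hL ca n 1) * q * eB) = a * om p * om (rho n (aL hL ca n 1) * q * eB)"
     using om_OA(2)[OF pq(1), of "rho n (aL hL ca n 1) * q * eB"] by (simp only: mult.assoc)
    also have "... \<in> ?S"
     using gens_rho(2)[OF r(1) s(1)] r s by (intro image_eqI[OF _ ssp_gen]) auto
    finally show "p * rho n (aL hL ca n 1) * q * eB \<in> {c. a * om c \<in> ?S}" by simp
   qed
   then show "a * om c \<in> ?S" by simp
  qed
  then obtain g where g: "g \<in> sspan ?G" "rho N y = rho N g" by blast
  then have gF: "g \<in> FA N" using sub by blast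
  have "rho N (y - g) = 0" using g y gF by (simp add: rho_diff)
  then have "y - g \<in> JJ N" using y(1) gF by (subst faithful) (auto intro: FA_diff)
  then have "g + (y - g) \<in> sspan ?G"
   by (intro sspan.ssp_add[OF g(1) sspan.ssp_gen] UnI2)
  then show "y \<in> sspan ?G" by simp
 qed
qed

lemma em_act: "y \<in> FA N ==> rho N y \<in> K.Y ==> s \<in> Rr ==> rho N (fmul y (em s)) = rho N y * om (rho n s)"
proof -
 assume y: "y \<in> FA N" "rho N y \<in> K.Y" and s: "s \<in> Rr"
 have "rho N (fmul y (em s)) = rho N y * om eB * rho N (em s)"
  using y em[OF Rr_FA[OF s]] by (simp add: rho_fmul K.Y_def)
 also have "... = rho N y * om (eB * rho n s)" by (simp only: mult.assoc em_left[OF Rr_FA[OF s]])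
 finally show ?thesis by (simp only: BB_unit(4)[OF Rr_BB[OF s]])
qed

lemma qmod_K: "qmod t w ord qd pd hL ca n bt K.Y K.Z om em"
proof unfold_locales
 show "subgrp K.Y" "subgrp K.Z" "K.Y \<subseteq> AA" "K.Z \<subseteq> K.Y" using K.Y_subgrp K.Z_subgrp K.Z_Y by (auto simp: K.Y_def)
qed (use K.A_Y K.A_Z K.Y_om K.Z_om K.Y_om_I K.om em em_act in \<open>auto simp: K.Y_def\<close>)

lemma K_expand:
 assumes y: "y \<in> K.Y"
 shows "\<exists>J. (\<forall>j\<ge>J. K.cf y (j mod N) (j div N) = 0) \<and>
  y = (\<Sum>j<J. tf (j mod N) * Xf (j div N) * om eB * om (K.cf y (j mod N) (j div N)))"
proof -
 obtain M where g: "K.good M (K.cf y) y" using K.good_cf[OF y] by blast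
 have "y = (\<Sum>k\<le>n. \<Sum>m<M. tf k * Xf m * om (K.cf y k m))" using g by (simp add: K.good_def K.ex_def)
 also have "... = (\<Sum>k<N. \<Sum>m<M. tf k * Xf m * om eB * om (K.cf y k m))"
  unfolding lessThan_Suc_atMost
 proof (intro sum.cong refl)
  fix k m
  have "om eB * om (K.cf y k m) = om (K.cf y k m)"
   using K.om(2)[OF K.B(3) K.cf_B[OF y]] K.B(4)[OF K.cf_B[OF y]] by simp
  then show "tf k * Xf m * om (K.cf y k m) = tf k * Xf m * om eB * om (K.cf y k m)" by (simp only: mult.assoc)
 qed
 also have "... = (\<Sum>j<M * N. tf (j mod N) * Xf (j div N) * om eB * om (K.cf y (j mod N) (j div N)))"
  by (rule sum_div_mod[symmetric]) simp
 finally have e: "y = (\<Sum>j<M * N. tf (j mod N) * Xf (j div N) * om eB * om (K.cf y (j mod N) (j div N)))" .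
 have "K.cf y (j mod N) (j div N) = 0" if "j \<ge> M * N" for j
 proof -
  have "M \<le> j div N" using that by (simp add: less_eq_div_iff_mult_less_eq)
  then show ?thesis using g by (simp add: K.good_def)
 qed
 then show ?thesis using e by blast
qed

lemma qproj_K:
 "qproj TYPE('z) {y \<in> FA N. rho N y \<in> K.Y} {y \<in> FA N. rho N y \<in> K.Z} (\<lambda>y s. fmul y (em s)) Rr Ir eb"
 and qbimod_K: "Lc \<subseteq> FA N ==>
  is_qbimod {y \<in> FA N. rho N y \<in> K.Y} {y \<in> FA N. rho N y \<in> K.Z} (\<lambda>y s. fmul y (em s)) Lc (JJ N) Rr Ir eb"
proof -
 interpret Q: qmod t w ord qd pd hL ca n i bt K.Y K.Z om em by (rule qmod_K)
 have a: "Q.actf = (\<lambda>y s. fmul y (em s))" by (intro ext) (simp add: Q.actf_def)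
 note II0 = subgrpD[OF II_ideal(1)]
 have jn: "j mod N \<le> n" for j by (simp add: less_Suc_eq_le[symmetric])
 have "qproj TYPE('z) Q.Ms Q.Ns Q.actf Rr Ir eb"
 proof (rule Q.qproj[where bs = "\<lambda>j. tf (j mod N) * Xf (j div N) * om eB" and cr = "\<lambda>y j. K.cf y (j mod N) (j div N)"])
  show "tf (j mod N) * Xf (j div N) * om eB \<in> K.Y" for j by (rule K.tX_Y[OF jn K.B(3)])
  show "\<exists>J. (\<forall>j\<ge>J. K.cf y (j mod N) (j div N) \<in> II) \<and>
   y - (\<Sum>j<J. tf (j mod N) * Xf (j div N) * om eB * om (K.cf y (j mod N) (j div N))) \<in> K.Z" if yY: "y \<in> K.Y" for y
  proof -
   obtain J where J: "!!j. j \<ge> J ==> K.cf y (j mod N) (j div N) = 0"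
    "y = (\<Sum>j<J. tf (j mod N) * Xf (j div N) * om eB * om (K.cf y (j mod N) (j div N)))" using K_expand[OF yY] by blast
   have "y - (\<Sum>j<J. tf (j mod N) * Xf (j div N) * om eB * om (K.cf y (j mod N) (j div N))) = 0" using J(2) by simp
   then show ?thesis using J(1) II0(1) subgrpD(1)[OF K.Z_subgrp] by (intro exI[of _ J]) simp
  qed
  show "K.cf y (j mod N) (j div N) \<in> II" if "y \<in> K.Z" for y j using that jn by (simp add: K.Z_def)
 qed (use K.cf_B K.cf_diff K.cf_om(2) II0(1) jn in auto)
 then show "qproj TYPE('z) {y \<in> FA N. rho N y \<in> K.Y} {y \<in> FA N. rho N y \<in> K.Z} (\<lambda>y s. fmul y (em s)) Rr Ir eb"
  unfolding Q.Ms_def Q.Ns_def a .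
 show "is_qbimod {y \<in> FA N. rho N y \<in> K.Y} {y \<in> FA N. rho N y \<in> K.Z} (\<lambda>y s. fmul y (em s)) Lc (JJ N) Rr Ir eb" if "Lc \<subseteq> FA N"
  using Q.qbimod[OF that] unfolding Q.Ms_def Q.Ns_def a .
qed

end

end

section \<open>The exact sequence\<close>

context klr_cyc begin

abbreviation "ebi \<equiv> (\<Sum>nu\<in>Iseq bt. ee (nu @ [i]) :: ('a, 'b) fa)"
abbreviation "eib \<equiv> (\<Sum>nu\<in>Iseq bt. ee (i # nu) :: ('a, 'b) fa)"
abbreviation "cPf \<equiv> fmul (aL hL ca N 1) (fprod (map tt [1..<Suc n])) :: ('a, 'b) fa"

lemma ebi: "ebi \<in> FA N" "rho N ebi = iot i eB"
proof -
 have F: "ee (nu @ [i]) \<in> (FA N :: ('a, 'b) fa set)" if "nu \<in> Iseq bt" for nu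
  using len_bt[OF that] by (intro FA_ee) (simp add: Iseqs_def)
 then show "ebi \<in> FA N" by (rule FA_sum)
 have "rho N ebi = (\<Sum>nu\<in>Iseq bt. rho N (ee (nu @ [i])))" using F by (rule rho_sum)
 also have "... = iot i eB" unfolding iot_eB by (intro sum.cong refl rho_ee) (simp add: len_bt)
 finally show "rho N ebi = iot i eB" .
qed

lemma eib: "eib \<in> FA N" "rho N eib = xio n i eB"
proof -
 have F: "ee (i # nu) \<in> (FA N :: ('a, 'b) fa set)" if "nu \<in> Iseq bt" for nu
  using len_bt[OF that] by (intro FA_ee) (simp add: Iseqs_def)
 then show "eib \<in> FA N" by (rule FA_sum)
 have "rho N eib = (\<Sum>nu\<in>Iseq bt. rho N (ee (i # nu)))" using F by (rule rho_sum)
 also have "... = xio n i eB" unfolding xio_eB by (intro sum.cong refl rho_ee) (simp add: len_bt)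
 finally show "rho N eib = xio n i eB" .
qed

lemma rho_OA: "x \<in> FA n ==> rho n x \<in> OA n {1..<n}"
 using OA_FA[of n "{1..<n}"] by blast

lemma xio_OA_mult: "p \<in> OA n {1..<n} ==> xio n i (p * q) = xio n i p * xio n i q"
 by (rule xio_mult) (rule OA_unit)

lemma em0: "x \<in> FA n ==> rho N (iota n i x) * iot i eB = iot i (rho n x * eB)"
 "x \<in> FA n ==> iot i eB * rho N (iota n i x) = iot i (eB * rho n x)"
 by (simp_all only: rho_iota iot_mult)

lemma em1: assumes x: "x \<in> FA n"
 shows "rho N (xi x) * xio n i eB = xio n i (rho n x * eB)" "xio n i eB * rho N (xi x) = xio n i (eB * rho n x)"
proof -
 have "rho N (xi x) * xio n i eB = rho N (xi x) * Hp n i * xio n i eB" by (simp only: mult.assoc Hp_xio)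
 also have "... = xio n i (rho n x * eB)" by (simp only: rho_xi[OF x] xio_OA_mult[OF rho_OA[OF x]])
 finally show "rho N (xi x) * xio n i eB = xio n i (rho n x * eB)" .
 have "xio n i eB * rho N (xi x) = xio n i eB * (Hp n i * rho N (xi x))" by (simp only: mult.assoc[symmetric] Hp_xio)
 also have "... = xio n i eB * xio n i (rho n x)" by (simp only: Hp_rho_xi[OF x] rho_xi[OF x])
 finally show "xio n i eB * rho N (xi x) = xio n i (eB * rho n x)" by (simp only: xio_OA_mult[OF eB_OA])
qed

lemma om0A: "p \<in> OA n {1..<n} ==> iot i p \<in> AA" and om1A: "p \<in> OA n {1..<n} ==> xio n i p \<in> AA"
 unfolding AA_def by (rule iot_OA, assumption) (rule xio_OA, assumption)

lemmas M0_char = M_char[OF K0.fpres_axioms FA_iota ebi em0 EE_eB(1) om0A iot_mult]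
lemmas N0_char = N_char[OF K0.fpres_axioms FA_iota ebi em0 EE_eB(1) om0A iot_mult]
lemmas qmod_0 = qmod_K[OF K0.fpres_axioms FA_iota ebi em0 EE_eB(1) om0A iot_mult]
lemmas expand_0 = K_expand[OF K0.fpres_axioms FA_iota ebi em0 EE_eB(1) om0A iot_mult]
lemmas qproj_0 = qproj_K[OF K0.fpres_axioms FA_iota ebi em0 EE_eB(1) om0A iot_mult]
lemmas qbimod_0 = qbimod_K[OF K0.fpres_axioms FA_iota ebi em0 EE_eB(1) om0A iot_mult]
lemmas M1_char = M_char[OF K1.fpres_axioms FA_xi eib em1 EE_eB(2) om1A xio_OA_mult]
lemmas N1_char = N_char[OF K1.fpres_axioms FA_xi eib em1 EE_eB(2) om1A xio_OA_mult]
lemmas qmod_1 = qmod_K[OF K1.fpres_axioms FA_xi eib em1 EE_eB(2) om1A xio_OA_mult]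
lemmas qproj_1 = qproj_K[OF K1.fpres_axioms FA_xi eib em1 EE_eB(2) om1A xio_OA_mult]
lemmas qbimod_1 = qbimod_K[OF K1.fpres_axioms FA_xi eib em1 EE_eB(2) om1A xio_OA_mult]

lemma cPf: "cPf \<in> FA N"
 by (intro FA_fmul FA_aL FA_fprod) (auto intro!: FA_tt)

lemma rho_tts: "rho N (fprod (map tt ls)) = pr N * prod_list (map To ls)"
proof -
 have "fprod (map tt ls) = (fw (map T ls) :: ('a, 'b) fa)" using fprod_gens[of "map T ls"] by (simp add: comp_def)
 moreover have "wop (map T ls) = prod_list (map To ls)" by (induction ls) simp_all
 ultimately show ?thesis by (simp only: rho_def rh_fw)
qed

lemma rho_cPf: "y \<in> FA N ==> rho N (fmul y cPf) = rho N y * cP"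
proof -
 assume y: "y \<in> FA N"
 have yA: "rho N y \<in> AA" using y unfolding AA_rho by (rule imageI)
 have F: "fprod (map tt [1..<N]) \<in> (FA N :: ('a, 'b) fa set)" by (intro FA_fprod) (auto intro!: FA_tt)
 have a: "rho N (aL hL ca N 1) = pr N * aop 1" by (rule rho_aL) simp_all
 have "rho N (fmul y cPf) = rho N y * (rho N (aL hL ca N 1) * rho N (fprod (map tt [1..<N])))"
  using y F FA_aL by (simp only: rho_fmul FA_fmul)
 also have "... = rho N y * pr N * ((aop 1 * pr N) * tau 1 N)" unfolding a rho_tts tau_def by (simp only: mult.assoc)
 also have "... = rho N y * pr N * (aop 1 * tau 1 N)"
  unfolding aop_commute(4) AA_unit(2)[OF yA] by (simp only: mult.assoc[symmetric] AA_unit(2)[OF yA])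
 finally show ?thesis unfolding AA_unit(2)[OF yA] cP_def .
qed

text \<open>\<open>K0.Z\<close> enlarged by the image of \<open>cP\<close>. Exactness in the middle
  amounts to its identification with the kernel of the projection to F^Lambda in
  \<open>NF_char\<close>.\<close>

definition ZF :: "('a, 'b) op set" where
 "ZF = {y \<in> K0.Y. \<exists>y1\<in>K1.Y. y - y1 * cP \<in> K0.Z}"

lemma Z0_ZF: "K0.Z \<subseteq> ZF"
 unfolding ZF_def using K0.Z_Y subgrpD(1)[OF K1.Y_subgrp] by (auto intro!: bexI[of _ 0])

lemma ZF_subgrp: "subgrp ZF"
 unfolding subgrp_def
proof (intro conjI ballI)
 show "0 \<in> ZF" using Z0_ZF subgrpD(1)[OF K0.Z_subgrp] by blast
 fix a b assume ab: "a \<in> ZF" "b \<in> ZF"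
 then obtain a1 b1 where 1: "a1 \<in> K1.Y" "b1 \<in> K1.Y" "a - a1 * cP \<in> K0.Z" "b - b1 * cP \<in> K0.Z" by (auto simp: ZF_def)
 have e: "(a - a1 * cP) - (b - b1 * cP) = (a - b) - (a1 - b1) * cP" by (simp add: algebra_simps)
 from subgrpD(2)[OF K0.Z_subgrp 1(3,4)] have "(a - b) - (a1 - b1) * cP \<in> K0.Z" unfolding e .
 moreover have "a - b \<in> K0.Y" using ab subgrpD(2)[OF K0.Y_subgrp] by (simp add: ZF_def)
 ultimately show "a - b \<in> ZF" unfolding ZF_def using subgrpD(2)[OF K1.Y_subgrp 1(1,2)] by blast
qed

lemma ZF_left: "a \<in> AA ==> y \<in> ZF ==> a * y \<in> ZF"
proof -
 assume a: "a \<in> AA" and y: "y \<in> ZF"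
 then obtain y1 where y1: "y1 \<in> K1.Y" "y - y1 * cP \<in> K0.Z" by (auto simp: ZF_def)
 have "a * y - (a * y1) * cP \<in> K0.Z" using K0.A_Z[OF a y1(2)] by (simp only: right_diff_distrib mult.assoc)
 moreover have "a * y \<in> K0.Y" using y K0.A_Y[OF a] by (simp add: ZF_def)
 ultimately show ?thesis unfolding ZF_def using K1.A_Y[OF a y1(1)] by blast
qed

lemma ZF_right: "y \<in> ZF ==> x \<in> BB ==> y * iot i x \<in> ZF"
proof -
 assume y: "y \<in> ZF" and x: "x \<in> BB"
 then obtain y1 where y1: "y1 \<in> K1.Y" "y - y1 * cP \<in> K0.Z" by (auto simp: ZF_def)
 have y1A: "y1 \<in> AA" using y1 by (simp add: K1.Y_def)
 have "y * iot i x - (y1 * xio n i x) * cP = (y - y1 * cP) * iot i x - y1 * (xio n i x * cP - cP * iot i x)"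
  by (simp only: left_diff_distrib right_diff_distrib mult.assoc) simp
 then have "y * iot i x - (y1 * xio n i x) * cP \<in> K0.Z"
  using subgrpD(2)[OF K0.Z_subgrp K0.Z_om[OF y1(2) x] K0.A_Z[OF y1A cP_comm'[OF x]]] by (simp only:)
 moreover have "y * iot i x \<in> K0.Y" using y K0.Y_om[OF _ x] by (simp add: ZF_def)
 ultimately show ?thesis unfolding ZF_def using K1.Y_om[OF y1(1) x] by blast
qed

lemma qmod_F: "qmod t w ord qd pd hL ca n bt K0.Y ZF (iot i) (iota n i)"
proof -
 interpret Q: qmod t w ord qd pd hL ca n i bt K0.Y K0.Z "iot i" "iota n i" by (rule qmod_0)
 show ?thesis
 proof unfold_locales
  show "ZF \<subseteq> K0.Y" by (auto simp: ZF_def)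
  show "y * iot i c \<in> ZF" if "y \<in> K0.Y" "c \<in> II" for y c using Q.YI[OF that] Z0_ZF by blast
 qed (rule Q.Ysub ZF_subgrp Q.left ZF_left Q.right ZF_right Q.Yu Q.om_diff Q.om_mult Q.em Q.act; assumption)+
qed

lemma JL_FA_N: "f \<in> JL t w hL ca N ==> f \<in> FA N"
 unfolding JL_def using rels_FA FA_aL by (intro rideal_sub) auto

text \<open>The ideal of R^Lambda(n+1) is generated by p a(x_1) q, and \<open>image_cP\<close>
  reduces a(x_1) q modulo \<open>K0.Z\<close> to a multiple of \<open>cP\<close>. Conversely
  \<open>cP\<close> has the factor a(x_1), and so do the generators of \<open>K0.Z\<close>.\<close>

lemma NF_char: "{y \<in> FA N. rho N y \<in> K0.Y} \<inter> JL t w hL ca N = {y \<in> FA N. rho N y \<in> ZF}"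
proof (intro equalityI subsetI)
 fix y assume "y \<in> {y \<in> FA N. rho N y \<in> K0.Y} \<inter> JL t w hL ca N"
 then have y: "y \<in> FA N" "rho N y \<in> K0.Y" "y \<in> JL t w hL ca N" by auto
 have a: "rho N (aL hL ca N 1) = pr N * aop 1" by (rule rho_aL) simp_all
 from y(3) have "y \<in> FA N \<and> rho N y * iot i eB \<in> ZF"
  unfolding JL_def
 proof induction
  case rid_zero
  then show ?case using subgrpD(1)[OF ZF_subgrp] by simp
 next
  case (rid_gen s p q)
  then have s: "s \<in> FA N" using rels_FA FA_aL by auto
  have pq: "rho N p \<in> AA" "rho N q \<in> AA" using rid_gen unfolding AA_rho by auto
  have e: "rho N (fmul (fmul p s) q) = rho N p * rho N s * rho N q" using rid_gen s by (simp add: rho_fmul FA_fmul)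
  have "rho N (fmul (fmul p s) q) * iot i eB \<in> ZF"
  proof (cases "s \<in> rels t w N")
   case True
   then have "rho N s = 0" using rho_rels by auto
   then show ?thesis unfolding e using subgrpD(1)[OF ZF_subgrp] by simp
  next
   case False
   then have "rho N s = pr N * aop 1" using rid_gen(1) a by auto
   then have e2: "rho N (fmul (fmul p s) q) * iot i eB = rho N p * (aop 1 * rho N q * iot i eB)"
    unfolding e using AA_unit(2)[OF pq(1)] by (simp only: mult.assoc[symmetric])
   have "aop 1 * rho N q \<in> AA"
   proof -
    have "pr N * aop 1 \<in> AA" unfolding AA_rho a[symmetric] using FA_aL by (rule imageI)
    from AA_mult[OF this pq(2)] have "aop 1 * (pr N * rho N q) \<in> AA"
     by (simp only: aop_commute(4)[symmetric] mult.assoc)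
    then show ?thesis by (simp only: AA_unit(1)[OF pq(2)])
   qed
   then have "aop 1 * rho N q * iot i eB \<in> K0.Y" by (rule K0.A_om[OF _ K0.B(3)])
   then have "aop 1 * rho N q * iot i eB \<in> ZF" unfolding ZF_def using image_cP[OF pq(2)] by blast
   then show ?thesis unfolding e2 by (rule ZF_left[OF pq(1)])
  qed
  then show ?case using rid_gen s by (simp add: FA_fmul)
 next
  case (rid_add x y)
  then show ?case using subgrpD(4)[OF ZF_subgrp] by (simp add: rho_add FA_add distrib_right)
 qed
 then have "rho N y * iot i eB \<in> ZF" by blast
 moreover have "rho N y * iot i eB = rho N y" using y(2) by (simp add: K0.Y_def)
 ultimately show "y \<in> {y \<in> FA N. rho N y \<in> ZF}" using y(1) by simp
next
 fix y assume "y \<in> {y \<in> FA N. rho N y \<in> ZF}"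
 then have y: "y \<in> FA N" "rho N y \<in> ZF" by auto
 then obtain y1 where y1: "y1 \<in> K1.Y" "rho N y - y1 * cP \<in> K0.Z" by (auto simp: ZF_def)
 let ?JL = "JL t w hL ca N" and ?S = "rho N ` JL t w hL ca N"
 have J: "subgrp ?JL" unfolding JL_def by (rule subgrp_rideal)
 have S: "subgrp ?S" unfolding subgrp_def
 proof (intro conjI ballI)
  have "rho N 0 \<in> ?S" using subgrpD(1)[OF J] by (rule imageI)
  then show "0 \<in> ?S" by simp
  fix a b assume "a \<in> ?S" "b \<in> ?S"
  then obtain f g where fg: "f \<in> ?JL" "g \<in> ?JL" "a = rho N f" "b = rho N g" by blast
  have "a - b = rho N (f - g)" unfolding fg(3,4) using JL_FA_N fg(1,2) by (simp add: rho_diff)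
  then show "a - b \<in> ?S" using subgrpD(2)[OF J fg(1,2)] by blast
 qed
 have aJ: "aL hL ca N 1 \<in> ?JL" unfolding JL_def by (rule rideal_mem) simp
 have JJm: "fmul f g \<in> ?JL" "fmul g f \<in> ?JL" if "f \<in> ?JL" "g \<in> FA N" for f g
  using that unfolding JL_def by (auto intro: rideal_fmul)
 have a: "rho N (aL hL ca N 1) = pr N * aop 1" by (rule rho_aL) simp_all
 have paS: "p * (aop 1 * q) \<in> ?S" if p: "p \<in> AA" and q: "q \<in> AA" for p q
 proof -
  obtain f g where fg: "f \<in> FA N" "g \<in> FA N" "p = rho N f" "q = rho N g" using p q unfolding AA_rho by blast
  have "rho N (fmul f (fmul (aL hL ca N 1) g)) = p * (pr N * aop 1 * q)"
   using fg FA_aL by (simp only: rho_fmul FA_fmul a)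
  also have "... = p * (aop 1 * q)" using AA_unit(2)[OF p] by (simp only: mult.assoc[symmetric])
  finally show ?thesis using JJm(2)[OF JJm(1)[OF aJ fg(2)] fg(1)] by (metis imageI)
 qed
 have "rho N y - y1 * cP \<in> ?S"
 proof (rule K0.Z_gen[OF y1(2) S])
  fix a c assume aY: "a \<in> K0.Y" and c: "c \<in> II"
  have aA: "a \<in> AA" using aY by (simp add: K0.Y_def)
  have "c \<in> {c. a * iot i c \<in> ?S}"
  proof (rule II_induct[OF c])
   show "subgrp {c. a * iot i c \<in> ?S}" using subgrpD(1,2)[OF S] by (simp add: subgrp_def iot_diff right_diff_distrib)
   fix p q assume pq: "p \<in> OA n {1..<n}" "q \<in> OA n {1..<n}"
   have qB: "q * eB \<in> BB" by (rule BB_left[OF pq(2) K0.B(3)])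
   show "p * rho n (aL hL ca n 1) * q * eB \<in> {c. a * iot i c \<in> ?S}"
   proof (cases "1 \<le> n")
    case True
    have "a * iot i (p * rho n (aL hL ca n 1) * q * eB) = a * iot i p * (iot i (pr n * aop 1) * iot i (q * eB))"
     unfolding aL_rho if_P[OF True] by (simp only: iot_mult mult.assoc)
    also have "... = (a * iot i p) * (aop 1 * iot i (q * eB))"
     unfolding iot_aop[OF True] mult.assoc Lp_iot_BB[OF qB] ..
    also have "... \<in> ?S" by (rule paS[OF AA_mult[OF aA om0A[OF pq(1)]] iot_AA[OF qB]])
    finally show ?thesis by simp
   next
    case False
    \<comment> \<open>For n = 0 the algebra R(0) has no x_1 and the generator is 0 by
      convention.\<close>
    then show ?thesis unfolding aL_rho using subgrpD(1)[OF S] by simp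
   qed
  qed
  then show "a * iot i c \<in> ?S" by simp
 qed
 moreover have "y1 * cP \<in> ?S"
 proof -
  have "tau 1 N * pr N \<in> AA" unfolding AA_def by (rule tau_OA) auto
  then have "y1 * (aop 1 * (tau 1 N * pr N)) \<in> ?S" using y1(1) by (intro paS) (simp add: K1.Y_def)
  moreover have "y1 * (aop 1 * (tau 1 N * pr N)) = y1 * pr N * cP"
   unfolding cP_def tau_pr by (simp only: left_comm[OF aop_commute(4)] mult.assoc)
  moreover have "y1 * pr N = y1" using y1(1) by (intro AA_unit) (simp add: K1.Y_def)
  ultimately show ?thesis by simp
 qed
 ultimately have "(rho N y - y1 * cP) + y1 * cP \<in> ?S" by (rule subgrpD(4)[OF S])
 then obtain g where g: "g \<in> ?JL" "rho N y = rho N g" by auto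
 have "rho N (y - g) = 0" using g y(1) JL_FA_N by (simp add: rho_diff)
 then have "y - g \<in> ?JL" using y(1) JL_FA_N[OF g(1)] by (intro JJ_JL) (subst faithful, auto intro: FA_diff)
 from subgrpD(4)[OF J this g(1)] have "y \<in> ?JL" by simp
 then show "y \<in> {y \<in> FA N. rho N y \<in> K0.Y} \<inter> JL t w hL ca N" using y by (auto simp: ZF_def)
qed

text \<open>The left inverse splits the sequence, so F^Lambda is a direct summand of K_0. A dual
  basis is obtained from that of K_0 by applying the coordinates after the projection to the
  complement.\<close>

lemma qproj_F:
 "qproj TYPE('z) {y \<in> FA N. rho N y \<in> K0.Y} {y \<in> FA N. rho N y \<in> ZF} (\<lambda>y s. fmul y (iota n i s)) Rr Ir eb"
 and qbimod_F: "Lc \<subseteq> FA N ==>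
  is_qbimod {y \<in> FA N. rho N y \<in> K0.Y} {y \<in> FA N. rho N y \<in> ZF} (\<lambda>y s. fmul y (iota n i s)) Lc (JJ N) Rr Ir eb"
proof -
 interpret Q: qmod t w ord qd pd hL ca n i bt K0.Y ZF "iot i" "iota n i" by (rule qmod_F)
 have act: "Q.actf = (\<lambda>y s. fmul y (iota n i s))" by (intro ext) (simp add: Q.actf_def)
 show "is_qbimod {y \<in> FA N. rho N y \<in> K0.Y} {y \<in> FA N. rho N y \<in> ZF} (\<lambda>y s. fmul y (iota n i s)) Lc (JJ N) Rr Ir eb"
  if "Lc \<subseteq> FA N" using Q.qbimod[OF that] unfolding Q.Ms_def Q.Ns_def act .
 obtain L where L: "!!y. y \<in> K0.Y ==> L y \<in> K1.Y" "!!y. y \<in> K0.Z ==> L y \<in> K1.Z"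
  "!!y y'. y \<in> K0.Y ==> y' \<in> K0.Y ==> L (y - y') - (L y - L y') \<in> K1.Z"
  "!!y x. y \<in> K0.Y ==> x \<in> BB ==> L (y * iot i x) - L y * xio n i x \<in> K1.Z"
  "!!y. y \<in> K1.Y ==> L (y * cP) - y \<in> K1.Z" using left_inverse by blast
 \<comment> \<open>The projection to a complement of the image of \<open>cP\<close>: it sends
   \<open>ZF\<close> into \<open>K0.Z\<close> and differs from the identity by an element of
   \<open>ZF\<close>.\<close>
 define S where "S = (\<lambda>y. y - L y * cP)"
 have SY: "S y \<in> K0.Y" if "y \<in> K0.Y" for y
  unfolding S_def by (rule subgrpD(2)[OF K0.Y_subgrp that cP_Y[OF L(1)[OF that]]])
 have jn: "j mod N \<le> n" for j by (simp add: less_Suc_eq_le[symmetric])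
 have cfI: "K0.cf a (j mod N) m - K0.cf b (j mod N) m \<in> II" if ab: "a \<in> K0.Y" "b \<in> K0.Y" "a - b \<in> K0.Z" for a b j m
 proof -
  have "K0.cf (a - b) (j mod N) m \<in> II" using ab(3) jn[of j] by (simp add: K0.Z_def)
  then show ?thesis by (simp only: K0.cf_diff[OF ab(1,2) jn])
 qed
 have "qproj TYPE('z) Q.Ms Q.Ns Q.actf Rr Ir eb"
 proof (rule Q.qproj[where bs = "\<lambda>j. chop (\<lambda>r. n - r) (j mod N) * po (Vr N ^ (j div N)) * iot i eB"
    and cr = "\<lambda>y j. K0.cf (S y) (j mod N) (j div N)"])
  show "chop (\<lambda>r. n - r) (j mod N) * po (Vr N ^ (j div N)) * iot i eB \<in> K0.Y" for j by (rule K0.tX_Y[OF jn K0.B(3)])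
  show "K0.cf (S y) (j mod N) (j div N) \<in> BB" if "y \<in> K0.Y" for y j by (rule K0.cf_B[OF SY[OF that]])
  show "K0.cf (S (y - y')) (j mod N) (j div N) - (K0.cf (S y) (j mod N) (j div N) - K0.cf (S y') (j mod N) (j div N)) \<in> II"
   if y: "y \<in> K0.Y" "y' \<in> K0.Y" for y y' j
  proof -
   have yy: "y - y' \<in> K0.Y" by (rule subgrpD(2)[OF K0.Y_subgrp y])
   have "S (y - y') - (S y - S y') = - ((L (y - y') - (L y - L y')) * cP)"
    unfolding S_def by (simp add: algebra_simps)
   then have "S (y - y') - (S y - S y') \<in> K0.Z" using subgrpD(3)[OF K0.Z_subgrp cP_Z[OF L(3)[OF y]]] by (simp only:)
   from cfI[OF SY[OF yy] subgrpD(2)[OF K0.Y_subgrp SY[OF y(1)] SY[OF y(2)]] this]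
   show ?thesis by (simp only: K0.cf_diff[OF SY[OF y(1)] SY[OF y(2)] jn])
  qed
  show "K0.cf (S (y * iot i b)) (j mod N) (j div N) - K0.cf (S y) (j mod N) (j div N) * b \<in> II"
   if y: "y \<in> K0.Y" and b: "b \<in> BB" for y b j
  proof -
   have yb: "y * iot i b \<in> K0.Y" by (rule K0.Y_om[OF y b])
   have LA: "L y \<in> AA" using L(1)[OF y] by (simp add: K1.Y_def)
   have "S (y * iot i b) - S y * iot i b =
    - ((L (y * iot i b) - L y * xio n i b) * cP) - L y * (xio n i b * cP - cP * iot i b)"
    unfolding S_def by (simp only: left_diff_distrib right_diff_distrib mult.assoc) simp
   then have "S (y * iot i b) - S y * iot i b \<in> K0.Z"
    using subgrpD(2)[OF K0.Z_subgrp subgrpD(3)[OF K0.Z_subgrp cP_Z[OF L(4)[OF y b]]] K0.A_Z[OF LA cP_comm'[OF b]]] by (simp only:)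
   from cfI[OF SY[OF yb] K0.Y_om[OF SY[OF y] b] this] show ?thesis by (simp only: K0.cf_om(2)[OF SY[OF y] b jn])
  qed
  show "K0.cf (S y) (j mod N) (j div N) \<in> II" if yF: "y \<in> ZF" for y j
  proof -
   obtain y1 where y1: "y1 \<in> K1.Y" "y - y1 * cP \<in> K0.Z" using yF by (auto simp: ZF_def)
   have y: "y \<in> K0.Y" using yF by (simp add: ZF_def)
   note ZZ = subgrpD[OF K1.Z_subgrp]
   have 1: "L (y - y1 * cP) - (L (y - y1 * cP) - (L y - L (y1 * cP))) \<in> K1.Z"
    by (rule ZZ(2)[OF L(2)[OF y1(2)] L(3)[OF y cP_Y[OF y1(1)]]])
   have "(L (y - y1 * cP) - (L (y - y1 * cP) - (L y - L (y1 * cP)))) + (L (y1 * cP) - y1) = L y - y1" by simp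
   with ZZ(4)[OF 1 L(5)[OF y1(1)]] have "L y - y1 \<in> K1.Z" by (simp only:)
   from subgrpD(2)[OF K0.Z_subgrp y1(2) cP_Z[OF this]]
   have "S y \<in> K0.Z" unfolding S_def by (simp add: algebra_simps)
   then show ?thesis using jn[of j] by (simp add: K0.Z_def)
  qed
  show "\<exists>J. (\<forall>j\<ge>J. K0.cf (S y) (j mod N) (j div N) \<in> II) \<and>
   y - (\<Sum>j<J. chop (\<lambda>r. n - r) (j mod N) * po (Vr N ^ (j div N)) * iot i eB * iot i (K0.cf (S y) (j mod N) (j div N))) \<in> ZF"
   if y: "y \<in> K0.Y" for y
  proof -
   obtain J where J: "!!j. j \<ge> J ==> K0.cf (S y) (j mod N) (j div N) = 0"
    "S y = (\<Sum>j<J. chop (\<lambda>r. n - r) (j mod N) * po (Vr N ^ (j div N)) * iot i eB * iot i (K0.cf (S y) (j mod N) (j div N)))"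
    using expand_0[OF _ _ _ _ SY[OF y]] by blast
   have "y - S y = L y * cP" by (simp add: S_def)
   moreover have "L y * cP \<in> ZF"
    unfolding ZF_def using cP_Y[OF L(1)[OF y]] L(1)[OF y] subgrpD(1)[OF K0.Z_subgrp] by (auto intro!: bexI[of _ "L y"])
   ultimately have "y - S y \<in> ZF" by simp
   then show ?thesis unfolding J(2)[symmetric] using J(1) subgrpD(1)[OF II_ideal(1)] by (intro exI[of _ J] conjI) (auto simp flip: J(2))
  qed
 qed
 then show "qproj TYPE('z) {y \<in> FA N. rho N y \<in> K0.Y} {y \<in> FA N. rho N y \<in> ZF} (\<lambda>y s. fmul y (iota n i s)) Rr Ir eb"
  unfolding Q.Ms_def Q.Ns_def act .
qed

lemma P_map:
 fixes M0 N0 M1 N1 NF Rl :: "('a, 'b) fa set"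
 assumes M0_def: "M0 = {y \<in> FA N. rho N y \<in> K0.Y}" and N0_def: "N0 = {y \<in> FA N. rho N y \<in> K0.Z}"
  and M1_def: "M1 = {y \<in> FA N. rho N y \<in> K1.Y}" and N1_def: "N1 = {y \<in> FA N. rho N y \<in> K1.Z}"
  and NF_def: "NF = {y \<in> FA N. rho N y \<in> ZF}"
 shows "\<forall>y\<in>M1. fmul y cPf \<in> M0"
  and "\<forall>y\<in>M1. \<forall>y'\<in>M1. y - y' \<in> N1 --> fmul y cPf - fmul y' cPf \<in> N0"
  and "\<forall>y\<in>M1. \<forall>y'\<in>M1. fmul (y + y') cPf - (fmul y cPf + fmul y' cPf) \<in> N0"
  and "\<forall>y\<in>M1. \<forall>r\<in>Rl. fmul (fmul r y) cPf - fmul r (fmul y cPf) \<in> N0"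
  and "\<forall>y\<in>M1. \<forall>s\<in>Rr. fmul (fmul y (xi s)) cPf - fmul (fmul y cPf) (iota n i s) \<in> N0"
  and "N0 \<subseteq> NF" and "\<forall>y\<in>M1. fmul y cPf \<in> N0 --> y \<in> N1"
  and "\<forall>z\<in>M0. z \<in> NF \<longleftrightarrow> (\<exists>y\<in>M1. z - fmul y cPf \<in> N0)"
proof -
 interpret Q0: qmod t w ord qd pd hL ca n i bt K0.Y K0.Z "iot i" "iota n i" by (rule qmod_0)
 interpret Q1: qmod t w ord qd pd hL ca n i bt K1.Y K1.Z "xio n i" xi by (rule qmod_1)
 note Z = subgrpD[OF K0.Z_subgrp]
 have z0: "0 \<in> N0" using Z(1) by (simp add: N0_def)
 have F: "fmul y cPf \<in> FA N" if "y \<in> FA N" for y using that cPf by (rule FA_fmul)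
 show P: "\<forall>y\<in>M1. fmul y cPf \<in> M0"
 proof (intro ballI)
  fix y assume "y \<in> M1"
  then have yF: "y \<in> FA N" "rho N y \<in> K1.Y" by (auto simp: M1_def)
  show "fmul y cPf \<in> M0"
   unfolding M0_def using F[OF yF(1)] cP_Y[OF yF(2)] by (simp only: rho_cPf[OF yF(1)] mem_Collect_eq simp_thms)
 qed
 show "\<forall>y\<in>M1. \<forall>y'\<in>M1. y - y' \<in> N1 --> fmul y cPf - fmul y' cPf \<in> N0"
 proof (intro ballI impI)
  fix y y' assume y: "y \<in> M1" "y' \<in> M1" "y - y' \<in> N1"
  then have yF: "y \<in> FA N" "y' \<in> FA N" "y - y' \<in> FA N" "rho N (y - y') \<in> K1.Z" by (auto simp: M1_def N1_def)
  have "fmul (y - y') cPf \<in> N0" unfolding N0_def using F[OF yF(3)] cP_Z[OF yF(4)] by (simp only: rho_cPf[OF yF(3)] mem_Collect_eq simp_thms)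
  then show "fmul y cPf - fmul y' cPf \<in> N0" by (simp only: fmul_diff_left)
 qed
 show "\<forall>y\<in>M1. \<forall>y'\<in>M1. fmul (y + y') cPf - (fmul y cPf + fmul y' cPf) \<in> N0"
  using z0 by (simp add: fmul_add_left)
 show "\<forall>y\<in>M1. \<forall>r\<in>Rl. fmul (fmul r y) cPf - fmul r (fmul y cPf) \<in> N0"
  using z0 by (simp add: fmul_assoc)
 show "\<forall>y\<in>M1. \<forall>s\<in>Rr. fmul (fmul y (xi s)) cPf - fmul (fmul y cPf) (iota n i s) \<in> N0"
 proof (intro ballI)
  fix y s assume y: "y \<in> M1" and s: "s \<in> Rr"
  have yF: "y \<in> FA N" "rho N y \<in> K1.Y" "rho N y \<in> AA" using y by (auto simp: M1_def K1.Y_def)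
  have sF: "s \<in> FA n" and sB: "rho n s \<in> BB" using Rr_FA[OF s] Rr_BB[OF s] by auto
  have yx: "fmul y (xi s) \<in> FA N" using yF(1) FA_xi[OF sF] by (rule FA_fmul)
  have cY: "rho N (fmul y cPf) \<in> K0.Y" unfolding rho_cPf[OF yF(1)] by (rule cP_Y[OF yF(2)])
  have fF: "fmul (fmul y cPf) (iota n i s) \<in> FA N" using F[OF yF(1)] FA_iota[OF sF] by (rule FA_fmul)
  have "rho N (fmul (fmul y (xi s)) cPf - fmul (fmul y cPf) (iota n i s)) =
   rho N y * (xio n i (rho n s) * cP - cP * iot i (rho n s))"
   unfolding rho_diff[OF F[OF yx] fF] rho_cPf[OF yx] Q1.act[OF yF(1,2) s] Q0.act[OF F[OF yF(1)] cY s] rho_cPf[OF yF(1)]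
   by (simp only: right_diff_distrib mult.assoc)
  then have "rho N (fmul (fmul y (xi s)) cPf - fmul (fmul y cPf) (iota n i s)) \<in> K0.Z"
   using K0.A_Z[OF yF(3) cP_comm'[OF sB]] by (simp only:)
  then show "fmul (fmul y (xi s)) cPf - fmul (fmul y cPf) (iota n i s) \<in> N0"
   unfolding N0_def using FA_diff[OF F[OF yx] fF] by (simp only: mem_Collect_eq simp_thms)
 qed
 show "N0 \<subseteq> NF" unfolding N0_def NF_def using Z0_ZF by blast
 show "\<forall>y\<in>M1. fmul y cPf \<in> N0 --> y \<in> N1"
 proof (intro ballI impI)
  fix y assume y: "y \<in> M1" "fmul y cPf \<in> N0"
  then have yF: "y \<in> FA N" "rho N y \<in> K1.Y" by (auto simp: M1_def)
  have "rho N (fmul y cPf) \<in> K0.Z" using y(2)[unfolded N0_def] unfolding mem_Collect_eq by (rule conjunct2)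
  then have yZ: "rho N y * cP \<in> K0.Z" unfolding rho_cPf[OF yF(1)] .
  \<comment> \<open>Injectivity of P: the left inverse takes \<open>rho N y * cP\<close> into
    \<open>K1.Z\<close> and also returns \<open>rho N y\<close> up to \<open>K1.Z\<close>.\<close>
  obtain L where L: "!!y. y \<in> K0.Z ==> L y \<in> K1.Z" "!!y. y \<in> K1.Y ==> L (y * cP) - y \<in> K1.Z" using left_inverse by metis
  from subgrpD(2)[OF K1.Z_subgrp L(1)[OF yZ] L(2)[OF yF(2)]] have "rho N y \<in> K1.Z" by simp
  then show "y \<in> N1" using yF by (simp add: N1_def)
 qed
 show "\<forall>z\<in>M0. z \<in> NF \<longleftrightarrow> (\<exists>y\<in>M1. z - fmul y cPf \<in> N0)"
 proof (intro ballI iffI)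
  fix z assume z: "z \<in> M0"
  have zF: "z \<in> FA N" using z by (simp add: M0_def)
  show "\<exists>y\<in>M1. z - fmul y cPf \<in> N0" if "z \<in> NF"
  proof -
   obtain y1 where y1: "y1 \<in> K1.Y" "rho N z - y1 * cP \<in> K0.Z" using \<open>z \<in> NF\<close> by (auto simp: NF_def ZF_def)
   have "y1 \<in> AA" using y1(1) by (simp add: K1.Y_def)
   then obtain y where y: "y \<in> FA N" "rho N y = y1" unfolding AA_rho by auto
   have "rho N (z - fmul y cPf) \<in> K0.Z" using y1(2) by (simp only: rho_diff[OF zF F[OF y(1)]] rho_cPf[OF y(1)] y(2))
   then have "z - fmul y cPf \<in> N0" unfolding N0_def using FA_diff[OF zF F[OF y(1)]] by (simp only: mem_Collect_eq simp_thms)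
   moreover have "y \<in> M1" using y y1(1) by (simp add: M1_def)
   ultimately show ?thesis by blast
  qed
  show "z \<in> NF" if H: "\<exists>y\<in>M1. z - fmul y cPf \<in> N0"
  proof -
   obtain y where y: "y \<in> M1" "z - fmul y cPf \<in> N0" using H by blast
   have yF: "y \<in> FA N" "rho N y \<in> K1.Y" using y(1) by (auto simp: M1_def)
   have "rho N (z - fmul y cPf) \<in> K0.Z" using y(2) by (simp add: N0_def)
   then have "rho N z - rho N y * cP \<in> K0.Z" by (simp only: rho_diff[OF zF F[OF yF(1)]] rho_cPf[OF yF(1)])
   then have "rho N z \<in> ZF" unfolding ZF_def using z yF(2) by (auto simp: M0_def)
   then show ?thesis using zF by (simp add: NF_def)
  qed
 qed
qed

end

section \<open>Assembly of the exact sequence\<close>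

context klr_cyc begin

theorem exact_sequence:
  "let N = n + 1; J = Jrel t w N;
    eall = (eblk (bt(i := bt i + 1)) :: ('a,'b) fa); eb = (eblk bt :: ('a,'b) fa);
    ebi = (\<Sum>nu\<in>Iseq bt. ee (nu @ [i]) :: ('a,'b) fa);
    eib = (\<Sum>nu\<in>Iseq bt. ee (i # nu) :: ('a,'b) fa);
    Rl = {fmul eall r | r. r \<in> FA N};
    Rr = {fmul eb s | s. s \<in> FA n};
    Ir = JL t w hL ca n;
    M0 = {y \<in> FA N. \<exists>r\<in>FA N. y - fmul (fmul eall r) ebi \<in> J};
    N0 = sspan ({fmul (fmul (fmul eall r) (iota n i (fmul (fmul (aL hL ca n 1) eb) s))) ebi
           | r s. r \<in> FA N \<and> s \<in> FA n} \<union> J);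
    M1 = {y \<in> FA N. \<exists>r\<in>FA N. y - fmul (fmul eall r) eib \<in> J};
    N1 = sspan ({fmul (fmul (fmul eall r) (xi (fmul (fmul (aL hL ca n 1) eb) s))) eib
           | r s. r \<in> FA N \<and> s \<in> FA n} \<union> J);
    NF = M0 \<inter> JL t w hL ca N;
    act0 = (\<lambda>y s. fmul y (iota n i s));
    act1 = (\<lambda>y s. fmul y (xi s));
    cP = fmul (aL hL ca N 1) (fprod (map tt [1..<n+1]))
  in is_qbimod M1 N1 act1 Rl J Rr Ir eb
   \<and> is_qbimod M0 N0 act0 Rl J Rr Ir eb
   \<and> is_qbimod M0 NF act0 Rl J Rr Ir eb
   \<and> (\<forall>y\<in>M1. fmul y cP \<in> M0)
   \<and> (\<forall>y\<in>M1. \<forall>y'\<in>M1. y - y' \<in> N1 --> fmul y cP - fmul y' cP \<in> N0)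
   \<and> (\<forall>y\<in>M1. \<forall>y'\<in>M1. fmul (y + y') cP - (fmul y cP + fmul y' cP) \<in> N0)
   \<and> (\<forall>y\<in>M1. \<forall>r\<in>Rl. fmul (fmul r y) cP - fmul r (fmul y cP) \<in> N0)
   \<and> (\<forall>y\<in>M1. \<forall>s\<in>Rr. fmul (act1 y s) cP - act0 (fmul y cP) s \<in> N0)
   \<and> N0 \<subseteq> NF
   \<and> (\<forall>y\<in>M1. fmul y cP \<in> N0 --> y \<in> N1)
   \<and> (\<forall>z\<in>M0. z \<in> NF \<longleftrightarrow> (\<exists>y\<in>M1. z - fmul y cP \<in> N0))
   \<and> qproj TYPE('z) M1 N1 act1 Rr Ir eb
   \<and> qproj TYPE('z) M0 N0 act0 Rr Ir eb
   \<and> qproj TYPE('z) M0 NF act0 Rr Ir eb"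
proof -
 have M0: "{y \<in> FA N. \<exists>r\<in>FA N. y - fmul (fmul ealf r) ebi \<in> JJ N} = {y \<in> FA N. rho N y \<in> K0.Y}" by (rule M0_char)
 have N0: "sspan (gens (iota n i) ebi) = {y \<in> FA N. rho N y \<in> K0.Z}" by (rule N0_char)
 have M1: "{y \<in> FA N. \<exists>r\<in>FA N. y - fmul (fmul ealf r) eib \<in> JJ N} = {y \<in> FA N. rho N y \<in> K1.Y}" by (rule M1_char)
 have N1: "sspan (gens xi eib) = {y \<in> FA N. rho N y \<in> K1.Z}" by (rule N1_char)
 let ?Rl = "{fmul ealf r | r. r \<in> FA N}"
 have Rl: "?Rl \<subseteq> FA N" using ealf(1) by (auto intro: FA_fmul)
 have B0: "is_qbimod {y \<in> FA N. rho N y \<in> K0.Y} {y \<in> FA N. rho N y \<in> K0.Z} (\<lambda>y s. fmul y (iota n i s)) ?Rl (JJ N) Rr Ir eb"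
  by (rule qbimod_0; (assumption | rule Rl))
 have B1: "is_qbimod {y \<in> FA N. rho N y \<in> K1.Y} {y \<in> FA N. rho N y \<in> K1.Z} (\<lambda>y s. fmul y (xi s)) ?Rl (JJ N) Rr Ir eb"
  by (rule qbimod_1; (assumption | rule Rl))
 have R0: "qproj TYPE('z) {y \<in> FA N. rho N y \<in> K0.Y} {y \<in> FA N. rho N y \<in> K0.Z} (\<lambda>y s. fmul y (iota n i s)) Rr Ir eb"
  by (rule qproj_0)
 have R1: "qproj TYPE('z) {y \<in> FA N. rho N y \<in> K1.Y} {y \<in> FA N. rho N y \<in> K1.Z} (\<lambda>y s. fmul y (xi s)) Rr Ir eb"
  by (rule qproj_1)
 have Rr: "{fmul (eblk bt) s | s. s \<in> FA n} = Rr" by (simp add: Rr_def eb_def)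
 show ?thesis
  unfolding Let_def Suc_eq_plus1[symmetric]
  unfolding M0 N0 M1 N1
  unfolding NF_char Rr
  unfolding eb_def[symmetric] Ir_def[symmetric]
  by (intro conjI B0 B1 qbimod_F[OF Rl] P_map[OF refl refl refl refl refl] R0 R1 qproj_F)
qed

end

theorem theorem4p11:
 fixes A :: "'i::finite \<Rightarrow> 'i \<Rightarrow> int" and d :: "'i \<Rightarrow> nat"
  and gr :: "int \<Rightarrow> 'k::comm_ring_1 set"
  and t :: "'i \<Rightarrow> 'i \<Rightarrow> nat \<Rightarrow> nat \<Rightarrow> 'k" and w :: "'i \<Rightarrow> nat \<Rightarrow> nat \<Rightarrow> 'k"
  and hL :: "'i \<Rightarrow> int" and c :: "'i \<Rightarrow> nat \<Rightarrow> 'k"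
  and i :: 'i and b :: "'i \<Rightarrow> nat" and n :: nat
 assumes "cartan A d" and "graded gr" and "Qdata A d gr t" and "Pdata A d gr w"
  and "Ldata d gr hL c"
  and "(\<Sum>j\<in>UNIV. b j) = n"
 shows
  "let N = n + 1; J = Jrel t w N;
    eall = (eblk (b(i := b i + 1)) :: ('i,'k) fa); eb = (eblk b :: ('i,'k) fa);
    ebi = (\<Sum>nu\<in>Iseq b. ee (nu @ [i]) :: ('i,'k) fa);
    eib = (\<Sum>nu\<in>Iseq b. ee (i # nu) :: ('i,'k) fa);
    Rl = {fmul eall r | r. r \<in> FA N};
    Rr = {fmul eb s | s. s \<in> FA n};
    Ir = JL t w hL c n;
    M0 = {y \<in> FA N. \<exists>r\<in>FA N. y - fmul (fmul eall r) ebi \<in> J};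
    N0 = sspan ({fmul (fmul (fmul eall r) (iota n i (fmul (fmul (aL hL c n 1) eb) s))) ebi
           | r s. r \<in> FA N \<and> s \<in> FA n} \<union> J);
    M1 = {y \<in> FA N. \<exists>r\<in>FA N. y - fmul (fmul eall r) eib \<in> J};
    N1 = sspan ({fmul (fmul (fmul eall r) (xi (fmul (fmul (aL hL c n 1) eb) s))) eib
           | r s. r \<in> FA N \<and> s \<in> FA n} \<union> J);
    NF = M0 \<inter> JL t w hL c N;
    act0 = (\<lambda>y s. fmul y (iota n i s));
    act1 = (\<lambda>y s. fmul y (xi s));
    cP = fmul (aL hL c N 1) (fprod (map tt [1..<n+1]))
  in is_qbimod M1 N1 act1 Rl J Rr Ir eb
   \<and> is_qbimod M0 N0 act0 Rl J Rr Ir eb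
   \<and> is_qbimod M0 NF act0 Rl J Rr Ir eb
   \<and> (\<forall>y\<in>M1. fmul y cP \<in> M0)
   \<and> (\<forall>y\<in>M1. \<forall>y'\<in>M1. y - y' \<in> N1 \<longrightarrow> fmul y cP - fmul y' cP \<in> N0)
   \<and> (\<forall>y\<in>M1. \<forall>y'\<in>M1. fmul (y + y') cP - (fmul y cP + fmul y' cP) \<in> N0)
   \<and> (\<forall>y\<in>M1. \<forall>r\<in>Rl. fmul (fmul r y) cP - fmul r (fmul y cP) \<in> N0)
   \<and> (\<forall>y\<in>M1. \<forall>s\<in>Rr. fmul (act1 y s) cP - act0 (fmul y cP) s \<in> N0)
   \<and> N0 \<subseteq> NF
   \<and> (\<forall>y\<in>M1. fmul y cP \<in> N0 \<longrightarrow> y \<in> N1)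
   \<and> (\<forall>z\<in>M0. z \<in> NF \<longleftrightarrow> (\<exists>y\<in>M1. z - fmul y cP \<in> N0))
   \<and> qproj TYPE('z) M1 N1 act1 Rr Ir eb
   \<and> qproj TYPE('z) M0 N0 act0 Rr Ir eb
   \<and> qproj TYPE('z) M0 NF act0 Rr Ir eb"
proof -
 \<comment> \<open>The set of colours is finite; any injective numbering can decide which crossing
   carries \<open>Q\<close>.\<close>
 obtain ord :: "'i \<Rightarrow> nat" where ord: "inj ord"
  using finite_imp_inj_to_nat_seg[of "UNIV :: 'i set"] by auto
 define qd where "qd = (\<lambda>x y. nat (- A x y))"
 define pd where "pd = (\<lambda>x. nat (1 - A x x div 2))"
 have d: "0 < d x" for x using assms(1) by (simp add: cartan_def)
 have A: "A x y \<le> 0" if "x \<noteq> y" for x y using assms(1) that by (simp add: cartan_def)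
 have t0: "t x y p q = 0" if "x \<noteq> y" "int (d x * p + d y * q) > - (int (d x) * A x y)" for x y p q
  using assms(3) that unfolding Qdata_def by blast
 have unit: "\<exists>v. u * v = 1" if "unit0 gr u" for u using that unfolding unit0_def by blast
 interpret klr_cyc t w ord qd pd hL c n i b
 proof unfold_locales
  show "inj ord" by (rule ord)
  show "t x y p q = t y x q p" for x y p q using assms(3) unfolding Qdata_def by blast
  show "\<exists>m. \<forall>p q. p > m \<or> q > m \<longrightarrow> t x y p q = 0" if "x \<noteq> y" for x y
  \<comment> \<open>Since the d's are at least 1, each exponent alone is at most d_x p + d_y q,
    which the weight condition bounds wherever the coefficient is nonzero.\<close>
  proof (intro exI[of _ "nat (- (int (d x) * A x y))"] allI impI)
   fix p q assume pq: "p > nat (- (int (d x) * A x y)) \<or> q > nat (- (int (d x) * A x y))"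
   have "p \<le> d x * p" "q \<le> d y * q" using d[of x] d[of y] by simp_all
   then have "nat (- (int (d x) * A x y)) < d x * p + d y * q" using pq by linarith
   then show "t x y p q = 0" by (intro t0[OF that]) linarith
  qed
  show "\<exists>v. t x y (qd x y) 0 * v = 1" if "x \<noteq> y" for x y
   using assms(3) that unit unfolding Qdata_def qd_def by blast
  \<comment> \<open>The monomial of exponent -a_xy in the first variable alone already attains the
    weight bound, so a larger exponent or an additional power of the second variable forces the
    coefficient 0.\<close>
  have q: "int (d x * qd x y) = - (int (d x) * A x y)" if "x \<noteq> y" for x y
   using A[OF that] by (simp add: qd_def)
  show "t x y (qd x y) q = 0" if "x \<noteq> y" "q > 0" for x y q
  proof (rule t0[OF that(1)])
   have "0 < d y * q" using d[of y] that(2) by simp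
   then show "int (d x * qd x y + d y * q) > - (int (d x) * A x y)" using q[OF that(1)] by linarith
  qed
  show "t x y p q = 0" if "x \<noteq> y" "p > qd x y" for x y p q
  proof (rule t0[OF that(1)])
   have "d x * qd x y < d x * p" using d[of x] that(2) by simp
   then show "int (d x * p + d y * q) > - (int (d x) * A x y)" using q[OF that(1)] by linarith
  qed
  show "\<exists>v. w x (pd x) 0 * v = 1" "\<exists>v. w x 0 (pd x) * v = 1" for x
   using assms(4) unit unfolding Pdata_def pd_def by blast+
  show "w x p q = 0" if "p + q > pd x" for x p q
  proof -
   have "int (p + q) > 1 - A x x div 2" using that unfolding pd_def by linarith
   then show ?thesis using assms(4) unfolding Pdata_def by blast
  qed
  show "(\<Sum>j\<in>UNIV. b j) = n" by (rule assms(6))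
  show "c j 0 = 1" for j using assms(5) unfolding Ldata_def by blast
 qed
 show ?thesis by (rule exact_sequence)
qed

end
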